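(* Let $n\in\{2,3\}$. For any $s\in\mathbb{R}$, the single-layer operator $S_k$ defines a bounded linear operator $S_k:H^s_{\overline\Gamma}\to H^{s+1}(\Gamma)$ for every $k>0$ and every bounded, non-empty, relatively open $\Gamma\subset\Gamma_\infty$, and there exists a constant $C>0$, independent of $k$ and $\Gamma$, such that, for all $\phi\in H^s_{\overline\Gamma}$, and with $L:=\operatorname{diam}\Gamma$, $$\|S_k\phi\|_{H^{s+1}_k(\Gamma)}\le\begin{cases}C\,(1+(kL)^{1/2})\,\|\phi\|_{H^s_k(\mathbb{R}^{n-1})},&n=3,\\ C\log(2+(kL)^{-1})\,(1+(kL)^{1/2})\,\|\phi\|_{H^s_k(\mathbb{R}^{n-1})},&n=2,\end{cases}\qquad k>0.$$
   Context: $\Gamma_\infty=\{x\in\mathbb{R}^n:x_n=0\}$ is identified with $\mathbb{R}^{n-1}$, and Sobolev spaces on $\Gamma_\infty,\Gamma$ are defined through this identification. Sobolev spaces: with $m=n-1$ and $\hat u(\xi)=(2\pi)^{-m/2}\int_{\mathbb{R}^m}e^{-i\xi\cdot x}u(x)\,dx$ (extended to tempered distributions), $H^s(\mathbb{R}^m)$ is the space of tempered distributions $u$ with $\hat u$ locally integrable and $\|u\|_{H^s_k(\mathbb{R}^m)}^2=\int(k^2+|\xi|^2)^s|\hat u(\xi)|^2\,d\xi<\infty$. For $F$ closed, $H^s_F=\{u\in H^s(\mathbb{R}^m):\operatorname{supp}u\subset F\}$. For $\Omega$ open, $H^s(\Omega)=\{U|_\Omega:U\in H^s(\mathbb{R}^m)\}$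 (restrictions of distributions) with $\|u\|_{H^s_k(\Omega)}=\inf\{\|U\|_{H^s_k(\mathbb{R}^m)}:U|_\Omega=u\}$. Single-layer operator: let $\Phi(x,y)=e^{ik|x-y|}/(4\pi|x-y|)$ if $n=3$ and $\Phi(x,y)=\frac i4H_0^{(1)}(k|x-y|)$ if $n=2$. For $\phi\in C_c^\infty(\Gamma_\infty)$, $$S_k\phi(x)=\int_{\Gamma_\infty}\Phi(x,y)\phi(y)\,ds(y),\qquad x\in\Gamma.$$ For general $\phi\in H^s_{\overline\Gamma}$, $S_k\phi$ is understood by continuous extension: it is the limit in $H^{s+1}(\Gamma)$ of $S_k\phi_j$ for any $\phi_j\in C_c^\infty(\Gamma_\infty)$ with $\phi_j\to\phi$ in $H^s(\mathbb{R}^{n-1})$ and $\operatorname{supp}\phi_j\subset\{x\in\Gamma_\infty:\operatorname{dist}(x,\Gamma)<1/j\}$ (such sequences exist for every $\phi\in H^s_{\overline\Gamma}$). Equivalently, $S_k\phi$ is the restriction to $\Gamma$ of the convolution over $\mathbb{R}^{n-1}$ of the locally integrable function $\tilde x\mapsto\Phi((\tilde x,0),0)$ with the compactly supported distribution $\phi$. *)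

theory Defs
  imports "HOL-Analysis.Analysis"
begin

section \<open>Smooth functions and test functions\<close>

text \<open>Multi-indices are written as lists of basis vectors: \<open>pderivs [b1, ..., bl] f\<close> is the iterated
  partial derivative of \<open>f\<close> in the directions \<open>bl, ..., b1\<close>.\<close>

fun pderivs :: "'a::euclidean_space list \<Rightarrow> ('a \<Rightarrow> complex) \<Rightarrow> 'a \<Rightarrow> complex" where
  "pderivs [] f = f"
| "pderivs (b # bs) f = (\<lambda>x. frechet_derivative (pderivs bs f) (at x) b)"

definition smooth :: "('a::euclidean_space \<Rightarrow> complex) \<Rightarrow> bool" where
  "smooth f \<longleftrightarrow> (\<forall>bs. set bs \<subseteq> Basis \<longrightarrow> pderivs bs f differentiable_on UNIV)"

definition fun_supp :: "('a::topological_space \<Rightarrow> complex) \<Rightarrow> 'a set" where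
  "fun_supp f = closure {x. f x \<noteq> 0}"

definition test_functions :: "'a::euclidean_space set \<Rightarrow> ('a \<Rightarrow> complex) set" where
  "test_functions \<Omega> = {\<phi>. smooth \<phi> \<and> compact (fun_supp \<phi>) \<and> fun_supp \<phi> \<subseteq> \<Omega>}"

definition schwartz :: "('a::euclidean_space \<Rightarrow> complex) set" where
  "schwartz = {\<phi>. smooth \<phi> \<and>
     (\<forall>N bs. set bs \<subseteq> Basis \<longrightarrow> bounded (range (\<lambda>x. (1 + norm x) ^ N * norm (pderivs bs \<phi> x))))}"

definition schwartz_seminorm :: "nat \<Rightarrow> ('a::euclidean_space \<Rightarrow> complex) \<Rightarrow> real" where
  "schwartz_seminorm N \<phi> =
     (SUP (bs, x) \<in> {bs. set bs \<subseteq> Basis \<and> length bs \<le> N} \<times> UNIV.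
        (1 + norm x) ^ N * norm (pderivs bs \<phi> x))"


section \<open>Distributions\<close>

text \<open>A distribution is a functional on all functions that is set to 0 outside its space of test
  functions (Schwartz functions for tempered distributions, \<open>test_functions \<Omega>\<close> for distributions
  on \<open>\<Omega>\<close>), so that equality of distributions is equality in HOL. The pairing with functions is
  bilinear, not sesquilinear.\<close>

type_synonym 'a distr = "('a \<Rightarrow> complex) \<Rightarrow> complex"

definition distr_add :: "'a distr \<Rightarrow> 'a distr \<Rightarrow> 'a distr" where
  "distr_add u v = (\<lambda>\<phi>. u \<phi> + v \<phi>)"

definition distr_diff :: "'a distr \<Rightarrow> 'a distr \<Rightarrow> 'a distr" where
  "distr_diff u v = (\<lambda>\<phi>. u \<phi> - v \<phi>)"

definition distr_scale :: "complex \<Rightarrow> 'a distr \<Rightarrow> 'a distr" where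
  "distr_scale c u = (\<lambda>\<phi>. c * u \<phi>)"

definition tempered :: "'a::euclidean_space distr set" where
  "tempered = {u.
     (\<forall>\<phi>. \<phi> \<notin> schwartz \<longrightarrow> u \<phi> = 0) \<and>
     (\<forall>\<phi>\<in>schwartz. \<forall>\<psi>\<in>schwartz. u (\<lambda>x. \<phi> x + \<psi> x) = u \<phi> + u \<psi>) \<and>
     (\<forall>c. \<forall>\<phi>\<in>schwartz. u (\<lambda>x. c * \<phi> x) = c * u \<phi>) \<and>
     (\<exists>N C. \<forall>\<phi>\<in>schwartz. norm (u \<phi>) \<le> C * schwartz_seminorm N \<phi>)}"

text \<open>The regular distribution of \<open>f\<close>, for the space of test functions \<open>D\<close>.\<close>

definition regular_distr ::
    "('a::euclidean_space \<Rightarrow> complex) set \<Rightarrow> ('a \<Rightarrow> complex) \<Rightarrow> 'a distr" where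
  "regular_distr D f = (\<lambda>\<phi>. if \<phi> \<in> D then (LINT x|lborel. f x * \<phi> x) else 0)"

definition distr_restrict :: "'a::euclidean_space set \<Rightarrow> 'a distr \<Rightarrow> 'a distr" where
  "distr_restrict \<Omega> u = (\<lambda>\<phi>. if \<phi> \<in> test_functions \<Omega> then u \<phi> else 0)"

definition distr_supp :: "'a::euclidean_space distr \<Rightarrow> 'a set" where
  "distr_supp u = - \<Union> {U. open U \<and> (\<forall>\<phi>\<in>test_functions U. u \<phi> = 0)}"

definition fourier :: "('a::euclidean_space \<Rightarrow> complex) \<Rightarrow> 'a \<Rightarrow> complex" where
  "fourier f \<xi> = of_real ((2 * pi) powr (- real DIM('a) / 2)) *
     (LINT x|lborel. exp (- (\<i> * of_real (\<xi> \<bullet> x))) * f x)"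

definition fourier_distr :: "'a::euclidean_space distr \<Rightarrow> 'a distr" where
  "fourier_distr u = (\<lambda>\<phi>. if \<phi> \<in> schwartz then u (fourier \<phi>) else 0)"

definition locally_integrable :: "('a::euclidean_space \<Rightarrow> complex) \<Rightarrow> bool" where
  "locally_integrable g \<longleftrightarrow> (\<forall>K. compact K \<longrightarrow> set_integrable lborel K g)"


section \<open>Sobolev spaces\<close>

text \<open>\<open>represents g u\<close>: the distribution \<open>u\<close> is the locally integrable function \<open>g\<close>, tested against
  \<open>C\<^sub>c\<^sup>\<infinity>\<close>. Such a \<open>g\<close> is unique up to null sets, so the choice in \<open>fourier_fun\<close> is immaterial.\<close>

definition represents :: "('a::euclidean_space \<Rightarrow> complex) \<Rightarrow> 'a distr \<Rightarrow> bool" where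
  "represents g u \<longleftrightarrow> locally_integrable g \<and>
     (\<forall>\<phi>\<in>test_functions UNIV. u \<phi> = (LINT \<xi>|lborel. g \<xi> * \<phi> \<xi>))"

definition fourier_fun :: "'a::euclidean_space distr \<Rightarrow> 'a \<Rightarrow> complex" where
  "fourier_fun u = (SOME g. represents g (fourier_distr u))"

definition sobolev_energy :: "real \<Rightarrow> real \<Rightarrow> 'a::euclidean_space distr \<Rightarrow> ennreal" where
  "sobolev_energy k s u =
     (\<integral>\<^sup>+\<xi>. ennreal ((k\<^sup>2 + (norm \<xi>)\<^sup>2) powr s * (norm (fourier_fun u \<xi>))\<^sup>2) \<partial>lborel)"

text \<open>As a set, \<open>sobolev k s\<close> does not depend on \<open>k > 0\<close>; only its norm does. The same holds for the
  spaces derived from it.\<close>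

definition sobolev :: "real \<Rightarrow> real \<Rightarrow> 'a::euclidean_space distr set" where
  "sobolev k s = {u \<in> tempered. (\<exists>g. represents g (fourier_distr u)) \<and> sobolev_energy k s u < \<infinity>}"

definition sobolev_norm :: "real \<Rightarrow> real \<Rightarrow> 'a::euclidean_space distr \<Rightarrow> real" where
  "sobolev_norm k s u = sqrt (enn2real (sobolev_energy k s u))"

definition sobolev_supp :: "real \<Rightarrow> real \<Rightarrow> 'a::euclidean_space set \<Rightarrow> 'a distr set" where
  "sobolev_supp k s F = {u \<in> sobolev k s. distr_supp u \<subseteq> F}"

definition sobolev_on :: "real \<Rightarrow> real \<Rightarrow> 'a::euclidean_space set \<Rightarrow> 'a distr set" where
  "sobolev_on k s \<Omega> = distr_restrict \<Omega> ` sobolev k s"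

definition sobolev_norm_on :: "real \<Rightarrow> real \<Rightarrow> 'a::euclidean_space set \<Rightarrow> 'a distr \<Rightarrow> real" where
  "sobolev_norm_on k s \<Omega> u = Inf {sobolev_norm k s U | U. U \<in> sobolev k s \<and> distr_restrict \<Omega> U = u}"

definition converges_in ::
    "'a distr set \<Rightarrow> ('a distr \<Rightarrow> real) \<Rightarrow> (nat \<Rightarrow> 'a distr) \<Rightarrow> 'a distr \<Rightarrow> bool" where
  "converges_in V nrm u v \<longleftrightarrow>
     (\<forall>j. u j \<in> V) \<and> v \<in> V \<and> (\<lambda>j. nrm (distr_diff (u j) v)) \<longlonglongrightarrow> 0"

definition bounded_linear_operator ::
    "'a distr set \<Rightarrow> ('a distr \<Rightarrow> real) \<Rightarrow> 'a distr set \<Rightarrow> ('a distr \<Rightarrow> real) \<Rightarrow>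
     ('a distr \<Rightarrow> 'a distr) \<Rightarrow> bool" where
  "bounded_linear_operator V nrmV W nrmW T \<longleftrightarrow>
     (\<forall>u\<in>V. T u \<in> W) \<and>
     (\<forall>u\<in>V. \<forall>v\<in>V. T (distr_add u v) = distr_add (T u) (T v)) \<and>
     (\<forall>c. \<forall>u\<in>V. T (distr_scale c u) = distr_scale c (T u)) \<and>
     (\<exists>B. \<forall>u\<in>V. nrmW (T u) \<le> B * nrmV u)"


section \<open>The single-layer operator\<close>

text \<open>\<open>J\<^sub>0\<close>, \<open>Y\<^sub>0\<close> and \<open>H\<^sub>0\<^sup>(\<^sup>1\<^sup>)\<close> on the positive reals, by their standard power series.\<close>

definition bessel_J0 :: "real \<Rightarrow> real" where
  "bessel_J0 x = (\<Sum>m. (-1) ^ m / (fact m)\<^sup>2 * (x / 2) ^ (2 * m))"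

definition bessel_Y0 :: "real \<Rightarrow> real" where
  "bessel_Y0 x = 2 / pi * (ln (x / 2) + euler_mascheroni) * bessel_J0 x
     - 2 / pi * (\<Sum>m. (-1) ^ m * harm m / (fact m)\<^sup>2 * (x / 2) ^ (2 * m))"

definition hankel_H0 :: "real \<Rightarrow> complex" where
  "hankel_H0 x = Complex (bessel_J0 x) (bessel_Y0 x)"

text \<open>The fundamental solution on \<open>\<real>\<^sup>n\<close>; only \<open>n = 2\<close> and \<open>n = 3\<close> are meaningful.\<close>

definition Phi :: "real \<Rightarrow> 'b::euclidean_space \<Rightarrow> 'b \<Rightarrow> complex" where
  "Phi k x y = (if DIM('b) = 3
     then exp (\<i> * of_real (k * norm (x - y))) / of_real (4 * pi * norm (x - y))
     else \<i> / 4 * hankel_H0 (k * norm (x - y)))"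

text \<open>\<open>\<real>\<^sup>n\<close> is \<open>'a \<times> real\<close>, where the Euclidean space \<open>'a\<close> is \<open>\<real>\<^sup>n\<^sup>-\<^sup>1\<close> and the second
  component is \<open>x\<^sub>n\<close>. A subset \<open>\<Gamma>\<close> of \<open>Gamma_inf\<close> is identified with \<open>fst ` \<Gamma>\<close>, a point \<open>x\<close> of
  \<open>'a\<close> with \<open>(x, 0)\<close>, and the surface measure with Lebesgue measure on \<open>'a\<close>.\<close>

definition Gamma_inf :: "('a::euclidean_space \<times> real) set" where
  "Gamma_inf = {x. snd x = 0}"

definition single_layer_fun :: "real \<Rightarrow> ('a::euclidean_space \<Rightarrow> complex) \<Rightarrow> 'a \<Rightarrow> complex" where
  "single_layer_fun k \<phi> x = (LINT y|lborel. Phi k (x, 0::real) (y, 0) * \<phi> y)"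

text \<open>Sequences are indexed from 0, so that the bound on the distance of the \<open>j\<close>-th term is
  \<open>1 / (j + 1)\<close>.\<close>

definition approx_seq :: "real \<Rightarrow> real \<Rightarrow> 'a::euclidean_space set \<Rightarrow> 'a distr \<Rightarrow>
    (nat \<Rightarrow> 'a \<Rightarrow> complex) \<Rightarrow> bool" where
  "approx_seq k s \<Omega> \<phi> f \<longleftrightarrow>
     (\<forall>j. f j \<in> test_functions {x. infdist x \<Omega> < 1 / real (Suc j)}) \<and>
     converges_in (sobolev k s) (sobolev_norm k s) (\<lambda>j. regular_distr schwartz (f j)) \<phi>"

definition is_single_layer :: "real \<Rightarrow> real \<Rightarrow> 'a::euclidean_space set \<Rightarrow> 'a distr \<Rightarrow> 'a distr \<Rightarrow> bool" where
  "is_single_layer k s \<Omega> \<phi> v \<longleftrightarrow>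
     (\<exists>f. approx_seq k s \<Omega> \<phi> f) \<and>
     (\<forall>f. approx_seq k s \<Omega> \<phi> f \<longrightarrow>
        converges_in (sobolev_on k (s + 1) \<Omega>) (sobolev_norm_on k (s + 1) \<Omega>)
          (\<lambda>j. regular_distr (test_functions \<Omega>) (single_layer_fun k (f j))) v)"

definition single_layer :: "real \<Rightarrow> real \<Rightarrow> 'a::euclidean_space set \<Rightarrow> 'a distr \<Rightarrow> 'a distr" where
  "single_layer k s \<Omega> \<phi> = (THE v. is_single_layer k s \<Omega> \<phi> v)"

end

theory Submission
  imports Defs "HOL-Probability.Characteristic_Functions" "HOL-Probability.Sinc_Integral"
begin

text \<open>If \<open>\<phi>\<close> is supported in the closure of \<open>\<Gamma>\<close>, then on \<open>\<Gamma>\<close> only the values of the kernel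
  \<open>K(x) = \<Phi>((x,0),0)\<close> with \<open>|x| < R\<close>, \<open>R > L\<close>, enter \<open>S\<^sub>k \<phi>\<close>. Cutting \<open>K\<close> off sharply at \<open>R\<close> turns
  \<open>S\<^sub>k\<close> into the Fourier multiplier with symbol \<open>m(\<xi>) = \<integral> exp(-i \<xi>\<sqdot>x) K(x) dx\<close> over \<open>|x| < R\<close>, and
  since the Fourier transform maps the Sobolev spaces to weighted \<open>L\<^sup>2\<close> spaces it remains to bound
  \<open>|m(\<xi>)|\<close> by \<open>(k\<^sup>2 + |\<xi>|\<^sup>2)\<^sup>-\<^sup>1\<^sup>/\<^sup>2\<close> times the constant of the theorem, for \<open>R = 2 L\<close>.

  In polar coordinates \<open>m(\<xi>)\<close> is an oscillatory integral over \<open>0 < r < R\<close>, of \<open>exp(i k r) J\<^sub>0(|\<xi>| r)\<close>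
  for \<open>n = 3\<close> and of \<open>H\<^sub>0(k r) cos(|\<xi>| r)\<close> for \<open>n = 2\<close>. One integrates by parts in the faster
  oscillating factor (which is unnecessary for \<open>n = 2\<close>, \<open>|\<xi>| \<le> k\<close>); as Bessel functions of order 0
  decay like \<open>z\<^sup>-\<^sup>1\<^sup>/\<^sup>2\<close>, the remaining integral contributes \<open>(k R)\<^sup>1\<^sup>/\<^sup>2\<close>. For \<open>n = 2\<close> the boundary term at \<open>R\<close> contributes the logarithm, while the
  \<open>1 / z\<close> singularity of \<open>Y\<^sub>0'\<close> only produces a value of the bounded sine integral.\<close>

section \<open>Smooth functions\<close>

text \<open>A multiplier commutes with the weights, so a pointwise bound of the symbol is at once an
  operator bound between the spaces of order \<open>s\<close> and \<open>s + 1\<close>, with one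
  constant for all \<open>s\<close>; restriction to \<Gamma> cannot increase the quotient norm. A
  sharp cutoff is affordable because only one order of decay is wanted: the jump at \<open>R\<close>
  produces boundary terms that carry one division by \<open>max k |\<xi>|\<close>, which is
  comparable with the square root of \<open>k^2 + |\<xi>|^2\<close>. The integral left over carries
  the slower frequency as a factor, and this is what turns the decay \<open>z^(-1/2)\<close>,
  integrated up to \<open>R\<close>, into the square root of \<open>k R\<close>. The second obstacle
  is the meaning of the operator on distributions, a limit along arbitrary approximating sequences.
  One such sequence has to be constructed, by mollification with control of the supports; every term
  has to be identified with the multiplier; and limits in the quotient norm have to be unique.
  Identifying all terms at once asks for the radius \<open>L + 1\<close>, which is not scale
  invariant, whereas \<open>2 L\<close> covers the terms only from some index on; both give the same
  limit.\<close>

definition pdiff :: "'a::euclidean_space \<Rightarrow> ('a \<Rightarrow> complex) \<Rightarrow> 'a \<Rightarrow> complex" where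
  "pdiff b f = (\<lambda>x. frechet_derivative f (at x) b)"

lemma pderivs_Cons: "pderivs (b # bs) f = pdiff b (pderivs bs f)"
  by (simp add: pdiff_def)

text \<open>The head of the list is the derivative taken last, so an appended direction acts first.
  This is how smoothness and the Schwartz bounds pass from \<open>f\<close> to
  \<open>pdiff b f\<close>.\<close>

lemma pderivs_snoc: "pderivs (bs @ [b]) f = pderivs bs (pdiff b f)"
  by (induction bs) (simp_all add: pdiff_def)

lemma pdiff_eqI: "(f has_derivative D) (at x) \<Longrightarrow> pdiff b f x = D b"
  unfolding pdiff_def by (metis frechet_derivative_at)

lemma has_derivative_pdiff:
  "f differentiable (at x) \<Longrightarrow> (f has_derivative (\<lambda>b. pdiff b f x)) (at x)"
  unfolding pdiff_def using frechet_derivative_works by auto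

lemma smooth_differentiable: "smooth f \<Longrightarrow> f differentiable (at x)"
proof -
  assume "smooth f"
  then have "pderivs [] f differentiable_on UNIV"
    unfolding smooth_def by (metis empty_set empty_subsetI)
  then show ?thesis by (simp add: differentiable_on_def)
qed

lemma smooth_pdiff:
  assumes "smooth f" "b \<in> Basis"
  shows "smooth (pdiff b f)"
  unfolding smooth_def
proof (intro allI impI)
  fix bs :: "'a list" assume "set bs \<subseteq> Basis"
  then have "pderivs (bs @ [b]) f differentiable_on UNIV"
    using assms unfolding smooth_def by (metis Un_insert_right insert_subset list.simps(15) set_append append_Nil2 empty_set)
  then show "pderivs bs (pdiff b f) differentiable_on UNIV" by (simp add: pderivs_snoc)
qed

lemma smooth_pderivs: "smooth f \<Longrightarrow> set bs \<subseteq> Basis \<Longrightarrow> smooth (pderivs bs f)"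
  by (induction bs) (auto simp: pderivs_Cons smooth_pdiff simp del: pderivs.simps(2))

lemma smooth_continuous: "smooth f \<Longrightarrow> continuous_on A f"
  by (meson continuous_at_imp_continuous_on differentiable_imp_continuous_within smooth_differentiable)

lemma smooth_measurable: "smooth f \<Longrightarrow> f \<in> borel_measurable borel"
  by (intro borel_measurable_continuous_onI smooth_continuous)

lemma pdiff_add:
  assumes "f differentiable (at x)" "g differentiable (at x)"
  shows "pdiff b (\<lambda>x. f x + g x) x = pdiff b f x + pdiff b g x"
  by (rule pdiff_eqI[where D="\<lambda>b. pdiff b f x + pdiff b g x"])
     (intro has_derivative_add has_derivative_pdiff assms)

lemma pdiff_cmult:
  assumes "f differentiable (at x)"
  shows "pdiff b (\<lambda>x. c * f x) x = c * pdiff b f x"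
  by (rule pdiff_eqI[where D="\<lambda>b. c * pdiff b f x"])
     (intro has_derivative_mult_right has_derivative_pdiff assms)

lemma pdiff_mult:
  assumes "f differentiable (at x)" "g differentiable (at x)"
  shows "pdiff b (\<lambda>x. f x * g x) x = f x * pdiff b g x + pdiff b f x * g x"
  by (rule pdiff_eqI[where D="\<lambda>b. f x * pdiff b g x + pdiff b f x * g x"])
     (intro has_derivative_mult has_derivative_pdiff assms)

text \<open>Differentiation turns a single product into a sum of products. Working with the span
  allows the generating set in a smoothness proof to consist of single products, or of single
  functions \<open>flat n\<close>, all the same.\<close>

inductive_set lspan :: "('a \<Rightarrow> complex) set \<Rightarrow> ('a \<Rightarrow> complex) set" for S where
  base: "f \<in> S \<Longrightarrow> f \<in> lspan S"
| add: "f \<in> lspan S \<Longrightarrow> g \<in> lspan S \<Longrightarrow> (\<lambda>x. f x + g x) \<in> lspan S"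
| cmult: "f \<in> lspan S \<Longrightarrow> (\<lambda>x. c * f x) \<in> lspan S"

text \<open>Coinduction for smoothness: it suffices to find a set of differentiable functions whose
  linear span is closed under partial derivatives.\<close>

lemma smooth_coinduct:
  assumes "f \<in> lspan S"
    and diff: "\<And>f x. f \<in> S \<Longrightarrow> f differentiable (at x)"
    and pd: "\<And>f b. f \<in> S \<Longrightarrow> b \<in> Basis \<Longrightarrow> pdiff b f \<in> lspan S"
  shows "smooth f"
proof -
  have d: "(\<forall>x. f differentiable (at x)) \<and> (\<forall>b\<in>Basis. pdiff b f \<in> lspan S)" if "f \<in> lspan S" for f
    using that
  proof induction
    case (base f)
    then show ?case using diff pd by blast
  next
    case (add f g)
    have "pdiff b (\<lambda>x. f x + g x) = (\<lambda>x. pdiff b f x + pdiff b g x)" for b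
      using add by (auto simp: pdiff_add)
    then show ?case using add by (auto intro!: lspan.add)
  next
    case (cmult f c)
    have "pdiff b (\<lambda>x. c * f x) = (\<lambda>x. c * pdiff b f x)" for b
      using cmult by (auto simp: pdiff_cmult)
    then show ?case using cmult by (auto intro!: lspan.cmult)
  qed
  have "pderivs bs f \<in> lspan S" if "set bs \<subseteq> Basis" for bs
    using that
  proof (induction bs)
    case (Cons b bs)
    then show ?case using d by (auto simp: pderivs_Cons simp del: pderivs.simps(2))
  qed (simp add: assms)
  then show ?thesis
    unfolding smooth_def differentiable_on_def using d by blast
qed

lemma smooth_coinduct':
  assumes "f \<in> S"
    and "\<And>f x. f \<in> S \<Longrightarrow> f differentiable (at x)"
    and "\<And>f b. f \<in> S \<Longrightarrow> b \<in> Basis \<Longrightarrow> pdiff b f \<in> S"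
  shows "smooth f"
  using assms by (intro smooth_coinduct[of f S]) (auto intro: lspan.base)

lemma smooth_const: "smooth (\<lambda>x. c)"
proof (rule smooth_coinduct'[of _ "range (\<lambda>c x. c)"])
  fix f :: "'a \<Rightarrow> complex" and b :: 'a assume "f \<in> range (\<lambda>c x. c)"
  then obtain c where "f = (\<lambda>x. c)" by auto
  then have "pdiff b f = (\<lambda>x. 0)" by (auto intro!: ext pdiff_eqI[where D="\<lambda>_. 0"])
  then show "pdiff b f \<in> range (\<lambda>c x. c)" by simp
qed auto

lemma smooth_add:
  assumes "smooth f" "smooth g"
  shows "smooth (\<lambda>x. f x + g x)"
  by (rule smooth_coinduct[of _ "Collect smooth"])
     (auto intro: lspan.intros assms smooth_pdiff simp: smooth_differentiable)

lemma smooth_mult: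
  assumes "smooth f" "smooth g"
  shows "smooth (\<lambda>x. f x * g x)"
proof (rule smooth_coinduct[of _ "{(\<lambda>x. f x * g x) | f g. smooth f \<and> smooth g}"])
  show "(\<lambda>x. f x * g x) \<in> lspan {(\<lambda>x. f x * g x) |f g. smooth f \<and> smooth g}"
    using assms by (intro lspan.base) auto
  fix h assume "h \<in> {(\<lambda>x. f x * g x) | f g :: 'a \<Rightarrow> complex. smooth f \<and> smooth g}"
  then obtain f g where h: "h = (\<lambda>x. f x * g x)" and s: "smooth f" "smooth g" by auto
  show "h differentiable (at x)" for x
    unfolding h by (intro differentiable_mult smooth_differentiable s)
  fix b :: 'a assume b: "b \<in> Basis"
  have "pdiff b h = (\<lambda>x. f x * pdiff b g x + pdiff b f x * g x)"
    unfolding h by (intro ext pdiff_mult smooth_differentiable s)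
  also have "\<dots> \<in> lspan {(\<lambda>x. f x * g x) |f g. smooth f \<and> smooth g}"
    using s b by (intro lspan.add lspan.base) (auto intro: smooth_pdiff)
  finally show "pdiff b h \<in> lspan {(\<lambda>x. f x * g x) |f g. smooth f \<and> smooth g}" .
qed

lemma smooth_cmult: "smooth f \<Longrightarrow> smooth (\<lambda>x. c * f x)"
  by (rule smooth_mult[OF smooth_const])

lemma smooth_prod:
  assumes "\<And>i. i \<in> I \<Longrightarrow> smooth (f i)"
  shows "smooth (\<lambda>x. \<Prod>i\<in>I. f i x)"
  using assms by (induction I rule: infinite_finite_induct) (auto intro: smooth_mult smooth_const)

lemma pdiff_affine:
  assumes "smooth f"
  shows "pdiff b (\<lambda>x. f (c + a *\<^sub>R x)) x = of_real a * pdiff b f (c + a *\<^sub>R x)"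
proof -
  have "((\<lambda>x. c + a *\<^sub>R x) has_derivative (\<lambda>h. a *\<^sub>R h)) (at x)"
    by (auto intro!: derivative_eq_intros)
  then have D: "((\<lambda>x. f (c + a *\<^sub>R x)) has_derivative (\<lambda>h. pdiff (a *\<^sub>R h) f (c + a *\<^sub>R x))) (at x)"
    by (rule has_derivative_compose)
      (rule has_derivative_pdiff[OF smooth_differentiable[OF assms]])
  have "bounded_linear (\<lambda>h. pdiff h f (c + a *\<^sub>R x))"
    using has_derivative_pdiff[OF smooth_differentiable[OF assms]] has_derivative_bounded_linear by blast
  then have "pdiff (a *\<^sub>R b) f (c + a *\<^sub>R x) = a *\<^sub>R pdiff b f (c + a *\<^sub>R x)"
    by (rule linear_scale[OF bounded_linear.linear])
  then show ?thesis using pdiff_eqI[OF D, of b] by (simp add: scaleR_conv_of_real)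
qed

lemma smooth_affine:
  assumes "smooth f"
  shows "smooth (\<lambda>x. f (c + a *\<^sub>R x))"
proof (rule smooth_coinduct[of _ "{(\<lambda>x. f (c + a *\<^sub>R x)) | f. smooth f}"])
  show "(\<lambda>x. f (c + a *\<^sub>R x)) \<in> lspan {(\<lambda>x. f (c + a *\<^sub>R x)) | f. smooth f}"
    using assms by (intro lspan.base) auto
  fix h assume "h \<in> {(\<lambda>x. f (c + a *\<^sub>R x)) | f. smooth f}"
  then obtain f where h: "h = (\<lambda>x. f (c + a *\<^sub>R x))" and s: "smooth f" by auto
  show "h differentiable (at x)" for x
  proof -
    have A: "((\<lambda>x. c + a *\<^sub>R x) has_derivative (\<lambda>h. a *\<^sub>R h)) (at x)"
      by (auto intro!: derivative_eq_intros)
    show ?thesis unfolding h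
      by (rule differentiableI[OF has_derivative_compose[OF A
          has_derivative_pdiff[OF smooth_differentiable[OF s]]]])
  qed
  fix b :: 'a assume b: "b \<in> Basis"
  have "pdiff b h = (\<lambda>x. of_real a * pdiff b f (c + a *\<^sub>R x))"
    unfolding h by (intro ext pdiff_affine s)
  also have "\<dots> \<in> lspan {(\<lambda>x. f (c + a *\<^sub>R x)) | f. smooth f}"
    using s b by (intro lspan.cmult lspan.base) (auto intro: smooth_pdiff)
  finally show "pdiff b h \<in> lspan {(\<lambda>x. f (c + a *\<^sub>R x)) | f. smooth f}" .
qed

lemma smooth_reflect: "smooth f \<Longrightarrow> smooth (\<lambda>x. f (- x))"
  using smooth_affine[of f 0 "-1"] by simp

lemma smooth_inner: "smooth (\<lambda>x. complex_of_real (x \<bullet> b))"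
proof (rule smooth_coinduct'[of _ "insert (\<lambda>x. complex_of_real (x \<bullet> b)) (range (\<lambda>c x. c))"])
  fix f :: "'a \<Rightarrow> complex" assume f: "f \<in> insert (\<lambda>x. complex_of_real (x \<bullet> b)) (range (\<lambda>c x. c))"
  have D: "((\<lambda>x. complex_of_real (x \<bullet> b)) has_derivative (\<lambda>h. of_real (h \<bullet> b))) (at x)" for x
    by (auto intro!: derivative_eq_intros)
  show "f differentiable at x" for x
    using f D by (auto intro: differentiableI)
  fix e :: 'a
  have "pdiff e (\<lambda>x. c) = (\<lambda>x. 0)" for c :: complex
    by (auto intro!: ext pdiff_eqI[where D="\<lambda>_. 0"])
  moreover have "pdiff e (\<lambda>x. complex_of_real (x \<bullet> b)) = (\<lambda>x. of_real (e \<bullet> b))"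
    by (auto intro!: ext pdiff_eqI D)
  ultimately show "pdiff e f \<in> insert (\<lambda>x. complex_of_real (x \<bullet> b)) (range (\<lambda>c x. c))"
    using f by auto
qed auto

section \<open>Bump functions\<close>

text \<open>The derivative of \<open>flat n\<close> is a combination of \<open>flat (n + 2)\<close>
  and \<open>flat (n + 1)\<close>, also at the origin. So the whole family, and not only the
  classical function \<open>flat 0\<close>, is what the coinductive smoothness criterion can be
  applied to.\<close>

definition flat :: "nat \<Rightarrow> real \<Rightarrow> real" where
  "flat n t = (if t > 0 then (1 / t) ^ n * exp (- (1 / t)) else 0)"

lemma flat_nonneg: "flat n t \<ge> 0"
  by (simp add: flat_def)

text \<open>This quotient is the difference quotient of \<open>flat n\<close> at 0; from the right
  the exponential beats every power of \<open>1 / t\<close>.\<close>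

lemma tendsto_flat_0: "((\<lambda>t. flat n t / t) \<longlongrightarrow> 0) (at 0)"
proof -
  have "((\<lambda>t. inverse t ^ Suc n / exp (inverse t)) \<longlongrightarrow> 0) (at_right (0::real))"
    by (rule filterlim_compose[OF tendsto_power_div_exp_0 filterlim_inverse_at_top_right])
  moreover have "\<forall>\<^sub>F t in at_right 0. inverse t ^ Suc n / exp (inverse t) = flat n t / (t::real)"
    by (rule eventually_at_rightI[of 0 1])
       (auto simp: flat_def exp_minus field_simps)
  ultimately have R: "((\<lambda>t. flat n t / t) \<longlongrightarrow> 0) (at_right 0)"
    by (rule Lim_transform_eventually)
  have "\<forall>\<^sub>F t in at_left 0. 0 = flat n t / (t::real)"
    by (rule eventually_at_leftI[of "-1"]) (auto simp: flat_def)
  then have "((\<lambda>t. flat n t / t) \<longlongrightarrow> 0) (at_left 0)"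
    by (rule Lim_transform_eventually[OF tendsto_const])
  with R show ?thesis by (simp add: filterlim_split_at)
qed

lemma flat_deriv: "(flat n has_real_derivative flat (n + 2) t - real n * flat (n + 1) t) (at t)"
proof (cases t "0::real" rule: linorder_cases)
  case less
  have "((\<lambda>t. 0) has_real_derivative 0) (at t)" by simp
  moreover have "\<forall>\<^sub>F s in nhds t. flat n s = 0"
    using less by (intro eventually_nhds_in_open[of "{..<0}", THEN eventually_mono]) (auto simp: flat_def)
  ultimately show ?thesis using less
    by (subst DERIV_cong_ev[OF refl _ refl, where g="\<lambda>t. 0"]) (auto simp: flat_def)
next
  case equal
  show ?thesis using tendsto_flat_0[of n] equal
    by (simp add: has_field_derivative_iff flat_def)
next
  case greater
  have "((\<lambda>t. (1 / t) ^ n * exp (- (1 / t))) has_real_derivative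
      flat (n + 2) t - real n * flat (n + 1) t) (at t)"
  proof -
    have "((\<lambda>t. (1 / t) ^ n * exp (- (1 / t))) has_real_derivative
        (1 / t) ^ n * (exp (- (1 / t)) * (1 / t\<^sup>2)) + real n * (1 / t) ^ (n - 1) * - (1 / t\<^sup>2) * exp (- (1 / t))) (at t)"
    proof (rule DERIV_mult')
      show "((\<lambda>t. (1 / t) ^ n) has_real_derivative real n * (1 / t) ^ (n - 1) * - (1 / t\<^sup>2)) (at t)"
        using greater DERIV_power[of "\<lambda>t. 1 / t" "- (1 / t\<^sup>2)" t UNIV n]
        by (auto intro!: derivative_eq_intros simp: power2_eq_square mult_ac)
      show "((\<lambda>t. exp (- (1 / t))) has_real_derivative exp (- (1 / t)) * (1 / t\<^sup>2)) (at t)"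
        using greater by (auto intro!: derivative_eq_intros simp: power2_eq_square)
    qed
    also have "(1 / t) ^ n * (exp (- (1 / t)) * (1 / t\<^sup>2)) + real n * (1 / t) ^ (n - 1) * - (1 / t\<^sup>2) * exp (- (1 / t))
        = flat (n + 2) t - real n * flat (n + 1) t"
      using greater by (cases n) (simp_all add: flat_def power2_eq_square algebra_simps add_divide_distrib)
    finally show ?thesis .
  qed
  moreover have "\<forall>\<^sub>F s in nhds t. flat n s = (1 / s) ^ n * exp (- (1 / s))"
    using greater by (intro eventually_nhds_in_open[of "{0<..}", THEN eventually_mono]) (auto simp: flat_def)
  ultimately show ?thesis
    by (subst DERIV_cong_ev[OF refl _ refl])
qed

lemma smooth_flat: "smooth (\<lambda>x. complex_of_real (flat n (c + \<alpha> * (x \<bullet> b))))"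
proof (rule smooth_coinduct[of _ "range (\<lambda>n x. complex_of_real (flat n (c + \<alpha> * (x \<bullet> b))))"])
  let ?S = "range (\<lambda>n x. complex_of_real (flat n (c + \<alpha> * (x \<bullet> b))))"
  fix f :: "'a \<Rightarrow> complex" assume "f \<in> ?S"
  then obtain n where f: "f = (\<lambda>x. complex_of_real (flat n (c + \<alpha> * (x \<bullet> b))))" by auto
  have D: "(f has_derivative (\<lambda>h. of_real (\<alpha> * (h \<bullet> b) *
     (flat (n + 2) (c + \<alpha> * (x \<bullet> b)) - real n * flat (n + 1) (c + \<alpha> * (x \<bullet> b)))))) (at x)" for x
  proof -
    have 1: "((\<lambda>x. c + \<alpha> * (x \<bullet> b)) has_derivative (\<lambda>h. \<alpha> * (h \<bullet> b))) (at x)"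
      by (auto intro!: derivative_eq_intros)
    have 2: "(flat n has_derivative (\<lambda>h. h *
        (flat (n + 2) (c + \<alpha> * (x \<bullet> b)) - real n * flat (n + 1) (c + \<alpha> * (x \<bullet> b))))) (at (c + \<alpha> * (x \<bullet> b)))"
      using flat_deriv[of n "c + \<alpha> * (x \<bullet> b)"] unfolding has_field_derivative_def
      by (subst mult.commute)
    show ?thesis unfolding f
      by (rule has_derivative_of_real[OF has_derivative_compose[OF 1 2]])
  qed
  show "f differentiable at x" for x using D by (rule differentiableI)
  fix e :: 'a
  have "pdiff e f = (\<lambda>x. of_real (\<alpha> * (e \<bullet> b)) * of_real (flat (n + 2) (c + \<alpha> * (x \<bullet> b))) +
     (- of_real (\<alpha> * (e \<bullet> b) * real n)) * of_real (flat (n + 1) (c + \<alpha> * (x \<bullet> b))))"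
    by (subst pdiff_eqI[OF D, THEN ext]) (auto simp: algebra_simps)
  also have "\<dots> \<in> lspan ?S"
    by (intro lspan.add lspan.cmult lspan.base) auto
  finally show "pdiff e f \<in> lspan ?S" .
qed (auto intro: lspan.base)

text \<open>The parameter \<open>n\<close> steepens the walls: as it grows, the bumps tend pointwise
  to the indicator of the open box and stay bounded by 1. Integrals over boxes thus become limits of
  integrals against test functions.\<close>

definition box_bump :: "nat \<Rightarrow> 'a::euclidean_space \<Rightarrow> 'a \<Rightarrow> 'a \<Rightarrow> real" where
  "box_bump n a c x = (\<Prod>b\<in>Basis. flat 0 (real n * (x \<bullet> b - a \<bullet> b)) * flat 0 (real n * (c \<bullet> b - x \<bullet> b)))"

lemma flat_0_le_1: "flat 0 t \<le> 1"
  by (simp add: flat_def)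

lemma flat_0_eq_0_iff: "flat 0 t = 0 \<longleftrightarrow> t \<le> 0"
  by (simp add: flat_def)

lemma box_bump_nonneg: "box_bump n a c x \<ge> 0"
  unfolding box_bump_def by (intro prod_nonneg) (simp add: flat_nonneg)

lemma box_bump_le_1: "box_bump n a c x \<le> 1"
  unfolding box_bump_def by (intro prod_le_1) (simp_all add: flat_nonneg flat_0_le_1 mult_le_one)

lemma box_bump_eq_0_iff: "n > 0 \<Longrightarrow> box_bump n a c x = 0 \<longleftrightarrow> x \<notin> box a c"
  unfolding box_bump_def box_def
  by (auto simp: flat_0_eq_0_iff prod_zero_iff mult_le_0_iff not_less)

lemma box_bump_tendsto: "(\<lambda>n. box_bump (Suc n) a c x) \<longlonglongrightarrow> indicator (box a c) x"
proof (cases "x \<in> box a c")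
  case True
  have t: "(\<lambda>n. flat 0 (real (Suc n) * t)) \<longlonglongrightarrow> 1" if "t > 0" for t
  proof -
    have "(\<lambda>n. exp (- (inverse (real (Suc n)) * (1 / t)))) \<longlonglongrightarrow> exp (- (0 * (1 / t)))"
      by (intro tendsto_intros LIMSEQ_inverse_real_of_nat)
    then show ?thesis using that by (simp add: flat_def divide_inverse mult.commute)
  qed
  have "(\<lambda>n. box_bump (Suc n) a c x) \<longlonglongrightarrow> (\<Prod>b\<in>(Basis::'a set). 1 * 1)"
    unfolding box_bump_def using True
    by (intro tendsto_prod tendsto_mult t) (auto simp: box_def)
  then show ?thesis using True by simp
next
  case False
  then have "(\<lambda>n. box_bump (Suc n) a c x) = (\<lambda>n. 0)" by (simp add: box_bump_eq_0_iff fun_eq_iff)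
  then show ?thesis using False by simp
qed

lemma smooth_box_bump: "smooth (\<lambda>x. complex_of_real (box_bump n a c x))"
proof -
  have "smooth (\<lambda>x. complex_of_real (flat 0 (real n * (x \<bullet> b - a \<bullet> b))))" for b
    using smooth_flat[of 0 "- (real n * (a \<bullet> b))" "real n" b] by (simp add: right_diff_distrib)
  moreover have "smooth (\<lambda>x. complex_of_real (flat 0 (real n * (c \<bullet> b - x \<bullet> b))))" for b
    using smooth_flat[of 0 "real n * (c \<bullet> b)" "- real n" b] by (simp add: right_diff_distrib)
  ultimately show ?thesis unfolding box_bump_def of_real_prod of_real_mult
    by (intro smooth_prod smooth_mult) auto
qed

section \<open>Test functions\<close>

lemma test_functionsI:
  assumes "smooth f" "compact K" "K \<subseteq> \<Omega>" "\<And>x. x \<notin> K \<Longrightarrow> f x = 0"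
  shows "f \<in> test_functions \<Omega>"
proof -
  have "fun_supp f \<subseteq> K"
    unfolding fun_supp_def using assms by (intro closure_minimal compact_imp_closed) auto
  moreover have "closed (fun_supp f)" by (simp add: fun_supp_def)
  ultimately show ?thesis using assms unfolding test_functions_def
    by (auto intro: compact_Int_closed[of K "fun_supp f", unfolded Int_absorb1[OF \<open>fun_supp f \<subseteq> K\<close>]])
qed

lemma test_functionsD:
  assumes "f \<in> test_functions \<Omega>"
  shows "smooth f" "compact (fun_supp f)" "fun_supp f \<subseteq> \<Omega>" "x \<notin> fun_supp f \<Longrightarrow> f x = 0"
  using assms closure_subset[of "{x. f x \<noteq> 0}"] by (auto simp: test_functions_def fun_supp_def)

lemma test_functions_mono: "\<Omega> \<subseteq> \<Omega>' \<Longrightarrow> test_functions \<Omega> \<subseteq> test_functions \<Omega>'"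
  by (auto simp: test_functions_def)

lemma test_functions_UNIV: "f \<in> test_functions \<Omega> \<Longrightarrow> f \<in> test_functions UNIV"
  using test_functions_mono by blast

lemma test_functions_pdiff:
  assumes f: "f \<in> test_functions \<Omega>" and b: "b \<in> Basis"
  shows "pdiff b f \<in> test_functions \<Omega>"
proof (rule test_functionsI[where K="fun_supp f"])
  fix x assume "x \<notin> fun_supp f"
  then have "\<forall>\<^sub>F y in nhds x. y \<in> - fun_supp f"
    by (intro eventually_nhds_in_open) (auto simp: fun_supp_def)
  then have "\<forall>\<^sub>F y in nhds x. 0 = f y"
    by (rule eventually_mono) (use test_functionsD[OF f] in auto)
  moreover have "((\<lambda>x. 0) has_derivative (\<lambda>h. 0)) (at x)" by simp
  ultimately have "(f has_derivative (\<lambda>h. 0)) (at x)"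
    using has_derivative_transform_eventually[of "\<lambda>x. 0" "\<lambda>h. 0" x UNIV f]
    by (auto simp: eventually_at_filter eventually_mono dest: eventually_nhds_x_imp_x)
  then show "pdiff b f x = 0" by (rule pdiff_eqI)
qed (use test_functionsD[OF f] smooth_pdiff b in auto)

lemma test_functions_pderivs:
  "f \<in> test_functions \<Omega> \<Longrightarrow> set bs \<subseteq> Basis \<Longrightarrow> pderivs bs f \<in> test_functions \<Omega>"
  by (induction bs) (auto simp: pderivs_Cons test_functions_pdiff simp del: pderivs.simps(2))

lemma test_functions_mult:
  assumes f: "f \<in> test_functions \<Omega>" and g: "smooth g"
  shows "(\<lambda>x. g x * f x) \<in> test_functions \<Omega>"
  by (rule test_functionsI[where K="fun_supp f"])
     (use test_functionsD[OF f] g in \<open>auto intro: smooth_mult\<close>)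

lemma test_functions_cmult: "f \<in> test_functions \<Omega> \<Longrightarrow> (\<lambda>x. c * f x) \<in> test_functions \<Omega>"
  by (rule test_functions_mult[OF _ smooth_const])

lemma test_functions_affine:
  assumes f: "f \<in> test_functions UNIV" and a: "a \<noteq> 0"
  shows "(\<lambda>x. f (c + a *\<^sub>R x)) \<in> test_functions ((\<lambda>x. (1 / a) *\<^sub>R (x - c)) ` fun_supp f)"
proof (rule test_functionsI)
  let ?K = "(\<lambda>x. (1 / a) *\<^sub>R (x - c)) ` fun_supp f"
  show "compact ?K"
    using test_functionsD[OF f] by (intro compact_continuous_image continuous_intros) auto
  fix x assume "x \<notin> ?K"
  then have "c + a *\<^sub>R x \<notin> fun_supp f" using a
    by (auto simp: image_iff dest!: bspec[where x="c + a *\<^sub>R x"])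
  then show "f (c + a *\<^sub>R x) = 0" by (rule test_functionsD[OF f])
qed (use test_functionsD[OF f] smooth_affine in auto)

lemma box_bump_test_functions:
  assumes "n > 0"
  shows "(\<lambda>x. complex_of_real (box_bump n a c x)) \<in> test_functions (cbox a c)"
proof (rule test_functionsI[where K="cbox a c"])
  fix x assume "x \<notin> cbox a c"
  then have "x \<notin> box a c" using box_subset_cbox by blast
  then show "complex_of_real (box_bump n a c x) = 0" using assms by (simp add: box_bump_eq_0_iff)
qed (auto simp: smooth_box_bump)

lemma continuous_compact_support_bounded:
  fixes f :: "'a::topological_space \<Rightarrow> 'b::real_normed_vector"
  assumes "continuous_on UNIV f" "compact K" "\<And>x. x \<notin> K \<Longrightarrow> f x = 0"
  shows "bounded (range f)"
proof -
  have "bounded (f ` K)"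
    using assms by (intro compact_imp_bounded compact_continuous_image) (auto intro: continuous_on_subset)
  moreover have "range f \<subseteq> insert 0 (f ` K)" using assms(3) by auto
  ultimately show ?thesis by (meson bounded_insert bounded_subset)
qed

lemma test_functions_schwartz:
  assumes f: "f \<in> test_functions \<Omega>"
  shows "f \<in> schwartz"
  unfolding schwartz_def
proof (intro CollectI conjI allI impI)
  fix N :: nat and bs :: "'a list" assume "set bs \<subseteq> Basis"
  then have p: "pderivs bs f \<in> test_functions \<Omega>" by (rule test_functions_pderivs[OF f])
  show "bounded (range (\<lambda>x. (1 + norm x) ^ N * norm (pderivs bs f x)))"
    by (rule continuous_compact_support_bounded[where K="fun_supp (pderivs bs f)"])
       (use test_functionsD[OF p] in \<open>auto intro!: continuous_intros smooth_continuous\<close>)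
qed (rule test_functionsD[OF f])

lemma test_functions_integrable:
  assumes f: "f \<in> test_functions \<Omega>"
  shows "integrable lborel f"
proof -
  have "integrable lborel (\<lambda>x. indicator (fun_supp f) x *\<^sub>R f x)"
    using test_functionsD[OF f] by (intro borel_integrable_compact smooth_continuous)
  also have "(\<lambda>x. indicator (fun_supp f) x *\<^sub>R f x) = f"
    using test_functionsD(4)[OF f] by (force simp: indicator_def)
  finally show ?thesis .
qed

section \<open>Integration lemmas\<close>

text \<open>\<open>lborel\<close> is the image of a product of one-dimensional Lebesgue measures
  under the coordinate map, so products of functions of single coordinates factorize. It serves both
  the Gaussian and the integrable majorant below.\<close>

lemma integrable_lborel_prod:
  fixes f :: "'a::euclidean_space \<Rightarrow> real \<Rightarrow> complex"
  assumes f: "\<And>b. b \<in> Basis \<Longrightarrow> integrable lborel (f b)"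
  shows "integrable lborel (\<lambda>x::'a. \<Prod>b\<in>Basis. f b (x \<bullet> b))"
    and "(LINT x|lborel. (\<Prod>b\<in>(Basis::'a set). f b (x \<bullet> b))) = (\<Prod>b\<in>Basis. LINT x|lborel. f b x)"
proof -
  interpret product_sigma_finite "\<lambda>_::'a. lborel :: real measure" ..
  let ?P = "\<Pi>\<^sub>M b\<in>(Basis::'a set). (lborel :: real measure)"
  let ?g = "\<lambda>x::'a. \<Prod>b\<in>Basis. f b (x \<bullet> b)"
  have [measurable]: "f b \<in> borel_measurable borel" if "b \<in> Basis" for b
    using f[OF that] by (simp add: integrable_iff_bounded)
  have g[measurable]: "?g \<in> borel_measurable borel" by measurable
  have T[measurable]: "(\<lambda>f. \<Sum>b\<in>Basis. f b *\<^sub>R b) \<in> measurable ?P (borel :: 'a measure)" by measurable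
  have c: "?g (\<Sum>b\<in>Basis. h b *\<^sub>R b) = (\<Prod>b\<in>Basis. f b (h b))" for h
    by (intro prod.cong) (auto simp: inner_sum_left_Basis)
  show "integrable lborel ?g"
    by (subst lborel_eq, subst integrable_distr_eq[OF T g], unfold c)
       (intro product_integrable_prod f finite_Basis)
  show "(LINT x|lborel. ?g x) = (\<Prod>b\<in>Basis. LINT x|lborel. f b x)"
    by (subst lborel_eq, subst integral_distr[OF T g], unfold c)
       (intro product_integral_prod f finite_Basis)
qed

text \<open>Each factor \<open>1 + (x \<bullet> b)^2\<close> is at most
  \<open>(1 + norm x)^2\<close>, so the product of the one-dimensional functions
  \<open>1 / (1 + t^2)\<close> is an integrable majorant. This is where the exponent
  \<open>2 * DIM('a)\<close> comes from.\<close>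

lemma integrable_inverse_power:
  "integrable lborel (\<lambda>x::'a::euclidean_space. 1 / (1 + norm x) ^ (2 * DIM('a)))"
proof -
  have "integrable lborel (\<lambda>x. inverse (1 + x\<^sup>2) :: real)"
    using integrable_inverse_1_plus_square by (simp add: set_integrable_def)
  then have "integrable lborel (\<lambda>x. complex_of_real (inverse (1 + x\<^sup>2)))"
    by (rule integrable_of_real)
  then have I: "integrable lborel (\<lambda>x::'a. \<Prod>b\<in>Basis. complex_of_real (inverse (1 + (x \<bullet> b)\<^sup>2)))"
    by (intro integrable_lborel_prod)
  show ?thesis
  proof (rule Bochner_Integration.integrable_bound[OF I])
    show "AE x in lborel. norm (1 / (1 + norm (x::'a)) ^ (2 * DIM('a))) \<le>
      norm (\<Prod>b\<in>Basis. complex_of_real (inverse (1 + (x \<bullet> b)\<^sup>2)))"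
    proof (intro AE_I2)
      fix x :: 'a
      have "(\<Prod>b\<in>(Basis::'a set). 1 + (x \<bullet> b)\<^sup>2) \<le> (\<Prod>b\<in>(Basis::'a set). (1 + norm x)\<^sup>2)"
      proof (intro prod_mono conjI)
        fix b :: 'a assume "b \<in> Basis"
        then have "\<bar>x \<bullet> b\<bar>\<^sup>2 \<le> (norm x)\<^sup>2" by (intro power_mono Basis_le_norm) auto
        then show "1 + (x \<bullet> b)\<^sup>2 \<le> (1 + norm x)\<^sup>2" by (simp add: power2_sum add_increasing2)
      qed auto
      also have "\<dots> = (1 + norm x) ^ (2 * DIM('a))" by (simp add: power_mult)
      finally have "inverse ((1 + norm x) ^ (2 * DIM('a))) \<le> inverse (\<Prod>b\<in>(Basis::'a set). 1 + (x \<bullet> b)\<^sup>2)"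
        by (intro le_imp_inverse_le prod_pos) (auto intro: add_pos_nonneg)
      moreover have "norm (\<Prod>b\<in>(Basis::'a set). complex_of_real (inverse (1 + (x \<bullet> b)\<^sup>2))) =
         inverse (\<Prod>b\<in>(Basis::'a set). 1 + (x \<bullet> b)\<^sup>2)"
      proof -
        have "norm (\<Prod>b\<in>(Basis::'a set). complex_of_real (inverse (1 + (x \<bullet> b)\<^sup>2))) =
            (\<Prod>b\<in>(Basis::'a set). \<bar>inverse (1 + (x \<bullet> b)\<^sup>2)\<bar>)"
          by (simp only: prod_norm[symmetric] norm_of_real)
        also have "\<dots> = (\<Prod>b\<in>(Basis::'a set). inverse (1 + (x \<bullet> b)\<^sup>2))"
          by (intro prod.cong refl abs_of_nonneg) simp
        finally show ?thesis by (simp only: prod_inversef[unfolded comp_def])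
      qed
      ultimately show "norm (1 / (1 + norm (x::'a)) ^ (2 * DIM('a))) \<le>
          norm (\<Prod>b\<in>Basis. complex_of_real (inverse (1 + (x \<bullet> b)\<^sup>2)))"
        by (simp add: divide_inverse)
    qed
  qed measurable
qed

lemma lborel_integral_affine:
  fixes f :: "'a::euclidean_space \<Rightarrow> 'b::{banach, second_countable_topology}"
  assumes [measurable]: "f \<in> borel_measurable borel" and a: "a \<noteq> 0"
  shows "(LINT x|lborel. f x) = (\<bar>a\<bar> ^ DIM('a)) *\<^sub>R (LINT x|lborel. f (c + a *\<^sub>R x))"
  by (subst lborel_affine[OF a, of c], subst integral_density)
     (auto simp: integral_distr)

lemma lborel_integrable_affine:
  fixes f :: "'a::euclidean_space \<Rightarrow> 'b::{banach, second_countable_topology}"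
  assumes f: "integrable lborel f" and a: "a \<noteq> 0"
  shows "integrable lborel (\<lambda>x. f (c + a *\<^sub>R x))"
proof -
  have [measurable]: "f \<in> borel_measurable borel" using f by (simp add: integrable_iff_bounded)
  have "integrable (density (distr lborel borel (\<lambda>x. c + a *\<^sub>R x)) (\<lambda>_. \<bar>a\<bar>^DIM('a))) f"
    using f lborel_affine[OF a, of c] by simp
  then have "integrable lborel (\<lambda>x. (\<bar>a\<bar>^DIM('a)) *\<^sub>R f (c + a *\<^sub>R x))"
    by (subst (asm) integrable_density) (auto simp: integrable_distr_eq)
  then have "integrable lborel (\<lambda>x. (1 / \<bar>a\<bar>^DIM('a)) *\<^sub>R (\<bar>a\<bar>^DIM('a)) *\<^sub>R f (c + a *\<^sub>R x))"
    by (rule integrable_scaleR_right)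
  then show ?thesis using a by simp
qed

lemma lborel_integral_translate:
  fixes f :: "'a::euclidean_space \<Rightarrow> 'b::{banach, second_countable_topology}"
  assumes "f \<in> borel_measurable borel"
  shows "(LINT x|lborel. f (c + x)) = (LINT x|lborel. f x)"
  using lborel_integral_affine[OF assms, of 1 c] by simp

lemma lborel_integrable_translate:
  fixes f :: "'a::euclidean_space \<Rightarrow> 'b::{banach, second_countable_topology}"
  assumes "integrable lborel f"
  shows "integrable lborel (\<lambda>x. f (c + x))"
  using lborel_integrable_affine[OF assms, of 1 c] by simp

lemma lborel_integral_reflect:
  fixes f :: "'a::euclidean_space \<Rightarrow> 'b::{banach, second_countable_topology}"
  assumes "f \<in> borel_measurable borel"
  shows "(LINT x|lborel. f (c - x)) = (LINT x|lborel. f x)"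
  using lborel_integral_affine[OF assms, of "-1" c] by simp

lemma lborel_integrable_reflect:
  fixes f :: "'a::euclidean_space \<Rightarrow> 'b::{banach, second_countable_topology}"
  assumes "integrable lborel f"
  shows "integrable lborel (\<lambda>x. f (c - x))"
  using lborel_integrable_affine[OF assms, of "-1" c] by simp

lemma integrable_pair_bound:
  fixes h :: "'a::euclidean_space \<times> 'b::euclidean_space \<Rightarrow> complex"
  assumes h[measurable]: "h \<in> borel_measurable (lborel \<Otimes>\<^sub>M lborel)"
    and f: "integrable lborel f" and g: "integrable lborel g"
    and le: "\<And>x y. norm (h (x, y)) \<le> f x * (g y :: real)"
  shows "integrable (lborel \<Otimes>\<^sub>M lborel) h"
proof (rule lborel_pair.Fubini_integrable)
  have i: "integrable lborel (\<lambda>y. h (x, y))" for x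
    by (rule Bochner_Integration.integrable_bound[OF integrable_mult_right[OF g, of "f x"]])
       (auto intro!: AE_I2 order_trans[OF le])
  show "AE x in lborel. integrable lborel (\<lambda>y. h (x, y))" using i by simp
  have "norm (LINT y|lborel. norm (h (x, y))) \<le> norm (f x * (LINT y|lborel. g y))" for x
  proof -
    have "(LINT y|lborel. norm (h (x, y))) \<le> (LINT y|lborel. f x * g y)"
      by (intro integral_mono integrable_norm i integrable_mult_right g le)
    moreover have "0 \<le> (LINT y|lborel. norm (h (x, y)))" by (intro integral_nonneg_AE) auto
    ultimately show ?thesis by simp
  qed
  then show "integrable lborel (\<lambda>x. LINT y|lborel. norm (h (x, y)))"
    by (intro Bochner_Integration.integrable_bound[OF integrable_mult_left[OF f, of "LINT y|lborel. g y"]]) auto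
qed (rule h)

lemma Fubini_bound:
  fixes h :: "'a::euclidean_space \<Rightarrow> 'b::euclidean_space \<Rightarrow> complex"
  assumes h: "(\<lambda>(x, y). h x y) \<in> borel_measurable (lborel \<Otimes>\<^sub>M lborel)"
    and f: "integrable lborel f" and g: "integrable lborel g"
    and le: "\<And>x y. norm (h x y) \<le> f x * (g y :: real)"
  shows "(LINT y|lborel. LINT x|lborel. h x y) = (LINT x|lborel. LINT y|lborel. h x y)"
  by (rule lborel_pair.Fubini_integral) (intro integrable_pair_bound[OF h f g], use le in auto)

text \<open>Averaging the translates \<open>f (x + t b)\<close> over \<open>0 \<le> t \<le> 1\<close> turns translation invariance of the
  integral into the vanishing of the integral of the derivative.\<close>

lemma integral_pdiff_eq_0:
  fixes f :: "'a::euclidean_space \<Rightarrow> complex"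
  assumes d: "\<And>x. f differentiable (at x)" and c: "continuous_on UNIV (pdiff b f)"
    and f: "integrable lborel f" and g: "integrable lborel (pdiff b f)"
  shows "(LINT x|lborel. pdiff b f x) = 0"
proof -
  let ?h = "\<lambda>x t. indicator {0..1} t *\<^sub>R pdiff b f (x + t *\<^sub>R b)"
  have [measurable]: "pdiff b f \<in> borel_measurable borel" using c by (rule borel_measurable_continuous_onI)
  have [measurable]: "f \<in> borel_measurable borel" using f by (simp add: integrable_iff_bounded)
  have v: "((\<lambda>t. f (x + t *\<^sub>R b)) has_vector_derivative pdiff b f (x + t *\<^sub>R b)) (at t within A)" for x t A
  proof -
    have 1: "((\<lambda>t. x + t *\<^sub>R b) has_derivative (\<lambda>h. h *\<^sub>R b)) (at t within A)"
      by (auto intro!: derivative_eq_intros)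
    have D: "(f has_derivative (\<lambda>e. pdiff e f (x + t *\<^sub>R b))) (at (x + t *\<^sub>R b))"
      by (rule has_derivative_pdiff[OF d])
    have "((\<lambda>t. f (x + t *\<^sub>R b)) has_derivative (\<lambda>h. pdiff (h *\<^sub>R b) f (x + t *\<^sub>R b))) (at t within A)"
      by (rule has_derivative_compose[OF 1 D])
    moreover have "pdiff (h *\<^sub>R b) f (x + t *\<^sub>R b) = h *\<^sub>R pdiff b f (x + t *\<^sub>R b)" for h
      using linear_scale[OF bounded_linear.linear[OF has_derivative_bounded_linear[OF D]]] by blast
    ultimately show ?thesis unfolding has_vector_derivative_def by simp
  qed
  have inner: "(LINT t|lborel. ?h x t) = f (x + b) - f x" for x
    using integral_FTC_Icc[of 0 1 "\<lambda>t. f (x + t *\<^sub>R b)" "\<lambda>t. pdiff b f (x + t *\<^sub>R b)"] v[of x]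
    by (simp add: continuous_on_compose2[OF c] continuous_intros)
  have int: "integrable (lborel \<Otimes>\<^sub>M lborel) (\<lambda>(t, x). ?h x t)"
  proof (rule lborel_pair.Fubini_integrable)
    show "(\<lambda>(t, x). ?h x t) \<in> borel_measurable (lborel \<Otimes>\<^sub>M lborel)" by measurable
    have "integrable lborel (\<lambda>x. pdiff b f (t *\<^sub>R b + x))" for t
      by (rule lborel_integrable_translate[OF g])
    then show "AE t in lborel. integrable lborel (\<lambda>x. case (t, x) of (t, x) \<Rightarrow> ?h x t)"
      by (auto simp: add.commute)
    have eq: "(LINT x|lborel. norm (?h x t)) = indicator {0..1} t * (LINT x|lborel. norm (pdiff b f x))" for t
      using lborel_integral_translate[of "\<lambda>x. norm (pdiff b f x)" "t *\<^sub>R b"]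
      by (simp add: add.commute)
    then show "integrable lborel (\<lambda>t. LINT x|lborel. norm (case (t, x) of (t, x) \<Rightarrow> ?h x t))"
      unfolding prod.case eq by simp
  qed
  have "(LINT x|lborel. f (x + b) - f x) = (LINT x|lborel. LINT t|lborel. ?h x t)"
    by (simp only: inner)
  also have "\<dots> = (LINT t|lborel. LINT x|lborel. ?h x t)"
    by (rule lborel_pair.Fubini_integral[OF int])
  also have "\<dots> = (LINT t::real|lborel. indicator {0..1} t *\<^sub>R (LINT x|lborel. pdiff b f x))"
  proof -
    have "(LINT x|lborel. pdiff b f (x + t *\<^sub>R b)) = (LINT x|lborel. pdiff b f x)" for t
      using lborel_integral_translate[of "pdiff b f" "t *\<^sub>R b"] by (simp add: add.commute)
    then show ?thesis by (simp only: integral_scaleR_right)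
  qed
  also have "\<dots> = (LINT x|lborel. pdiff b f x)"
    by (subst integral_scaleR_left) auto
  finally have "(LINT x|lborel. pdiff b f x) = (LINT x|lborel. f (x + b) - f x)" ..
  also have "\<dots> = 0"
  proof -
    have "(LINT x|lborel. f (x + b)) = (LINT x|lborel. f x)"
      using lborel_integral_translate[of f b] by (simp add: add.commute)
    moreover have "integrable lborel (\<lambda>x. f (x + b))"
      using lborel_integrable_translate[OF f, of b] by (simp add: add.commute)
    ultimately show ?thesis using f by simp
  qed
  finally show ?thesis .
qed

section \<open>Schwartz functions\<close>

lemma schwartzD: "f \<in> schwartz \<Longrightarrow> smooth f"
  by (simp add: schwartz_def)

lemma schwartz_pdiff:
  assumes f: "f \<in> schwartz" and b: "b \<in> Basis"
  shows "pdiff b f \<in> schwartz"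
  unfolding schwartz_def
proof (intro CollectI conjI allI impI)
  fix N and bs :: "'a list" assume "set bs \<subseteq> Basis"
  then have "set (bs @ [b]) \<subseteq> Basis" using b by simp
  then show "bounded (range (\<lambda>x. (1 + norm x) ^ N * norm (pderivs bs (pdiff b f) x)))"
    using f unfolding schwartz_def pderivs_snoc[symmetric] by blast
qed (intro smooth_pdiff schwartzD f b)

lemma schwartz_pderivs: "f \<in> schwartz \<Longrightarrow> set bs \<subseteq> Basis \<Longrightarrow> pderivs bs f \<in> schwartz"
  by (induction bs) (auto simp: pderivs_Cons schwartz_pdiff simp del: pderivs.simps(2))

lemma pderivs_add:
  assumes "smooth f" "smooth g" "set bs \<subseteq> Basis"
  shows "pderivs bs (\<lambda>x. f x + g x) = (\<lambda>x. pderivs bs f x + pderivs bs g x)"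
  using assms(3)
proof (induction bs)
  case (Cons b bs)
  then have "pderivs (b # bs) (\<lambda>x. f x + g x) = pdiff b (\<lambda>x. pderivs bs f x + pderivs bs g x)"
    unfolding pderivs_Cons by simp
  also have "\<dots> = (\<lambda>x. pderivs (b # bs) f x + pderivs (b # bs) g x)"
    unfolding pderivs_Cons using Cons assms
    by (intro ext pdiff_add smooth_differentiable smooth_pderivs) auto
  finally show ?case .
qed simp

lemma pderivs_cmult:
  assumes "smooth f" "set bs \<subseteq> Basis"
  shows "pderivs bs (\<lambda>x. c * f x) = (\<lambda>x. c * pderivs bs f x)"
  using assms(2)
proof (induction bs)
  case (Cons b bs)
  then have "pderivs (b # bs) (\<lambda>x. c * f x) = pdiff b (\<lambda>x. c * pderivs bs f x)"
    unfolding pderivs_Cons by simp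
  also have "\<dots> = (\<lambda>x. c * pderivs (b # bs) f x)"
    unfolding pderivs_Cons using Cons assms
    by (intro ext pdiff_cmult smooth_differentiable smooth_pderivs) auto
  finally show ?case .
qed simp

lemma schwartz_add:
  assumes "f \<in> schwartz" "g \<in> schwartz"
  shows "(\<lambda>x. f x + g x) \<in> schwartz"
  unfolding schwartz_def
proof (intro CollectI conjI allI impI)
  fix N and bs :: "'a list" assume bs: "set bs \<subseteq> Basis"
  obtain A where A: "\<And>x. (1 + norm x) ^ N * norm (pderivs bs f x) \<le> A"
    using assms(1) bs unfolding schwartz_def bounded_iff by fastforce
  obtain B where B: "\<And>x. (1 + norm x) ^ N * norm (pderivs bs g x) \<le> B"
    using assms(2) bs unfolding schwartz_def bounded_iff by fastforce
  have "(1 + norm x) ^ N * norm (pderivs bs f x + pderivs bs g x) \<le> A + B" for x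
  proof -
    have "(1 + norm x) ^ N * norm (pderivs bs f x + pderivs bs g x) \<le>
        (1 + norm x) ^ N * (norm (pderivs bs f x) + norm (pderivs bs g x))"
      by (intro mult_left_mono norm_triangle_ineq) auto
    then show ?thesis using A[of x] B[of x] by (simp add: distrib_left)
  qed
  then show "bounded (range (\<lambda>x. (1 + norm x) ^ N * norm (pderivs bs (\<lambda>x. f x + g x) x)))"
    unfolding bounded_iff pderivs_add[OF schwartzD schwartzD, OF assms bs] by (auto simp: abs_mult)
qed (intro smooth_add schwartzD assms)

lemma schwartz_cmult:
  assumes "f \<in> schwartz"
  shows "(\<lambda>x. c * f x) \<in> schwartz"
  unfolding schwartz_def
proof (intro CollectI conjI allI impI)
  fix N and bs :: "'a list" assume bs: "set bs \<subseteq> Basis"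
  obtain A where A: "\<And>x. (1 + norm x) ^ N * norm (pderivs bs f x) \<le> A"
    using assms(1) bs unfolding schwartz_def bounded_iff by fastforce
  have "(1 + norm x) ^ N * norm (c * pderivs bs f x) \<le> norm c * A" for x
    using mult_left_mono[OF A norm_ge_zero, of c x] by (simp add: norm_mult mult_ac)
  then show "bounded (range (\<lambda>x. (1 + norm x) ^ N * norm (pderivs bs (\<lambda>x. c * f x) x)))"
    unfolding bounded_iff pderivs_cmult[OF schwartzD, OF assms bs] by (auto simp: abs_mult)
qed (intro smooth_cmult schwartzD assms)

lemma schwartz_seminorm_upper:
  assumes f: "f \<in> schwartz" and bs: "set bs \<subseteq> Basis" "length bs \<le> N"
  shows "(1 + norm x) ^ N * norm (pderivs bs f x) \<le> schwartz_seminorm N f"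
proof -
  let ?L = "{bs. set bs \<subseteq> (Basis :: 'a set) \<and> length bs \<le> N}"
  have "bounded (\<Union>bs\<in>?L. range (\<lambda>x. (1 + norm x) ^ N * norm (pderivs bs f x)))"
    using f finite_lists_length_le[of "Basis :: 'a set" N]
    by (intro bounded_UN) (auto simp: schwartz_def)
  then have "bdd_above (\<Union>bs\<in>?L. range (\<lambda>x. (1 + norm x) ^ N * norm (pderivs bs f x)))"
    by (rule bounded_imp_bdd_above)
  also have "(\<Union>bs\<in>?L. range (\<lambda>x. (1 + norm x) ^ N * norm (pderivs bs f x))) =
     (\<lambda>(bs, x). (1 + norm x) ^ N * norm (pderivs bs f x)) ` (?L \<times> UNIV)" by force
  finally have "bdd_above ((\<lambda>(bs, x). (1 + norm x) ^ N * norm (pderivs bs f x)) ` (?L \<times> UNIV))" .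
  from cSUP_upper[OF _ this, of "(bs, x)"] bs show ?thesis
    by (simp add: schwartz_seminorm_def)
qed

lemma schwartz_seminorm_le:
  assumes "\<And>bs x. set bs \<subseteq> Basis \<Longrightarrow> length bs \<le> N \<Longrightarrow> (1 + norm x) ^ N * norm (pderivs bs f x) \<le> B"
  shows "schwartz_seminorm N f \<le> B"
  unfolding schwartz_seminorm_def
proof (rule cSUP_least)
  have "([], undefined) \<in> {bs. set bs \<subseteq> Basis \<and> length bs \<le> N} \<times> UNIV" by simp
  then show "{bs. set bs \<subseteq> Basis \<and> length bs \<le> N} \<times> UNIV \<noteq> {}" by (metis emptyE)
qed (use assms in auto)

lemma schwartz_seminorm_nonneg: "f \<in> schwartz \<Longrightarrow> 0 \<le> schwartz_seminorm N f"
  by (rule order_trans[OF _ schwartz_seminorm_upper[of f "[]" N undefined]]) auto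

definition decay_mass :: "'a::euclidean_space itself \<Rightarrow> real" where
  "decay_mass _ = (LINT x::'a|lborel. 1 / (1 + norm x) ^ (2 * DIM('a)))"

lemma decay_mass_nonneg: "0 \<le> decay_mass TYPE('a::euclidean_space)"
  unfolding decay_mass_def by (intro integral_nonneg_AE) auto

lemma integrable_if_decay:
  fixes f :: "'a::euclidean_space \<Rightarrow> 'b::{banach, second_countable_topology}"
  assumes [measurable]: "f \<in> borel_measurable borel"
    and le: "\<And>x. (1 + norm x) ^ (2 * DIM('a)) * norm (f x) \<le> B"
  shows "integrable lborel f" "(LINT x|lborel. norm (f x)) \<le> decay_mass TYPE('a) * B"
proof -
  have le': "norm (f x) \<le> 1 / (1 + norm x) ^ (2 * DIM('a)) * B" for x
    using le[of x] by (simp add: field_simps zero_less_power add_pos_nonneg)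
  have i: "integrable lborel (\<lambda>x::'a. 1 / (1 + norm x) ^ (2 * DIM('a)) * B)"
    by (intro integrable_mult_left integrable_inverse_power)
  show 1: "integrable lborel f"
    by (rule Bochner_Integration.integrable_bound[OF i]) (simp, intro AE_I2, unfold real_norm_def, rule order_trans[OF le' abs_ge_self])
  have "(LINT x|lborel. norm (f x)) \<le> (LINT x::'a|lborel. 1 / (1 + norm x) ^ (2 * DIM('a)) * B)"
    by (intro integral_mono integrable_norm 1 i le')
  also have "\<dots> = decay_mass TYPE('a) * B"
    unfolding decay_mass_def by (rule integral_mult_left_zero)
  finally show "(LINT x|lborel. norm (f x)) \<le> decay_mass TYPE('a) * B" .
qed

lemma schwartz_integrable_seminorm:
  fixes f :: "'a::euclidean_space \<Rightarrow> complex"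
  assumes f: "f \<in> schwartz" and bs: "set bs \<subseteq> Basis" "length bs \<le> N" "2 * DIM('a) \<le> N"
  shows "integrable lborel (pderivs bs f)"
    and "(LINT x|lborel. norm (pderivs bs f x)) \<le> decay_mass TYPE('a) * schwartz_seminorm N f"
proof -
  have m: "pderivs bs f \<in> borel_measurable borel"
    by (intro smooth_measurable smooth_pderivs schwartzD f bs)
  have le: "(1 + norm x) ^ (2 * DIM('a)) * norm (pderivs bs f x) \<le> schwartz_seminorm N f" for x
  proof (rule order_trans[OF _ schwartz_seminorm_upper[OF f bs(1,2), of x]])
    show "(1 + norm x) ^ (2 * DIM('a)) * norm (pderivs bs f x) \<le> (1 + norm x) ^ N * norm (pderivs bs f x)"
      by (intro mult_right_mono power_increasing bs) auto
  qed
  show "integrable lborel (pderivs bs f)"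
    "(LINT x|lborel. norm (pderivs bs f x)) \<le> decay_mass TYPE('a) * schwartz_seminorm N f"
    using integrable_if_decay[OF m le] by auto
qed

lemma schwartz_integrable: "f \<in> schwartz \<Longrightarrow> integrable lborel f"
  using schwartz_integrable_seminorm(1)[of f "[]"] by auto

section \<open>The Fourier transform\<close>

definition fourier_const :: "'a::euclidean_space itself \<Rightarrow> real" where
  "fourier_const _ = (2 * pi) powr (- real DIM('a) / 2)"

definition ifourier :: "('a::euclidean_space \<Rightarrow> complex) \<Rightarrow> 'a \<Rightarrow> complex" where
  "ifourier f \<xi> = fourier f (- \<xi>)"

lemma fourier_const_pos: "fourier_const TYPE('a::euclidean_space) > 0"
  by (simp add: fourier_const_def)

lemma fourier_eq:
  "fourier f \<xi> = of_real (fourier_const TYPE('a)) * (LINT x|lborel. exp (- (\<i> * of_real (\<xi> \<bullet> x))) * f x)"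
  for \<xi> :: "'a::euclidean_space"
  by (simp add: fourier_def fourier_const_def)

lemma integrable_exp_mult:
  fixes f :: "'a::euclidean_space \<Rightarrow> complex"
  assumes f: "integrable lborel f"
  shows "integrable lborel (\<lambda>x. exp (- (\<i> * of_real (\<xi> \<bullet> x))) * f x)"
proof -
  have [measurable]: "f \<in> borel_measurable borel" using f by (simp add: integrable_iff_bounded)
  show ?thesis
    by (rule Bochner_Integration.integrable_bound[OF f]) (auto simp: norm_mult)
qed

lemma norm_fourier_le:
  fixes f :: "'a::euclidean_space \<Rightarrow> complex"
  shows "norm (fourier f \<xi>) \<le> fourier_const TYPE('a) * (LINT x|lborel. norm (f x))"
proof -
  have "norm (LINT x|lborel. exp (- (\<i> * of_real (\<xi> \<bullet> x))) * f x) \<le>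
      (LINT x|lborel. norm (exp (- (\<i> * of_real (\<xi> \<bullet> x))) * f x))"
    by (rule integral_norm_bound)
  then show ?thesis
    using fourier_const_pos[where 'a='a] by (simp add: fourier_eq norm_mult)
qed

lemma fourier_add:
  assumes "integrable lborel f" "integrable lborel g"
  shows "fourier (\<lambda>x. f x + g x) \<xi> = fourier f \<xi> + fourier g \<xi>"
  using assms by (simp add: fourier_eq distrib_left integrable_exp_mult)

lemma fourier_cmult: "fourier (\<lambda>x. c * f x) \<xi> = c * fourier f \<xi>"
  by (simp add: fourier_eq mult.left_commute[of _ c])

lemma ifourier_add:
  assumes "integrable lborel f" "integrable lborel g"
  shows "ifourier (\<lambda>x. f x + g x) \<xi> = ifourier f \<xi> + ifourier g \<xi>"
  using assms by (simp add: ifourier_def fourier_add)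

lemma ifourier_cmult: "ifourier (\<lambda>x. c * f x) \<xi> = c * ifourier f \<xi>"
  by (simp add: ifourier_def fourier_cmult)

lemma fourier_measurable [measurable]:
  fixes f :: "'a::euclidean_space \<Rightarrow> complex"
  assumes [measurable]: "f \<in> borel_measurable borel"
  shows "fourier f \<in> borel_measurable borel"
  unfolding fourier_eq by measurable

lemma ifourier_measurable [measurable]:
  fixes f :: "'a::euclidean_space \<Rightarrow> complex"
  assumes [measurable]: "f \<in> borel_measurable borel"
  shows "ifourier f \<in> borel_measurable borel"
  unfolding ifourier_def fourier_eq by measurable

lemma fourier_mult_formula:
  fixes f g :: "'a::euclidean_space \<Rightarrow> complex"
  assumes f: "integrable lborel f" and g: "integrable lborel g"
  shows "(LINT x|lborel. fourier f x * g x) = (LINT x|lborel. f x * fourier g x)"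
proof -
  have [measurable]: "f \<in> borel_measurable borel" "g \<in> borel_measurable borel"
    using f g by (auto simp: integrable_iff_bounded)
  let ?c = "complex_of_real (fourier_const TYPE('a))"
  let ?h = "\<lambda>y x. exp (- (\<i> * of_real (x \<bullet> y))) * f y * g x"
  have "(LINT x|lborel. fourier f x * g x) = ?c * (LINT x|lborel. LINT y|lborel. ?h y x)"
  proof -
    have "(LINT y|lborel. ?h y x) = (LINT y|lborel. exp (- (\<i> * of_real (x \<bullet> y))) * f y) * g x" for x
      by (rule integral_mult_left_zero)
    then show ?thesis by (simp only: fourier_eq mult.assoc integral_mult_right_zero)
  qed
  also have "(LINT x|lborel. LINT y|lborel. ?h y x) = (LINT y|lborel. LINT x|lborel. ?h y x)"
  proof (rule Fubini_bound[OF _ integrable_norm[OF f] integrable_norm[OF g]])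
    show "(\<lambda>(y, x). ?h y x) \<in> borel_measurable (lborel \<Otimes>\<^sub>M lborel)" by measurable
  qed (simp add: norm_mult)
  also have "?c * (LINT y|lborel. LINT x|lborel. ?h y x) = (LINT y|lborel. f y * fourier g y)"
  proof -
    have "(LINT x|lborel. ?h y x) = f y * (LINT x|lborel. exp (- (\<i> * of_real (y \<bullet> x))) * g x)" for y
      by (subst integral_mult_right_zero[symmetric]) (simp add: mult_ac inner_commute)
    then show ?thesis
      by (simp only: fourier_eq mult.left_commute[of "f _"] integral_mult_right_zero)
  qed
  finally show ?thesis .
qed

lemma ifourier_mult_formula:
  fixes f g :: "'a::euclidean_space \<Rightarrow> complex"
  assumes f: "integrable lborel f" and g: "integrable lborel g"
  shows "(LINT x|lborel. ifourier f x * g x) = (LINT x|lborel. f x * ifourier g x)"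
proof -
  have [measurable]: "f \<in> borel_measurable borel" "g \<in> borel_measurable borel"
    using f g by (auto simp: integrable_iff_bounded)
  have r: "fourier (\<lambda>x. g (- x)) y = ifourier g y" for y
    using lborel_integral_reflect[of "\<lambda>x. exp (- (\<i> * of_real (- y \<bullet> x))) * g x" 0]
    by (simp add: ifourier_def fourier_eq)
  have "(LINT x|lborel. ifourier f x * g x) = (LINT x|lborel. fourier f x * g (- x))"
    using lborel_integral_reflect[of "\<lambda>x. fourier f x * g (- x)" 0] by (simp add: ifourier_def)
  also have "\<dots> = (LINT x|lborel. f x * fourier (\<lambda>x. g (- x)) x)"
    using lborel_integrable_reflect[OF g, of 0] by (intro fourier_mult_formula f) simp
  finally show ?thesis by (simp add: r)
qed

subsection \<open>Differentiation and decay\<close>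

lemma pdiff_exp_mult:
  fixes f :: "'a::euclidean_space \<Rightarrow> complex"
  assumes f: "f differentiable (at x)"
  shows "(\<lambda>x. exp (- (\<i> * of_real (\<xi> \<bullet> x))) * f x) differentiable (at x)"
    and "pdiff b (\<lambda>x. exp (- (\<i> * of_real (\<xi> \<bullet> x))) * f x) x =
       exp (- (\<i> * of_real (\<xi> \<bullet> x))) * (pdiff b f x - \<i> * of_real (\<xi> \<bullet> b) * f x)"
proof -
  have "((\<lambda>x. - (\<i> * complex_of_real (\<xi> \<bullet> x))) has_derivative (\<lambda>h. - (\<i> * of_real (\<xi> \<bullet> h)))) (at x)"
    by (auto intro!: derivative_eq_intros)
  from has_derivative_compose[OF this DERIV_exp[unfolded has_field_derivative_def]]
  have D: "((\<lambda>x. exp (- (\<i> * complex_of_real (\<xi> \<bullet> x)))) has_derivative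
    (\<lambda>h. - (\<i> * of_real (\<xi> \<bullet> h)) * exp (- (\<i> * of_real (\<xi> \<bullet> x))))) (at x)"
    by (simp add: mult.commute)
  then have d: "(\<lambda>x. exp (- (\<i> * complex_of_real (\<xi> \<bullet> x)))) differentiable (at x)"
    by (rule differentiableI)
  then show "(\<lambda>x. exp (- (\<i> * of_real (\<xi> \<bullet> x))) * f x) differentiable (at x)"
    by (intro differentiable_mult f)
  show "pdiff b (\<lambda>x. exp (- (\<i> * of_real (\<xi> \<bullet> x))) * f x) x =
       exp (- (\<i> * of_real (\<xi> \<bullet> x))) * (pdiff b f x - \<i> * of_real (\<xi> \<bullet> b) * f x)"
    unfolding pdiff_mult[OF d f] pdiff_eqI[OF D] by (simp add: algebra_simps)
qed

lemma fourier_pdiff: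
  fixes f :: "'a::euclidean_space \<Rightarrow> complex"
  assumes f: "f \<in> schwartz" and b: "b \<in> Basis"
  shows "fourier (pdiff b f) \<xi> = \<i> * of_real (\<xi> \<bullet> b) * fourier f \<xi>"
proof -
  let ?e = "\<lambda>x. exp (- (\<i> * complex_of_real (\<xi> \<bullet> x)))"
  let ?h = "\<lambda>x. ?e x * f x"
  have d: "f differentiable (at x)" for x by (intro smooth_differentiable schwartzD f)
  have g: "pdiff b f \<in> schwartz" by (rule schwartz_pdiff[OF f b])
  have pd: "pdiff b ?h = (\<lambda>x. ?e x * pdiff b f x - \<i> * of_real (\<xi> \<bullet> b) * (?e x * f x))"
    by (rule ext, subst pdiff_exp_mult(2)[OF d]) (simp add: algebra_simps)
  have i_f: "integrable lborel ?h" by (intro integrable_exp_mult schwartz_integrable f)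
  have i_g: "integrable lborel (\<lambda>x. ?e x * pdiff b f x)" by (intro integrable_exp_mult schwartz_integrable g)
  have "(LINT x|lborel. pdiff b ?h x) = 0"
  proof (rule integral_pdiff_eq_0[OF pdiff_exp_mult(1)[OF d] _ i_f])
    show "continuous_on UNIV (pdiff b ?h)"
      unfolding pd by (intro continuous_intros smooth_continuous schwartzD f g)
    show "integrable lborel (pdiff b ?h)" unfolding pd
      by (intro Bochner_Integration.integrable_diff i_g integrable_mult_right i_f)
  qed
  then have "(LINT x|lborel. ?e x * pdiff b f x) = \<i> * of_real (\<xi> \<bullet> b) * (LINT x|lborel. ?e x * f x)"
    unfolding pd by (subst (asm) Bochner_Integration.integral_diff[OF i_g integrable_mult_right[OF i_f]]) simp
  then show ?thesis by (simp add: fourier_eq mult_ac)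
qed

lemma fourier_pderivs_replicate:
  assumes f: "f \<in> schwartz" and b: "b \<in> Basis"
  shows "fourier (pderivs (replicate n b) f) \<xi> = (\<i> * of_real (\<xi> \<bullet> b)) ^ n * fourier f \<xi>"
proof (induction n)
  case (Suc n)
  have "pderivs (replicate n b) f \<in> schwartz" using b by (intro schwartz_pderivs f) auto
  from fourier_pdiff[OF this b] Suc show ?case
    by (simp add: pderivs_Cons del: pderivs.simps(2)) 
qed simp

text \<open>Comparison with the largest of 1 and the coordinates
  \<open>\<bar>\<xi> \<bullet> b\<bar>\<close> leaves only pure powers of single coordinates. Decay
  of a Fourier transform then follows from derivatives in one direction at a time, the lists
  \<open>replicate M b\<close>.\<close>

lemma one_plus_norm_power_le:
  fixes \<xi> :: "'a::euclidean_space"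
  shows "(1 + norm \<xi>) ^ M \<le> (real DIM('a) + 1) ^ M * (1 + (\<Sum>b\<in>Basis. \<bar>\<xi> \<bullet> b\<bar> ^ M))"
proof -
  define \<mu> where "\<mu> = Max (insert 1 ((\<lambda>b. \<bar>\<xi> \<bullet> b\<bar>) ` Basis))"
  have le: "\<bar>\<xi> \<bullet> b\<bar> \<le> \<mu>" if "b \<in> Basis" for b
    unfolding \<mu>_def using that by (intro Max_ge) auto
  have le1: "1 \<le> \<mu>" unfolding \<mu>_def by (intro Max_ge) auto
  have "norm \<xi> \<le> (\<Sum>b\<in>Basis. \<bar>\<xi> \<bullet> b\<bar>)" by (rule norm_le_l1)
  also have "\<dots> \<le> (\<Sum>b\<in>(Basis::'a set). \<mu>)" by (intro sum_mono le)
  finally have "1 + norm \<xi> \<le> (real DIM('a) + 1) * \<mu>" using le1 by (simp add: algebra_simps)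
  then have "(1 + norm \<xi>) ^ M \<le> ((real DIM('a) + 1) * \<mu>) ^ M" by (intro power_mono) auto
  also have "\<dots> = (real DIM('a) + 1) ^ M * \<mu> ^ M" by (simp add: power_mult_distrib)
  also have "\<dots> \<le> (real DIM('a) + 1) ^ M * (1 + (\<Sum>b\<in>Basis. \<bar>\<xi> \<bullet> b\<bar> ^ M))"
  proof (intro mult_left_mono)
    have "\<mu> \<in> insert 1 ((\<lambda>b. \<bar>\<xi> \<bullet> b\<bar>) ` Basis)" unfolding \<mu>_def by (intro Max_in) auto
    then show "\<mu> ^ M \<le> 1 + (\<Sum>b\<in>Basis. \<bar>\<xi> \<bullet> b\<bar> ^ M)"
    proof
      assume "\<mu> = 1"
      then show ?thesis by (simp add: sum_nonneg)
    next
      assume "\<mu> \<in> (\<lambda>b. \<bar>\<xi> \<bullet> b\<bar>) ` Basis"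
      then obtain b where "b \<in> Basis" "\<mu> = \<bar>\<xi> \<bullet> b\<bar>" by auto
      then have "\<mu> ^ M \<le> (\<Sum>b\<in>Basis. \<bar>\<xi> \<bullet> b\<bar> ^ M)"
        by (auto intro!: member_le_sum[of b Basis "\<lambda>b. \<bar>\<xi> \<bullet> b\<bar> ^ M"])
      then show ?thesis by simp
    qed
  qed auto
  finally show ?thesis .
qed

text \<open>Up to \<open>M\<close> derivatives produce \<open>M\<close> powers of \<xi>, and
  \<open>2 * DIM('a)\<close> powers of \<open>x\<close> make each derivative integrable; hence the
  order of the seminorm. The exponent \<open>Suc M\<close> collects the constant of
  \<open>one_plus_norm_power_le\<close> and the \<open>DIM('a) + 1\<close> equal terms of the final
  sum.\<close>

lemma fourier_decay:
  fixes f :: "'a::euclidean_space \<Rightarrow> complex"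
  assumes f: "f \<in> schwartz"
  shows "(1 + norm \<xi>) ^ M * norm (fourier f \<xi>) \<le>
    (real DIM('a) + 1) ^ Suc M * (fourier_const TYPE('a) * decay_mass TYPE('a)) *
      schwartz_seminorm (max M (2 * DIM('a))) f"
proof -
  let ?N = "max M (2 * DIM('a))" let ?c = "fourier_const TYPE('a)" let ?d = "decay_mass TYPE('a)"
  have c: "?c > 0" by (rule fourier_const_pos)
  have b: "norm (fourier (pderivs bs f) \<xi>) \<le> ?c * ?d * schwartz_seminorm ?N f"
    if "set bs \<subseteq> Basis" "length bs \<le> M" for bs
  proof -
    have "norm (fourier (pderivs bs f) \<xi>) \<le> ?c * (LINT x|lborel. norm (pderivs bs f x))"
      by (rule norm_fourier_le)
    also have "\<dots> \<le> ?c * (?d * schwartz_seminorm ?N f)"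
      using that c by (intro mult_left_mono schwartz_integrable_seminorm f) auto
    finally show ?thesis by (simp add: mult.assoc)
  qed
  have "(1 + norm \<xi>) ^ M * norm (fourier f \<xi>) \<le>
      (real DIM('a) + 1) ^ M * (1 + (\<Sum>b\<in>Basis. \<bar>\<xi> \<bullet> b\<bar> ^ M)) * norm (fourier f \<xi>)"
    by (intro mult_right_mono one_plus_norm_power_le) auto
  also have "\<dots> = (real DIM('a) + 1) ^ M * (norm (fourier (pderivs [] f) \<xi>) +
      (\<Sum>b\<in>Basis. norm (fourier (pderivs (replicate M b) f) \<xi>)))"
    by (simp add: fourier_pderivs_replicate[OF f] norm_mult norm_power sum_distrib_right
        distrib_left distrib_right mult.assoc)
  also have "\<dots> \<le> (real DIM('a) + 1) ^ M * (?c * ?d * schwartz_seminorm ?N f +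
      (\<Sum>b\<in>(Basis::'a set). ?c * ?d * schwartz_seminorm ?N f))"
    by (intro mult_left_mono add_mono sum_mono b) auto
  also have "\<dots> = (real DIM('a) + 1) ^ Suc M * (?c * ?d) * schwartz_seminorm ?N f"
    by (simp add: algebra_simps)
  finally show ?thesis .
qed

section \<open>Moment conditions and differentiability of Fourier transforms\<close>

text \<open>Finite moments of all orders, with no regularity demanded. The class is stable under
  multiplication by coordinates, hence its Fourier transforms are closed under differentiation, and
  it contains the damped transforms \<open>mollify_hat\<close>, which are merely measurable.\<close>

definition rapid :: "('a::euclidean_space \<Rightarrow> complex) \<Rightarrow> bool" where
  "rapid g \<longleftrightarrow> (\<forall>N. integrable lborel (\<lambda>x. (1 + norm x) ^ N *\<^sub>R g x))"

lemma rapid_integrable: "rapid g \<Longrightarrow> integrable lborel g"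
  unfolding rapid_def by (drule spec[of _ 0]) simp

lemma rapid_measurable: "rapid g \<Longrightarrow> g \<in> borel_measurable borel"
  using rapid_integrable[of g] by (simp add: integrable_iff_bounded)

lemma rapid_bound:
  assumes g: "rapid g" and [measurable]: "h \<in> borel_measurable borel"
    and le: "\<And>x. norm (h x) \<le> C * (1 + norm x) ^ N * norm (g x)"
  shows "rapid h"
  unfolding rapid_def
proof
  fix M
  have [measurable]: "g \<in> borel_measurable borel" by (rule rapid_measurable[OF g])
  have i: "integrable lborel (\<lambda>x. C * norm ((1 + norm x) ^ (M + N) *\<^sub>R g x))"
    using g unfolding rapid_def by (intro integrable_mult_right integrable_norm) auto
  show "integrable lborel (\<lambda>x. (1 + norm x) ^ M *\<^sub>R h x)"
  proof (rule Bochner_Integration.integrable_bound[OF i])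
    show "AE x in lborel. norm ((1 + norm x) ^ M *\<^sub>R h x) \<le> norm (C * norm ((1 + norm x) ^ (M + N) *\<^sub>R g x))"
    proof (intro AE_I2)
      fix x
      have "norm ((1 + norm x) ^ M *\<^sub>R h x) \<le> (1 + norm x) ^ M * (C * (1 + norm x) ^ N * norm (g x))"
        by (simp add: mult_left_mono le)
      also have "\<dots> \<le> norm (C * norm ((1 + norm x) ^ (M + N) *\<^sub>R g x))"
        unfolding real_norm_def by (rule order_trans[OF _ abs_ge_self]) (simp add: power_add mult_ac)
      finally show "norm ((1 + norm x) ^ M *\<^sub>R h x) \<le> norm (C * norm ((1 + norm x) ^ (M + N) *\<^sub>R g x))" .
    qed
  qed measurable
qed

text \<open>The factor is the derivative of \<open>- (\<i> * (\<xi> \<bullet> x))\<close> in \<xi>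
  along \<open>b\<close>, so this is \<open>pdiff b\<close> seen from the other side of the Fourier
  transform.\<close>

definition mult_coord :: "'a::euclidean_space \<Rightarrow> ('a \<Rightarrow> complex) \<Rightarrow> 'a \<Rightarrow> complex" where
  "mult_coord b f = (\<lambda>x. - (\<i> * of_real (x \<bullet> b)) * f x)"

lemma rapid_mult_coord:
  assumes g: "rapid g"
  shows "rapid (mult_coord b g)"
proof (rule rapid_bound[OF g, where C="norm b" and N=1])
  have [measurable]: "g \<in> borel_measurable borel" by (rule rapid_measurable[OF g])
  show "mult_coord b g \<in> borel_measurable borel" unfolding mult_coord_def by measurable
  fix x
  have "\<bar>x \<bullet> b\<bar> \<le> norm b * (1 + norm x)"
    using Cauchy_Schwarz_ineq2[of x b] by (simp add: algebra_simps add_increasing)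
  then show "norm (mult_coord b g x) \<le> norm b * (1 + norm x) ^ 1 * norm (g x)"
    by (simp add: mult_coord_def norm_mult mult_right_mono)
qed

lemma norm_exp_ii_diff_le: "norm (exp (- (\<i> * complex_of_real t)) - 1 + \<i> * of_real t) \<le> t\<^sup>2 / 2"
  using iexp_approx1[of "- t" 1] by (simp add: power2_eq_square fact_numeral algebra_simps)

text \<open>The second-order Taylor remainder of the exponential is at most \<open>t^2 / 2\<close>.
  Integrated against the finite second moment of \<open>g\<close>, the error is quadratic in
  \<open>\<eta> - \<xi>\<close>, uniformly in \<xi>.\<close>

lemma fourier_has_derivative:
  fixes g :: "'a::euclidean_space \<Rightarrow> complex"
  assumes g: "rapid g"
  shows "(fourier g has_derivative (\<lambda>h. fourier (mult_coord h g) \<xi>)) (at \<xi>)"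
proof (rule has_derivativeI_sandwich[of 1])
  let ?c = "fourier_const TYPE('a)"
  have [measurable]: "g \<in> borel_measurable borel" by (rule rapid_measurable[OF g])
  have i[simp]: "integrable lborel (mult_coord h g)" "integrable lborel g" for h
    by (intro rapid_integrable rapid_mult_coord g)+
  have lin: "mult_coord (h + h') g = (\<lambda>x. mult_coord h g x + mult_coord h' g x)"
    "mult_coord (r *\<^sub>R h) g = (\<lambda>x. of_real r * mult_coord h g x)" for h h' r
    by (auto simp: mult_coord_def inner_simps algebra_simps)
  let ?m1 = "LINT x|lborel. norm ((1 + norm x) ^ 1 *\<^sub>R g x)"
  let ?m2 = "LINT x|lborel. norm ((1 + norm x) ^ 2 *\<^sub>R g x)"
  have i1: "integrable lborel (\<lambda>x. norm ((1 + norm x) ^ 1 *\<^sub>R g x))"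
    and i2: "integrable lborel (\<lambda>x. norm ((1 + norm x) ^ 2 *\<^sub>R g x))"
    using g unfolding rapid_def by (rule_tac integrable_norm, blast)+
  show "bounded_linear (\<lambda>h. fourier (mult_coord h g) \<xi>)"
  proof (rule bounded_linear_intro[where K="?c * ?m1"])
    fix h
    have "norm (fourier (mult_coord h g) \<xi>) \<le> ?c * (LINT x|lborel. norm (mult_coord h g x))"
      by (rule norm_fourier_le)
    also have "(LINT x|lborel. norm (mult_coord h g x)) \<le> (LINT x|lborel. norm h * norm ((1 + norm x) ^ 1 *\<^sub>R g x))"
    proof (rule integral_mono[OF integrable_norm[OF i(1)] integrable_mult_right[OF i1]])
      fix x
      have "\<bar>x \<bullet> h\<bar> \<le> norm h * (1 + norm x)"
        using Cauchy_Schwarz_ineq2[of x h] by (simp add: algebra_simps add_increasing)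
      from mult_right_mono[OF this norm_ge_zero[of "g x"]]
      show "norm (mult_coord h g x) \<le> norm h * norm ((1 + norm x) ^ 1 *\<^sub>R g x)"
        by (simp add: mult_coord_def norm_mult mult.assoc)
    qed
    finally show "norm (fourier (mult_coord h g) \<xi>) \<le> norm h * (?c * ?m1)"
      using fourier_const_pos[where 'a='a] by (simp add: mult_ac)
  qed (simp_all add: lin fourier_add fourier_cmult scaleR_conv_of_real)
  show "((\<lambda>\<eta>. (?c * ?m2) * norm (\<eta> - \<xi>)) \<longlongrightarrow> 0) (at \<xi>)"
    by (rule tendsto_eq_intros refl | simp)+
  fix \<eta> assume "\<eta> \<noteq> \<xi>"
  let ?e = "\<lambda>\<xi> x. exp (- (\<i> * complex_of_real (\<xi> \<bullet> x)))"
  let ?r = "\<lambda>x. ?e \<eta> x * g x - ?e \<xi> x * g x - ?e \<xi> x * mult_coord (\<eta> - \<xi>) g x"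
  have ir: "integrable lborel ?r"
    by (intro Bochner_Integration.integrable_diff integrable_exp_mult i)
  have r1: "fourier g \<eta> - fourier g \<xi> - fourier (mult_coord (\<eta> - \<xi>) g) \<xi> = of_real ?c * (LINT x|lborel. ?r x)"
    by (simp add: fourier_eq integrable_exp_mult right_diff_distrib)
  have r2: "norm (of_real ?c * (LINT x|lborel. ?r x)) \<le> ?c * (LINT x|lborel. norm (?r x))"
    using fourier_const_pos[where 'a='a] by (simp add: norm_mult integral_norm_bound)
  have r3: "(LINT x|lborel. norm (?r x)) \<le> (LINT x|lborel. (norm (\<eta> - \<xi>))\<^sup>2 * norm ((1 + norm x) ^ 2 *\<^sub>R g x))"
  proof (rule integral_mono)
    show "integrable lborel (\<lambda>x. norm (?r x))" by (rule integrable_norm[OF ir])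
    show "integrable lborel (\<lambda>x. (norm (\<eta> - \<xi>))\<^sup>2 * norm ((1 + norm x) ^ 2 *\<^sub>R g x))"
      by (rule integrable_mult_right[OF i2])
    fix x
    have "?r x = ?e \<xi> x * (exp (- (\<i> * complex_of_real ((\<eta> - \<xi>) \<bullet> x))) - 1 + \<i> * of_real ((\<eta> - \<xi>) \<bullet> x)) * g x"
    proof -
      have gen: "a * b * z - a * z - a * (- t * z) = a * (b - 1 + t) * z" for a b t z :: complex
        by (simp add: algebra_simps)
      have 1: "?e \<eta> x = ?e \<xi> x * exp (- (\<i> * complex_of_real ((\<eta> - \<xi>) \<bullet> x)))"
        by (subst exp_add[symmetric]) (simp add: inner_diff_left algebra_simps)
      have 2: "mult_coord (\<eta> - \<xi>) g x = - (\<i> * of_real ((\<eta> - \<xi>) \<bullet> x)) * g x"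
        by (simp add: mult_coord_def inner_commute)
      show ?thesis unfolding 1 2 by (rule gen)
    qed
    then have "norm (?r x) = norm (exp (- (\<i> * complex_of_real ((\<eta> - \<xi>) \<bullet> x))) - 1 + \<i> * of_real ((\<eta> - \<xi>) \<bullet> x)) * norm (g x)"
      by (simp add: norm_mult)
    also have "\<dots> \<le> (norm (\<eta> - \<xi>) * (1 + norm x))\<^sup>2 * norm (g x)"
    proof (intro mult_right_mono order_trans[OF norm_exp_ii_diff_le])
      have "\<bar>(\<eta> - \<xi>) \<bullet> x\<bar> \<le> norm (\<eta> - \<xi>) * (1 + norm x)"
        using Cauchy_Schwarz_ineq2[of "\<eta> - \<xi>" x] by (simp add: algebra_simps add_increasing)
      then have "\<bar>(\<eta> - \<xi>) \<bullet> x\<bar>\<^sup>2 \<le> (norm (\<eta> - \<xi>) * (1 + norm x))\<^sup>2" by (intro power_mono) auto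
      then show "((\<eta> - \<xi>) \<bullet> x)\<^sup>2 / 2 \<le> (norm (\<eta> - \<xi>) * (1 + norm x))\<^sup>2"
        unfolding power2_abs using zero_le_power2[of "norm (\<eta> - \<xi>) * (1 + norm x)"] by linarith
    qed auto
    also have "\<dots> = (norm (\<eta> - \<xi>))\<^sup>2 * norm ((1 + norm x) ^ 2 *\<^sub>R g x)"
      by (simp add: power_mult_distrib)
    finally show "norm (?r x) \<le> (norm (\<eta> - \<xi>))\<^sup>2 * norm ((1 + norm x) ^ 2 *\<^sub>R g x)" .
  qed
  have "norm (fourier g \<eta> - fourier g \<xi> - fourier (mult_coord (\<eta> - \<xi>) g) \<xi>) \<le> (?c * ?m2) * (norm (\<eta> - \<xi>))\<^sup>2"
    unfolding r1 using order_trans[OF r2 mult_left_mono[OF r3 less_imp_le[OF fourier_const_pos[where 'a='a]]]]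
    by (simp only: integral_mult_right_zero mult_ac)
  then show "norm (fourier g \<eta> - fourier g \<xi> - fourier (mult_coord (\<eta> - \<xi>) g) \<xi>) / norm (\<eta> - \<xi>)
     \<le> (?c * ?m2) * norm (\<eta> - \<xi>)"
    using \<open>\<eta> \<noteq> \<xi>\<close> by (simp add: divide_le_eq power2_eq_square mult.assoc)
qed simp

lemma pdiff_fourier: "rapid g \<Longrightarrow> pdiff b (fourier g) = fourier (mult_coord b g)"
  by (intro ext pdiff_eqI fourier_has_derivative)

lemma smooth_fourier:
  assumes "rapid g"
  shows "smooth (fourier g)"
  by (rule smooth_coinduct'[of _ "fourier ` Collect rapid"])
     (use assms in \<open>auto simp: pdiff_fourier intro: rapid_mult_coord differentiableI fourier_has_derivative\<close>)

lemma smooth_ifourier: "rapid g \<Longrightarrow> smooth (ifourier g)"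
  unfolding ifourier_def[abs_def] by (intro smooth_reflect smooth_fourier)

lemma rapid_schwartz:
  assumes f: "f \<in> schwartz"
  shows "rapid f"
  unfolding rapid_def
proof
  fix N
  have m[measurable]: "f \<in> borel_measurable borel" by (intro smooth_measurable schwartzD f)
  obtain B where "\<And>x. (1 + norm x) ^ (2 * DIM('a) + N) * norm (f x) \<le> B"
    using schwartz_seminorm_upper[OF f, of "[]" "2 * DIM('a) + N"] by auto
  then show "integrable lborel (\<lambda>x. (1 + norm x) ^ N *\<^sub>R f x)"
    by (intro integrable_if_decay[of _ B]) (auto simp: power_add mult.assoc)
qed

lemma test_functions_mult_coord: "f \<in> test_functions \<Omega> \<Longrightarrow> mult_coord b f \<in> test_functions \<Omega>"
  unfolding mult_coord_def using smooth_cmult[OF smooth_inner, of "- \<i>"]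
  by (intro test_functions_mult) auto

text \<open>Every derivative of \<open>fourier f\<close> is the Fourier transform of another test
  function, \<open>f\<close> times coordinate factors, so the decay estimate for undifferentiated
  transforms covers all derivatives.\<close>

lemma fourier_test_function_schwartz:
  assumes f: "f \<in> test_functions \<Omega>"
  shows "fourier f \<in> schwartz"
proof -
  have *: "\<exists>g\<in>test_functions \<Omega>. pderivs bs (fourier f) = fourier g" if "set bs \<subseteq> Basis" for bs
    using that
  proof (induction bs)
    case (Cons b bs)
    then obtain g where "g \<in> test_functions \<Omega>" "pderivs bs (fourier f) = fourier g" by auto
    then show ?case
      by (intro bexI[of _ "mult_coord b g"])
         (simp_all add: pderivs_Cons pdiff_fourier rapid_schwartz test_functions_schwartz
           test_functions_mult_coord del: pderivs.simps(2))
  qed (use f in auto)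
  show ?thesis unfolding schwartz_def
  proof (intro CollectI conjI allI impI)
    show "smooth (fourier f)" by (intro smooth_fourier rapid_schwartz test_functions_schwartz[OF f])
    fix N :: nat and bs :: "'a list" assume "set bs \<subseteq> Basis"
    then obtain g where g: "g \<in> test_functions \<Omega>" "pderivs bs (fourier f) = fourier g" using * by blast
    show "bounded (range (\<lambda>x. (1 + norm x) ^ N * norm (pderivs bs (fourier f) x)))"
      unfolding g bounded_iff using fourier_decay[OF test_functions_schwartz[OF g(1)], of _ N]
      by (auto simp: abs_mult)
  qed
qed

lemma pderivs_reflect:
  assumes "smooth f" "set bs \<subseteq> Basis"
  shows "pderivs bs (\<lambda>x. f (- x)) = (\<lambda>x. (-1) ^ length bs * pderivs bs f (- x))"
  using assms(2)
proof (induction bs)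
  case (Cons b bs)
  let ?p = "pderivs bs f"
  have s: "smooth ?p" using Cons assms by (intro smooth_pderivs) auto
  have "pderivs (b # bs) (\<lambda>x. f (- x)) = pdiff b (\<lambda>x. (-1) ^ length bs * ?p (- x))"
    using Cons by (simp only: pderivs_Cons) simp
  also have "\<dots> = (\<lambda>x. (-1) ^ length bs * pdiff b (\<lambda>x. ?p (- x)) x)"
    by (intro ext pdiff_cmult smooth_differentiable smooth_reflect s)
  also have "\<dots> = (\<lambda>x. (-1) ^ length (b # bs) * pderivs (b # bs) f (- x))"
    using pdiff_affine[OF s, of b 0 "-1"] by (simp add: pderivs_Cons del: pderivs.simps(2))
  finally show ?case .
qed simp

lemma schwartz_reflect:
  assumes f: "f \<in> schwartz"
  shows "(\<lambda>x. f (- x)) \<in> schwartz"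
  unfolding schwartz_def
proof (intro CollectI conjI allI impI)
  fix N :: nat and bs :: "'a list" assume bs: "set bs \<subseteq> Basis"
  have "range (\<lambda>x. (1 + norm x) ^ N * norm (pderivs bs (\<lambda>x. f (- x)) x)) =
      range (\<lambda>x. (1 + norm (- x)) ^ N * norm (pderivs bs f (- x)))"
    unfolding pderivs_reflect[OF schwartzD[OF f] bs] by (simp add: norm_mult norm_power)
  also have "\<dots> \<subseteq> range (\<lambda>x. (1 + norm x) ^ N * norm (pderivs bs f x))" by blast
  finally show "bounded (range (\<lambda>x. (1 + norm x) ^ N * norm (pderivs bs (\<lambda>x. f (- x)) x)))"
    using f bs bounded_subset unfolding schwartz_def by blast
qed (intro smooth_reflect schwartzD f)

lemma ifourier_test_function_schwartz: "f \<in> test_functions \<Omega> \<Longrightarrow> ifourier f \<in> schwartz"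
  unfolding ifourier_def[abs_def] by (intro schwartz_reflect fourier_test_function_schwartz)

subsection \<open>Fourier inversion\<close>

definition gauss :: "'a::euclidean_space \<Rightarrow> real" where
  "gauss x = exp (- (norm x)\<^sup>2 / 2)"

lemma gauss_measurable [measurable]: "gauss \<in> borel_measurable borel"
  unfolding gauss_def by measurable

lemma gauss_eq_prod: "complex_of_real (gauss x) = (\<Prod>b\<in>Basis. complex_of_real (gauss (x \<bullet> b)))"
proof -
  have "(norm x)\<^sup>2 = (\<Sum>b\<in>Basis. (x \<bullet> b)\<^sup>2)"
    unfolding power2_norm_eq_inner by (subst euclidean_inner) (simp add: power2_eq_square)
  then have "- (norm x)\<^sup>2 / 2 = (\<Sum>b\<in>Basis. - (norm (x \<bullet> b))\<^sup>2 / 2)"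
    by (simp add: sum_divide_distrib sum_negf)
  then show ?thesis
    by (simp only: gauss_def exp_sum[OF finite_Basis] of_real_prod)
qed

text \<open>Up to scaling, the Gaussian is the density of the standard normal distribution, so its
  transform is that distribution's characteristic function.\<close>

lemma gauss_real_fourier:
  fixes t :: real
  shows "integrable lborel (\<lambda>x. exp (- (\<i> * of_real (t * x))) * of_real (gauss x))"
    and "(LINT x|lborel. exp (- (\<i> * of_real (t * x))) * of_real (gauss x)) = of_real (sqrt (2 * pi) * gauss t)"
proof -
  have g: "gauss x = sqrt (2 * pi) * std_normal_density x" for x :: real
    by (simp add: gauss_def std_normal_density_def)
  have "integrable lborel (\<lambda>x. complex_of_real (gauss (x::real)))"
    unfolding g by (intro integrable_of_real integrable_mult_right integrable_normal_density) simp
  then show "integrable lborel (\<lambda>x. exp (- (\<i> * of_real (t * x))) * of_real (gauss x))"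
    using integrable_exp_mult[of "\<lambda>x. complex_of_real (gauss (x::real))" t] by simp
  have "(LINT x|lborel. exp (- (\<i> * of_real (t * x))) * of_real (gauss x)) =
      (LINT x|lborel. of_real (sqrt (2 * pi)) * (std_normal_density x *\<^sub>R iexp (- t * x)))"
    unfolding g by (intro Bochner_Integration.integral_cong) (simp_all add: scaleR_conv_of_real)
  also have "\<dots> = of_real (sqrt (2 * pi)) * char std_normal_distribution (- t)"
    unfolding char_def integral_mult_right_zero
    by (subst integral_density) (simp_all add: normal_density_nonneg)
  also have "\<dots> = of_real (sqrt (2 * pi) * gauss t)"
    by (simp add: char_std_normal_distribution gauss_def)
  finally show "(LINT x|lborel. exp (- (\<i> * of_real (t * x))) * of_real (gauss x)) = of_real (sqrt (2 * pi) * gauss t)" .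
qed

lemma gauss_fourier:
  fixes \<xi> :: "'a::euclidean_space"
  shows "integrable lborel (\<lambda>x. exp (- (\<i> * of_real (\<xi> \<bullet> x))) * of_real (gauss x))"
    and "(LINT x|lborel. exp (- (\<i> * of_real (\<xi> \<bullet> x))) * of_real (gauss x)) =
      of_real (gauss \<xi> / fourier_const TYPE('a))"
proof -
  have eq: "exp (- (\<i> * of_real (\<xi> \<bullet> x))) * of_real (gauss x) =
    (\<Prod>b\<in>Basis. exp (- (\<i> * of_real ((\<xi> \<bullet> b) * (x \<bullet> b)))) * of_real (gauss (x \<bullet> b)))" for x
  proof -
    have "- (\<i> * complex_of_real (\<xi> \<bullet> x)) = (\<Sum>b\<in>Basis. - (\<i> * of_real ((\<xi> \<bullet> b) * (x \<bullet> b))))"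
      by (subst euclidean_inner) (simp add: sum_distrib_left sum_negf)
    then show ?thesis
      by (simp only: gauss_eq_prod[of x] prod.distrib exp_sum[OF finite_Basis])
  qed
  show "integrable lborel (\<lambda>x. exp (- (\<i> * of_real (\<xi> \<bullet> x))) * of_real (gauss x))"
    unfolding eq by (intro integrable_lborel_prod gauss_real_fourier)
  have "sqrt (2 * pi) ^ DIM('a) = 1 / fourier_const TYPE('a)"
  proof -
    have "sqrt (2 * pi) ^ DIM('a) = ((2 * pi) powr (1 / 2)) powr real DIM('a)"
      by (subst powr_realpow) (simp_all add: powr_half_sqrt)
    also have "\<dots> = (2 * pi) powr (real DIM('a) / 2)" by (simp add: powr_powr)
    also have "\<dots> = 1 / fourier_const TYPE('a)"
      unfolding fourier_const_def minus_divide_left[symmetric] powr_minus_divide by simp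
    finally show ?thesis .
  qed
  moreover have "(LINT x|lborel. exp (- (\<i> * of_real (\<xi> \<bullet> x))) * of_real (gauss x)) =
    (\<Prod>b\<in>Basis. complex_of_real (sqrt (2 * pi) * gauss (\<xi> \<bullet> b)))"
    unfolding eq
    by (subst integrable_lborel_prod(2)[where f="\<lambda>b x. exp (- (\<i> * of_real ((\<xi> \<bullet> b) * x))) * of_real (gauss x)"])
       (rule gauss_real_fourier(1), simp only: gauss_real_fourier(2))
  moreover have "\<dots> = of_real (sqrt (2 * pi) ^ DIM('a) * gauss \<xi>)"
    by (simp only: of_real_mult prod.distrib prod_constant gauss_eq_prod[of \<xi>] of_real_power)
  ultimately show "(LINT x|lborel. exp (- (\<i> * of_real (\<xi> \<bullet> x))) * of_real (gauss x)) =
      of_real (gauss \<xi> / fourier_const TYPE('a))"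
    by simp
qed

text \<open>A wide Gaussian modulated by \<open>x\<close> transforms into a narrow one centred at
  \<open>- x\<close>, with the same total mass for all \<open>n\<close>: up to a constant, an
  approximate identity there.\<close>

lemma fourier_modulated_gauss:
  fixes x y :: "'a::euclidean_space"
  assumes n: "n > 0"
  shows "integrable lborel (\<lambda>\<xi>. exp (- (\<i> * of_real (x \<bullet> \<xi>))) * of_real (gauss ((1 / n) *\<^sub>R \<xi>)))"
    and "fourier (\<lambda>\<xi>. exp (- (\<i> * of_real (x \<bullet> \<xi>))) * of_real (gauss ((1 / n) *\<^sub>R \<xi>))) y =
      of_real (n ^ DIM('a) * gauss (n *\<^sub>R (x + y)))"
proof -
  let ?h = "\<lambda>\<xi>. exp (- (\<i> * of_real (x \<bullet> \<xi>))) * complex_of_real (gauss ((1 / n) *\<^sub>R \<xi>))"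
  have "integrable lborel (\<lambda>\<xi>::'a. complex_of_real (gauss \<xi>))"
    using gauss_fourier(1)[of 0] by simp
  from lborel_integrable_affine[OF this, of "1 / n" 0] n
  have "integrable lborel (\<lambda>\<xi>::'a. complex_of_real (gauss ((1 / n) *\<^sub>R \<xi>)))" by simp
  then show "integrable lborel ?h" by (rule integrable_exp_mult)
  have "(LINT \<xi>|lborel. exp (- (\<i> * of_real (y \<bullet> \<xi>))) * ?h \<xi>) =
      of_real (n ^ DIM('a)) * (LINT \<xi>|lborel. exp (- (\<i> * of_real (y \<bullet> (n *\<^sub>R \<xi>)))) * ?h (n *\<^sub>R \<xi>))"
    using n by (subst lborel_integral_affine[where a=n and c=0]) (auto simp: scaleR_conv_of_real)
  also have "(\<lambda>\<xi>. exp (- (\<i> * of_real (y \<bullet> (n *\<^sub>R \<xi>)))) * ?h (n *\<^sub>R \<xi>)) =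
      (\<lambda>\<xi>. exp (- (\<i> * of_real ((n *\<^sub>R (x + y)) \<bullet> \<xi>))) * of_real (gauss \<xi>))"
    using n by (auto simp: fun_eq_iff inner_simps algebra_simps simp flip: exp_add)
  finally have "(LINT \<xi>|lborel. exp (- (\<i> * of_real (y \<bullet> \<xi>))) * ?h \<xi>) =
      of_real (n ^ DIM('a)) * of_real (gauss (n *\<^sub>R (x + y)) / fourier_const TYPE('a))"
    by (simp only: gauss_fourier)
  then show "fourier ?h y = of_real (n ^ DIM('a) * gauss (n *\<^sub>R (x + y)))"
    unfolding fourier_eq using fourier_const_pos[where 'a='a] by simp
qed

text \<open>The multiplication formula moves \<open>fourier\<close> onto modulated Gaussians of
  growing width. One side is dominated by the integrable \<open>fourier f\<close> and tends to the
  double transform; the other, after rescaling, tends to \<open>f (- x)\<close> since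
  \<open>f\<close> is continuous and bounded. Both limits carry the factor \<open>1 / ?c\<close>,
  which on the second side is the mass of the Gaussian.\<close>

theorem fourier_inversion:
  fixes f :: "'a::euclidean_space \<Rightarrow> complex"
  assumes f: "integrable lborel f" and c: "continuous_on UNIV f" and b: "bounded (range f)"
    and Ff: "integrable lborel (fourier f)"
  shows "fourier (fourier f) x = f (- x)"
proof -
  let ?c = "complex_of_real (fourier_const TYPE('a))"
  have [measurable]: "f \<in> borel_measurable borel" using f by (simp add: integrable_iff_bounded)
  define h where "h n \<xi> = exp (- (\<i> * of_real (x \<bullet> \<xi>))) * complex_of_real (gauss ((1 / real (Suc n)) *\<^sub>R \<xi>))" for n \<xi>
  have h: "integrable lborel (h n)" "fourier (h n) y = of_real (real (Suc n) ^ DIM('a) * gauss (real (Suc n) *\<^sub>R (x + y)))" for n y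
    using fourier_modulated_gauss[of "real (Suc n)" x] unfolding h_def[abs_def] by auto
  have [measurable]: "h n \<in> borel_measurable borel" for n using h(1) by (simp add: integrable_iff_bounded)
  obtain B where B: "\<And>x. norm (f x) \<le> B" using b unfolding bounded_iff by auto
  have g1: "gauss z \<le> 1" "0 \<le> gauss z" for z :: 'a by (auto simp: gauss_def)
  have "(\<lambda>n. (LINT \<xi>|lborel. fourier f \<xi> * h n \<xi>)) \<longlonglongrightarrow> (LINT \<xi>|lborel. fourier f \<xi> * exp (- (\<i> * of_real (x \<bullet> \<xi>))))"
  proof (rule integral_dominated_convergence[where w="\<lambda>\<xi>. norm (fourier f \<xi>)"])
    show "AE \<xi> in lborel. (\<lambda>n. fourier f \<xi> * h n \<xi>) \<longlonglongrightarrow> fourier f \<xi> * exp (- (\<i> * of_real (x \<bullet> \<xi>)))"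
    proof (intro AE_I2)
      fix \<xi>
      have "(\<lambda>n. fourier f \<xi> * (exp (- (\<i> * of_real (x \<bullet> \<xi>))) * complex_of_real (exp (- (norm (inverse (real (Suc n)) *\<^sub>R \<xi>))\<^sup>2 / 2))))
         \<longlonglongrightarrow> fourier f \<xi> * (exp (- (\<i> * of_real (x \<bullet> \<xi>))) * complex_of_real (exp (- (norm (0 *\<^sub>R \<xi>))\<^sup>2 / 2)))"
        by (intro tendsto_intros LIMSEQ_inverse_real_of_nat) auto
      then show "(\<lambda>n. fourier f \<xi> * h n \<xi>) \<longlonglongrightarrow> fourier f \<xi> * exp (- (\<i> * of_real (x \<bullet> \<xi>)))"
        by (simp add: h_def gauss_def inverse_eq_divide)
    qed
    show "AE \<xi> in lborel. norm (fourier f \<xi> * h n \<xi>) \<le> norm (fourier f \<xi>)" for n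
      by (intro AE_I2) (simp add: h_def norm_mult g1 mult_left_le)
  qed (use Ff in auto)
  moreover have "(LINT \<xi>|lborel. fourier f \<xi> * exp (- (\<i> * of_real (x \<bullet> \<xi>)))) = fourier (fourier f) x / ?c"
    using fourier_const_pos[where 'a='a] by (simp add: fourier_eq[of "fourier f"] mult.commute)
  moreover have "(LINT \<xi>|lborel. fourier f \<xi> * h n \<xi>) = (LINT z|lborel. f (- x + (1 / real (Suc n)) *\<^sub>R z) * of_real (gauss z))" for n
  proof -
    have "(LINT \<xi>|lborel. fourier f \<xi> * h n \<xi>) = (LINT y|lborel. f y * fourier (h n) y)"
      by (rule fourier_mult_formula[OF f h(1)])
    also have "\<dots> = (LINT z|lborel. f (- x + (1 / real (Suc n)) *\<^sub>R z) * of_real (gauss z))"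
    proof -
      let ?N = "real (Suc n)"
      have pt: "f (- x + (1 / ?N) *\<^sub>R z) * of_real (?N ^ DIM('a) * gauss (?N *\<^sub>R (x + (- x + (1 / ?N) *\<^sub>R z)))) =
          of_real (?N ^ DIM('a)) * (f (- x + (1 / ?N) *\<^sub>R z) * of_real (gauss z))" for z
        by simp
      have "(LINT y|lborel. f y * fourier (h n) y) = (\<bar>1 / ?N\<bar> ^ DIM('a)) *\<^sub>R (LINT z|lborel. of_real (?N ^ DIM('a)) * (f (- x + (1 / ?N) *\<^sub>R z) * of_real (gauss z)))"
        unfolding h(2) by (subst lborel_integral_affine[where a="1 / ?N" and c="- x"]) (simp_all only: pt, simp_all)
      also have "\<dots> = (LINT z|lborel. f (- x + (1 / ?N) *\<^sub>R z) * of_real (gauss z))"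
        unfolding integral_mult_right_zero scaleR_conv_of_real
        by (simp add: power_divide del: of_nat_Suc)
      finally show ?thesis .
    qed
    finally show ?thesis .
  qed
  moreover have "(\<lambda>n. (LINT z|lborel. f (- x + (1 / real (Suc n)) *\<^sub>R z) * of_real (gauss z))) \<longlonglongrightarrow>
     (LINT z::'a|lborel. f (- x) * of_real (gauss z))"
  proof (rule integral_dominated_convergence[where w="\<lambda>z. B * norm (complex_of_real (gauss z))"])
    show "AE z in lborel. (\<lambda>n. f (- x + (1 / real (Suc n)) *\<^sub>R z) * of_real (gauss z)) \<longlonglongrightarrow> f (- x) * of_real (gauss z)"
    proof (intro AE_I2 tendsto_mult tendsto_const)
      fix z
      have "(\<lambda>n. - x + inverse (real (Suc n)) *\<^sub>R z) \<longlonglongrightarrow> - x + 0 *\<^sub>R z"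
        by (intro tendsto_add tendsto_scaleR tendsto_const LIMSEQ_inverse_real_of_nat)
      then have "(\<lambda>n. f (- x + inverse (real (Suc n)) *\<^sub>R z)) \<longlonglongrightarrow> f (- x)"
        by (intro isCont_tendsto_compose[of _ f] continuous_on_interior[OF c]) auto
      then show "(\<lambda>n. f (- x + (1 / real (Suc n)) *\<^sub>R z)) \<longlonglongrightarrow> f (- x)" by (simp add: inverse_eq_divide)
    qed
    show "integrable lborel (\<lambda>z::'a. B * norm (complex_of_real (gauss z)))"
      using gauss_fourier(1)[of 0] by (intro integrable_mult_right integrable_norm) simp
    show "AE z in lborel. norm (f (- x + (1 / real (Suc n)) *\<^sub>R z) * of_real (gauss z)) \<le> B * norm (complex_of_real (gauss z))" for n
      by (intro AE_I2) (simp add: norm_mult mult_right_mono B)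
  qed auto
  moreover have "(LINT z::'a|lborel. f (- x) * of_real (gauss z)) = f (- x) / ?c"
    using gauss_fourier(2)[of "0::'a"] by (simp add: gauss_def)
  ultimately have "fourier (fourier f) x / ?c = f (- x) / ?c"
    by (simp only: LIMSEQ_unique)
  then show ?thesis using fourier_const_pos[where 'a='a] by simp
qed

lemma schwartz_bounded: "f \<in> schwartz \<Longrightarrow> bounded (range f)"
  unfolding bounded_iff using schwartz_seminorm_upper[of f "[]" 0] by auto

lemma fourier_inversion_test:
  assumes f: "f \<in> test_functions \<Omega>"
  shows "fourier (ifourier f) = f" "ifourier (fourier f) = f"
proof -
  have s: "f \<in> schwartz" by (rule test_functions_schwartz[OF f])
  have inv: "fourier (fourier f) x = f (- x)" for x
    by (intro fourier_inversion schwartz_integrable schwartz_bounded smooth_continuous schwartzD s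
        fourier_test_function_schwartz[OF f])
  then show "ifourier (fourier f) = f" by (simp add: ifourier_def fun_eq_iff)
  have [measurable]: "f \<in> borel_measurable borel" by (intro smooth_measurable schwartzD s)
  have "fourier (ifourier f) x = fourier (fourier f) (- x)" for x
    using lborel_integral_reflect[of "\<lambda>\<xi>. exp (- (\<i> * of_real (- x \<bullet> \<xi>))) * fourier f \<xi>" 0]
    by (simp add: fourier_eq[of _ x] fourier_eq[of _ "- x"] ifourier_def)
  then show "fourier (ifourier f) = f" by (simp add: inv fun_eq_iff)
qed

section \<open>Tempered distributions with regular Fourier transform\<close>

text \<open>Normalized to the value 1 at the origin, not to unit mass: its dilates serve as
  frequency cutoffs and have to tend pointwise to 1.\<close>

definition unit_bump :: "'a::euclidean_space \<Rightarrow> complex" where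
  "unit_bump x = of_real (box_bump 1 (- One) One x) / of_real (box_bump 1 (- One) One (0::'a))"

lemma unit_bump_test: "(unit_bump :: 'a::euclidean_space \<Rightarrow> complex) \<in> test_functions UNIV"
proof -
  have "(\<lambda>x::'a. complex_of_real (box_bump 1 (- One) One x)) \<in> test_functions UNIV"
    by (rule test_functions_UNIV[OF box_bump_test_functions]) simp
  from test_functions_cmult[OF this, of "inverse (of_real (box_bump 1 (- One) One (0::'a)))"]
  show ?thesis unfolding unit_bump_def[abs_def] divide_inverse by (simp add: mult.commute)
qed

lemma unit_bump_0: "unit_bump 0 = 1"
  using box_bump_eq_0_iff[of 1 "- One" One "0::'a"] by (simp add: unit_bump_def box_def)

lemma test_functions_bounded:
  assumes "f \<in> test_functions \<Omega>"
  obtains B where "B > 0" "\<And>x. norm (f x) \<le> B"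
  using schwartz_bounded[OF test_functions_schwartz[OF assms]] unfolding bounded_pos by auto

lemma test_functions_lipschitz:
  fixes f :: "'a::euclidean_space \<Rightarrow> complex"
  assumes f: "f \<in> test_functions \<Omega>"
  obtains L where "L \<ge> 0" "\<And>x y. norm (f x - f y) \<le> L * norm (x - y)"
proof -
  have "\<exists>B. \<forall>x. norm (pdiff b f x) \<le> B" if "b \<in> Basis" for b
    using test_functions_bounded[OF test_functions_pdiff[OF f that]] by metis
  then obtain B where B: "\<And>b x. b \<in> Basis \<Longrightarrow> norm (pdiff b f x) \<le> B b" by metis
  let ?L = "\<Sum>b\<in>Basis. B b"
  have D: "(f has_derivative (\<lambda>h. pdiff h f x)) (at x within UNIV)" for x
    by (rule has_derivative_pdiff[OF smooth_differentiable[OF test_functionsD(1)[OF f]]])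
  have "norm (pdiff h f x) \<le> ?L * norm h" for h x
  proof -
    have "linear (\<lambda>h. pdiff h f x)" using D has_derivative_linear by blast
    then have "pdiff (\<Sum>b\<in>Basis. (h \<bullet> b) *\<^sub>R b) f x = (\<Sum>b\<in>Basis. (h \<bullet> b) *\<^sub>R pdiff b f x)"
      using linear_sum[of "\<lambda>h. pdiff h f x" "\<lambda>b. (h \<bullet> b) *\<^sub>R b" Basis] linear_scale[of "\<lambda>h. pdiff h f x"] by simp
    then have "pdiff h f x = (\<Sum>b\<in>Basis. (h \<bullet> b) *\<^sub>R pdiff b f x)"
      by (simp only: euclidean_representation)
    also have "norm \<dots> \<le> (\<Sum>b\<in>Basis. norm h * B b)"
      by (rule order_trans[OF norm_sum]) (auto intro!: sum_mono mult_mono B Basis_le_norm)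
    finally show ?thesis by (simp add: sum_distrib_left mult.commute)
  qed
  then have "onorm (\<lambda>h. pdiff h f x) \<le> ?L" for x by (intro onorm_le) 
  then have "norm (f x - f y) \<le> ?L * norm (x - y)" for x y
    using differentiable_bound[OF convex_UNIV D, of "?L" x y] by auto
  moreover have "?L \<ge> 0" by (intro sum_nonneg) (use B norm_ge_zero order_trans in blast)
  ultimately show ?thesis using that by blast
qed

definition cutoff_ifourier :: "real \<Rightarrow> ('a::euclidean_space \<Rightarrow> complex) \<Rightarrow> 'a \<Rightarrow> complex" where
  "cutoff_ifourier N f \<xi> = ifourier f \<xi> * unit_bump ((1 / N) *\<^sub>R \<xi>)"

lemma cutoff_ifourier_test:
  fixes f :: "'a::euclidean_space \<Rightarrow> complex"
  assumes f: "f \<in> test_functions \<Omega>" and N: "N > 0"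
  shows "cutoff_ifourier N f \<in> test_functions UNIV"
proof -
  have "(\<lambda>\<xi>::'a. unit_bump ((1 / N) *\<^sub>R \<xi>)) \<in> test_functions UNIV"
    using test_functions_UNIV[OF test_functions_affine[OF unit_bump_test, of "1 / N" 0]] N by simp
  then show ?thesis unfolding cutoff_ifourier_def[abs_def]
    by (rule test_functions_mult) (intro schwartzD ifourier_test_function_schwartz[OF f])
qed

text \<open>Multiplication by a dilated cutoff becomes convolution with the contracted transform of
  \<open>unit_bump\<close>; rescaling the variable places the parameter \<open>N\<close> in the
  argument of \<open>f\<close> alone.\<close>

lemma fourier_cutoff_ifourier:
  fixes f :: "'a::euclidean_space \<Rightarrow> complex"
  assumes f: "f \<in> test_functions \<Omega>" and N: "N > 0"
  shows "fourier (cutoff_ifourier N f) x =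
    of_real (fourier_const TYPE('a)) * (LINT z|lborel. f (x - (1 / N) *\<^sub>R z) * fourier unit_bump z)"
proof -
  let ?c = "complex_of_real (fourier_const TYPE('a))"
  let ?h = "\<lambda>\<xi>. exp (- (\<i> * complex_of_real (x \<bullet> \<xi>))) * unit_bump ((1 / N) *\<^sub>R \<xi>)"
  have bt: "(\<lambda>\<xi>::'a. unit_bump ((1 / N) *\<^sub>R \<xi>)) \<in> test_functions UNIV"
    using test_functions_UNIV[OF test_functions_affine[OF unit_bump_test, of "1 / N" 0]] N by simp
  have bi: "integrable lborel ?h" by (intro integrable_exp_mult test_functions_integrable[OF bt])
  have [measurable]: "(unit_bump :: 'a \<Rightarrow> complex) \<in> borel_measurable borel" "f \<in> borel_measurable borel"
    by (intro smooth_measurable test_functionsD[OF unit_bump_test] test_functionsD[OF f])+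
  have h: "ifourier ?h y = of_real (N ^ DIM('a)) * fourier unit_bump (N *\<^sub>R (x - y))" for y
  proof -
    have "(LINT \<xi>|lborel. exp (- (\<i> * of_real (- y \<bullet> \<xi>))) * ?h \<xi>) =
        of_real (N ^ DIM('a)) * (LINT \<xi>|lborel. exp (- (\<i> * of_real (- y \<bullet> (N *\<^sub>R \<xi>)))) * ?h (N *\<^sub>R \<xi>))"
      using N by (subst lborel_integral_affine[where a=N and c=0]) (auto simp: scaleR_conv_of_real)
    also have "(\<lambda>\<xi>. exp (- (\<i> * of_real (- y \<bullet> (N *\<^sub>R \<xi>)))) * ?h (N *\<^sub>R \<xi>)) =
        (\<lambda>\<xi>. exp (- (\<i> * of_real ((N *\<^sub>R (x - y)) \<bullet> \<xi>))) * unit_bump \<xi>)"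
      using N by (auto simp: fun_eq_iff inner_simps algebra_simps simp flip: exp_add)
    finally show ?thesis by (simp only: ifourier_def fourier_eq mult.left_commute)
  qed
  have "fourier (cutoff_ifourier N f) x = ?c * (LINT \<xi>|lborel. ifourier f \<xi> * ?h \<xi>)"
    by (simp add: fourier_eq cutoff_ifourier_def mult_ac)
  also have "(LINT \<xi>|lborel. ifourier f \<xi> * ?h \<xi>) = (LINT y|lborel. f y * ifourier ?h y)"
    by (rule ifourier_mult_formula[OF test_functions_integrable[OF f] bi])
  also have "\<dots> = (LINT z|lborel. f (x - (1 / N) *\<^sub>R z) * fourier unit_bump z)"
  proof -
    have "(LINT y|lborel. f y * ifourier ?h y) = (\<bar>- 1 / N\<bar> ^ DIM('a)) *\<^sub>R
       (LINT z|lborel. of_real (N ^ DIM('a)) * (f (x - (1 / N) *\<^sub>R z) * fourier unit_bump z))"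
      unfolding h using N
      by (subst lborel_integral_affine[where a="- 1 / N" and c=x]) (simp_all add: mult.left_commute)
    then show ?thesis
      unfolding integral_mult_right_zero using N by (simp add: scaleR_conv_of_real power_divide)
  qed
  finally show ?thesis .
qed

text \<open>Differentiation commutes with the frequency cutoff, both being multiplications on the
  Fourier side. An error estimate without derivatives, applied to the derivatives of
  \<open>f\<close>, therefore controls every Schwartz seminorm.\<close>

lemma pderivs_fourier_cutoff_ifourier:
  assumes f: "f \<in> test_functions \<Omega>" and N: "N > 0" and bs: "set bs \<subseteq> Basis"
  shows "pderivs bs (fourier (cutoff_ifourier N f)) = fourier (cutoff_ifourier N (pderivs bs f))"
  using bs
proof (induction bs)
  case (Cons b bs)
  let ?g = "pderivs bs f"
  have g: "?g \<in> test_functions \<Omega>" using Cons f by (intro test_functions_pderivs) auto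
  have "pderivs (b # bs) (fourier (cutoff_ifourier N f)) = pdiff b (fourier (cutoff_ifourier N ?g))"
    using Cons by (simp only: pderivs_Cons) simp
  also have "\<dots> = fourier (mult_coord b (cutoff_ifourier N ?g))"
    by (intro pdiff_fourier rapid_schwartz test_functions_schwartz[OF cutoff_ifourier_test[OF g N]])
  also have "mult_coord b (cutoff_ifourier N ?g) = cutoff_ifourier N (pdiff b ?g)"
    using fourier_pdiff[OF test_functions_schwartz[OF g], of b] Cons
    by (auto simp: mult_coord_def cutoff_ifourier_def ifourier_def fun_eq_iff)
  finally show ?case by (simp only: pderivs_Cons)
qed simp

text \<open>Lipschitz continuity of \<open>f\<close> gives the rate \<open>1 / N\<close>. The weight
  in \<open>x\<close> is absorbed by moments of the convolution kernel: either
  \<open>norm x \<le> r + norm z\<close>, and the weight is at most a power of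
  \<open>(1 + r) * (1 + norm z)\<close>, or both values of \<open>f\<close> lie outside the support
  and vanish.\<close>

lemma fourier_cutoff_ifourier_error:
  fixes f :: "'a::euclidean_space \<Rightarrow> complex"
  assumes f: "f \<in> test_functions \<Omega>"
  obtains C where "\<And>N x. N \<ge> 1 \<Longrightarrow> (1 + norm x) ^ M * norm (fourier (cutoff_ifourier N f) x - f x) \<le> C / N"
proof -
  let ?c = "fourier_const TYPE('a)" let ?\<theta> = "fourier (unit_bump :: 'a \<Rightarrow> complex)"
  have c: "?c > 0" by (rule fourier_const_pos)
  obtain L where L: "L \<ge> 0" "\<And>x y. norm (f x - f y) \<le> L * norm (x - y)"
    using test_functions_lipschitz[OF f] by blast
  have "bounded (fun_supp f)" by (intro compact_imp_bounded test_functionsD[OF f])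
  then obtain r where r: "r > 0" "\<And>x. x \<in> fun_supp f \<Longrightarrow> norm x \<le> r" unfolding bounded_pos by auto
  have f0: "f x = 0" if "norm x > r" for x using test_functionsD(4)[OF f] r(2)[of x] that by force
  obtain B where B: "\<And>x. norm (f x) \<le> B" using test_functions_bounded[OF f] by metis
  have [measurable]: "f \<in> borel_measurable borel" by (intro smooth_measurable test_functionsD[OF f])
  have \<theta>: "?\<theta> \<in> schwartz" by (rule fourier_test_function_schwartz[OF unit_bump_test])
  have \<theta>r: "rapid ?\<theta>" by (rule rapid_schwartz[OF \<theta>])
  have [measurable]: "?\<theta> \<in> borel_measurable borel" by (rule rapid_measurable[OF \<theta>r])
  let ?m = "LINT z|lborel. norm ((1 + norm z) ^ Suc M *\<^sub>R ?\<theta> z)"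
  have mi: "integrable lborel (\<lambda>z. norm ((1 + norm z) ^ Suc M *\<^sub>R ?\<theta> z))"
    using \<theta>r unfolding rapid_def by (rule_tac integrable_norm, blast)
  \<comment> \<open>The total mass of the kernel is the value of its inverse transform at 0, that
    is, the normalization of \<open>unit_bump\<close>.\<close>
  have one: "of_real ?c * (LINT z|lborel. ?\<theta> z) = 1"
  proof -
    have "ifourier ?\<theta> 0 = unit_bump (0::'a)"
      by (simp only: fourier_inversion_test(2)[OF unit_bump_test])
    then show ?thesis by (simp add: ifourier_def fourier_eq[of _ "0::'a"] unit_bump_0)
  qed
  show ?thesis
  proof (rule that[of "?c * (L * (1 + r) ^ M * ?m)"])
    fix N :: real and x :: 'a assume N: "N \<ge> 1"
    have i: "integrable lborel (\<lambda>z. f (x - (1 / N) *\<^sub>R z) * ?\<theta> z)"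
      by (rule Bochner_Integration.integrable_bound[OF integrable_mult_right[OF rapid_integrable[OF \<theta>r], of "of_real B"]])
         (auto intro!: AE_I2 mult_right_mono order_trans[OF B abs_ge_self] simp: norm_mult)
    have ix: "integrable lborel (\<lambda>z. f x * ?\<theta> z)"
      by (intro integrable_mult_right rapid_integrable[OF \<theta>r])
    let ?d = "\<lambda>z. (f (x - (1 / N) *\<^sub>R z) - f x) * ?\<theta> z"
    have id: "integrable lborel ?d" using Bochner_Integration.integrable_diff[OF i ix] by (simp add: left_diff_distrib)
    have "fourier (cutoff_ifourier N f) x - f x =
        of_real ?c * (LINT z|lborel. f (x - (1 / N) *\<^sub>R z) * ?\<theta> z) - f x * (of_real ?c * (LINT z|lborel. ?\<theta> z))"
      using N by (subst fourier_cutoff_ifourier[OF f]) (auto simp: one)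
    also have "\<dots> = of_real ?c * (LINT z|lborel. ?d z)"
      unfolding left_diff_distrib Bochner_Integration.integral_diff[OF i ix] integral_mult_right_zero
      by (simp add: algebra_simps)
    finally have eq: "fourier (cutoff_ifourier N f) x - f x = of_real ?c * (LINT z|lborel. ?d z)" .
    have pt: "(1 + norm x) ^ M * norm (?d z) \<le> (L * (1 + r) ^ M / N) * norm ((1 + norm z) ^ Suc M *\<^sub>R ?\<theta> z)" for z
    proof -
      have le: "(1 + norm x) ^ M * norm (f (x - (1 / N) *\<^sub>R z) - f x) \<le> ((1 + r) * (1 + norm z)) ^ M * (L * (norm z / N))"
      proof (cases "norm x \<le> r + norm z")
        case True
        have "norm (f (x - (1 / N) *\<^sub>R z) - f x) \<le> L * (norm z / N)"
          using L(2)[of "x - (1 / N) *\<^sub>R z" x] N by simp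
        moreover have "1 + norm x \<le> (1 + r) * (1 + norm z)" 
          using True mult_nonneg_nonneg[of r "norm z"] r(1) unfolding ring_distribs mult_1 mult_1_right
          by (smt (verit) norm_ge_zero)
        ultimately show ?thesis using L(1) N r(1) by (intro mult_mono power_mono) auto
      next
        case False
        have "norm x \<le> norm (x - (1 / N) *\<^sub>R z) + norm ((1 / N) *\<^sub>R z)" by (metis diff_add_cancel norm_triangle_ineq)
        moreover have "norm ((1 / N) *\<^sub>R z) \<le> norm z" using N by (simp add: divide_le_eq mult_le_cancel_left1)
        ultimately have "norm (x - (1 / N) *\<^sub>R z) > r" "norm x > r" using False norm_ge_zero[of z] by linarith+
        then show ?thesis using f0 L(1) N r by simp
      qed
      have "(1 + norm x) ^ M * norm (?d z) \<le> ((1 + r) * (1 + norm z)) ^ M * (L * (norm z / N)) * norm (?\<theta> z)"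
        using mult_right_mono[OF le norm_ge_zero[of "?\<theta> z"]] by (simp add: norm_mult mult.assoc)
      also have "\<dots> = (L * (1 + r) ^ M / N) * ((1 + norm z) ^ M * norm z * norm (?\<theta> z))"
        by (simp add: power_mult_distrib mult_ac)
      also have "\<dots> \<le> (L * (1 + r) ^ M / N) * ((1 + norm z) ^ M * (1 + norm z) * norm (?\<theta> z))"
        using L(1) N r by (intro mult_left_mono mult_right_mono) auto
      finally show ?thesis by (simp add: mult_ac)
    qed
    have "(1 + norm x) ^ M * norm (fourier (cutoff_ifourier N f) x - f x) =
        ?c * ((1 + norm x) ^ M * norm (LINT z|lborel. ?d z))"
      unfolding eq using c by (simp add: norm_mult)
    also have "\<dots> \<le> ?c * ((1 + norm x) ^ M * (LINT z|lborel. norm (?d z)))"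
      using c by (intro mult_left_mono integral_norm_bound) auto
    also have "\<dots> = ?c * (LINT z|lborel. (1 + norm x) ^ M * norm (?d z))"
      by (simp only: integral_mult_right_zero)
    also have "\<dots> \<le> ?c * (LINT z|lborel. (L * (1 + r) ^ M / N) * norm ((1 + norm z) ^ Suc M *\<^sub>R ?\<theta> z))"
      using c by (intro mult_left_mono integral_mono pt integrable_mult_right mi integrable_norm id) auto
    also have "\<dots> = ?c * (L * (1 + r) ^ M * ?m) / N"
      unfolding integral_mult_right_zero by simp
    finally show "(1 + norm x) ^ M * norm (fourier (cutoff_ifourier N f) x - f x) \<le> ?c * (L * (1 + r) ^ M * ?m) / N" .
  qed
qed

lemma schwartz_diff: "f \<in> schwartz \<Longrightarrow> g \<in> schwartz \<Longrightarrow> (\<lambda>x. f x - g x) \<in> schwartz"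
  using schwartz_add[of f "\<lambda>x. (-1) * g x"] schwartz_cmult[of g "-1"] by simp

lemma pderivs_diff:
  assumes "smooth f" "smooth g" "set bs \<subseteq> Basis"
  shows "pderivs bs (\<lambda>x. f x - g x) = (\<lambda>x. pderivs bs f x - pderivs bs g x)"
  using pderivs_add[OF assms(1) smooth_cmult[OF assms(2), of "-1"] assms(3)]
    pderivs_cmult[OF assms(2,3), of "-1"] by simp

lemma seminorm_fourier_cutoff_tendsto:
  fixes f :: "'a::euclidean_space \<Rightarrow> complex"
  assumes f: "f \<in> test_functions \<Omega>"
  shows "(\<lambda>n. schwartz_seminorm M (\<lambda>x. fourier (cutoff_ifourier (real (Suc n)) f) x - f x)) \<longlonglongrightarrow> 0"
proof -
  let ?L = "{bs. set bs \<subseteq> (Basis :: 'a set) \<and> length bs \<le> M}"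
  have "\<exists>C. \<forall>N\<ge>1. \<forall>x. (1 + norm x) ^ M * norm (fourier (cutoff_ifourier N (pderivs bs f)) x - pderivs bs f x) \<le> C / N"
    if "bs \<in> ?L" for bs
  proof -
    have "pderivs bs f \<in> test_functions \<Omega>" using that by (intro test_functions_pderivs f) simp
    from fourier_cutoff_ifourier_error[OF this, of M]
    obtain C where "\<And>N x. N \<ge> 1 \<Longrightarrow> (1 + norm x) ^ M * norm (fourier (cutoff_ifourier N (pderivs bs f)) x - pderivs bs f x) \<le> C / N"
      by metis
    then show ?thesis by (intro exI[of _ C]) simp
  qed
  then have "\<forall>bs\<in>?L. \<exists>C. \<forall>N\<ge>1. \<forall>x. (1 + norm x) ^ M * norm (fourier (cutoff_ifourier N (pderivs bs f)) x - pderivs bs f x) \<le> C / N"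
    by (rule ballI)
  from bchoice[OF this] obtain C where C: "\<And>bs N x. bs \<in> ?L \<Longrightarrow> N \<ge> 1 \<Longrightarrow>
     (1 + norm x) ^ M * norm (fourier (cutoff_ifourier N (pderivs bs f)) x - pderivs bs f x) \<le> C bs / N"
    by blast
  have C0: "C bs \<ge> 0" if "bs \<in> ?L" for bs
    using order_trans[OF _ C[OF that, of 1 0]] by simp
  have fin: "finite ?L" by (intro finite_lists_length_le) simp
  have fs: "(\<lambda>x. fourier (cutoff_ifourier (real (Suc n)) f) x - f x) \<in> schwartz" for n
    by (intro schwartz_diff test_functions_schwartz[OF f]
        fourier_test_function_schwartz[OF cutoff_ifourier_test[OF f]]) simp
  have le: "schwartz_seminorm M (\<lambda>x. fourier (cutoff_ifourier (real (Suc n)) f) x - f x) \<le> (\<Sum>bs\<in>?L. C bs) / real (Suc n)" for n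
  proof (rule schwartz_seminorm_le)
    fix bs :: "'a list" and x assume bs: "set bs \<subseteq> Basis" "length bs \<le> M"
    have "pderivs bs (\<lambda>x. fourier (cutoff_ifourier (real (Suc n)) f) x - f x) =
        (\<lambda>x. fourier (cutoff_ifourier (real (Suc n)) (pderivs bs f)) x - pderivs bs f x)"
      using pderivs_diff[OF schwartzD schwartzD bs(1), OF fourier_test_function_schwartz[OF cutoff_ifourier_test[OF f]]
           test_functions_schwartz[OF f], of "real (Suc n)"]
      by (simp only: pderivs_fourier_cutoff_ifourier[OF f _ bs(1)] of_nat_0_less_iff zero_less_Suc simp_thms)
    then have "(1 + norm x) ^ M * norm (pderivs bs (\<lambda>x. fourier (cutoff_ifourier (real (Suc n)) f) x - f x) x) \<le> C bs / real (Suc n)"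
      using C[of bs "real (Suc n)" x] bs by simp
    also have "\<dots> \<le> (\<Sum>bs\<in>?L. C bs) / real (Suc n)"
      using bs C0 by (intro divide_right_mono member_le_sum fin) auto
    finally show "(1 + norm x) ^ M * norm (pderivs bs (\<lambda>x. fourier (cutoff_ifourier (real (Suc n)) f) x - f x) x)
       \<le> (\<Sum>bs\<in>?L. C bs) / real (Suc n)" .
  qed
  have "(\<lambda>n. (\<Sum>bs\<in>?L. C bs) * inverse (real (Suc n))) \<longlonglongrightarrow> (\<Sum>bs\<in>?L. C bs) * 0"
    by (intro tendsto_mult tendsto_const LIMSEQ_inverse_real_of_nat)
  then have "(\<lambda>n. (\<Sum>bs\<in>?L. C bs) / real (Suc n)) \<longlonglongrightarrow> 0" by (simp add: divide_inverse)
  then show ?thesis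
    by (rule tendsto_sandwich[rotated 2, OF tendsto_const])
       (rule always_eventually, rule allI, rule schwartz_seminorm_nonneg[OF fs],
        rule always_eventually, rule allI, rule le)
qed

lemma locally_integrable_measurable:
  fixes g :: "'a::euclidean_space \<Rightarrow> complex"
  assumes g: "locally_integrable g"
  shows "g \<in> borel_measurable borel"
proof (rule borel_measurable_LIMSEQ_metric)
  show "(\<lambda>x. indicator (cball 0 (real n)) x *\<^sub>R g x) \<in> borel_measurable borel" for n
    using g unfolding locally_integrable_def set_integrable_def
    by (auto simp: integrable_iff_bounded)
  fix x
  have "\<forall>\<^sub>F n in sequentially. g x = indicator (cball 0 (real n)) x *\<^sub>R g x"
    using eventually_ge_at_top[of "nat \<lceil>norm x\<rceil>"]
    by eventually_elim (auto simp: indicator_def nat_le_iff ceiling_le_iff)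
  then show "(\<lambda>n. indicator (cball 0 (real n)) x *\<^sub>R g x) \<longlonglongrightarrow> g x"
    by (rule Lim_transform_eventually[OF tendsto_const])
qed

lemma tempered_add: "u \<in> tempered \<Longrightarrow> \<phi> \<in> schwartz \<Longrightarrow> \<psi> \<in> schwartz \<Longrightarrow> u (\<lambda>x. \<phi> x + \<psi> x) = u \<phi> + u \<psi>"
  and tempered_cmult: "u \<in> tempered \<Longrightarrow> \<phi> \<in> schwartz \<Longrightarrow> u (\<lambda>x. c * \<phi> x) = c * u \<phi>"
  by (auto simp: tempered_def)

lemma tempered_diff:
  "u \<in> tempered \<Longrightarrow> \<phi> \<in> schwartz \<Longrightarrow> \<psi> \<in> schwartz \<Longrightarrow> u (\<lambda>x. \<phi> x - \<psi> x) = u \<phi> - u \<psi>"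
  using tempered_add[of u \<phi> "\<lambda>x. (-1) * \<psi> x"] tempered_cmult[of u \<psi> "-1"] schwartz_cmult[of \<psi> "-1"] by simp

text \<open>By definition a regular Fourier transform is only tested against \<open>C\<^sub>c\<^sup>\<infinity>\<close>, whereas the inverse
  Fourier transform of a test function is merely a Schwartz function; the truncations
  \<open>cutoff_ifourier n \<psi>\<close> bridge the gap.\<close>

lemma tempered_pairing:
  fixes u :: "'a::euclidean_space distr"
  assumes u: "u \<in> tempered" and g: "represents g (fourier_distr u)" and \<psi>: "\<psi> \<in> test_functions \<Omega>"
    and i: "integrable lborel (\<lambda>\<xi>. g \<xi> * ifourier \<psi> \<xi>)"
  shows "u \<psi> = (LINT \<xi>|lborel. g \<xi> * ifourier \<psi> \<xi>)"
proof (rule LIMSEQ_unique)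
  let ?p = "\<lambda>n. cutoff_ifourier (real (Suc n)) \<psi>"
  have p: "?p n \<in> test_functions UNIV" for n by (rule cutoff_ifourier_test[OF \<psi>]) simp
  have s: "\<psi> \<in> schwartz" "fourier (?p n) \<in> schwartz" for n
    using test_functions_schwartz[OF \<psi>] fourier_test_function_schwartz[OF p] by auto
  obtain M C where C: "\<And>\<phi>. \<phi> \<in> schwartz \<Longrightarrow> norm (u \<phi>) \<le> C * schwartz_seminorm M \<phi>"
    using u unfolding tempered_def by blast
  have [measurable]: "g \<in> borel_measurable borel"
    using g unfolding represents_def by (intro locally_integrable_measurable) auto
  have "(\<lambda>n. u (fourier (?p n)) - u \<psi>) \<longlonglongrightarrow> 0"
  proof (rule Lim_null_comparison)
    show "\<forall>\<^sub>F n in sequentially. norm (u (fourier (?p n)) - u \<psi>) \<le> C * schwartz_seminorm M (\<lambda>x. fourier (?p n) x - \<psi> x)"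
      using C[OF schwartz_diff[OF s(2,1)]] tempered_diff[OF u s(2,1)] by (auto intro!: always_eventually)
    show "(\<lambda>n. C * schwartz_seminorm M (\<lambda>x. fourier (?p n) x - \<psi> x)) \<longlonglongrightarrow> 0"
      using tendsto_mult[OF tendsto_const seminorm_fourier_cutoff_tendsto[OF \<psi>], of C M] by simp
  qed
  then show "(\<lambda>n. u (fourier (?p n))) \<longlonglongrightarrow> u \<psi>" by (simp add: LIM_zero_iff)
  obtain B where B: "\<And>x::'a. norm (unit_bump x) \<le> B" using test_functions_bounded[OF unit_bump_test] by metis
  have [measurable]: "\<psi> \<in> borel_measurable borel" "(unit_bump::'a \<Rightarrow> complex) \<in> borel_measurable borel"
    by (intro smooth_measurable test_functionsD[OF \<psi>] test_functionsD[OF unit_bump_test])+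
  have "(\<lambda>n. LINT \<xi>|lborel. g \<xi> * ?p n \<xi>) \<longlonglongrightarrow> (LINT \<xi>|lborel. g \<xi> * ifourier \<psi> \<xi>)"
  proof (rule integral_dominated_convergence[where w="\<lambda>\<xi>. norm (g \<xi> * ifourier \<psi> \<xi>) * B"])
    show "integrable lborel (\<lambda>\<xi>. norm (g \<xi> * ifourier \<psi> \<xi>) * B)"
      by (intro integrable_mult_left integrable_norm i)
    show "AE \<xi> in lborel. norm (g \<xi> * ?p n \<xi>) \<le> norm (g \<xi> * ifourier \<psi> \<xi>) * B" for n
      unfolding cutoff_ifourier_def mult.assoc[symmetric] norm_mult[of "_ * _"]
      by (intro AE_I2 mult_left_mono B) auto
    show "AE \<xi> in lborel. (\<lambda>n. g \<xi> * ?p n \<xi>) \<longlonglongrightarrow> g \<xi> * ifourier \<psi> \<xi>"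
    proof (intro AE_I2)
      fix \<xi> :: 'a
      have t: "(\<lambda>n. inverse (real (Suc n)) *\<^sub>R \<xi>) \<longlonglongrightarrow> 0"
        using tendsto_scaleR[OF LIMSEQ_inverse_real_of_nat tendsto_const[of \<xi>]] by simp
      have c: "isCont (unit_bump::'a \<Rightarrow> complex) 0"
        by (rule continuous_on_interior[OF smooth_continuous[of _ UNIV]])
           (auto intro: test_functionsD[OF unit_bump_test])
      have "(\<lambda>n. unit_bump (inverse (real (Suc n)) *\<^sub>R \<xi>)) \<longlonglongrightarrow> unit_bump (0::'a)"
        by (rule isCont_tendsto_compose[OF c t])
      from tendsto_mult[OF tendsto_const this, of "g \<xi> * ifourier \<psi> \<xi>"]
      show "(\<lambda>n. g \<xi> * ?p n \<xi>) \<longlonglongrightarrow> g \<xi> * ifourier \<psi> \<xi>"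
        by (simp add: cutoff_ifourier_def unit_bump_0 inverse_eq_divide mult.assoc)
    qed
  qed (auto simp: cutoff_ifourier_def[abs_def])
  moreover have "(LINT \<xi>|lborel. g \<xi> * ?p n \<xi>) = u (fourier (?p n))" for n
    using bspec[OF conjunct2[OF g[unfolded represents_def]] p[of n]] test_functions_schwartz[OF p[of n]]
    by (simp add: fourier_distr_def del: of_nat_Suc)
  ultimately show "(\<lambda>n. u (fourier (?p n))) \<longlonglongrightarrow> (LINT \<xi>|lborel. g \<xi> * ifourier \<psi> \<xi>)"
    by (simp only:)
qed

subsection \<open>Uniqueness of the representing function\<close>

text \<open>\<open>ennreal\<close> cuts off negative values, so \<open>?M 1\<close> and
  \<open>?M (- 1)\<close> have the positive and the negative part of \<open>h\<close> as densities.
  They agree on open boxes, an intersection-stable generator, hence everywhere, and densities are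
  unique almost everywhere.\<close>

lemma integrable_real_AE_0_if_box_integrals_0:
  fixes h :: "'a::euclidean_space \<Rightarrow> real"
  assumes h: "integrable lborel h" and box: "\<And>a c. (LINT x|lborel. indicator (box a c) x * h x) = 0"
  shows "AE x in lborel. h x = 0"
proof -
  have [measurable]: "h \<in> borel_measurable borel" using h by (simp add: integrable_iff_bounded)
  let ?M = "\<lambda>s. density lborel (\<lambda>x. ennreal (s * h x))"
  have eq: "emeasure (?M 1) (box a c) = emeasure (?M (- 1)) (box a c)"
    and fin: "emeasure (?M 1) (box a c) < \<infinity>" for a c
  proof -
    let ?g = "\<lambda>x. indicator (box a c) x * h x"
    have g: "integrable lborel ?g"
      using integrable_mult_indicator[OF _ h, of "box a c"] by simp
    have em: "emeasure (?M s) (box a c) = (\<integral>\<^sup>+x. ennreal (s * ?g x) \<partial>lborel)" for s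
      by (subst emeasure_density) (auto intro!: nn_integral_cong split: split_indicator)
    have f: "(\<integral>\<^sup>+x. ennreal (s * ?g x) \<partial>lborel) < \<infinity>" for s
    proof -
      have "integrable lborel (\<lambda>x. s * ?g x)" by (intro integrable_mult_right g)
      then show ?thesis unfolding real_integrable_def by (simp add: top.not_eq_extremum)
    qed
    have e: "enn2real (\<integral>\<^sup>+x. ennreal (1 * ?g x) \<partial>lborel) = enn2real (\<integral>\<^sup>+x. ennreal (- 1 * ?g x) \<partial>lborel)"
      using real_lebesgue_integral_def[OF g] box[of a c] by simp
    show "emeasure (?M 1) (box a c) = emeasure (?M (- 1)) (box a c)"
      unfolding em
      by (rule trans[OF ennreal_enn2real[OF f[of 1, unfolded infinity_ennreal_def], symmetric]
            trans[OF arg_cong[OF e, of ennreal] ennreal_enn2real[OF f[of "- 1", unfolded infinity_ennreal_def]]]])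
    show "emeasure (?M 1) (box a c) < \<infinity>" unfolding em by (rule f)
  qed
  have "?M 1 = ?M (- 1)"
  proof (rule measure_eqI_generator_eq)
    let ?E = "range (\<lambda>(a, b). box a b::'a set)"
    show "Int_stable ?E" by (auto simp: Int_stable_def box_Int_box)
    show "?E \<subseteq> Pow UNIV" "sets (?M 1) = sigma_sets UNIV ?E" "sets (?M (- 1)) = sigma_sets UNIV ?E"
      by (simp_all add: borel_eq_box)
    let ?A = "\<lambda>n::nat. box (- (real n *\<^sub>R One)) (real n *\<^sub>R One) :: 'a set"
    show "range ?A \<subseteq> ?E" "(\<Union>i. ?A i) = UNIV" unfolding UN_box_eq_UNIV by auto
    show "emeasure (?M 1) (?A i) \<noteq> \<infinity>" for i using fin[of "- (real i *\<^sub>R One)" "real i *\<^sub>R One"] by auto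
    show "emeasure (?M 1) X = emeasure (?M (- 1)) X" if "X \<in> ?E" for X
      using that eq by auto
  qed
  then have "AE x in lborel. ennreal (1 * h x) = ennreal (- 1 * h x)"
    by (subst (asm) sigma_finite_measure.density_unique_iff[OF sigma_finite_lborel]) auto
  then show ?thesis
  proof eventually_elim
    case (elim x)
    then show ?case by (cases "h x \<ge> 0") (auto simp: ennreal_neg ennreal_eq_0_iff)
  qed
qed

text \<open>The bumps \<open>box_bump\<close> converge boundedly to indicators of boxes, so
  vanishing against test functions gives vanishing box integrals. As \<open>g\<close> is only
  locally integrable, the real and imaginary parts are treated on an increasing sequence of
  boxes.\<close>

lemma locally_integrable_AE_0:
  fixes g :: "'a::euclidean_space \<Rightarrow> complex"
  assumes g: "locally_integrable g" and 0: "\<And>\<phi>. \<phi> \<in> test_functions UNIV \<Longrightarrow> (LINT x|lborel. g x * \<phi> x) = 0"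
  shows "AE x in lborel. g x = 0"
proof -
  have [measurable]: "g \<in> borel_measurable borel" by (rule locally_integrable_measurable[OF g])
  have ib: "integrable lborel (\<lambda>x. indicator (box a c) x *\<^sub>R g x)"
    and ic: "integrable lborel (\<lambda>x. indicator (cbox a c) x *\<^sub>R g x)" for a c
  proof -
    show ic: "integrable lborel (\<lambda>x. indicator (cbox a c) x *\<^sub>R g x)"
      using g unfolding locally_integrable_def set_integrable_def by (auto simp: compact_cbox)
    show "integrable lborel (\<lambda>x. indicator (box a c) x *\<^sub>R g x)"
      by (rule Bochner_Integration.integrable_bound[OF ic])
         (use box_subset_cbox[of a c] in \<open>auto split: split_indicator\<close>)
  qed
  have box: "(LINT x|lborel. indicator (box a c) x *\<^sub>R g x) = 0" for a c
  proof (rule LIMSEQ_unique)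
    have [measurable]: "(\<lambda>x. complex_of_real (box_bump (Suc n) a c x)) \<in> borel_measurable borel" for n
      by (intro smooth_measurable smooth_box_bump)
    show "(\<lambda>n. LINT x|lborel. g x * of_real (box_bump (Suc n) a c x)) \<longlonglongrightarrow> (LINT x|lborel. indicator (box a c) x *\<^sub>R g x)"
    proof (rule integral_dominated_convergence[where w="\<lambda>x. norm (indicator (box a c) x *\<^sub>R g x)"])
      show "integrable lborel (\<lambda>x. norm (indicator (box a c) x *\<^sub>R g x))" by (intro integrable_norm ib)
      show "AE x in lborel. (\<lambda>n. g x * of_real (box_bump (Suc n) a c x)) \<longlonglongrightarrow> indicator (box a c) x *\<^sub>R g x"
      proof (intro AE_I2)
        fix x
        have "(\<lambda>n. g x * complex_of_real (box_bump (Suc n) a c x)) \<longlonglongrightarrow> g x * of_real (indicator (box a c) x)"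
          by (intro tendsto_mult tendsto_const tendsto_of_real box_bump_tendsto)
        then show "(\<lambda>n. g x * of_real (box_bump (Suc n) a c x)) \<longlonglongrightarrow> indicator (box a c) x *\<^sub>R g x"
          by (simp add: scaleR_conv_of_real mult.commute)
      qed
      show "AE x in lborel. norm (g x * of_real (box_bump (Suc n) a c x)) \<le> norm (indicator (box a c) x *\<^sub>R g x)" for n
      proof (intro AE_I2)
        fix x
        show "norm (g x * of_real (box_bump (Suc n) a c x)) \<le> norm (indicator (box a c) x *\<^sub>R g x)"
        proof (cases "x \<in> box a c")
          case True
          then show ?thesis
            using box_bump_nonneg[of "Suc n" a c x] box_bump_le_1[of "Suc n" a c x]
            by (simp add: norm_mult mult_left_le)
        next
          case False
          then have "box_bump (Suc n) a c x = 0" by (simp add: box_bump_eq_0_iff)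
          then show ?thesis by simp
        qed
      qed
    qed measurable
    have "(LINT x|lborel. g x * of_real (box_bump (Suc n) a c x)) = 0" for n
      by (intro 0 test_functions_UNIV[OF box_bump_test_functions]) simp
    then show "(\<lambda>n. LINT x|lborel. g x * of_real (box_bump (Suc n) a c x)) \<longlonglongrightarrow> 0" by simp
  qed
  have AE_n: "AE x in lborel. indicator (box (- (real n *\<^sub>R One)) (real n *\<^sub>R One)) x *\<^sub>R g x = 0" for n
  proof -
    let ?B = "box (- (real n *\<^sub>R One)) (real n *\<^sub>R One) :: 'a set"
    let ?g = "\<lambda>x. indicator ?B x *\<^sub>R g x"
    \<comment> \<open>The intersection of two boxes is a box, so the localized function inherits the
      vanishing box integrals.\<close>
    have z: "(LINT x|lborel. indicator (box a c) x *\<^sub>R ?g x) = 0" for a c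
    proof -
      obtain a' c' where "box a c \<inter> ?B = box a' c'" using box_Int_box by blast
      then have "(\<lambda>x. indicator (box a c) x *\<^sub>R ?g x) = (\<lambda>x. indicator (box a' c') x *\<^sub>R g x)"
        by (auto simp: fun_eq_iff split: split_indicator)
      then show ?thesis using box by simp
    qed
    have zi: "integrable lborel (\<lambda>x. indicator (box a c) x *\<^sub>R ?g x)" for a c
      by (intro integrable_mult_indicator ib) auto
    have "AE x in lborel. Re (?g x) = 0"
    proof (rule integrable_real_AE_0_if_box_integrals_0)
      show "integrable lborel (\<lambda>x. Re (?g x))" by (intro integrable_Re ib)
      show "(LINT x|lborel. indicator (box a c) x * Re (?g x)) = 0" for a c
        using integral_Re[OF zi[of a c]] z[of a c] by (simp add: mult.assoc)
    qed
    moreover have "AE x in lborel. Im (?g x) = 0"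
    proof (rule integrable_real_AE_0_if_box_integrals_0)
      show "integrable lborel (\<lambda>x. Im (?g x))" by (intro integrable_Im ib)
      show "(LINT x|lborel. indicator (box a c) x * Im (?g x)) = 0" for a c
        using integral_Im[OF zi[of a c]] z[of a c] by (simp add: mult.assoc)
    qed
    ultimately show ?thesis by eventually_elim (simp add: complex_eq_iff)
  qed
  then have "AE x in lborel. \<forall>n. indicator (box (- (real n *\<^sub>R One)) (real n *\<^sub>R One)) x *\<^sub>R g x = 0"
    by (subst AE_all_countable) (rule allI)
  then show ?thesis
  proof eventually_elim
    case (elim x)
    have "x \<in> (\<Union>i::nat. box (- (real i *\<^sub>R One)) (real i *\<^sub>R One))" unfolding UN_box_eq_UNIV by simp
    then obtain n :: nat where "x \<in> box (- (real n *\<^sub>R One)) (real n *\<^sub>R One)" by (rule UN_E)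
    then show ?case using elim[rule_format, of n] by simp
  qed
qed

lemma locally_integrable_mult_test:
  assumes g: "locally_integrable g" and \<phi>: "\<phi> \<in> test_functions \<Omega>"
  shows "integrable lborel (\<lambda>x. g x * \<phi> x)"
proof -
  have [measurable]: "g \<in> borel_measurable borel" by (rule locally_integrable_measurable[OF g])
  have [measurable]: "\<phi> \<in> borel_measurable borel" by (intro smooth_measurable test_functionsD[OF \<phi>])
  obtain B where B: "B > 0" "\<And>x. norm (\<phi> x) \<le> B" using test_functions_bounded[OF \<phi>] by metis
  have "integrable lborel (\<lambda>x. indicator (fun_supp \<phi>) x *\<^sub>R g x)"
    using g test_functionsD(2)[OF \<phi>] unfolding locally_integrable_def set_integrable_def by auto
  then have i: "integrable lborel (\<lambda>x. B *\<^sub>R (indicator (fun_supp \<phi>) x *\<^sub>R g x))"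
    by (rule integrable_scaleR_right)
  show ?thesis
  proof (rule Bochner_Integration.integrable_bound[OF i])
    show "AE x in lborel. norm (g x * \<phi> x) \<le> norm (B *\<^sub>R (indicator (fun_supp \<phi>) x *\<^sub>R g x))"
    proof (intro AE_I2)
      fix x
      show "norm (g x * \<phi> x) \<le> norm (B *\<^sub>R (indicator (fun_supp \<phi>) x *\<^sub>R g x))"
        using B(1) mult_left_mono[OF B(2)[of x] norm_ge_zero[of "g x"]] test_functionsD(4)[OF \<phi>, of x]
        by (cases "x \<in> fun_supp \<phi>") (auto simp: norm_mult mult.commute)
    qed
  qed measurable
qed

lemma represents_unique:
  assumes g: "represents g u" and h: "represents h u"
  shows "AE x in lborel. g x = h x"
proof -
  have lg: "locally_integrable g" and lh: "locally_integrable h" using g h by (auto simp: represents_def)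
  have "AE x in lborel. g x - h x = 0"
  proof (rule locally_integrable_AE_0)
    show "locally_integrable (\<lambda>x. g x - h x)"
      using lg lh unfolding locally_integrable_def by (auto intro: set_integral_diff)
    fix \<phi> :: "'a \<Rightarrow> complex" assume \<phi>: "\<phi> \<in> test_functions UNIV"
    show "(LINT x|lborel. (g x - h x) * \<phi> x) = 0"
      using g h \<phi> locally_integrable_mult_test[OF lg \<phi>] locally_integrable_mult_test[OF lh \<phi>]
      by (simp add: represents_def left_diff_distrib)
  qed
  then show ?thesis by simp
qed

lemma fourier_fun_AE_eq: "represents g (fourier_distr u) \<Longrightarrow> AE x in lborel. fourier_fun u x = g x"
  unfolding fourier_fun_def by (rule represents_unique[OF someI[of "\<lambda>g. represents g (fourier_distr u)"]])

section \<open>Weighted energies\<close>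

definition weight :: "real \<Rightarrow> real \<Rightarrow> 'a::euclidean_space \<Rightarrow> real" where
  "weight k t \<xi> = (k\<^sup>2 + (norm \<xi>)\<^sup>2) powr t"

definition energy :: "real \<Rightarrow> real \<Rightarrow> ('a::euclidean_space \<Rightarrow> complex) \<Rightarrow> ennreal" where
  "energy k t G = (\<integral>\<^sup>+\<xi>. ennreal (weight k t \<xi> * (norm (G \<xi>))\<^sup>2) \<partial>lborel)"

lemma sobolev_energy_eq: "sobolev_energy k s u = energy k s (fourier_fun u)"
  by (simp add: sobolev_energy_def energy_def weight_def)

lemma weight_measurable [measurable]: "weight k t \<in> borel_measurable borel"
  unfolding weight_def[abs_def] by measurable

lemma weight_nonneg: "weight k t \<xi> \<ge> 0"
  by (simp add: weight_def)

lemma weight_add: "weight k (s + t) \<xi> = weight k s \<xi> * weight k t \<xi>"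
  by (simp add: weight_def powr_add)

lemma weight_mult_minus: "k > 0 \<Longrightarrow> weight k t \<xi> * weight k (- t) \<xi> = 1"
  unfolding weight_add[symmetric] by (simp add: weight_def add_pos_nonneg)

lemma weight_bound:
  assumes k: "k > 0"
  obtains C N where "C > 0" "\<And>\<xi>::'a::euclidean_space. weight k t \<xi> \<le> C * (1 + norm \<xi>) ^ (2 * N)"
proof (cases "t \<ge> 0")
  case True
  obtain N :: nat where N: "t \<le> real N" using real_arch_simple by blast
  have "weight k t \<xi> \<le> (1 + k\<^sup>2) ^ N * (1 + norm \<xi>) ^ (2 * N)" for \<xi> :: 'a
  proof -
    let ?X = "(1 + k\<^sup>2) * (1 + norm \<xi>)\<^sup>2"
    have 1: "1 \<le> (1 + norm \<xi>)\<^sup>2" by (simp add: one_le_power)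
    have 2: "(norm \<xi>)\<^sup>2 \<le> (1 + norm \<xi>)\<^sup>2" by (intro power_mono) auto
    have 3: "k\<^sup>2 * 1 \<le> k\<^sup>2 * (1 + norm \<xi>)\<^sup>2" by (intro mult_left_mono 1) auto
    have X: "k\<^sup>2 + (norm \<xi>)\<^sup>2 \<le> ?X" using 2 3 unfolding distrib_right by linarith
    have X1: "1 \<le> ?X" using 1 3 zero_le_power2[of k] by (simp only: distrib_right)
    have "weight k t \<xi> \<le> ?X powr t" unfolding weight_def using True X by (intro powr_mono2) auto
    also have "\<dots> \<le> ?X powr real N" using X1 N by (intro powr_mono) auto
    also have "\<dots> = ?X ^ N" using X1 by (intro powr_realpow) auto
    finally show ?thesis by (simp add: power_mult_distrib power_mult)
  qed
  moreover have "(1 + k\<^sup>2) ^ N > 0" by (intro zero_less_power add_pos_nonneg) auto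
  ultimately show ?thesis using that by blast
next
  case False
  have "weight k t \<xi> \<le> (k\<^sup>2) powr t * (1 + norm \<xi>) ^ (2 * 0)" for \<xi> :: 'a
    unfolding weight_def using False k by (simp add: powr_mono2')
  moreover have "(k\<^sup>2) powr t > 0" using k by simp
  ultimately show ?thesis using that by blast
qed

text \<open>\<open>C\<close> and \<open>N\<close> are chosen before \<open>H\<close> and
  \<open>B\<close>, which is what later yields continuity in the Schwartz seminorms. Of the
  \<open>N\<close> powers demanded, \<open>DIM('a)\<close> are spent on making the square integrable
  and the rest on the weight.\<close>

lemma energy_decay:
  assumes k: "k > 0"
  obtains C N where "C \<ge> 0"
    "\<And>(H::'a::euclidean_space \<Rightarrow> complex) B. (\<And>\<xi>. (1 + norm \<xi>) ^ N * norm (H \<xi>) \<le> B) \<Longrightarrow> energy k t H \<le> ennreal ((C * B)\<^sup>2)"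
proof -
  obtain C N where C: "C > 0" "\<And>\<xi>::'a. weight k t \<xi> \<le> C * (1 + norm \<xi>) ^ (2 * N)"
    using weight_bound[OF k] by metis
  show ?thesis
  proof (rule that[of "sqrt (C * decay_mass TYPE('a))" "N + DIM('a)"])
    show "0 \<le> sqrt (C * decay_mass TYPE('a))" using C decay_mass_nonneg[where 'a='a] by simp
    fix H :: "'a \<Rightarrow> complex" and B
    assume H: "\<And>\<xi>. (1 + norm \<xi>) ^ (N + DIM('a)) * norm (H \<xi>) \<le> B"
    have pt: "weight k t \<xi> * (norm (H \<xi>))\<^sup>2 \<le> C * B\<^sup>2 * (1 / (1 + norm \<xi>) ^ (2 * DIM('a)))" for \<xi>
    proof -
      have n: "1 + norm \<xi> > 0" by (simp add: add_pos_nonneg)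
      have "((1 + norm \<xi>) ^ (N + DIM('a)) * norm (H \<xi>))\<^sup>2 \<le> B\<^sup>2" by (intro power_mono H) auto
      then have "(1 + norm \<xi>) ^ (2 * N) * (norm (H \<xi>))\<^sup>2 * (1 + norm \<xi>) ^ (2 * DIM('a)) \<le> B\<^sup>2"
        by (simp add: power_mult_distrib power_mult[symmetric] power_add mult_ac)
      then have "(1 + norm \<xi>) ^ (2 * N) * (norm (H \<xi>))\<^sup>2 \<le> B\<^sup>2 / (1 + norm \<xi>) ^ (2 * DIM('a))"
        using n by (simp add: pos_le_divide_eq)
      from mult_left_mono[OF this, of C] C(1)
      have "C * (1 + norm \<xi>) ^ (2 * N) * (norm (H \<xi>))\<^sup>2 \<le> C * B\<^sup>2 * (1 / (1 + norm \<xi>) ^ (2 * DIM('a)))"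
        by (simp add: mult.assoc)
      from order_trans[OF mult_right_mono[OF C(2) zero_le_power2] this] show ?thesis .
    qed
    have "energy k t H \<le> (\<integral>\<^sup>+\<xi>. ennreal (C * B\<^sup>2 * (1 / (1 + norm (\<xi>::'a)) ^ (2 * DIM('a)))) \<partial>lborel)"
      unfolding energy_def by (intro nn_integral_mono ennreal_leI pt)
    also have "\<dots> = ennreal (LINT \<xi>::'a|lborel. C * B\<^sup>2 * (1 / (1 + norm \<xi>) ^ (2 * DIM('a))))"
      using C(1) by (intro nn_integral_eq_integral integrable_mult_right integrable_inverse_power) auto
    also have "(LINT \<xi>::'a|lborel. C * B\<^sup>2 * (1 / (1 + norm \<xi>) ^ (2 * DIM('a)))) = C * B\<^sup>2 * decay_mass TYPE('a)"
      unfolding decay_mass_def by (rule integral_mult_right_zero)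
    also have "C * B\<^sup>2 * decay_mass TYPE('a) = (sqrt (C * decay_mass TYPE('a)) * B)\<^sup>2"
      using C(1) decay_mass_nonneg[where 'a='a] by (simp add: power_mult_distrib)
    finally show "energy k t H \<le> ennreal ((sqrt (C * decay_mass TYPE('a)) * B)\<^sup>2)" .
  qed
qed

lemma energy_ifourier_schwartz:
  assumes k: "k > 0"
  obtains C M where "C \<ge> 0"
    "\<And>\<psi>::'a::euclidean_space \<Rightarrow> complex. \<psi> \<in> schwartz \<Longrightarrow> energy k t (ifourier \<psi>) \<le> ennreal ((C * schwartz_seminorm M \<psi>)\<^sup>2)"
proof -
  obtain C N where C: "C \<ge> 0"
    "\<And>(H::'a \<Rightarrow> complex) B. (\<And>\<xi>. (1 + norm \<xi>) ^ N * norm (H \<xi>) \<le> B) \<Longrightarrow> energy k t H \<le> ennreal ((C * B)\<^sup>2)"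
    using energy_decay[OF k] by metis
  let ?D = "(real DIM('a) + 1) ^ Suc N * (fourier_const TYPE('a) * decay_mass TYPE('a))"
  have D: "?D \<ge> 0" using fourier_const_pos[where 'a='a] decay_mass_nonneg[where 'a='a] by auto
  show ?thesis
  proof (rule that[of "C * ?D" "max N (2 * DIM('a))"])
    show "0 \<le> C * ?D" using C(1) D by simp
    fix \<psi> :: "'a \<Rightarrow> complex" assume \<psi>: "\<psi> \<in> schwartz"
    show "energy k t (ifourier \<psi>) \<le> ennreal ((C * ?D * schwartz_seminorm (max N (2 * DIM('a))) \<psi>)\<^sup>2)"
      unfolding mult.assoc[of C]
    proof (rule C(2))
      fix \<xi>
      show "(1 + norm \<xi>) ^ N * norm (ifourier \<psi> \<xi>) \<le> ?D * schwartz_seminorm (max N (2 * DIM('a))) \<psi>"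
        using fourier_decay[OF \<psi>, of "- \<xi>" N] by (simp add: ifourier_def)
    qed
  qed
qed

lemma energy_finite_if_decay:
  fixes H :: "'a::euclidean_space \<Rightarrow> complex"
  assumes k: "k > 0" and H: "\<And>N. \<exists>B. \<forall>\<xi>. (1 + norm \<xi>) ^ N * norm (H \<xi>) \<le> B"
  shows "energy k t H < \<infinity>"
proof -
  obtain C N where C: "\<And>(H::'a \<Rightarrow> complex) B. (\<And>\<xi>. (1 + norm \<xi>) ^ N * norm (H \<xi>) \<le> B) \<Longrightarrow> energy k t H \<le> ennreal ((C * B)\<^sup>2)"
    using energy_decay[OF k] by metis
  obtain B where "\<And>\<xi>. (1 + norm \<xi>) ^ N * norm (H \<xi>) \<le> B" using H by blast
  from C[OF this] show ?thesis by (auto intro: order_le_less_trans)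
qed

lemma energy_ifourier_finite:
  assumes "k > 0" "\<psi> \<in> schwartz"
  shows "energy k t (ifourier \<psi>) < \<infinity>"
  using energy_ifourier_schwartz[OF assms(1), of t] assms(2) 
  by (metis ennreal_less_top infinity_ennreal_def order_le_less_trans)

text \<open>The weights with exponents \<open>t\<close> and \<open>- t\<close> are reciprocal, so
  distributing their square roots over the two factors gives the duality of the Sobolev spaces of
  opposite order.\<close>

lemma energy_Cauchy_Schwarz:
  fixes G H :: "'a::euclidean_space \<Rightarrow> complex"
  assumes k: "k > 0" and [measurable]: "G \<in> borel_measurable borel" "H \<in> borel_measurable borel"
  shows "(\<integral>\<^sup>+\<xi>. ennreal (norm (G \<xi> * H \<xi>)) \<partial>lborel)\<^sup>2 \<le> energy k t G * energy k (- t) H"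
proof -
  have s: "ennreal (sqrt a * b) ^ 2 = ennreal (a * b\<^sup>2)" if "a \<ge> 0" "b \<ge> 0" for a b
    using that by (simp add: ennreal_power power_mult_distrib)
  have eq: "ennreal (norm (G \<xi> * H \<xi>)) =
      ennreal (sqrt (weight k t \<xi>) * norm (G \<xi>)) * ennreal (sqrt (weight k (- t) \<xi>) * norm (H \<xi>))" for \<xi>
  proof -
    have "sqrt (weight k t \<xi>) * sqrt (weight k (- t) \<xi>) = 1"
      by (simp add: real_sqrt_mult[symmetric] weight_mult_minus k)
    then have "norm (G \<xi> * H \<xi>) = (sqrt (weight k t \<xi>) * norm (G \<xi>)) * (sqrt (weight k (- t) \<xi>) * norm (H \<xi>))"
      by (simp add: norm_mult mult.left_commute mult.commute[of _ "norm (H \<xi>)"] mult.assoc[symmetric])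
    then show ?thesis by (simp add: weight_nonneg ennreal_mult)
  qed
  show ?thesis
    unfolding eq
    by (rule order_trans[OF Cauchy_Schwarz_nn_integral])
       (simp_all add: s energy_def weight_nonneg)
qed

lemma energy_pairing:
  fixes G H :: "'a::euclidean_space \<Rightarrow> complex"
  assumes k: "k > 0" and m[measurable]: "G \<in> borel_measurable borel" "H \<in> borel_measurable borel"
    and fin: "energy k t G < \<infinity>" "energy k (- t) H < \<infinity>"
  shows "integrable lborel (\<lambda>\<xi>. G \<xi> * H \<xi>)"
    and "norm (LINT \<xi>|lborel. G \<xi> * H \<xi>) \<le> sqrt (enn2real (energy k t G)) * sqrt (enn2real (energy k (- t) H))"
proof -
  let ?I = "\<integral>\<^sup>+\<xi>. ennreal (norm (G \<xi> * H \<xi>)) \<partial>lborel"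
  have CS: "?I\<^sup>2 \<le> energy k t G * energy k (- t) H" by (rule energy_Cauchy_Schwarz[OF k m])
  also have "\<dots> < \<infinity>" using fin by (simp add: ennreal_mult_less_top)
  finally have "?I\<^sup>2 < \<infinity>" .
  then have I: "?I < \<infinity>" by (auto simp: power2_eq_square ennreal_mult_less_top top.not_eq_extremum)
  then show i: "integrable lborel (\<lambda>\<xi>. G \<xi> * H \<xi>)" by (intro integrableI_bounded) auto
  have "norm (LINT \<xi>|lborel. G \<xi> * H \<xi>) \<le> (LINT \<xi>|lborel. norm (G \<xi> * H \<xi>))" by (rule integral_norm_bound)
  also have "\<dots> = enn2real ?I" by (rule integral_eq_nn_integral) auto
  also have "\<dots> \<le> sqrt (enn2real (energy k t G) * enn2real (energy k (- t) H))"
  proof (rule real_le_rsqrt)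
    have "(enn2real ?I)\<^sup>2 = enn2real (?I\<^sup>2)" by (simp add: power2_eq_square enn2real_mult)
    also have "\<dots> \<le> enn2real (energy k t G * energy k (- t) H)"
      using CS fin by (intro enn2real_mono) (simp_all add: ennreal_mult_less_top)
    finally show "(enn2real ?I)\<^sup>2 \<le> enn2real (energy k t G) * enn2real (energy k (- t) H)"
      by (simp add: enn2real_mult)
  qed
  finally show "norm (LINT \<xi>|lborel. G \<xi> * H \<xi>) \<le> sqrt (enn2real (energy k t G)) * sqrt (enn2real (energy k (- t) H))"
    by (simp add: real_sqrt_mult)
qed

text \<open>The indicator of a compact set has finite energy for the opposite weight, and pairing
  with it is integration over that set.\<close>

lemma energy_locally_integrable:
  fixes G :: "'a::euclidean_space \<Rightarrow> complex"
  assumes k: "k > 0" and m[measurable]: "G \<in> borel_measurable borel" and fin: "energy k t G < \<infinity>"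
  shows "locally_integrable G"
  unfolding locally_integrable_def
proof (intro allI impI)
  fix K :: "'a set" assume K: "compact K"
  then have [measurable]: "K \<in> sets borel" by (intro borel_closed compact_imp_closed)
  let ?H = "\<lambda>x. complex_of_real (indicator K x)"
  obtain C N where C: "C > 0" "\<And>\<xi>::'a. weight k (- t) \<xi> \<le> C * (1 + norm \<xi>) ^ (2 * N)"
    using weight_bound[OF k] by metis
  obtain r where r: "\<And>x. x \<in> K \<Longrightarrow> norm x \<le> r" using compact_imp_bounded[OF K] unfolding bounded_iff by auto
  have "energy k (- t) ?H \<le> (\<integral>\<^sup>+\<xi>. ennreal (C * (1 + r) ^ (2 * N)) * indicator K \<xi> \<partial>lborel)"
    unfolding energy_def
  proof (intro nn_integral_mono)
    fix \<xi>
    have "weight k (- t) \<xi> \<le> C * (1 + r) ^ (2 * N)" if "\<xi> \<in> K"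
      using C(1) r[OF that] by (intro order_trans[OF C(2)] mult_left_mono power_mono) auto
    then show "ennreal (weight k (- t) \<xi> * (norm (?H \<xi>))\<^sup>2) \<le> ennreal (C * (1 + r) ^ (2 * N)) * indicator K \<xi>"
      by (auto split: split_indicator intro: ennreal_leI)
  qed
  also have "\<dots> = ennreal (C * (1 + r) ^ (2 * N)) * emeasure lborel K" by (simp add: nn_integral_cmult)
  also have "\<dots> < \<infinity>" using emeasure_compact_finite[OF K] by (simp add: ennreal_mult_less_top)
  finally have "integrable lborel (\<lambda>\<xi>. G \<xi> * ?H \<xi>)" by (intro energy_pairing[OF k m _ fin]) auto
  then show "set_integrable lborel K G" unfolding set_integrable_def
    by (simp add: scaleR_conv_of_real mult.commute)
qed

section \<open>Sobolev spaces as weighted spaces on the Fourier side\<close>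

text \<open>The tempered distribution whose Fourier transform is the function \<open>G\<close>,
  defined by duality. Every finite-energy \<open>G\<close> produces an element of the Sobolev space
  in this way.\<close>

definition spectral_distr :: "('a::euclidean_space \<Rightarrow> complex) \<Rightarrow> 'a distr" where
  "spectral_distr G = (\<lambda>\<psi>. if \<psi> \<in> schwartz then (LINT \<xi>|lborel. G \<xi> * ifourier \<psi> \<xi>) else 0)"

lemma schwartz_measurable: "\<psi> \<in> schwartz \<Longrightarrow> \<psi> \<in> borel_measurable borel"
  by (intro smooth_measurable schwartzD)

lemma energy_pairing_schwartz:
  fixes G :: "'a::euclidean_space \<Rightarrow> complex"
  assumes k: "k > 0" and m: "G \<in> borel_measurable borel" and fin: "energy k t G < \<infinity>"
    and \<psi>: "\<psi> \<in> schwartz"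
  shows "integrable lborel (\<lambda>\<xi>. G \<xi> * ifourier \<psi> \<xi>)"
    and "norm (LINT \<xi>|lborel. G \<xi> * ifourier \<psi> \<xi>) \<le>
      sqrt (enn2real (energy k t G)) * sqrt (enn2real (energy k (- t) (ifourier \<psi>)))"
  using energy_pairing[OF k m ifourier_measurable[OF schwartz_measurable[OF \<psi>]] fin energy_ifourier_finite[OF k \<psi>]]
  by auto

lemma spectral_distr_tempered:
  fixes G :: "'a::euclidean_space \<Rightarrow> complex"
  assumes k: "k > 0" and m: "G \<in> borel_measurable borel" and fin: "energy k t G < \<infinity>"
  shows "spectral_distr G \<in> tempered"
  unfolding tempered_def
proof (intro CollectI conjI allI ballI impI)
  note i = energy_pairing_schwartz[OF k m fin]
  fix \<phi> \<psi> :: "'a \<Rightarrow> complex" assume s: "\<phi> \<in> schwartz" "\<psi> \<in> schwartz"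
  then show "spectral_distr G (\<lambda>x. \<phi> x + \<psi> x) = spectral_distr G \<phi> + spectral_distr G \<psi>"
    by (simp add: spectral_distr_def schwartz_add ifourier_add schwartz_integrable distrib_left i)
next
  fix c and \<phi> :: "'a \<Rightarrow> complex" assume s: "\<phi> \<in> schwartz"
  then show "spectral_distr G (\<lambda>x. c * \<phi> x) = c * spectral_distr G \<phi>"
    by (simp add: spectral_distr_def schwartz_cmult ifourier_cmult mult.left_commute[of _ c])
next
  obtain C M where C: "C \<ge> 0"
    "\<And>\<psi>::'a \<Rightarrow> complex. \<psi> \<in> schwartz \<Longrightarrow> energy k (- t) (ifourier \<psi>) \<le> ennreal ((C * schwartz_seminorm M \<psi>)\<^sup>2)"
    using energy_ifourier_schwartz[OF k, of "- t"] by metis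
  show "\<exists>N C. \<forall>\<phi>\<in>schwartz. norm (spectral_distr G \<phi>) \<le> C * schwartz_seminorm N \<phi>"
  proof (intro exI ballI)
    fix \<phi> :: "'a \<Rightarrow> complex" assume s: "\<phi> \<in> schwartz"
    have "norm (spectral_distr G \<phi>) \<le>
      sqrt (enn2real (energy k t G)) * sqrt (enn2real (energy k (- t) (ifourier \<phi>)))"
      using energy_pairing_schwartz(2)[OF k m fin s] s by (simp add: spectral_distr_def)
    also have "sqrt (enn2real (energy k (- t) (ifourier \<phi>))) \<le> sqrt ((C * schwartz_seminorm M \<phi>)\<^sup>2)"
      using enn2real_mono[OF C(2)[OF s]] by (intro real_sqrt_le_mono) simp
    also have "\<dots> = C * schwartz_seminorm M \<phi>"
      using C(1) schwartz_seminorm_nonneg[OF s, of M] by simp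
    finally show "norm (spectral_distr G \<phi>) \<le> sqrt (enn2real (energy k t G)) * C * schwartz_seminorm M \<phi>"
      by (simp add: mult_left_mono mult.assoc)
  qed
qed (simp add: spectral_distr_def)

lemma spectral_distr_represents:
  fixes G :: "'a::euclidean_space \<Rightarrow> complex"
  assumes k: "k > 0" and m: "G \<in> borel_measurable borel" and fin: "energy k t G < \<infinity>"
  shows "represents G (fourier_distr (spectral_distr G))"
  unfolding represents_def
proof (intro conjI ballI)
  show "locally_integrable G" by (rule energy_locally_integrable[OF k m fin])
  fix \<phi> :: "'a \<Rightarrow> complex" assume \<phi>: "\<phi> \<in> test_functions UNIV"
  show "fourier_distr (spectral_distr G) \<phi> = (LINT \<xi>|lborel. G \<xi> * \<phi> \<xi>)"
    using fourier_test_function_schwartz[OF \<phi>] test_functions_schwartz[OF \<phi>] fourier_inversion_test(2)[OF \<phi>]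
    by (simp add: fourier_distr_def spectral_distr_def)
qed

lemma sobolev_energy_represents:
  assumes "represents g (fourier_distr u)"
  shows "sobolev_energy k s u = energy k s g"
  unfolding sobolev_energy_eq energy_def
  by (rule nn_integral_cong_AE) (use fourier_fun_AE_eq[OF assms] in auto)

lemma sobolevI:
  assumes "u \<in> tempered" "represents g (fourier_distr u)" "energy k s g < \<infinity>"
  shows "u \<in> sobolev k s"
  using assms sobolev_energy_represents[OF assms(2)] by (auto simp: sobolev_def)

lemma spectral_distr_sobolev:
  fixes G :: "'a::euclidean_space \<Rightarrow> complex"
  assumes k: "k > 0" and m: "G \<in> borel_measurable borel" and fin: "energy k t G < \<infinity>"
  shows "spectral_distr G \<in> sobolev k t"
  by (intro sobolevI[of _ G] spectral_distr_tempered[OF assms] spectral_distr_represents[OF assms] fin)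

lemma represents_measurable: "represents g u \<Longrightarrow> g \<in> borel_measurable borel"
  unfolding represents_def by (intro locally_integrable_measurable) auto

lemma sobolevD:
  assumes "u \<in> sobolev k s"
  shows "u \<in> tempered" "represents (fourier_fun u) (fourier_distr u)" "energy k s (fourier_fun u) < \<infinity>"
    "fourier_fun u \<in> borel_measurable borel"
proof -
  show "u \<in> tempered" "energy k s (fourier_fun u) < \<infinity>"
    using assms by (auto simp: sobolev_def sobolev_energy_eq)
  show r: "represents (fourier_fun u) (fourier_distr u)"
    using assms unfolding sobolev_def fourier_fun_def by (auto intro: someI[of "\<lambda>g. represents g (fourier_distr u)"])
  then show "fourier_fun u \<in> borel_measurable borel" by (rule represents_measurable)
qed

lemma sobolev_norm_energy: "sobolev_norm k s u = sqrt (enn2real (energy k s (fourier_fun u)))"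
  by (simp add: sobolev_norm_def sobolev_energy_eq)

lemma sobolev_pairing:
  assumes k: "k > 0" and u: "u \<in> sobolev k s" and \<psi>: "\<psi> \<in> test_functions \<Omega>"
  shows "u \<psi> = (LINT \<xi>|lborel. fourier_fun u \<xi> * ifourier \<psi> \<xi>)"
  by (intro tempered_pairing[OF _ _ \<psi>] sobolevD[OF u]
      energy_pairing_schwartz[OF k sobolevD(4,3)[OF u]] test_functions_schwartz[OF \<psi>])

lemma norm_sobolev_pairing_le:
  assumes k: "k > 0" and u: "u \<in> sobolev k s" and \<psi>: "\<psi> \<in> test_functions \<Omega>"
  shows "norm (u \<psi>) \<le> sobolev_norm k s u * sqrt (enn2real (energy k (- s) (ifourier \<psi>)))"
  unfolding sobolev_pairing[OF assms] sobolev_norm_energy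
  by (intro energy_pairing_schwartz[OF k sobolevD(4,3)[OF u]] test_functions_schwartz[OF \<psi>])

lemma schwartz_seminorm_mono:
  assumes f: "f \<in> schwartz" and "N \<le> N'"
  shows "schwartz_seminorm N f \<le> schwartz_seminorm N' f"
proof (rule schwartz_seminorm_le)
  fix bs :: "'a list" and x assume bs: "set bs \<subseteq> Basis" "length bs \<le> N"
  have "(1 + norm x) ^ N * norm (pderivs bs f x) \<le> (1 + norm x) ^ N' * norm (pderivs bs f x)"
    using assms by (intro mult_right_mono power_increasing) auto
  also have "\<dots> \<le> schwartz_seminorm N' f"
    using bs assms by (intro schwartz_seminorm_upper f) auto
  finally show "(1 + norm x) ^ N * norm (pderivs bs f x) \<le> schwartz_seminorm N' f" .
qed

lemma distr_add_tempered:
  assumes u: "u \<in> tempered" and v: "v \<in> tempered"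
  shows "distr_add u v \<in> tempered"
  unfolding tempered_def
proof (intro CollectI conjI allI ballI impI)
  obtain M C where C: "\<And>\<phi>. \<phi> \<in> schwartz \<Longrightarrow> norm (u \<phi>) \<le> C * schwartz_seminorm M \<phi>"
    using u unfolding tempered_def by blast
  obtain M' C' where C': "\<And>\<phi>. \<phi> \<in> schwartz \<Longrightarrow> norm (v \<phi>) \<le> C' * schwartz_seminorm M' \<phi>"
    using v unfolding tempered_def by blast
  show "\<exists>N C. \<forall>\<phi>\<in>schwartz. norm (distr_add u v \<phi>) \<le> C * schwartz_seminorm N \<phi>"
  proof (intro exI ballI)
    fix \<phi> :: "'a \<Rightarrow> complex" assume \<phi>: "\<phi> \<in> schwartz"
    have "norm (u \<phi>) \<le> \<bar>C\<bar> * schwartz_seminorm (max M M') \<phi>"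
      using schwartz_seminorm_nonneg[OF \<phi>]
      by (intro order_trans[OF C[OF \<phi>]] mult_mono schwartz_seminorm_mono \<phi>) auto
    moreover have "norm (v \<phi>) \<le> \<bar>C'\<bar> * schwartz_seminorm (max M M') \<phi>"
      using schwartz_seminorm_nonneg[OF \<phi>]
      by (intro order_trans[OF C'[OF \<phi>]] mult_mono schwartz_seminorm_mono \<phi>) auto
    ultimately show "norm (distr_add u v \<phi>) \<le> (\<bar>C\<bar> + \<bar>C'\<bar>) * schwartz_seminorm (max M M') \<phi>"
      unfolding distr_add_def distrib_right by (intro order_trans[OF norm_triangle_ineq] add_mono)
  qed
qed (use u v in \<open>auto simp: distr_add_def tempered_def distrib_left\<close>)

lemma distr_scale_tempered:
  assumes u: "u \<in> tempered"
  shows "distr_scale c u \<in> tempered"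
  unfolding tempered_def
proof (intro CollectI conjI allI ballI impI)
  obtain M C where C: "\<And>\<phi>. \<phi> \<in> schwartz \<Longrightarrow> norm (u \<phi>) \<le> C * schwartz_seminorm M \<phi>"
    using u unfolding tempered_def by blast
  then have "norm (distr_scale c u \<phi>) \<le> (norm c * C) * schwartz_seminorm M \<phi>" if "\<phi> \<in> schwartz" for \<phi>
    using mult_left_mono[OF C[OF that] norm_ge_zero[of c]] by (simp add: distr_scale_def norm_mult mult.assoc)
  then show "\<exists>N C. \<forall>\<phi>\<in>schwartz. norm (distr_scale c u \<phi>) \<le> C * schwartz_seminorm N \<phi>" by blast
qed (use u in \<open>auto simp: distr_scale_def tempered_def distrib_left\<close>)

lemma represents_add:
  assumes g: "represents g (fourier_distr u)" and h: "represents h (fourier_distr v)"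
  shows "represents (\<lambda>\<xi>. g \<xi> + h \<xi>) (fourier_distr (distr_add u v))"
proof -
  have lg: "locally_integrable g" and lh: "locally_integrable h" using g h by (auto simp: represents_def)
  have "locally_integrable (\<lambda>\<xi>. g \<xi> + h \<xi>)"
    using lg lh unfolding locally_integrable_def by (auto intro: set_integral_add)
  moreover have "fourier_distr (distr_add u v) \<phi> = (LINT \<xi>|lborel. (g \<xi> + h \<xi>) * \<phi> \<xi>)"
    if \<phi>: "\<phi> \<in> test_functions UNIV" for \<phi>
  proof -
    have "fourier_distr (distr_add u v) \<phi> = fourier_distr u \<phi> + fourier_distr v \<phi>"
      by (simp add: fourier_distr_def distr_add_def)
    then show ?thesis
      using g h \<phi> locally_integrable_mult_test[OF lg \<phi>] locally_integrable_mult_test[OF lh \<phi>]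
      by (simp add: represents_def distrib_right)
  qed
  ultimately show ?thesis by (simp add: represents_def)
qed

lemma represents_scale:
  assumes g: "represents g (fourier_distr u)"
  shows "represents (\<lambda>\<xi>. c * g \<xi>) (fourier_distr (distr_scale c u))"
proof -
  have lg: "locally_integrable g" using g by (auto simp: represents_def)
  have "locally_integrable (\<lambda>\<xi>. c * g \<xi>)"
    using lg unfolding locally_integrable_def by (auto intro: set_integrable_mult_right)
  moreover have "fourier_distr (distr_scale c u) \<phi> = (LINT \<xi>|lborel. (c * g \<xi>) * \<phi> \<xi>)"
    if \<phi>: "\<phi> \<in> test_functions UNIV" for \<phi>
  proof -
    have "fourier_distr (distr_scale c u) \<phi> = c * fourier_distr u \<phi>"
      by (simp add: fourier_distr_def distr_scale_def)
    then show ?thesis using g \<phi> by (simp add: represents_def mult.assoc)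
  qed
  ultimately show ?thesis by (simp add: represents_def)
qed

lemma energy_add_finite:
  fixes G H :: "'a::euclidean_space \<Rightarrow> complex"
  assumes [measurable]: "G \<in> borel_measurable borel" "H \<in> borel_measurable borel"
    and "energy k t G < \<infinity>" "energy k t H < \<infinity>"
  shows "energy k t (\<lambda>\<xi>. G \<xi> + H \<xi>) < \<infinity>"
proof -
  have pt: "weight k t \<xi> * (norm (G \<xi> + H \<xi>))\<^sup>2 \<le> 2 * (weight k t \<xi> * (norm (G \<xi>))\<^sup>2) + 2 * (weight k t \<xi> * (norm (H \<xi>))\<^sup>2)" for \<xi>
  proof -
    have "(norm (G \<xi> + H \<xi>))\<^sup>2 \<le> (norm (G \<xi>) + norm (H \<xi>))\<^sup>2" by (intro power_mono norm_triangle_ineq) auto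
    also have "\<dots> \<le> 2 * (norm (G \<xi>))\<^sup>2 + 2 * (norm (H \<xi>))\<^sup>2"
      using sum_squares_bound[of "norm (G \<xi>)" "norm (H \<xi>)"] by (simp add: power2_sum)
    finally have "weight k t \<xi> * (norm (G \<xi> + H \<xi>))\<^sup>2 \<le> weight k t \<xi> * (2 * (norm (G \<xi>))\<^sup>2 + 2 * (norm (H \<xi>))\<^sup>2)"
      by (intro mult_left_mono weight_nonneg)
    then show ?thesis by (simp add: algebra_simps)
  qed
  have "energy k t (\<lambda>\<xi>. G \<xi> + H \<xi>) \<le>
      (\<integral>\<^sup>+\<xi>. 2 * ennreal (weight k t \<xi> * (norm (G \<xi>))\<^sup>2) + 2 * ennreal (weight k t \<xi> * (norm (H \<xi>))\<^sup>2) \<partial>lborel)"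
    unfolding energy_def
  proof (intro nn_integral_mono)
    fix \<xi>
    have "ennreal (weight k t \<xi> * (norm (G \<xi> + H \<xi>))\<^sup>2) \<le>
      ennreal (2 * (weight k t \<xi> * (norm (G \<xi>))\<^sup>2) + 2 * (weight k t \<xi> * (norm (H \<xi>))\<^sup>2))"
      by (rule ennreal_leI[OF pt])
    also have "\<dots> = 2 * ennreal (weight k t \<xi> * (norm (G \<xi>))\<^sup>2) + 2 * ennreal (weight k t \<xi> * (norm (H \<xi>))\<^sup>2)"
      by (simp add: weight_nonneg ennreal_mult)
    finally show "ennreal (weight k t \<xi> * (norm (G \<xi> + H \<xi>))\<^sup>2) \<le> \<dots>" .
  qed
  also have "\<dots> = 2 * energy k t G + 2 * energy k t H"
    unfolding energy_def by (simp add: nn_integral_add nn_integral_cmult)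
  also have "\<dots> < \<infinity>" using assms by (simp add: ennreal_mult_less_top)
  finally show ?thesis .
qed

lemma energy_le_cmult:
  assumes "A \<ge> 0" "\<And>\<xi>. weight k t \<xi> * (norm (H \<xi>))\<^sup>2 \<le> A * (weight k s \<xi> * (norm (G \<xi>))\<^sup>2)"
    and [measurable]: "G \<in> borel_measurable borel"
  shows "energy k t H \<le> ennreal A * energy k s G"
proof -
  have "energy k t H \<le> (\<integral>\<^sup>+\<xi>. ennreal A * ennreal (weight k s \<xi> * (norm (G \<xi>))\<^sup>2) \<partial>lborel)"
    unfolding energy_def
    by (intro nn_integral_mono) (simp add: ennreal_mult[symmetric] assms weight_nonneg ennreal_leI)
  also have "\<dots> = ennreal A * energy k s G"
    unfolding energy_def by (rule nn_integral_cmult) measurable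
  finally show ?thesis .
qed

lemma sobolev_add:
  assumes u: "u \<in> sobolev k s" and v: "v \<in> sobolev k s"
  shows "distr_add u v \<in> sobolev k s"
  by (intro sobolevI[of _ "\<lambda>\<xi>. fourier_fun u \<xi> + fourier_fun v \<xi>"] distr_add_tempered
      represents_add energy_add_finite sobolevD[OF u] sobolevD[OF v])

lemma sobolev_scale:
  assumes u: "u \<in> sobolev k s"
  shows "distr_scale c u \<in> sobolev k s"
proof (intro sobolevI[of _ "\<lambda>\<xi>. c * fourier_fun u \<xi>"] distr_scale_tempered represents_scale sobolevD[OF u])
  have "energy k s (\<lambda>\<xi>. c * fourier_fun u \<xi>) \<le> ennreal ((norm c)\<^sup>2) * energy k s (fourier_fun u)"
    by (intro energy_le_cmult sobolevD[OF u]) (auto simp: norm_mult power_mult_distrib)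
  also have "\<dots> < \<infinity>" using sobolevD(3)[OF u] by (simp add: ennreal_mult_less_top)
  finally show "energy k s (\<lambda>\<xi>. c * fourier_fun u \<xi>) < \<infinity>" .
qed

lemma distr_diff_eq: "distr_diff u v = distr_add u (distr_scale (- 1) v)"
  by (simp add: distr_diff_def distr_add_def distr_scale_def)

lemma sobolev_diff: "u \<in> sobolev k s \<Longrightarrow> v \<in> sobolev k s \<Longrightarrow> distr_diff u v \<in> sobolev k s"
  unfolding distr_diff_eq by (intro sobolev_add sobolev_scale)

subsection \<open>Fourier multipliers\<close>

definition fourier_multiplier :: "('a::euclidean_space \<Rightarrow> complex) \<Rightarrow> 'a distr \<Rightarrow> 'a distr" where
  "fourier_multiplier m u = spectral_distr (\<lambda>\<xi>. m \<xi> * fourier_fun u \<xi>)"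

text \<open>\<open>fourier_fun\<close> is a chosen representative and thus linear only up to null
  sets; this is what still makes \<open>fourier_multiplier\<close> exactly linear.\<close>

lemma spectral_distr_cong_AE:
  assumes [measurable]: "G \<in> borel_measurable borel" "H \<in> borel_measurable borel"
    and "AE \<xi> in lborel. G \<xi> = H \<xi>"
  shows "spectral_distr G = spectral_distr H"
proof
  fix \<psi> :: "'a \<Rightarrow> complex"
  have "(LINT \<xi>|lborel. G \<xi> * ifourier \<psi> \<xi>) = (LINT \<xi>|lborel. H \<xi> * ifourier \<psi> \<xi>)" if "\<psi> \<in> schwartz"
  proof -
    have [measurable]: "\<psi> \<in> borel_measurable borel" by (rule schwartz_measurable[OF that])
    show ?thesis by (rule integral_cong_AE) (use assms in auto)
  qed
  then show "spectral_distr G \<psi> = spectral_distr H \<psi>" by (simp add: spectral_distr_def)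
qed

text \<open>The exponent of \<open>weight\<close> counts powers of \<open>k^2 + |\<xi>|^2\<close>,
  so \<open>- 1 / 2\<close> is a gain of one Sobolev order. \<open>A\<close> then bounds the
  operator norm for every \<open>s\<close> simultaneously.\<close>

locale order_one_multiplier =
  fixes k A :: real and m :: "'a::euclidean_space \<Rightarrow> complex"
  assumes k: "k > 0" and A: "A \<ge> 0" and m[measurable]: "m \<in> borel_measurable borel"
    and m_bound: "\<And>\<xi>. norm (m \<xi>) \<le> A * weight k (- 1 / 2) \<xi>"
begin

lemma multiplier_energy:
  assumes [measurable]: "g \<in> borel_measurable borel"
  shows "energy k (s + 1) (\<lambda>\<xi>. m \<xi> * g \<xi>) \<le> ennreal (A\<^sup>2) * energy k s g"
proof (rule energy_le_cmult)
  fix \<xi>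
  have "(norm (m \<xi>))\<^sup>2 \<le> (A * weight k (- 1 / 2) \<xi>)\<^sup>2" by (intro power_mono m_bound) auto
  also have "\<dots> = A\<^sup>2 * weight k (- 1) \<xi>"
    unfolding power_mult_distrib power2_eq_square[of "weight _ _ _"] weight_add[symmetric] by simp
  finally have "weight k (s + 1) \<xi> * (norm (m \<xi> * g \<xi>))\<^sup>2 \<le> weight k (s + 1) \<xi> * (A\<^sup>2 * weight k (- 1) \<xi> * (norm (g \<xi>))\<^sup>2)"
    unfolding norm_mult power_mult_distrib by (intro mult_left_mono mult_right_mono weight_nonneg) auto
  also have "\<dots> = A\<^sup>2 * ((weight k (s + 1) \<xi> * weight k (- 1) \<xi>) * (norm (g \<xi>))\<^sup>2)" by (simp add: mult_ac)
  also have "weight k (s + 1) \<xi> * weight k (- 1) \<xi> = weight k s \<xi>" unfolding weight_add[symmetric] by simp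
  finally show "weight k (s + 1) \<xi> * (norm (m \<xi> * g \<xi>))\<^sup>2 \<le> A\<^sup>2 * (weight k s \<xi> * (norm (g \<xi>))\<^sup>2)" .
qed auto

lemma multiplier_energy_finite:
  assumes "u \<in> sobolev k s"
  shows "energy k (s + 1) (\<lambda>\<xi>. m \<xi> * fourier_fun u \<xi>) < \<infinity>"
  using multiplier_energy[OF sobolevD(4)[OF assms], of s] sobolevD(3)[OF assms]
  by (auto simp: ennreal_mult_less_top intro: order_le_less_trans)

lemma multiplier_measurable: "u \<in> sobolev k s \<Longrightarrow> (\<lambda>\<xi>. m \<xi> * fourier_fun u \<xi>) \<in> borel_measurable borel"
  by (intro borel_measurable_times m sobolevD(4))

lemma multiplier_sobolev:
  assumes u: "u \<in> sobolev k s"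
  shows "fourier_multiplier m u \<in> sobolev k (s + 1)"
  unfolding fourier_multiplier_def
  by (intro spectral_distr_sobolev[OF k] multiplier_measurable[OF u] multiplier_energy_finite[OF u])

lemma multiplier_norm_le:
  assumes u: "u \<in> sobolev k s"
  shows "sobolev_norm k (s + 1) (fourier_multiplier m u) \<le> A * sobolev_norm k s u"
proof -
  have "sobolev_norm k (s + 1) (fourier_multiplier m u) = sqrt (enn2real (energy k (s + 1) (\<lambda>\<xi>. m \<xi> * fourier_fun u \<xi>)))"
    unfolding sobolev_norm_def fourier_multiplier_def
    by (subst sobolev_energy_represents[OF spectral_distr_represents[OF k multiplier_measurable[OF u] multiplier_energy_finite[OF u]]]) simp
  also have "\<dots> \<le> sqrt (enn2real (ennreal (A\<^sup>2) * energy k s (fourier_fun u)))"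
    using sobolevD(3)[OF u]
    by (intro real_sqrt_le_mono enn2real_mono multiplier_energy sobolevD(4)[OF u]) (simp add: ennreal_mult_less_top)
  also have "\<dots> = A * sobolev_norm k s u"
    using A by (simp add: enn2real_mult real_sqrt_mult sobolev_norm_energy)
  finally show ?thesis .
qed

lemma multiplier_add:
  assumes u: "u \<in> sobolev k s" and v: "v \<in> sobolev k s"
  shows "fourier_multiplier m (distr_add u v) = distr_add (fourier_multiplier m u) (fourier_multiplier m v)"
proof -
  note [measurable] = sobolevD(4)[OF u] sobolevD(4)[OF v] sobolevD(4)[OF sobolev_add[OF u v]]
  have "fourier_multiplier m (distr_add u v) = spectral_distr (\<lambda>\<xi>. m \<xi> * fourier_fun u \<xi> + m \<xi> * fourier_fun v \<xi>)"
    unfolding fourier_multiplier_def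
  proof (rule spectral_distr_cong_AE)
    show "AE \<xi> in lborel. m \<xi> * fourier_fun (distr_add u v) \<xi> = m \<xi> * fourier_fun u \<xi> + m \<xi> * fourier_fun v \<xi>"
      using fourier_fun_AE_eq[OF represents_add[OF sobolevD(2)[OF u] sobolevD(2)[OF v]]]
      by eventually_elim (simp add: distrib_left)
  qed measurable
  also have "\<dots> = distr_add (fourier_multiplier m u) (fourier_multiplier m v)"
  proof
    fix \<psi> :: "'a \<Rightarrow> complex"
    show "spectral_distr (\<lambda>\<xi>. m \<xi> * fourier_fun u \<xi> + m \<xi> * fourier_fun v \<xi>) \<psi> = distr_add (fourier_multiplier m u) (fourier_multiplier m v) \<psi>"
      using energy_pairing_schwartz(1)[OF k multiplier_measurable[OF u] multiplier_energy_finite[OF u]]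
        energy_pairing_schwartz(1)[OF k multiplier_measurable[OF v] multiplier_energy_finite[OF v]]
      by (simp add: spectral_distr_def fourier_multiplier_def distr_add_def distrib_right)
  qed
  finally show ?thesis .
qed

lemma multiplier_scale:
  assumes u: "u \<in> sobolev k s"
  shows "fourier_multiplier m (distr_scale c u) = distr_scale c (fourier_multiplier m u)"
proof -
  note [measurable] = sobolevD(4)[OF u] sobolevD(4)[OF sobolev_scale[OF u]]
  have "fourier_multiplier m (distr_scale c u) = spectral_distr (\<lambda>\<xi>. c * (m \<xi> * fourier_fun u \<xi>))"
    unfolding fourier_multiplier_def
  proof (rule spectral_distr_cong_AE)
    show "AE \<xi> in lborel. m \<xi> * fourier_fun (distr_scale c u) \<xi> = c * (m \<xi> * fourier_fun u \<xi>)"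
      using fourier_fun_AE_eq[OF represents_scale[OF sobolevD(2)[OF u], of c]]
      by eventually_elim simp
  qed measurable
  also have "\<dots> = distr_scale c (fourier_multiplier m u)"
    by (simp add: spectral_distr_def fourier_multiplier_def distr_scale_def fun_eq_iff mult.assoc)
  finally show ?thesis .
qed

lemma multiplier_diff:
  assumes "u \<in> sobolev k s" "v \<in> sobolev k s"
  shows "fourier_multiplier m (distr_diff u v) = distr_diff (fourier_multiplier m u) (fourier_multiplier m v)"
  using assms by (simp add: distr_diff_eq multiplier_add[OF _ sobolev_scale] multiplier_scale)

end

section \<open>Mollification of compactly supported distributions\<close>

text \<open>A cube of this half-width has points of l1-norm at most \<open>1 / 2\<close>, so the
  bump built on it vanishes outside the unit ball in every dimension.\<close>

definition bump_radius :: "'a::euclidean_space itself \<Rightarrow> real" where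
  "bump_radius _ = 1 / (2 * real DIM('a))"

definition std_bump :: "'a::euclidean_space \<Rightarrow> real" where
  "std_bump = box_bump 1 (- (bump_radius TYPE('a) *\<^sub>R One)) (bump_radius TYPE('a) *\<^sub>R One)"

definition bump_mass :: "'a::euclidean_space itself \<Rightarrow> real" where
  "bump_mass _ = (LINT x::'a|lborel. std_bump x)"

definition mollifier :: "real \<Rightarrow> 'a::euclidean_space \<Rightarrow> complex" where
  "mollifier \<epsilon> x = of_real (std_bump ((1 / \<epsilon>) *\<^sub>R x) / (\<epsilon> ^ DIM('a) * bump_mass TYPE('a)))"

lemma std_bump_test: "(\<lambda>x::'a::euclidean_space. complex_of_real (std_bump x)) \<in> test_functions UNIV"
  unfolding std_bump_def by (rule test_functions_UNIV[OF box_bump_test_functions]) simp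

lemma std_bump_integrable: "integrable lborel (std_bump :: 'a::euclidean_space \<Rightarrow> real)"
  using integrable_Re[OF test_functions_integrable[OF std_bump_test]] by simp

lemma std_bump_nonneg: "std_bump x \<ge> 0"
  unfolding std_bump_def by (rule box_bump_nonneg)

lemma std_bump_eq_0:
  fixes x :: "'a::euclidean_space"
  assumes "norm x \<ge> 1"
  shows "std_bump x = 0"
proof -
  have "x \<notin> box (- (bump_radius TYPE('a) *\<^sub>R One)) (bump_radius TYPE('a) *\<^sub>R One)"
  proof
    assume "x \<in> box (- (bump_radius TYPE('a) *\<^sub>R One)) (bump_radius TYPE('a) *\<^sub>R One)"
    then have "\<bar>x \<bullet> b\<bar> \<le> bump_radius TYPE('a)" if "b \<in> Basis" for b
      using that unfolding box_def by force
    then have "(\<Sum>b\<in>Basis. \<bar>x \<bullet> b\<bar>) \<le> (\<Sum>b\<in>(Basis::'a set). bump_radius TYPE('a))"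
      by (intro sum_mono) auto
    also have "\<dots> = 1 / 2" by (simp add: bump_radius_def)
    finally show False using norm_le_l1[of x] assms by linarith
  qed
  then show ?thesis unfolding std_bump_def by (simp add: box_bump_eq_0_iff)
qed

lemma bump_mass_pos: "bump_mass TYPE('a::euclidean_space) > 0"
proof (rule ccontr)
  let ?B = "box (- (bump_radius TYPE('a) *\<^sub>R One)) (bump_radius TYPE('a) *\<^sub>R One) :: 'a set"
  assume "\<not> bump_mass TYPE('a) > 0"
  moreover have "bump_mass TYPE('a) \<ge> 0"
    unfolding bump_mass_def by (intro integral_nonneg_AE AE_I2 std_bump_nonneg)
  ultimately have "(LINT x::'a|lborel. std_bump x) = 0" by (simp add: bump_mass_def)
  then have "AE x in lborel. std_bump (x::'a) = 0"
    using integral_nonneg_eq_0_iff_AE[OF std_bump_integrable] std_bump_nonneg by auto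
  then have "AE x in lborel. x \<notin> ?B"
    unfolding std_bump_def by eventually_elim (simp add: box_bump_eq_0_iff)
  then have "emeasure lborel ?B = 0" by (subst (asm) AE_iff_measurable[of ?B]) auto
  moreover have "emeasure lborel ?B = (\<Prod>b\<in>(Basis::'a set). 2 * bump_radius TYPE('a))"
    by (subst emeasure_lborel_box, simp add: bump_radius_def,
        intro arg_cong[where f=ennreal] prod.cong refl) (simp add: inner_add_left)
  moreover have "(\<Prod>b\<in>(Basis::'a set). 2 * bump_radius TYPE('a)) > 0" by (intro prod_pos) (simp add: bump_radius_def)
  ultimately show False
    using bump_radius_def[of "TYPE('a)"] by simp
qed

lemma mollifier_test:
  assumes "\<epsilon> > 0"
  shows "(mollifier \<epsilon> :: 'a::euclidean_space \<Rightarrow> complex) \<in> test_functions UNIV"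
proof -
  have "(\<lambda>x::'a. complex_of_real (std_bump ((1 / \<epsilon>) *\<^sub>R x))) \<in> test_functions UNIV"
    using test_functions_UNIV[OF test_functions_affine[OF std_bump_test, of "1 / \<epsilon>" 0]] assms by simp
  from test_functions_cmult[OF this, of "of_real (1 / (\<epsilon> ^ DIM('a) * bump_mass TYPE('a)))"]
  show ?thesis unfolding mollifier_def[abs_def] by (simp add: divide_inverse mult.commute)
qed

lemma mollifier_eq_0:
  assumes "\<epsilon> > 0" "norm x \<ge> \<epsilon>"
  shows "mollifier \<epsilon> x = 0"
  unfolding mollifier_def using assms by (subst std_bump_eq_0) (auto simp: field_simps)

lemma mollifier_translate_test:
  fixes x :: "'a::euclidean_space"
  assumes "\<epsilon> > 0" "cball x \<epsilon> \<subseteq> U"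
  shows "(\<lambda>y. mollifier \<epsilon> (x - y)) \<in> test_functions U"
proof (rule test_functionsI[where K="cball x \<epsilon>"])
  show "smooth (\<lambda>y. mollifier \<epsilon> (x - y))"
    using smooth_affine[OF test_functionsD(1)[OF mollifier_test[OF assms(1)]], of x "-1"] by simp
  show "mollifier \<epsilon> (x - y) = 0" if "y \<notin> cball x \<epsilon>" for y
    using that by (intro mollifier_eq_0 assms) (simp add: dist_norm)
qed (use assms in auto)

text \<open>Dividing out the unitary normalization makes the value at 0 equal to 1 and the modulus
  at most 1. Mollifying at scale \<epsilon> is then multiplication by this function of
  \<open>\<epsilon> *\<^sub>R \<xi>\<close>, a contraction of every energy.\<close>

definition mollifier_hat :: "'a::euclidean_space \<Rightarrow> complex" where
  "mollifier_hat \<xi> = fourier (mollifier 1) \<xi> / of_real (fourier_const TYPE('a))"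

lemma mollifier_hat_eq:
  "mollifier_hat \<xi> = (LINT x|lborel. exp (- (\<i> * of_real (\<xi> \<bullet> x))) * mollifier 1 x)"
  for \<xi> :: "'a::euclidean_space"
  using fourier_const_pos[where 'a='a] by (simp add: mollifier_hat_def fourier_eq)

lemma fourier_mollifier:
  fixes \<xi> :: "'a::euclidean_space"
  assumes \<epsilon>: "\<epsilon> > 0"
  shows "fourier (mollifier \<epsilon>) \<xi> = of_real (fourier_const TYPE('a)) * mollifier_hat (\<epsilon> *\<^sub>R \<xi>)"
proof -
  have [measurable]: "(mollifier \<epsilon> :: 'a \<Rightarrow> complex) \<in> borel_measurable borel"
    by (intro smooth_measurable test_functionsD[OF mollifier_test[OF \<epsilon>]])
  have m: "of_real (\<epsilon> ^ DIM('a)) * mollifier \<epsilon> (\<epsilon> *\<^sub>R x) = mollifier 1 x" for x :: 'a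
    using \<epsilon> by (simp add: mollifier_def)
  have "(LINT x|lborel. exp (- (\<i> * of_real (\<xi> \<bullet> x))) * mollifier \<epsilon> x) =
      of_real (\<epsilon> ^ DIM('a)) * (LINT x|lborel. exp (- (\<i> * of_real (\<xi> \<bullet> (\<epsilon> *\<^sub>R x)))) * mollifier \<epsilon> (\<epsilon> *\<^sub>R x))"
    using \<epsilon> by (subst lborel_integral_affine[where a=\<epsilon> and c=0]) (auto simp: scaleR_conv_of_real)
  also have "\<dots> = (LINT x|lborel. exp (- (\<i> * of_real ((\<epsilon> *\<^sub>R \<xi>) \<bullet> x))) * (of_real (\<epsilon> ^ DIM('a)) * mollifier \<epsilon> (\<epsilon> *\<^sub>R x)))"
    by (subst integral_mult_right_zero[symmetric]) (simp add: mult_ac)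
  also have "\<dots> = mollifier_hat (\<epsilon> *\<^sub>R \<xi>)" unfolding m mollifier_hat_eq ..
  finally show ?thesis by (simp add: fourier_eq)
qed

lemma integral_norm_mollifier: "(LINT x::'a::euclidean_space|lborel. norm (mollifier 1 x)) = 1"
  "(LINT x::'a|lborel. mollifier 1 x) = 1"
proof -
  have p: "bump_mass TYPE('a) > 0" by (rule bump_mass_pos)
  have "norm (mollifier 1 x) = std_bump x / bump_mass TYPE('a)" for x :: 'a
    using p std_bump_nonneg[of x] by (simp add: mollifier_def norm_divide)
  then show "(LINT x::'a|lborel. norm (mollifier 1 x)) = 1" using p by (simp add: bump_mass_def)
  have "(LINT x::'a|lborel. mollifier 1 x) = (LINT x::'a|lborel. complex_of_real (std_bump x / bump_mass TYPE('a)))"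
    by (simp add: mollifier_def)
  also have "\<dots> = of_real (LINT x::'a|lborel. std_bump x / bump_mass TYPE('a))" by (rule integral_complex_of_real)
  also have "(LINT x::'a|lborel. std_bump x / bump_mass TYPE('a)) = 1" using p by (simp add: bump_mass_def)
  finally show "(LINT x::'a|lborel. mollifier 1 x) = 1" by simp
qed

lemma mollifier_hat_0: "mollifier_hat 0 = 1"
  by (simp add: mollifier_hat_eq integral_norm_mollifier)

lemma norm_mollifier_hat_le: "norm (mollifier_hat \<xi>) \<le> 1"
  unfolding mollifier_hat_eq
  by (rule order_trans[OF integral_norm_bound]) (simp add: norm_mult integral_norm_mollifier)

lemma mollifier_hat_continuous: "continuous_on UNIV mollifier_hat"
  unfolding mollifier_hat_def[abs_def] using fourier_const_pos[where 'a='a]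
  by (intro continuous_intros smooth_continuous schwartzD fourier_test_function_schwartz[OF mollifier_test]) auto

lemma mollifier_hat_measurable [measurable]: "mollifier_hat \<in> borel_measurable borel"
  by (rule borel_measurable_continuous_onI[OF mollifier_hat_continuous])

lemma mollifier_hat_tendsto: "(\<lambda>n. mollifier_hat ((1 / real (n + c)) *\<^sub>R \<xi>)) \<longlonglongrightarrow> 1"
proof -
  have "(\<lambda>n. inverse (real (n + c)) *\<^sub>R \<xi>) \<longlonglongrightarrow> 0 *\<^sub>R \<xi>"
    by (intro tendsto_scaleR tendsto_const LIMSEQ_ignore_initial_segment lim_inverse_n)
  then have t: "(\<lambda>n. (1 / real (n + c)) *\<^sub>R \<xi>) \<longlonglongrightarrow> 0" by (simp add: inverse_eq_divide)
  have "isCont mollifier_hat (0::'a)" by (rule continuous_on_interior[OF mollifier_hat_continuous]) simp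
  from isCont_tendsto_compose[OF this t] show ?thesis by (simp add: mollifier_hat_0)
qed

section \<open>Mollification on the Fourier side\<close>

definition mollify_hat :: "real \<Rightarrow> 'a::euclidean_space distr \<Rightarrow> 'a \<Rightarrow> complex" where
  "mollify_hat \<epsilon> u \<xi> = fourier_fun u \<xi> * mollifier_hat (\<epsilon> *\<^sub>R \<xi>)"

text \<open>This is the convolution of \<open>u\<close> with \<open>mollifier \<epsilon>\<close>.
  Starting from the transform makes smoothness and norm convergence immediate; locality is recovered
  in \<open>mollify_eq_pairing\<close>.\<close>

definition mollify :: "real \<Rightarrow> 'a::euclidean_space distr \<Rightarrow> 'a \<Rightarrow> complex" where
  "mollify \<epsilon> u = ifourier (mollify_hat \<epsilon> u)"

context
  fixes k s :: real and u :: "'a::euclidean_space distr"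
  assumes k: "k > 0" and u: "u \<in> sobolev k s"
begin

lemma mollify_hat_measurable [measurable]: "mollify_hat \<epsilon> u \<in> borel_measurable borel"
proof -
  note [measurable] = sobolevD(4)[OF u]
  show ?thesis unfolding mollify_hat_def[abs_def] by measurable
qed

lemma norm_mollify_hat_le: "norm (mollify_hat \<epsilon> u \<xi>) \<le> norm (fourier_fun u \<xi>)"
  unfolding mollify_hat_def norm_mult by (intro mult_left_le norm_mollifier_hat_le) auto

lemma mollify_hat_energy: "energy k s (mollify_hat \<epsilon> u) < \<infinity>"
proof -
  have "energy k s (mollify_hat \<epsilon> u) \<le> energy k s (fourier_fun u)"
    unfolding energy_def
    by (intro nn_integral_mono ennreal_leI mult_left_mono power_mono norm_mollify_hat_le weight_nonneg) auto
  then show ?thesis using sobolevD(3)[OF u] by (rule order_le_less_trans)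
qed

text \<open>\<open>mollifier_hat\<close> is, up to a constant, the transform of a test function and
  decays faster than any power. Times any polynomial weight it still has finite energy of order
  \<open>- s\<close>, so the pairing with \<open>fourier_fun u\<close> converges absolutely.\<close>

lemma rapid_mollify_hat:
  assumes \<epsilon>: "\<epsilon> > 0"
  shows "rapid (mollify_hat \<epsilon> u)"
  unfolding rapid_def
proof
  fix N :: nat
  let ?c = "fourier_const TYPE('a)"
  have c: "?c > 0" by (rule fourier_const_pos)
  let ?H = "\<lambda>\<xi>::'a. of_real ((1 + norm \<xi>) ^ N) * mollifier_hat (\<epsilon> *\<^sub>R \<xi>)"
  have "energy k (- s) ?H < \<infinity>"
  proof (rule energy_finite_if_decay[OF k])
    fix M
    obtain B where B: "\<And>\<xi>. (1 + norm \<xi>) ^ (M + N) * norm (fourier (mollifier \<epsilon>) (\<xi>::'a)) \<le> B"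
      using fourier_decay[OF test_functions_schwartz[OF mollifier_test[OF \<epsilon>]], of _ "M + N"] by metis
    have "(1 + norm \<xi>) ^ M * norm (?H \<xi>) \<le> B / ?c" for \<xi>
    proof -
      have "norm (?H \<xi>) = (1 + norm \<xi>) ^ N * norm (mollifier_hat (\<epsilon> *\<^sub>R \<xi>))"
        unfolding norm_mult norm_of_real by simp
      moreover have "norm (fourier (mollifier \<epsilon>) \<xi>) = ?c * norm (mollifier_hat (\<epsilon> *\<^sub>R \<xi>))"
        unfolding fourier_mollifier[OF \<epsilon>] norm_mult norm_of_real using c by simp
      ultimately show ?thesis
        using B[of \<xi>] c by (simp add: power_add pos_le_divide_eq mult_ac)
    qed
    then show "\<exists>B. \<forall>\<xi>. (1 + norm \<xi>) ^ M * norm (?H \<xi>) \<le> B" by blast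
  qed
  moreover have "?H \<in> borel_measurable borel" by measurable
  ultimately have "integrable lborel (\<lambda>\<xi>. fourier_fun u \<xi> * ?H \<xi>)"
    by (intro energy_pairing(1)[OF k sobolevD(4)[OF u] _ sobolevD(3)[OF u]])
  then show "integrable lborel (\<lambda>\<xi>. (1 + norm \<xi>) ^ N *\<^sub>R mollify_hat \<epsilon> u \<xi>)"
    by (simp add: mollify_hat_def scaleR_conv_of_real mult.left_commute)
qed

text \<open>Translation of the mollifier becomes an exponential factor on the Fourier side. The
  formula exhibits that the value at \<open>x\<close> depends on \<open>u\<close> only near
  \<open>x\<close>, which is the source of all support statements.\<close>

lemma mollify_eq_pairing:
  assumes \<epsilon>: "\<epsilon> > 0"
  shows "mollify \<epsilon> u x = u (\<lambda>y. mollifier \<epsilon> (x - y))"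
proof -
  let ?\<psi> = "\<lambda>y. mollifier \<epsilon> (x - y)" let ?c = "complex_of_real (fourier_const TYPE('a))"
  have [measurable]: "(mollifier \<epsilon> :: 'a \<Rightarrow> complex) \<in> borel_measurable borel"
    by (intro smooth_measurable test_functionsD[OF mollifier_test[OF \<epsilon>]])
  have i_f: "ifourier ?\<psi> \<xi> = exp (\<i> * of_real (x \<bullet> \<xi>)) * fourier (mollifier \<epsilon>) \<xi>" for \<xi>
  proof -
    have "(LINT y|lborel. exp (- (\<i> * of_real (- \<xi> \<bullet> y))) * ?\<psi> y) =
        (LINT z|lborel. exp (- (\<i> * of_real (- \<xi> \<bullet> (x - z)))) * mollifier \<epsilon> (x - (x - z)))"
      by (rule lborel_integral_reflect[symmetric]) measurable
    also have "\<dots> = (LINT z|lborel. exp (\<i> * of_real (x \<bullet> \<xi>)) * (exp (- (\<i> * of_real (\<xi> \<bullet> z))) * mollifier \<epsilon> z))"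
    proof (intro Bochner_Integration.integral_cong refl)
      fix z
      have "exp (- (\<i> * of_real (- \<xi> \<bullet> (x - z)))) = exp (\<i> * of_real (x \<bullet> \<xi>)) * exp (- (\<i> * of_real (\<xi> \<bullet> z)))"
        by (subst exp_add[symmetric]) (simp add: inner_diff_right inner_commute[of \<xi> x] algebra_simps)
      then show "exp (- (\<i> * of_real (- \<xi> \<bullet> (x - z)))) * mollifier \<epsilon> (x - (x - z)) =
          exp (\<i> * of_real (x \<bullet> \<xi>)) * (exp (- (\<i> * of_real (\<xi> \<bullet> z))) * mollifier \<epsilon> z)"
        by (simp only: mult.assoc diff_diff_eq2 add_diff_cancel_left')
    qed
    also have "\<dots> = exp (\<i> * of_real (x \<bullet> \<xi>)) * (LINT z|lborel. exp (- (\<i> * of_real (\<xi> \<bullet> z))) * mollifier \<epsilon> z)"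
      by (rule integral_mult_right_zero)
    finally show ?thesis by (simp only: ifourier_def fourier_eq mult.left_commute)
  qed
  have "u ?\<psi> = (LINT \<xi>|lborel. fourier_fun u \<xi> * ifourier ?\<psi> \<xi>)"
    by (rule sobolev_pairing[OF k u mollifier_translate_test[OF \<epsilon> subset_UNIV]])
  also have "\<dots> = (LINT \<xi>|lborel. ?c * (exp (- (\<i> * of_real (- x \<bullet> \<xi>))) * mollify_hat \<epsilon> u \<xi>))"
    unfolding i_f fourier_mollifier[OF \<epsilon>] mollify_hat_def by (intro Bochner_Integration.integral_cong refl) (simp add: mult_ac)
  also have "\<dots> = mollify \<epsilon> u x"
    unfolding mollify_def ifourier_def fourier_eq by (rule integral_mult_right_zero)
  finally show ?thesis ..
qed

lemma mollify_eq_0_if_null: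
  assumes \<epsilon>: "\<epsilon> > 0" and "cball x \<epsilon> \<subseteq> U" and "\<And>\<phi>. \<phi> \<in> test_functions U \<Longrightarrow> u \<phi> = 0"
  shows "mollify \<epsilon> u x = 0"
  unfolding mollify_eq_pairing[OF \<epsilon>] by (intro assms mollifier_translate_test)

text \<open>For small \<open>\<epsilon>\<close> the mollification of \<open>u\<close> vanishes on the support of \<open>\<psi>\<close>, by the Lebesgue number
  lemma; this replaces the usual smooth partition of unity.\<close>

lemma sobolev_null_off_support:
  assumes \<psi>: "\<psi> \<in> test_functions \<Omega>" and disj: "fun_supp \<psi> \<inter> distr_supp u = {}"
  shows "u \<psi> = 0"
proof -
  let ?N = "{U. open U \<and> (\<forall>\<phi>\<in>test_functions U. u \<phi> = 0)}"
  have "fun_supp \<psi> \<subseteq> \<Union>?N" using disj by (auto simp: distr_supp_def)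
  then obtain \<delta> where \<delta>: "\<delta> > 0" "\<And>x. x \<in> fun_supp \<psi> \<Longrightarrow> \<exists>U\<in>?N. ball x \<delta> \<subseteq> U"
    using Heine_Borel_lemma[of "fun_supp \<psi>" ?N] test_functionsD(2)[OF \<psi>] by (metis (no_types, lifting) mem_Collect_eq)
  let ?\<epsilon> = "\<lambda>n. 1 / real (n + 1)"
  have i: "integrable lborel (\<lambda>\<xi>. fourier_fun u \<xi> * ifourier \<psi> \<xi>)"
    by (intro energy_pairing_schwartz[OF k sobolevD(4,3)[OF u]] test_functions_schwartz[OF \<psi>])
  note [measurable] = sobolevD(4)[OF u] schwartz_measurable[OF test_functions_schwartz[OF \<psi>]]
  have "(\<lambda>n. LINT \<xi>|lborel. mollify_hat (?\<epsilon> n) u \<xi> * ifourier \<psi> \<xi>) \<longlonglongrightarrow> (LINT \<xi>|lborel. fourier_fun u \<xi> * ifourier \<psi> \<xi>)"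
  proof (rule integral_dominated_convergence[where w="\<lambda>\<xi>. norm (fourier_fun u \<xi> * ifourier \<psi> \<xi>)"])
    show "integrable lborel (\<lambda>\<xi>. norm (fourier_fun u \<xi> * ifourier \<psi> \<xi>))" by (rule integrable_norm[OF i])
    show "AE \<xi> in lborel. norm (mollify_hat (?\<epsilon> n) u \<xi> * ifourier \<psi> \<xi>) \<le> norm (fourier_fun u \<xi> * ifourier \<psi> \<xi>)" for n
      unfolding norm_mult by (intro AE_I2 mult_right_mono norm_mollify_hat_le) auto
    show "AE \<xi> in lborel. (\<lambda>n. mollify_hat (?\<epsilon> n) u \<xi> * ifourier \<psi> \<xi>) \<longlonglongrightarrow> fourier_fun u \<xi> * ifourier \<psi> \<xi>"
    proof (intro AE_I2 tendsto_mult tendsto_const)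
      fix \<xi>
      show "(\<lambda>n. mollify_hat (?\<epsilon> n) u \<xi>) \<longlonglongrightarrow> fourier_fun u \<xi>"
        using tendsto_mult[OF tendsto_const mollifier_hat_tendsto[of 1 \<xi>], of "fourier_fun u \<xi>"]
        by (simp add: mollify_hat_def)
    qed
  qed measurable
  then have lim: "(\<lambda>n. LINT \<xi>|lborel. mollify_hat (?\<epsilon> n) u \<xi> * ifourier \<psi> \<xi>) \<longlonglongrightarrow> u \<psi>"
    by (simp only: sobolev_pairing[OF k u \<psi>])
  have "\<forall>\<^sub>F n in sequentially. ?\<epsilon> n < \<delta>"
  proof -
    have "(\<lambda>n. inverse (real (n + 1))) \<longlonglongrightarrow> 0"
      by (intro LIMSEQ_ignore_initial_segment lim_inverse_n)
    then show ?thesis using \<delta>(1) by (simp add: order_tendstoD(2) inverse_eq_divide)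
  qed
  then have "\<forall>\<^sub>F n in sequentially. (LINT \<xi>|lborel. mollify_hat (?\<epsilon> n) u \<xi> * ifourier \<psi> \<xi>) = 0"
  proof eventually_elim
    case (elim n)
    have "mollify (?\<epsilon> n) u x * \<psi> x = 0" for x
    proof (cases "x \<in> fun_supp \<psi>")
      case True
      obtain U where U: "U \<in> ?N" "ball x \<delta> \<subseteq> U" using \<delta>(2)[OF True] by blast
      have "cball x (?\<epsilon> n) \<subseteq> U" using elim U(2) by auto
      then have "mollify (?\<epsilon> n) u x = 0" using U(1) by (intro mollify_eq_0_if_null[of _ _ U]) auto
      then show ?thesis by simp
    next
      case False
      then show ?thesis using test_functionsD(4)[OF \<psi>] by simp
    qed
    then have "(\<lambda>x. mollify (?\<epsilon> n) u x * \<psi> x) = (\<lambda>x. 0)" by (rule ext)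
    then have "0 = (LINT x|lborel. mollify (?\<epsilon> n) u x * \<psi> x)" by (simp only: Bochner_Integration.integral_zero)
    also have "\<dots> = (LINT \<xi>|lborel. mollify_hat (?\<epsilon> n) u \<xi> * ifourier \<psi> \<xi>)"
      unfolding mollify_def
      by (intro ifourier_mult_formula rapid_integrable rapid_mollify_hat test_functions_integrable[OF \<psi>]) simp
    finally show ?case ..
  qed
  then have "(\<lambda>n. LINT \<xi>|lborel. mollify_hat (?\<epsilon> n) u \<xi> * ifourier \<psi> \<xi>) \<longlonglongrightarrow> 0"
    by (rule tendsto_eventually)
  from LIMSEQ_unique[OF lim this] show ?thesis .
qed

text \<open>At a point farther than \<epsilon> from \<open>F\<close> the translated mollifier is
  supported in a ball that misses the support of \<open>u\<close>, and
  \<open>sobolev_null_off_support\<close> applies.\<close>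

lemma mollify_test:
  assumes \<epsilon>: "\<epsilon> > 0" and F: "compact F" "F \<noteq> {}" "distr_supp u \<subseteq> F"
  shows "mollify \<epsilon> u \<in> test_functions {x. infdist x F \<le> \<epsilon>}"
proof (rule test_functionsI[where K="{x. infdist x F \<le> \<epsilon>}"])
  show "smooth (mollify \<epsilon> u)" unfolding mollify_def by (intro smooth_ifourier rapid_mollify_hat \<epsilon>)
  show "compact {x. infdist x F \<le> \<epsilon>}" by (rule compact_infdist_le[OF F(2,1) \<epsilon>])
  fix x assume "x \<notin> {x. infdist x F \<le> \<epsilon>}"
  then have "infdist x F > \<epsilon>" by simp
  then have "cball x \<epsilon> \<inter> F = {}" using infdist_le[of _ F x] by force
  moreover have "fun_supp (\<lambda>y. mollifier \<epsilon> (x - y)) \<subseteq> cball x \<epsilon>"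
    by (rule test_functionsD(3)[OF mollifier_translate_test[OF \<epsilon> order_refl]])
  ultimately show "mollify \<epsilon> u x = 0"
    unfolding mollify_eq_pairing[OF \<epsilon>] using F(3)
    by (intro sobolev_null_off_support[OF mollifier_translate_test[OF \<epsilon> order_refl]]) auto
qed auto

end

section \<open>Mollifications as approximating sequences\<close>

lemma integrable_mult_schwartz:
  fixes f :: "'a::euclidean_space \<Rightarrow> complex"
  assumes f: "integrable lborel f" and \<phi>: "\<phi> \<in> schwartz"
  shows "integrable lborel (\<lambda>x. f x * \<phi> x)"
    and "norm (LINT x|lborel. f x * \<phi> x) \<le> (LINT x|lborel. norm (f x)) * schwartz_seminorm 0 \<phi>"
proof -
  have [measurable]: "f \<in> borel_measurable borel" using f by (simp add: integrable_iff_bounded)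
  have [measurable]: "\<phi> \<in> borel_measurable borel" by (rule schwartz_measurable[OF \<phi>])
  have b: "norm (f x * \<phi> x) \<le> norm (f x) * schwartz_seminorm 0 \<phi>" for x
    using mult_left_mono[OF schwartz_seminorm_upper[OF \<phi>, of "[]" 0 x] norm_ge_zero[of "f x"]]
    by (simp add: norm_mult)
  have i: "integrable lborel (\<lambda>x. norm (f x) * schwartz_seminorm 0 \<phi>)"
    by (intro integrable_mult_left integrable_norm f)
  show 1: "integrable lborel (\<lambda>x. f x * \<phi> x)"
    by (rule Bochner_Integration.integrable_bound[OF i])
       (measurable, intro AE_I2, unfold real_norm_def, rule order_trans[OF b abs_ge_self])
  have "norm (LINT x|lborel. f x * \<phi> x) \<le> (LINT x|lborel. norm (f x * \<phi> x))" by (rule integral_norm_bound)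
  also have "\<dots> \<le> (LINT x|lborel. norm (f x) * schwartz_seminorm 0 \<phi>)"
    by (rule integral_mono[OF integrable_norm[OF 1] i b])
  finally show "norm (LINT x|lborel. f x * \<phi> x) \<le> (LINT x|lborel. norm (f x)) * schwartz_seminorm 0 \<phi>"
    by simp
qed

lemma regular_distr_tempered:
  fixes f :: "'a::euclidean_space \<Rightarrow> complex"
  assumes f: "integrable lborel f"
  shows "regular_distr schwartz f \<in> tempered"
  unfolding tempered_def
proof (intro CollectI conjI allI ballI impI)
  fix \<phi> \<psi> :: "'a \<Rightarrow> complex" assume s: "\<phi> \<in> schwartz" "\<psi> \<in> schwartz"
  show "regular_distr schwartz f (\<lambda>x. \<phi> x + \<psi> x) = regular_distr schwartz f \<phi> + regular_distr schwartz f \<psi>"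
    using s by (simp add: regular_distr_def schwartz_add distrib_left integrable_mult_schwartz[OF f])
next
  fix c and \<phi> :: "'a \<Rightarrow> complex" assume "\<phi> \<in> schwartz"
  then show "regular_distr schwartz f (\<lambda>x. c * \<phi> x) = c * regular_distr schwartz f \<phi>"
    by (simp add: regular_distr_def schwartz_cmult mult.left_commute[of _ c])
next
  show "\<exists>N C. \<forall>\<phi>\<in>schwartz. norm (regular_distr schwartz f \<phi>) \<le> C * schwartz_seminorm N \<phi>"
    using integrable_mult_schwartz(2)[OF f] unfolding regular_distr_def
    by (intro exI[of _ 0] exI[of _ "LINT x|lborel. norm (f x)"]) auto
qed (simp add: regular_distr_def)

lemma represents_fourier_regular:
  fixes G :: "'a::euclidean_space \<Rightarrow> complex"
  assumes G: "rapid G"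
  shows "represents G (fourier_distr (regular_distr schwartz (ifourier G)))"
  unfolding represents_def
proof (intro conjI ballI)
  have i: "integrable lborel G" by (rule rapid_integrable[OF G])
  show "locally_integrable G"
    unfolding locally_integrable_def set_integrable_def
    by (intro allI impI integrable_mult_indicator i) (simp add: borel_closed compact_imp_closed)
  fix \<phi> :: "'a \<Rightarrow> complex" assume \<phi>: "\<phi> \<in> test_functions UNIV"
  have s: "fourier \<phi> \<in> schwartz" by (rule fourier_test_function_schwartz[OF \<phi>])
  show "fourier_distr (regular_distr schwartz (ifourier G)) \<phi> = (LINT \<xi>|lborel. G \<xi> * \<phi> \<xi>)"
    using ifourier_mult_formula[OF i schwartz_integrable[OF s]] s test_functions_schwartz[OF \<phi>]
    by (simp add: fourier_distr_def regular_distr_def fourier_inversion_test[OF \<phi>])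
qed

text \<open>On the Fourier side the difference to \<open>u\<close> is \<open>fourier_fun u\<close>
  times a factor that is bounded by 2 and tends pointwise to 0, so the norms converge to 0 by
  domination; the supports are controlled by \<open>mollify_test\<close>.\<close>

theorem exists_approximating_sequence:
  fixes u :: "'a::euclidean_space distr"
  assumes k: "k > 0" and u: "u \<in> sobolev_supp k s (closure \<Omega>)" and \<Omega>: "bounded \<Omega>" "\<Omega> \<noteq> {}"
  shows "\<exists>f. approx_seq k s \<Omega> u f"
proof (intro exI)
  have us: "u \<in> sobolev k s" and supp: "distr_supp u \<subseteq> closure \<Omega>"
    using u by (auto simp: sobolev_supp_def)
  \<comment> \<open>The scale lies strictly below \<open>1 / Suc n\<close>, so the closed
    neighbourhood from \<open>mollify_test\<close> fits into the open one demanded by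
    \<open>approx_seq\<close>.\<close>
  let ?\<epsilon> = "\<lambda>n. 1 / real (n + 2)"
  let ?f = "\<lambda>n. mollify (?\<epsilon> n) u" let ?G = "\<lambda>n. mollify_hat (?\<epsilon> n) u"
  let ?r = "\<lambda>n. regular_distr schwartz (?f n)"
  have t: "?f n \<in> test_functions {x. infdist x (closure \<Omega>) \<le> ?\<epsilon> n}" for n
    using \<Omega> supp by (intro mollify_test[OF k us]) (auto simp: compact_closure)
  have sub: "{x. infdist x (closure \<Omega>) \<le> ?\<epsilon> n} \<subseteq> {x. infdist x \<Omega> < 1 / real (Suc n)}" for n
  proof -
    have "infdist x \<Omega> \<le> infdist x (closure \<Omega>)" for x
    proof -
      have "infdist x \<Omega> \<le> dist x y" if "y \<in> closure \<Omega>" for y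
        using infdist_triangle[of x \<Omega> y] that in_closure_iff_infdist_zero[OF \<Omega>(2), of y] by simp
      then show ?thesis
        unfolding infdist_def[of x "closure \<Omega>"] using \<Omega>(2) by (auto intro!: cINF_greatest)
    qed
    moreover have "?\<epsilon> n < 1 / real (Suc n)" by (simp add: field_simps)
    ultimately show ?thesis by (blast intro: order_le_less_trans order_trans)
  qed
  note [measurable] = sobolevD(4)[OF us] mollify_hat_measurable[OF k us]
  have rep: "represents (?G n) (fourier_distr (?r n))" for n
    unfolding mollify_def by (intro represents_fourier_regular rapid_mollify_hat[OF k us]) simp
  have rs: "?r n \<in> sobolev k s" for n
    by (intro sobolevI[OF _ rep] regular_distr_tempered test_functions_integrable[OF t] mollify_hat_energy[OF k us])
  have lim: "(\<lambda>n. sobolev_norm k s (distr_diff (?r n) u)) \<longlonglongrightarrow> 0"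
  proof -
    let ?w = "\<lambda>\<xi>. weight k s \<xi> * (norm (fourier_fun u \<xi>))\<^sup>2"
    let ?d = "\<lambda>n \<xi>. weight k s \<xi> * (norm (?G n \<xi> + (- 1) * fourier_fun u \<xi>))\<^sup>2"
    have w: "integrable lborel ?w"
      using sobolevD(3)[OF us] unfolding energy_def by (intro integrableI_bounded) (auto simp: weight_nonneg)
    have pt: "?d n \<xi> \<le> 4 * ?w \<xi>" for n \<xi>
    proof -
      have "norm (?G n \<xi> + (- 1) * fourier_fun u \<xi>) \<le> 2 * norm (fourier_fun u \<xi>)"
        using norm_triangle_ineq4[of "?G n \<xi>" "fourier_fun u \<xi>"] norm_mollify_hat_le[OF k us, of "?\<epsilon> n" \<xi>] by simp
      then have "(norm (?G n \<xi> + (- 1) * fourier_fun u \<xi>))\<^sup>2 \<le> (2 * norm (fourier_fun u \<xi>))\<^sup>2" by (intro power_mono) auto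
      from mult_left_mono[OF this weight_nonneg] show ?thesis by (simp add: power_mult_distrib mult_ac)
    qed
    have di: "integrable lborel (?d n)" for n
      by (rule Bochner_Integration.integrable_bound[OF integrable_mult_right[OF w, of 4]])
         (use pt in \<open>auto intro!: AE_I2 simp: weight_nonneg abs_mult\<close>)
    have en: "sobolev_norm k s (distr_diff (?r n) u) = sqrt (LINT \<xi>|lborel. ?d n \<xi>)" for n
    proof -
      have "sobolev_energy k s (distr_diff (?r n) u) = energy k s (\<lambda>\<xi>. ?G n \<xi> + (- 1) * fourier_fun u \<xi>)"
        unfolding distr_diff_eq
        by (intro sobolev_energy_represents represents_add represents_scale rep sobolevD(2)[OF us])
      also have "\<dots> = ennreal (LINT \<xi>|lborel. ?d n \<xi>)"
        unfolding energy_def by (intro nn_integral_eq_integral di) (auto simp: weight_nonneg)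
      finally show ?thesis
        unfolding sobolev_norm_def by (simp add: integral_nonneg_AE weight_nonneg)
    qed
    have "(\<lambda>n. LINT \<xi>|lborel. ?d n \<xi>) \<longlonglongrightarrow> (LINT \<xi>::'a|lborel. 0)"
    proof (rule integral_dominated_convergence[where w="\<lambda>\<xi>. 4 * ?w \<xi>"])
      show "AE \<xi> in lborel. (\<lambda>n. ?d n \<xi>) \<longlonglongrightarrow> 0"
      proof (intro AE_I2)
        fix \<xi>
        have "(\<lambda>n. weight k s \<xi> * (norm (fourier_fun u \<xi> * mollifier_hat (?\<epsilon> n *\<^sub>R \<xi>) + (- 1) * fourier_fun u \<xi>))\<^sup>2)
            \<longlonglongrightarrow> weight k s \<xi> * (norm (fourier_fun u \<xi> * 1 + (- 1) * fourier_fun u \<xi>))\<^sup>2"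
          by (intro tendsto_mult tendsto_power tendsto_norm tendsto_add tendsto_const mollifier_hat_tendsto)
        then show "(\<lambda>n. ?d n \<xi>) \<longlonglongrightarrow> 0" by (simp add: mollify_hat_def)
      qed
      show "integrable lborel (\<lambda>\<xi>. 4 * ?w \<xi>)" by (rule integrable_mult_right[OF w])
      show "AE \<xi> in lborel. norm (?d n \<xi>) \<le> 4 * ?w \<xi>" for n
        using pt by (intro AE_I2) (simp add: weight_nonneg abs_mult)
    qed measurable
    then have "(\<lambda>n. sqrt (LINT \<xi>|lborel. ?d n \<xi>)) \<longlonglongrightarrow> sqrt 0" by (intro tendsto_real_sqrt) simp
    then show ?thesis by (simp only: en real_sqrt_zero)
  qed
  show "approx_seq k s \<Omega> u ?f"
    unfolding approx_seq_def converges_in_def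
    using t test_functions_mono[OF sub] rs us lim by blast
qed

section \<open>Convolution with a truncated kernel\<close>

lemma convolution_integrable:
  fixes K f :: "'a::euclidean_space \<Rightarrow> complex"
  assumes K: "integrable lborel K" and f: "integrable lborel f"
  shows "integrable (lborel \<Otimes>\<^sub>M lborel) (\<lambda>(z, x). K z * f (x - z))"
proof (rule lborel_pair.Fubini_integrable)
  have [measurable]: "K \<in> borel_measurable borel" "f \<in> borel_measurable borel"
    using K f by (auto simp: integrable_iff_bounded)
  show "(\<lambda>(z, x). K z * f (x - z)) \<in> borel_measurable (lborel \<Otimes>\<^sub>M lborel)" by measurable
  have t: "integrable lborel (\<lambda>x. f (x - z))" for z
    using lborel_integrable_translate[OF f, of "- z"] by simp
  then show "AE z in lborel. integrable lborel (\<lambda>x. case (z, x) of (z, x) \<Rightarrow> K z * f (x - z))" by simp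
  have eq: "(LINT x|lborel. norm (K z * f (x - z))) = norm (K z) * (LINT x|lborel. norm (f x))" for z
  proof -
    have "(LINT x|lborel. norm (f (x - z))) = (LINT x|lborel. norm (f x))"
      using lborel_integral_translate[of "\<lambda>x. norm (f x)" "- z"] by simp
    then show ?thesis unfolding norm_mult integral_mult_right_zero by (simp only:)
  qed
  show "integrable lborel (\<lambda>z. LINT x|lborel. norm (case (z, x) of (z, x) \<Rightarrow> K z * f (x - z)))"
    unfolding prod.case eq by (intro integrable_mult_left integrable_norm K)
qed

lemma
  fixes K f :: "'a::euclidean_space \<Rightarrow> complex"
  assumes K: "integrable lborel K" and f: "integrable lborel f"
  shows integrable_convolution: "integrable lborel (\<lambda>x. LINT y|lborel. K (x - y) * f y)"
    and fourier_convolution: "fourier (\<lambda>x. LINT y|lborel. K (x - y) * f y) \<xi> =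
      (LINT z|lborel. exp (- (\<i> * of_real (\<xi> \<bullet> z))) * K z) * fourier f \<xi>"
proof -
  have [measurable]: "K \<in> borel_measurable borel" "f \<in> borel_measurable borel"
    using K f by (auto simp: integrable_iff_bounded)
  have swap: "(LINT y|lborel. K (x - y) * f y) = (LINT z|lborel. K z * f (x - z))" for x
    using lborel_integral_reflect[of "\<lambda>z. K z * f (x - z)" x] by simp
  note I = convolution_integrable[OF K f]
  show "integrable lborel (\<lambda>x. LINT y|lborel. K (x - y) * f y)"
    unfolding swap using lborel_pair.integrable_snd[OF I] by simp
  let ?e = "\<lambda>x. exp (- (\<i> * complex_of_real (\<xi> \<bullet> x)))"
  have I2: "integrable (lborel \<Otimes>\<^sub>M lborel) (\<lambda>(z, x). ?e x * (K z * f (x - z)))"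
    by (rule Bochner_Integration.integrable_bound[OF I]) (auto simp: norm_mult)
  have inner: "(LINT x|lborel. ?e x * (K z * f (x - z))) = (?e z * K z) * (LINT x|lborel. ?e x * f x)" for z
  proof -
    have "?e x = ?e z * ?e (x - z)" for x
      by (subst exp_add[symmetric]) (simp add: inner_diff_right algebra_simps)
    then have "?e x * (K z * f (x - z)) = (?e z * K z) * (?e (x - z) * f (x - z))" for x
      by (metis (no_types, lifting) mult.assoc mult.left_commute)
    then have "(LINT x|lborel. ?e x * (K z * f (x - z))) = (?e z * K z) * (LINT x|lborel. ?e (x - z) * f (x - z))"
      by (simp only: integral_mult_right_zero)
    also have "(LINT x|lborel. ?e (x - z) * f (x - z)) = (LINT x|lborel. ?e x * f x)"
      using lborel_integral_translate[of "\<lambda>x. ?e x * f x" "- z"] by simp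
    finally show ?thesis .
  qed
  have "(LINT x|lborel. ?e x * (LINT z|lborel. K z * f (x - z))) = (LINT x|lborel. LINT z|lborel. ?e x * (K z * f (x - z)))"
    by (simp only: integral_mult_right_zero)
  also have "\<dots> = (LINT z|lborel. LINT x|lborel. ?e x * (K z * f (x - z)))"
    by (rule lborel_pair.Fubini_integral[OF I2])
  also have "\<dots> = (LINT z|lborel. ?e z * K z) * (LINT x|lborel. ?e x * f x)"
    unfolding inner by (rule integral_mult_left_zero)
  finally show "fourier (\<lambda>x. LINT y|lborel. K (x - y) * f y) \<xi> =
      (LINT z|lborel. exp (- (\<i> * of_real (\<xi> \<bullet> z))) * K z) * fourier f \<xi>"
    unfolding swap fourier_eq by (simp only: mult.left_commute)
qed

section \<open>The truncated single-layer kernel and its symbol\<close>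

definition sl_kernel :: "real \<Rightarrow> 'a::euclidean_space \<Rightarrow> complex" where
  "sl_kernel k x = Phi k (x, 0::real) (0, 0)"

definition trunc_kernel :: "real \<Rightarrow> real \<Rightarrow> 'a::euclidean_space \<Rightarrow> complex" where
  "trunc_kernel k R x = indicator (ball 0 R) x *\<^sub>R sl_kernel k x"

text \<open>The factor of the unitary \<open>fourier\<close> is left out: in that normalization,
  convolution with a kernel is multiplication by the kernel's unnormalized transform.\<close>

definition trunc_symbol :: "real \<Rightarrow> real \<Rightarrow> 'a::euclidean_space \<Rightarrow> complex" where
  "trunc_symbol k R \<xi> = (LINT x|lborel. exp (- (\<i> * of_real (\<xi> \<bullet> x))) * trunc_kernel k R x)"

lemma Phi_eq_sl_kernel: "Phi k (x, 0::real) (y, 0) = sl_kernel k (x - y)"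
  by (simp add: sl_kernel_def Phi_def)

lemma represents_fourier_test:
  assumes f: "f \<in> test_functions \<Omega>"
  shows "represents (fourier f) (fourier_distr (regular_distr schwartz f))"
  using represents_fourier_regular[OF rapid_schwartz[OF fourier_test_function_schwartz[OF f]]]
  by (simp add: fourier_inversion_test[OF f])

text \<open>For \<open>x\<close> in the support of \<psi> and \<open>y\<close> in that of
  \<open>f\<close> the difference lies in the ball where the kernel is untouched, so truncation
  changes nothing. Writing \<psi> as \<open>fourier (ifourier \<psi>)\<close> then lets the
  multiplication formula move everything to the Fourier side.\<close>

lemma single_layer_fun_pairing:
  fixes f :: "'a::euclidean_space \<Rightarrow> complex"
  assumes K: "integrable lborel (trunc_kernel k R :: 'a \<Rightarrow> complex)"
    and f: "f \<in> test_functions \<Omega>'" and \<psi>: "\<psi> \<in> test_functions \<Omega>"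
    and near: "\<And>x y. x \<in> \<Omega> \<Longrightarrow> y \<in> fun_supp f \<Longrightarrow> dist x y < R"
  shows "(LINT x|lborel. single_layer_fun k f x * \<psi> x) =
    fourier_multiplier (trunc_symbol k R) (regular_distr schwartz f) \<psi>"
proof -
  let ?h = "\<lambda>x. LINT y|lborel. trunc_kernel k R (x - y) * f y"
  have fi: "integrable lborel f" by (rule test_functions_integrable[OF f])
  have hi: "integrable lborel ?h" by (rule integrable_convolution[OF K fi])
  have [measurable]: "trunc_kernel k R \<in> borel_measurable (borel :: 'a measure)" using K by (simp add: integrable_iff_bounded)
  have [measurable]: "trunc_symbol k R \<in> borel_measurable (borel :: 'a measure)"
    unfolding trunc_symbol_def[abs_def] by measurable
  have [measurable]: "\<psi> \<in> borel_measurable borel" "f \<in> borel_measurable borel"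
    by (intro schwartz_measurable test_functions_schwartz[OF \<psi>] test_functions_schwartz[OF f])+
  note rep = represents_fourier_test[OF f]
  have [measurable]: "fourier_fun (regular_distr schwartz f) \<in> borel_measurable borel"
    unfolding fourier_fun_def by (rule represents_measurable[OF someI[of "\<lambda>g. represents g (fourier_distr (regular_distr schwartz f))", OF rep]])
  have "single_layer_fun k f x * \<psi> x = ?h x * \<psi> x" for x
  proof (cases "x \<in> fun_supp \<psi>")
    case True
    then have x: "x \<in> \<Omega>" using test_functionsD(3)[OF \<psi>] by auto
    have "Phi k (x, 0::real) (y, 0) * f y = trunc_kernel k R (x - y) * f y" for y
      using near[OF x, of y] test_functionsD(4)[OF f, of y]
      by (cases "y \<in> fun_supp f") (auto simp: trunc_kernel_def Phi_eq_sl_kernel dist_norm indicator_def norm_minus_commute)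
    then show ?thesis by (simp only: single_layer_fun_def)
  next
    case False
    then show ?thesis using test_functionsD(4)[OF \<psi>] by simp
  qed
  then have "(LINT x|lborel. single_layer_fun k f x * \<psi> x) = (LINT x|lborel. ?h x * fourier (ifourier \<psi>) x)"
    by (simp only: fourier_inversion_test[OF \<psi>])
  also have "\<dots> = (LINT \<xi>|lborel. fourier ?h \<xi> * ifourier \<psi> \<xi>)"
    by (rule fourier_mult_formula[symmetric, OF hi schwartz_integrable[OF ifourier_test_function_schwartz[OF \<psi>]]])
  also have "\<dots> = (LINT \<xi>|lborel. (trunc_symbol k R \<xi> * fourier f \<xi>) * ifourier \<psi> \<xi>)"
    unfolding fourier_convolution[OF K fi] trunc_symbol_def ..
  also have "\<dots> = (LINT \<xi>|lborel. (trunc_symbol k R \<xi> * fourier_fun (regular_distr schwartz f) \<xi>) * ifourier \<psi> \<xi>)"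
    by (rule integral_cong_AE) (use fourier_fun_AE_eq[OF rep] in auto)
  also have "\<dots> = fourier_multiplier (trunc_symbol k R) (regular_distr schwartz f) \<psi>"
    using test_functions_schwartz[OF \<psi>] by (simp add: fourier_multiplier_def spectral_distr_def)
  finally show ?thesis .
qed

section \<open>The single-layer operator as a Fourier multiplier\<close>

lemma sobolev_norm_nonneg: "sobolev_norm k s u \<ge> 0"
  by (simp add: sobolev_norm_def)

lemma sobolev_norm_on_le:
  assumes "U \<in> sobolev k s"
  shows "sobolev_norm_on k s \<Omega> (distr_restrict \<Omega> U) \<le> sobolev_norm k s U"
  unfolding sobolev_norm_on_def
  using assms by (intro cInf_lower bdd_belowI[of _ 0]) (auto simp: sobolev_norm_nonneg)

lemma sobolev_norm_on_nonneg:
  assumes "u \<in> sobolev_on k s \<Omega>"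
  shows "0 \<le> sobolev_norm_on k s \<Omega> u"
  unfolding sobolev_norm_on_def
  using assms by (intro cInf_greatest) (auto simp: sobolev_norm_nonneg sobolev_on_def)

lemma distr_restrict_diff: "distr_restrict \<Omega> (distr_diff u v) = distr_diff (distr_restrict \<Omega> u) (distr_restrict \<Omega> v)"
  by (auto simp: distr_restrict_def distr_diff_def)

lemma distr_restrict_add: "distr_restrict \<Omega> (distr_add u v) = distr_add (distr_restrict \<Omega> u) (distr_restrict \<Omega> v)"
  by (auto simp: distr_restrict_def distr_add_def)

lemma distr_restrict_scale: "distr_restrict \<Omega> (distr_scale c u) = distr_scale c (distr_restrict \<Omega> u)"
  by (auto simp: distr_restrict_def distr_scale_def)

section \<open>Limits in restricted Sobolev spaces, and supports\<close>

text \<open>Every extension of \<open>u\<close> has the same value at \<psi> and obeys the duality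
  bound, so the bound survives the infimum that defines the quotient norm.\<close>

lemma norm_pairing_on_le:
  assumes k: "k > 0" and u: "u \<in> sobolev_on k s \<Omega>" and \<psi>: "\<psi> \<in> test_functions \<Omega>"
  shows "norm (u \<psi>) \<le> sobolev_norm_on k s \<Omega> u * (sqrt (enn2real (energy k (- s) (ifourier \<psi>))) + 1)"
proof -
  \<comment> \<open>The summand 1 makes the constant positive, so that it can be divided to the
    other side before the infimum is taken.\<close>
  let ?C = "sqrt (enn2real (energy k (- s) (ifourier \<psi>))) + 1"
  have C: "?C > 0" by (simp add: add_nonneg_pos)
  have "norm (u \<psi>) / ?C \<le> sobolev_norm_on k s \<Omega> u"
    unfolding sobolev_norm_on_def
  proof (rule cInf_greatest)
    show "{sobolev_norm k s U |U. U \<in> sobolev k s \<and> distr_restrict \<Omega> U = u} \<noteq> {}"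
      using u by (auto simp: sobolev_on_def)
    fix x assume "x \<in> {sobolev_norm k s U |U. U \<in> sobolev k s \<and> distr_restrict \<Omega> U = u}"
    then obtain U where U: "U \<in> sobolev k s" "u = distr_restrict \<Omega> U" "x = sobolev_norm k s U" by auto
    have "norm (u \<psi>) \<le> sobolev_norm k s U * sqrt (enn2real (energy k (- s) (ifourier \<psi>)))"
      using norm_sobolev_pairing_le[OF k U(1) \<psi>] U(2) \<psi> by (simp add: distr_restrict_def)
    also have "\<dots> \<le> sobolev_norm k s U * ?C" by (intro mult_left_mono sobolev_norm_nonneg) simp
    finally show "norm (u \<psi>) / ?C \<le> x" using C U(3) by (simp add: pos_divide_le_eq)
  qed
  then show ?thesis using C by (simp add: pos_divide_le_eq)
qed

lemma sobolev_on_diff: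
  assumes "u \<in> sobolev_on k s \<Omega>" "v \<in> sobolev_on k s \<Omega>"
  shows "distr_diff u v \<in> sobolev_on k s \<Omega>"
  using assms unfolding sobolev_on_def by (auto simp: distr_restrict_diff[symmetric] intro: sobolev_diff)

text \<open>Convergence in the quotient norm implies convergence of the values on each test function
  of \<Omega>. These values determine an element of \<open>sobolev_on\<close>, because it is 0 on
  all other functions.\<close>

lemma converges_in_sobolev_on_unique:
  assumes k: "k > 0"
    and v: "converges_in (sobolev_on k s \<Omega>) (sobolev_norm_on k s \<Omega>) u v"
    and w: "converges_in (sobolev_on k s \<Omega>) (sobolev_norm_on k s \<Omega>) u w"
  shows "v = w"
proof
  fix \<psi>
  show "v \<psi> = w \<psi>"
  proof (cases "\<psi> \<in> test_functions \<Omega>")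
    case True
    let ?C = "sqrt (enn2real (energy k (- s) (ifourier \<psi>))) + 1"
    have lim: "(\<lambda>j. u j \<psi>) \<longlonglongrightarrow> x \<psi>"
      if x: "converges_in (sobolev_on k s \<Omega>) (sobolev_norm_on k s \<Omega>) u x" for x
    proof -
      have "(\<lambda>j. u j \<psi> - x \<psi>) \<longlonglongrightarrow> 0"
      proof (rule Lim_null_comparison)
        have "norm (u j \<psi> - x \<psi>) \<le> sobolev_norm_on k s \<Omega> (distr_diff (u j) x) * ?C" for j
        proof -
          have d: "distr_diff (u j) x \<in> sobolev_on k s \<Omega>"
            using x by (intro sobolev_on_diff) (auto simp: converges_in_def)
          have "u j \<psi> - x \<psi> = distr_diff (u j) x \<psi>" by (simp add: distr_diff_def)
          then show ?thesis using norm_pairing_on_le[OF k d True] by (simp only:)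
        qed
        then show "\<forall>\<^sub>F j in sequentially. norm (u j \<psi> - x \<psi>) \<le> sobolev_norm_on k s \<Omega> (distr_diff (u j) x) * ?C" by simp
        show "(\<lambda>j. sobolev_norm_on k s \<Omega> (distr_diff (u j) x) * ?C) \<longlonglongrightarrow> 0"
          using x by (intro tendsto_mult_left_zero) (simp add: converges_in_def)
      qed
      then show ?thesis by (simp add: LIM_zero_iff)
    qed
    show ?thesis by (rule LIMSEQ_unique[OF lim[OF v] lim[OF w]])
  next
    case False
    then show ?thesis using v w by (auto simp: converges_in_def sobolev_on_def distr_restrict_def)
  qed
qed

lemma distr_supp_add: "distr_supp (distr_add u v) \<subseteq> distr_supp u \<union> distr_supp v"
proof
  fix x assume x: "x \<in> distr_supp (distr_add u v)"
  show "x \<in> distr_supp u \<union> distr_supp v"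
  proof (rule ccontr)
    assume "x \<notin> distr_supp u \<union> distr_supp v"
    then obtain U V where U: "open U" "\<forall>\<phi>\<in>test_functions U. u \<phi> = 0" "x \<in> U"
      and V: "open V" "\<forall>\<phi>\<in>test_functions V. v \<phi> = 0" "x \<in> V" by (auto simp: distr_supp_def)
    have "\<forall>\<phi>\<in>test_functions (U \<inter> V). distr_add u v \<phi> = 0"
    proof
      fix \<phi> assume "\<phi> \<in> test_functions (U \<inter> V)"
      then have "\<phi> \<in> test_functions U" "\<phi> \<in> test_functions V"
        using test_functions_mono[OF Int_lower1] test_functions_mono[OF Int_lower2] by blast+
      then show "distr_add u v \<phi> = 0" using U(2) V(2) by (simp add: distr_add_def)
    qed
    then have "x \<notin> distr_supp (distr_add u v)"
      using U V unfolding distr_supp_def by (simp, intro exI[of _ "U \<inter> V"]) (simp add: open_Int)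
    then show False using x by simp
  qed
qed

lemma distr_supp_scale: "distr_supp (distr_scale c u) \<subseteq> distr_supp u"
  unfolding distr_supp_def by (auto simp: distr_scale_def)

lemma sobolev_supp_add: "u \<in> sobolev_supp k s F \<Longrightarrow> v \<in> sobolev_supp k s F \<Longrightarrow> distr_add u v \<in> sobolev_supp k s F"
  using distr_supp_add[of u v] by (auto simp: sobolev_supp_def sobolev_add)

lemma sobolev_supp_scale: "u \<in> sobolev_supp k s F \<Longrightarrow> distr_scale c u \<in> sobolev_supp k s F"
  using distr_supp_scale[of c u] by (auto simp: sobolev_supp_def sobolev_scale)

section \<open>The operator on a fixed domain\<close>

text \<open>\<open>A\<close> is a function of the radius because two truncations are used on the
  same domain: one that represents every term of an approximating sequence, and one that gives the
  scale-invariant bound.\<close>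

locale single_layer_symbol =
  fixes k :: real and A :: "real \<Rightarrow> real" and \<Omega> :: "'a::euclidean_space set"
  assumes k_pos: "k > 0"
    and trunc_int: "\<And>R. R > 0 \<Longrightarrow> integrable lborel (trunc_kernel k R :: 'a \<Rightarrow> complex)"
    and A_nonneg: "\<And>R. R > 0 \<Longrightarrow> A R \<ge> 0"
    and symbol_bound: "\<And>R \<xi>. R > 0 \<Longrightarrow> norm (trunc_symbol k R (\<xi>::'a)) \<le> A R * weight k (- 1 / 2) \<xi>"
    and open_\<Omega>: "open \<Omega>" and bounded_\<Omega>: "bounded \<Omega>" and \<Omega>_ne: "\<Omega> \<noteq> {}"
begin

lemma order_one: "R > 0 \<Longrightarrow> order_one_multiplier k (A R) (trunc_symbol k R :: 'a \<Rightarrow> complex)"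
proof
  assume R: "R > 0"
  have [measurable]: "trunc_kernel k R \<in> borel_measurable (borel :: 'a measure)"
    using trunc_int[OF R] by (simp add: integrable_iff_bounded)
  show "trunc_symbol k R \<in> borel_measurable (borel :: 'a measure)"
    unfolding trunc_symbol_def[abs_def] by measurable
qed (use k_pos A_nonneg symbol_bound in auto)

abbreviation T :: "real \<Rightarrow> 'a distr \<Rightarrow> 'a distr" where
  "T R \<equiv> fourier_multiplier (trunc_symbol k R)"

lemma diameter_pos: "diameter \<Omega> > 0"
proof -
  obtain x where x: "x \<in> \<Omega>" using \<Omega>_ne by auto
  obtain e where e: "e > 0" "ball x e \<subseteq> \<Omega>" using open_\<Omega> x by (auto simp: open_contains_ball)
  obtain b :: 'a where b: "b \<in> Basis" using nonempty_Basis by blast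
  have "x + (e / 2) *\<^sub>R b \<in> \<Omega>" using e b by (intro subsetD[OF e(2)]) (simp add: dist_norm)
  then have "dist x (x + (e / 2) *\<^sub>R b) \<le> diameter \<Omega>" by (intro diameter_bounded_bound bounded_\<Omega> x)
  then show ?thesis using e b by (simp add: dist_norm)
qed

lemma dist_less_if_near:
  assumes f: "f \<in> test_functions {x. infdist x \<Omega> < 1 / real (Suc j)}" and x: "x \<in> \<Omega>" and y: "y \<in> fun_supp f"
  shows "dist x y < diameter \<Omega> + 1 / real (Suc j)"
proof -
  have "infdist y \<Omega> < 1 / real (Suc j)" using test_functionsD(3)[OF f] y by auto
  then obtain z where z: "z \<in> \<Omega>" "dist y z < 1 / real (Suc j)"
    using \<Omega>_ne cInf_lessD[of "dist y ` \<Omega>" "1 / real (Suc j)"] by (auto simp: infdist_def)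
  have "dist x z \<le> diameter \<Omega>" by (intro diameter_bounded_bound bounded_\<Omega> x z)
  then show ?thesis using dist_triangle[of x y z] z(2) by (simp add: dist_commute)
qed

lemma regular_single_layer_eq:
  assumes R: "R > 0" "diameter \<Omega> + 1 / real (Suc j) \<le> R"
    and f: "f \<in> test_functions {x. infdist x \<Omega> < 1 / real (Suc j)}"
  shows "regular_distr (test_functions \<Omega>) (single_layer_fun k f) =
    distr_restrict \<Omega> (T R (regular_distr schwartz f))"
proof
  fix \<psi>
  have near: "dist x y < R" if "x \<in> \<Omega>" "y \<in> fun_supp f" for x y
    using dist_less_if_near[OF f that] R(2) by simp
  show "regular_distr (test_functions \<Omega>) (single_layer_fun k f) \<psi> = distr_restrict \<Omega> (T R (regular_distr schwartz f)) \<psi>"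
    using single_layer_fun_pairing[OF trunc_int[OF R(1)] f _ near, of \<psi>]
    by (simp add: regular_distr_def distr_restrict_def)
qed

lemma T_converges:
  assumes R: "R > 0" and f: "approx_seq k s \<Omega> u f" and \<psi>: "\<psi> \<in> test_functions \<Omega>"
  shows "(\<lambda>j. T R (regular_distr schwartz (f j)) \<psi>) \<longlonglongrightarrow> T R u \<psi>"
proof -
  interpret order_one_multiplier k "A R" "trunc_symbol k R :: 'a \<Rightarrow> complex" by (rule order_one[OF R])
  let ?r = "\<lambda>j. regular_distr schwartz (f j)"
  let ?C = "sqrt (enn2real (energy k (- (s + 1)) (ifourier \<psi>)))"
  have r: "?r j \<in> sobolev k s" "u \<in> sobolev k s" for j using f by (auto simp: approx_seq_def converges_in_def)
  have "(\<lambda>j. T R (?r j) \<psi> - T R u \<psi>) \<longlonglongrightarrow> 0"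
  proof (rule Lim_null_comparison)
    have "norm (T R (?r j) \<psi> - T R u \<psi>) \<le> (A R * sobolev_norm k s (distr_diff (?r j) u)) * ?C" for j
    proof -
      have d: "distr_diff (?r j) u \<in> sobolev k s" by (intro sobolev_diff r)
      have "T R (?r j) \<psi> - T R u \<psi> = T R (distr_diff (?r j) u) \<psi>"
        unfolding multiplier_diff[OF r] by (simp add: distr_diff_def)
      also have "norm \<dots> \<le> sobolev_norm k (s + 1) (T R (distr_diff (?r j) u)) * ?C"
        by (rule norm_sobolev_pairing_le[OF k_pos multiplier_sobolev[OF d] \<psi>])
      also have "\<dots> \<le> (A R * sobolev_norm k s (distr_diff (?r j) u)) * ?C"
        by (intro mult_right_mono multiplier_norm_le[OF d]) simp
      finally show ?thesis .
    qed
    then show "\<forall>\<^sub>F j in sequentially. norm (T R (?r j) \<psi> - T R u \<psi>) \<le> (A R * sobolev_norm k s (distr_diff (?r j) u)) * ?C" by simp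
    show "(\<lambda>j. (A R * sobolev_norm k s (distr_diff (?r j) u)) * ?C) \<longlonglongrightarrow> 0"
      using f by (intro tendsto_mult_left_zero tendsto_mult_right_zero) (simp add: approx_seq_def converges_in_def)
  qed
  then show ?thesis by (simp add: LIM_zero_iff)
qed

text \<open>With radius \<open>diameter \<Omega> + 1\<close> the bound
  \<open>1 / Suc j \<le> 1\<close> covers all indices, including \<open>j = 0\<close>. Each term of
  each approximating sequence is then exactly the multiplier applied to \<open>f j\<close>, and
  continuity of the multiplier gives the limit.\<close>

lemma is_single_layer_T:
  assumes u: "u \<in> sobolev_supp k s (closure \<Omega>)"
  shows "is_single_layer k s \<Omega> u (distr_restrict \<Omega> (T (diameter \<Omega> + 1) u))"
proof -
  let ?R = "diameter \<Omega> + 1"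
  have R: "?R > 0" using diameter_pos by simp
  interpret order_one_multiplier k "A ?R" "trunc_symbol k ?R :: 'a \<Rightarrow> complex" by (rule order_one[OF R])
  have us: "u \<in> sobolev k s" using u by (simp add: sobolev_supp_def)
  have conv: "converges_in (sobolev_on k (s + 1) \<Omega>) (sobolev_norm_on k (s + 1) \<Omega>)
          (\<lambda>j. regular_distr (test_functions \<Omega>) (single_layer_fun k (f j))) (distr_restrict \<Omega> (T ?R u))"
    if f: "approx_seq k s \<Omega> u f" for f
  proof -
    let ?r = "\<lambda>j. regular_distr schwartz (f j)"
    have r: "?r j \<in> sobolev k s" for j using f by (auto simp: approx_seq_def converges_in_def)
    have eq: "regular_distr (test_functions \<Omega>) (single_layer_fun k (f j)) = distr_restrict \<Omega> (T ?R (?r j))" for j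
      using f by (intro regular_single_layer_eq[OF R, of j]) (auto simp: approx_seq_def)
    have on: "distr_restrict \<Omega> (T ?R v) \<in> sobolev_on k (s + 1) \<Omega>" if "v \<in> sobolev k s" for v
      unfolding sobolev_on_def by (intro imageI multiplier_sobolev that)
    have "(\<lambda>j. sobolev_norm_on k (s + 1) \<Omega> (distr_diff (distr_restrict \<Omega> (T ?R (?r j))) (distr_restrict \<Omega> (T ?R u)))) \<longlonglongrightarrow> 0"
    proof (rule tendsto_sandwich[OF _ _ tendsto_const])
      have d: "distr_diff (distr_restrict \<Omega> (T ?R (?r j))) (distr_restrict \<Omega> (T ?R u)) =
          distr_restrict \<Omega> (T ?R (distr_diff (?r j) u))" for j
        unfolding multiplier_diff[OF r us] distr_restrict_diff ..
      have ds: "distr_diff (?r j) u \<in> sobolev k s" for j by (intro sobolev_diff r us)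
      have "sobolev_norm_on k (s + 1) \<Omega> (distr_restrict \<Omega> (T ?R (distr_diff (?r j) u))) \<le> A ?R * sobolev_norm k s (distr_diff (?r j) u)" for j
        by (rule order_trans[OF sobolev_norm_on_le[OF multiplier_sobolev[OF ds]] multiplier_norm_le[OF ds]])
      then show "\<forall>\<^sub>F j in sequentially. sobolev_norm_on k (s + 1) \<Omega> (distr_diff (distr_restrict \<Omega> (T ?R (?r j))) (distr_restrict \<Omega> (T ?R u))) \<le> A ?R * sobolev_norm k s (distr_diff (?r j) u)"
        unfolding d by simp
      show "\<forall>\<^sub>F j in sequentially. 0 \<le> sobolev_norm_on k (s + 1) \<Omega> (distr_diff (distr_restrict \<Omega> (T ?R (?r j))) (distr_restrict \<Omega> (T ?R u)))"
        unfolding d by (intro always_eventually allI sobolev_norm_on_nonneg on ds)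
      show "(\<lambda>j. A ?R * sobolev_norm k s (distr_diff (?r j) u)) \<longlonglongrightarrow> 0"
        using f by (intro tendsto_mult_right_zero) (simp add: approx_seq_def converges_in_def)
    qed
    then show ?thesis unfolding converges_in_def eq using on r us by blast
  qed
  then show ?thesis
    unfolding is_single_layer_def using exists_approximating_sequence[OF k_pos u bounded_\<Omega> \<Omega>_ne] by blast
qed

lemma is_single_layer_unique:
  assumes v: "is_single_layer k s \<Omega> u v" and w: "is_single_layer k s \<Omega> u w"
  shows "v = w"
proof -
  obtain f where f: "approx_seq k s \<Omega> u f" using v unfolding is_single_layer_def by blast
  show ?thesis
    using v w f unfolding is_single_layer_def by (blast intro: converges_in_sobolev_on_unique[OF k_pos])
qed

lemma single_layer_eq:
  assumes u: "u \<in> sobolev_supp k s (closure \<Omega>)"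
  shows "single_layer k s \<Omega> u = distr_restrict \<Omega> (T (diameter \<Omega> + 1) u)"
  unfolding single_layer_def
  using is_single_layer_T[OF u] is_single_layer_unique by (intro the_equality) auto

text \<open>The truncation radius \<open>2 diameter \<Omega>\<close>, although too small for the first terms of an
  approximating sequence, gives the same operator in the limit and the scale-invariant bound.\<close>

lemma single_layer_eq':
  assumes u: "u \<in> sobolev_supp k s (closure \<Omega>)"
  shows "single_layer k s \<Omega> u = distr_restrict \<Omega> (T (2 * diameter \<Omega>) u)"
proof -
  let ?R1 = "diameter \<Omega> + 1" and ?R2 = "2 * diameter \<Omega>"
  have R1: "?R1 > 0" and R2: "?R2 > 0" using diameter_pos by auto
  obtain f where f: "approx_seq k s \<Omega> u f"
    using exists_approximating_sequence[OF k_pos u bounded_\<Omega> \<Omega>_ne] by blast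
  have "T ?R1 u \<psi> = T ?R2 u \<psi>" if \<psi>: "\<psi> \<in> test_functions \<Omega>" for \<psi>
  proof (rule LIMSEQ_unique[OF T_converges[OF R1 f \<psi>]])
    have "(\<lambda>j. inverse (real (Suc j))) \<longlonglongrightarrow> 0" by (rule LIMSEQ_inverse_real_of_nat)
    then have "\<forall>\<^sub>F j in sequentially. 1 / real (Suc j) < diameter \<Omega>"
      using diameter_pos by (simp add: order_tendstoD(2) inverse_eq_divide)
    then have "\<forall>\<^sub>F j in sequentially. T ?R2 (regular_distr schwartz (f j)) \<psi> = T ?R1 (regular_distr schwartz (f j)) \<psi>"
    proof eventually_elim
      case (elim j)
      have fj: "f j \<in> test_functions {x. infdist x \<Omega> < 1 / real (Suc j)}" using f by (auto simp: approx_seq_def)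
      have "distr_restrict \<Omega> (T ?R2 (regular_distr schwartz (f j))) = distr_restrict \<Omega> (T ?R1 (regular_distr schwartz (f j)))"
        using elim regular_single_layer_eq[OF R1 _ fj] regular_single_layer_eq[OF R2 _ fj] by simp
      from fun_cong[OF this, of \<psi>] show ?case using \<psi> by (simp add: distr_restrict_def)
    qed
    then show "(\<lambda>j. T ?R1 (regular_distr schwartz (f j)) \<psi>) \<longlonglongrightarrow> T ?R2 u \<psi>"
      by (rule Lim_transform_eventually[OF T_converges[OF R2 f \<psi>]])
  qed
  then show ?thesis unfolding single_layer_eq[OF u] by (auto simp: distr_restrict_def)
qed

theorem single_layer_norm_le:
  assumes u: "u \<in> sobolev_supp k s (closure \<Omega>)"
  shows "sobolev_norm_on k (s + 1) \<Omega> (single_layer k s \<Omega> u) \<le> A (2 * diameter \<Omega>) * sobolev_norm k s u"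
proof -
  have R: "2 * diameter \<Omega> > 0" using diameter_pos by simp
  interpret order_one_multiplier k "A (2 * diameter \<Omega>)" "trunc_symbol k (2 * diameter \<Omega>) :: 'a \<Rightarrow> complex"
    by (rule order_one[OF R])
  have us: "u \<in> sobolev k s" using u by (simp add: sobolev_supp_def)
  show ?thesis unfolding single_layer_eq'[OF u]
    by (rule order_trans[OF sobolev_norm_on_le[OF multiplier_sobolev[OF us]] multiplier_norm_le[OF us]])
qed

theorem single_layer_bounded_linear:
  "bounded_linear_operator (sobolev_supp k s (closure \<Omega>)) (sobolev_norm k s)
     (sobolev_on k (s + 1) \<Omega>) (sobolev_norm_on k (s + 1) \<Omega>) (single_layer k s \<Omega>)"
proof -
  have R: "diameter \<Omega> + 1 > 0" using diameter_pos by simp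
  interpret order_one_multiplier k "A (diameter \<Omega> + 1)" "trunc_symbol k (diameter \<Omega> + 1) :: 'a \<Rightarrow> complex"
    by (rule order_one[OF R])
  have s: "u \<in> sobolev k s" if "u \<in> sobolev_supp k s (closure \<Omega>)" for u using that by (simp add: sobolev_supp_def)
  show ?thesis unfolding bounded_linear_operator_def
  proof (intro conjI ballI allI)
    fix u assume u: "u \<in> sobolev_supp k s (closure \<Omega>)"
    show "single_layer k s \<Omega> u \<in> sobolev_on k (s + 1) \<Omega>"
      unfolding single_layer_eq[OF u] sobolev_on_def by (intro imageI multiplier_sobolev s u)
    show "single_layer k s \<Omega> (distr_scale c u) = distr_scale c (single_layer k s \<Omega> u)" for c
      unfolding single_layer_eq[OF u] single_layer_eq[OF sobolev_supp_scale[OF u]] multiplier_scale[OF s[OF u]]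
      by (rule distr_restrict_scale)
    fix v assume v: "v \<in> sobolev_supp k s (closure \<Omega>)"
    show "single_layer k s \<Omega> (distr_add u v) = distr_add (single_layer k s \<Omega> u) (single_layer k s \<Omega> v)"
      unfolding single_layer_eq[OF u] single_layer_eq[OF v] single_layer_eq[OF sobolev_supp_add[OF u v]]
        multiplier_add[OF s[OF u] s[OF v]]
      by (rule distr_restrict_add)
  next
    show "\<exists>B. \<forall>u\<in>sobolev_supp k s (closure \<Omega>). sobolev_norm_on k (s + 1) \<Omega> (single_layer k s \<Omega> u) \<le> B * sobolev_norm k s u"
      using single_layer_norm_le by blast
  qed
qed

end

section \<open>Bessel's equation of order zero\<close>

text \<open>With \<open>F z = z (u\<^sup>2 + u'\<^sup>2) + u u'\<close> Bessel's equation gives \<open>F' = - u u' / z\<close>, so \<open>F\<close> is almost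
  conserved: \<open>F z exp (1 / z)\<close> decreases on \<open>z \<ge> 1\<close>.\<close>

lemma bessel_ode_decay:
  fixes u u' u'' :: "real \<Rightarrow> real"
  assumes u: "\<And>z. z > 0 \<Longrightarrow> (u has_real_derivative u' z) (at z)"
    and u': "\<And>z. z > 0 \<Longrightarrow> (u' has_real_derivative u'' z) (at z)"
    and ode: "\<And>z. z > 0 \<Longrightarrow> z * u'' z + u' z + z * u z = 0"
  obtains C where "C \<ge> 0" "\<And>z. z \<ge> 1 \<Longrightarrow> \<bar>u z\<bar> \<le> C * z powr (- 1 / 2)" "\<And>z. z \<ge> 1 \<Longrightarrow> \<bar>u' z\<bar> \<le> C * z powr (- 1 / 2)"
proof -
  define F where "F z = z * ((u z)\<^sup>2 + (u' z)\<^sup>2) + u z * u' z" for z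
  have abs_le: "\<bar>u z * u' z\<bar> \<le> ((u z)\<^sup>2 + (u' z)\<^sup>2) / 2" for z
    using sum_squares_bound[of "\<bar>u z\<bar>" "\<bar>u' z\<bar>"] by (simp add: abs_mult)
  have lower: "z / 2 * ((u z)\<^sup>2 + (u' z)\<^sup>2) \<le> F z" if "z \<ge> 1" for z
  proof -
    have "((u z)\<^sup>2 + (u' z)\<^sup>2) / 2 \<le> z / 2 * ((u z)\<^sup>2 + (u' z)\<^sup>2)"
      using mult_right_mono[OF that, of "((u z)\<^sup>2 + (u' z)\<^sup>2) / 2"] by simp
    then show ?thesis using abs_le[of z] unfolding F_def by (simp add: field_simps abs_le_iff)
  qed
  have dF: "((\<lambda>z. F z * exp (1 / z)) has_real_derivative (- (u z * u' z) / z - F z / z\<^sup>2) * exp (1 / z)) (at z)"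
    if z: "z \<ge> 1" for z
  proof -
    have "(F has_real_derivative ((u z)\<^sup>2 + (u' z)\<^sup>2) + z * (2 * u z * u' z + 2 * u' z * u'' z) + (u' z * u' z + u z * u'' z)) (at z)"
      unfolding F_def[abs_def] using u[of z] u'[of z] z
      by (auto intro!: derivative_eq_intros simp: power2_eq_square)
    moreover have "((u z)\<^sup>2 + (u' z)\<^sup>2) + z * (2 * u z * u' z + 2 * u' z * u'' z) + (u' z * u' z + u z * u'' z) = - (u z * u' z) / z"
    proof -
      have e: "u'' z = - u z - u' z / z" using ode[of z] z by (simp add: field_simps)
      show ?thesis unfolding e using z by (simp add: field_simps power2_eq_square)
    qed
    ultimately have "(F has_real_derivative - (u z * u' z) / z) (at z)" by simp
    moreover have "((\<lambda>z. exp (1 / z)) has_real_derivative exp (1 / z) * (- 1 / z\<^sup>2)) (at z)"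
      using z by (auto intro!: derivative_eq_intros simp: power2_eq_square)
    ultimately have "((\<lambda>z. F z * exp (1 / z)) has_real_derivative F z * (exp (1 / z) * (- 1 / z\<^sup>2)) + - (u z * u' z) / z * exp (1 / z)) (at z)"
      by (rule DERIV_mult'[of F _ z UNIV])
    then show ?thesis by (simp add: algebra_simps)
  qed
  have mono: "F z * exp (1 / z) \<le> F 1 * exp (1 / 1)" if z: "z \<ge> 1" for z
  proof (rule DERIV_nonpos_imp_nonincreasing[OF z])
    fix x :: real assume x: "1 \<le> x" "x \<le> z"
    \<comment> \<open>Differentiating \<open>exp (1 / z)\<close> contributes
      \<open>- F z / z^2\<close>, and by \<open>lower\<close> this absorbs the only term of
      \<open>F'\<close>.\<close>
    have "- (u x * u' x) / x \<le> ((u x)\<^sup>2 + (u' x)\<^sup>2) / 2 / x"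
      using abs_le[of x] x by (intro divide_right_mono) (auto simp: abs_le_iff)
    also have "\<dots> = x / 2 * ((u x)\<^sup>2 + (u' x)\<^sup>2) / x\<^sup>2" using x by (simp add: field_simps power2_eq_square)
    also have "\<dots> \<le> F x / x\<^sup>2" using x by (intro divide_right_mono lower) auto
    finally have "(- (u x * u' x) / x - F x / x\<^sup>2) * exp (1 / x) \<le> 0" by (intro mult_nonpos_nonneg) auto
    then show "\<exists>y. DERIV (\<lambda>z. F z * exp (1 / z)) x :> y \<and> y \<le> 0" using dF[OF x(1)] by blast
  qed
  let ?D = "2 * (F 1 * exp 1)"
  have sq: "(u z)\<^sup>2 + (u' z)\<^sup>2 \<le> ?D / z" if z: "z \<ge> 1" for z
  proof -
    have Fz: "F z \<ge> 0" using lower[OF z] z by (smt (verit) divide_nonneg_nonneg mult_nonneg_nonneg zero_le_power2)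
    have "F z * 1 \<le> F z * exp (1 / z)" using Fz z by (intro mult_left_mono) auto
    then have "z / 2 * ((u z)\<^sup>2 + (u' z)\<^sup>2) \<le> F 1 * exp 1" using lower[OF z] mono[OF z] by simp
    then show ?thesis using z by (simp add: field_simps)
  qed
  have D: "?D \<ge> 0" using sq[of 1] by (smt (verit) divide_self_if one_neq_zero zero_le_power2 div_by_1)
  have root: "\<bar>x\<bar> \<le> sqrt ?D * z powr (- 1 / 2)" if z: "z \<ge> 1" and x: "x\<^sup>2 \<le> ?D / z" for x z
  proof -
    have "\<bar>x\<bar> \<le> sqrt (?D / z)" using x by (rule real_le_rsqrt[of "\<bar>x\<bar>", simplified])
    also have "\<dots> = sqrt ?D * z powr (- 1 / 2)"
      using z by (simp add: real_sqrt_divide powr_minus_divide powr_half_sqrt)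
    finally show ?thesis .
  qed
  show ?thesis
  proof (rule that[of "sqrt ?D"])
    show "sqrt ?D \<ge> 0" using D by simp
    fix z :: real assume z: "z \<ge> 1"
    show "\<bar>u z\<bar> \<le> sqrt ?D * z powr (- 1 / 2)"
      using sq[OF z] zero_le_power2[of "u' z"] by (intro root[OF z]) linarith
    show "\<bar>u' z\<bar> \<le> sqrt ?D * z powr (- 1 / 2)"
      using sq[OF z] zero_le_power2[of "u z"] by (intro root[OF z]) linarith
  qed
qed

subsection \<open>The integral of a plane wave over directions\<close>

abbreviation angles :: "real set" where
  "angles \<equiv> cbox (- (pi / 2)) (pi / 2)"

text \<open>Bessel's integral: this is \<open>pi\<close> times the Bessel function of order 0. The
  half circle is the range of angles in the polar coordinates below, where the radius takes both
  signs.\<close>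

definition circ :: "real \<Rightarrow> real" where
  "circ z = integral angles (\<lambda>\<theta>. cos (z * cos \<theta>))"

definition circ' :: "real \<Rightarrow> real" where
  "circ' z = integral angles (\<lambda>\<theta>. - (cos \<theta> * sin (z * cos \<theta>)))"

definition circ'' :: "real \<Rightarrow> real" where
  "circ'' z = integral angles (\<lambda>\<theta>. - ((cos \<theta>)\<^sup>2 * cos (z * cos \<theta>)))"

text \<open>Poisson's integral: \<open>pi\<close> times the Bessel function of order 1, divided by
  \<open>z\<close>. It is continuous at 0 and mediates between \<open>circ\<close>,
  \<open>circ'\<close> and \<open>circ''\<close>.\<close>

definition circ_sin :: "real \<Rightarrow> real" where
  "circ_sin z = integral angles (\<lambda>\<theta>. (sin \<theta>)\<^sup>2 * cos (z * cos \<theta>))"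

lemma circ_deriv: "(circ has_real_derivative circ' z) (at z)"
  unfolding circ_def[abs_def] circ'_def
  by (rule leibniz_rule_field_derivative[where U=UNIV, simplified])
     (auto intro!: derivative_eq_intros integrable_continuous_interval continuous_intros simp: split_beta)

lemma circ'_deriv: "(circ' has_real_derivative circ'' z) (at z)"
  unfolding circ'_def[abs_def] circ''_def
  by (rule leibniz_rule_field_derivative[where U=UNIV, simplified])
     (auto intro!: derivative_eq_intros integrable_continuous_interval continuous_intros simp: split_beta power2_eq_square)

lemma circ_add_circ'': "circ z + circ'' z = circ_sin z"
proof -
  have "circ z + circ'' z = integral angles (\<lambda>\<theta>. cos (z * cos \<theta>) + - ((cos \<theta>)\<^sup>2 * cos (z * cos \<theta>)))"
    unfolding circ_def circ''_def
    by (rule integral_add[symmetric]) (intro integrable_continuous continuous_intros)+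
  also have "\<dots> = circ_sin z"
    unfolding circ_sin_def by (intro integral_cong) (simp add: sin_squared_eq algebra_simps)
  finally show ?thesis .
qed

text \<open>The difference of the two integrands is the \<theta>-derivative of
  \<open>sin \<theta> * sin (z * cos \<theta>)\<close>, which vanishes at both ends of the half
  circle since the cosine does.\<close>

lemma circ'_eq: "circ' z = - (z * circ_sin z)"
proof -
  let ?d = "\<lambda>\<theta>. cos \<theta> * sin (z * cos \<theta>) - z * ((sin \<theta>)\<^sup>2 * cos (z * cos \<theta>))"
  have "(?d has_integral (sin (pi / 2) * sin (z * cos (pi / 2)) - sin (- (pi / 2)) * sin (z * cos (- (pi / 2))))) {- (pi / 2)..pi / 2}"
    by (rule fundamental_theorem_of_calculus[where f="\<lambda>\<theta>. sin \<theta> * sin (z * cos \<theta>)"])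
       (auto intro!: derivative_eq_intros simp: has_real_derivative_iff_has_vector_derivative[symmetric] power2_eq_square algebra_simps)
  then have "integral angles ?d = 0" by (simp add: integral_unique)
  moreover have "integral angles ?d = - circ' z - z * circ_sin z"
    unfolding circ'_def circ_sin_def integral_mult_right[symmetric] integral_neg[symmetric]
    by (subst integral_diff[symmetric]) (auto intro!: integrable_continuous_interval continuous_intros)
  ultimately show ?thesis by simp
qed

lemma circ_ode: "z * circ'' z + circ' z + z * circ z = 0"
  using circ_add_circ''[of z] circ'_eq[of z] by (simp add: algebra_simps flip: distrib_left)

lemma circ_sin_continuous: "continuous_on A circ_sin"
proof -
  have "continuous_on UNIV circ_sin"
    unfolding circ_sin_def[abs_def]
    by (rule integral_continuous_on_param) (auto intro!: continuous_intros simp: split_beta)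
  then show ?thesis by (rule continuous_on_subset) simp
qed

lemma abs_integral_angles_le:
  assumes "continuous_on angles f" "\<And>\<theta>. \<bar>f \<theta>\<bar> \<le> 1"
  shows "\<bar>integral angles f\<bar> \<le> pi"
  using integral_bound[of "- (pi / 2)" "pi / 2" f 1] assms by simp

lemma circ_bounds: "\<bar>circ z\<bar> \<le> pi" "\<bar>circ' z\<bar> \<le> pi" "\<bar>circ_sin z\<bar> \<le> pi"
proof -
  show "\<bar>circ z\<bar> \<le> pi"
    unfolding circ_def by (rule abs_integral_angles_le) (auto intro!: continuous_intros)
  show "\<bar>circ' z\<bar> \<le> pi"
    unfolding circ'_def
    by (rule abs_integral_angles_le) (auto intro!: continuous_intros simp: abs_mult mult_le_one)
  show "\<bar>circ_sin z\<bar> \<le> pi"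
    unfolding circ_sin_def
    by (rule abs_integral_angles_le)
       (auto intro!: continuous_intros mult_le_one simp: abs_mult abs_square_le_1)
qed

text \<open>Bessel's equation gives the decay for \<open>z \<ge> 1\<close>; below 1 the power is at
  least 1 and plain boundedness by \<open>pi\<close> is enough.\<close>

lemma circ_decay:
  obtains C where "C \<ge> 0" "\<And>z. z > 0 \<Longrightarrow> \<bar>circ z\<bar> \<le> C * z powr (- 1 / 2)"
    "\<And>z. z > 0 \<Longrightarrow> \<bar>circ' z\<bar> \<le> C * z powr (- 1 / 2)"
proof -
  obtain C where C: "C \<ge> 0" "\<And>z. z \<ge> 1 \<Longrightarrow> \<bar>circ z\<bar> \<le> C * z powr (- 1 / 2)" "\<And>z. z \<ge> 1 \<Longrightarrow> \<bar>circ' z\<bar> \<le> C * z powr (- 1 / 2)"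
    using bessel_ode_decay[OF circ_deriv circ'_deriv circ_ode] by metis
  have *: "\<bar>x\<bar> \<le> (C + pi) * z powr (- 1 / 2)"
    if z: "z > 0" and 1: "z \<ge> 1 \<Longrightarrow> \<bar>x\<bar> \<le> C * z powr (- 1 / 2)" and 2: "\<bar>x\<bar> \<le> pi" for x z
  proof (cases "z \<ge> 1")
    case True
    have "C * z powr (- 1 / 2) \<le> (C + pi) * z powr (- 1 / 2)" by (intro mult_right_mono) auto
    then show ?thesis using 1[OF True] by linarith
  next
    case False
    have "(1::real) \<le> z powr (- 1 / 2)" using z False powr_mono2'[of "- 1 / 2" z 1] by simp
    then have "(C + pi) * 1 \<le> (C + pi) * z powr (- 1 / 2)" using C(1) by (intro mult_left_mono) auto
    moreover have "\<bar>x\<bar> \<le> (C + pi) * 1" using 2 C(1) by simp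
    ultimately show ?thesis by (rule order_trans[rotated])
  qed
  show ?thesis
    by (rule that[of "C + pi"]) (use C circ_bounds * in auto)
qed

lemma has_integral_powr_minus_half:
  assumes "a > 0" "R \<ge> 0"
  shows "((\<lambda>r. (a * r) powr (- 1 / 2)) has_integral 2 * sqrt (R / a)) {0..R}"
proof -
  have "((\<lambda>r. r powr (- 1 / 2)) has_integral (R powr (- 1 / 2 + 1) / (- 1 / 2 + 1))) {0..R}"
    using assms by (intro has_integral_powr_from_0) auto
  from has_integral_mult_right[OF this, of "a powr (- 1 / 2)"]
  have "((\<lambda>r. a powr (- 1 / 2) * r powr (- 1 / 2)) has_integral (a powr (- 1 / 2) * (2 * sqrt R))) {0..R}"
    using assms by (simp add: powr_half_sqrt mult.commute[of 2])
  moreover have "a powr (- 1 / 2) * (2 * sqrt R) = 2 * sqrt (R / a)"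
    using assms by (simp add: powr_minus_divide powr_half_sqrt real_sqrt_divide)
  ultimately have "((\<lambda>r. a powr (- 1 / 2) * r powr (- 1 / 2)) has_integral 2 * sqrt (R / a)) {0..R}" by (simp only:)
  then show ?thesis
    by (rule has_integral_eq[rotated]) (use assms in \<open>auto simp: powr_mult\<close>)
qed

lemma norm_integral_le_powr_minus_half:
  fixes f :: "real \<Rightarrow> complex"
  assumes "continuous_on {0..R} f" "a > 0" "R \<ge> 0" "C \<ge> 0"
    and "\<And>r. 0 < r \<Longrightarrow> r \<le> R \<Longrightarrow> norm (f r) \<le> C * (a * r) powr (- 1 / 2)"
  shows "norm (integral {0..R} f) \<le> 2 * C * sqrt (R / a)"
proof -
  \<comment> \<open>\<open>0 powr (- 1 / 2)\<close> is 0, so the majorant is raised at the single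
    point \<open>r = 0\<close> to dominate \<open>f\<close> on the closed interval.\<close>
  have hi: "((\<lambda>r. if r = 0 then norm (f 0) else C * (a * r) powr (- 1 / 2)) has_integral C * (2 * sqrt (R / a))) {0..R}"
    by (rule has_integral_spike[OF negligible_sing[of 0] _ has_integral_mult_right[OF has_integral_powr_minus_half[OF assms(2,3)], of C]]) auto
  have "norm (integral {0..R} f) \<le> integral {0..R} (\<lambda>r. if r = 0 then norm (f 0) else C * (a * r) powr (- 1 / 2))"
    using assms
    by (intro Henstock_Kurzweil_Integration.integral_norm_bound_integral has_integral_integrable[OF hi]
        integrable_continuous_interval[OF assms(1)]) auto
  also have "\<dots> = C * (2 * sqrt (R / a))" using hi by (rule integral_unique)
  finally show ?thesis by simp
qed

text \<open>An antiderivative of \<open>circ\<close> on \<open>[0, X]\<close> that decays like \<open>z\<^sup>-\<^sup>1\<^sup>/\<^sup>2\<close>, uniformly in \<open>X\<close>.\<close>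

definition circ_anti :: "real \<Rightarrow> real \<Rightarrow> real" where
  "circ_anti X z = - circ' z - integral {z..X} circ_sin"

lemma circ_anti_deriv:
  assumes "0 \<le> z" "z \<le> X"
  shows "(circ_anti X has_real_derivative circ z) (at z within {0..X})"
proof -
  have "((\<lambda>z. integral {z..X} circ_sin) has_real_derivative - circ_sin z) (at z within {0..X})"
    using assms by (intro integral_has_real_derivative' circ_sin_continuous) auto
  then have "(circ_anti X has_real_derivative - circ'' z - - circ_sin z) (at z within {0..X})"
    unfolding circ_anti_def[abs_def]
    by (intro DERIV_diff DERIV_minus has_field_derivative_at_within[OF circ'_deriv])
  moreover have "- circ'' z - - circ_sin z = circ z" using circ_add_circ''[of z] by simp
  ultimately show ?thesis by (simp only:)
qed

text \<open>Dividing \<open>circ'\<close> by \<open>z\<close> shows that \<open>circ_sin\<close> is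
  of size \<open>z^(-3/2)\<close>, so its integral from \<open>z\<close> to \<open>X\<close> is of
  size \<open>z^(-1/2)\<close> with a constant free of \<open>X\<close>. Near 0 that bound blows up,
  so the value at 0 is treated by splitting the integral at 1; the constant
  \<open>3 * C + 2 * pi\<close> covers all three claims.\<close>

lemma circ_anti_decay:
  obtains C where "C \<ge> 0" "\<And>X z. 0 < z \<Longrightarrow> z \<le> X \<Longrightarrow> \<bar>circ_anti X z\<bar> \<le> C * z powr (- 1 / 2)"
    "\<And>X. X \<ge> 0 \<Longrightarrow> \<bar>circ_anti X 0\<bar> \<le> C" "\<And>X. X \<ge> 0 \<Longrightarrow> \<bar>circ_anti X X\<bar> \<le> C"
proof -
  obtain C where C: "C \<ge> 0" "\<And>z. z > 0 \<Longrightarrow> \<bar>circ' z\<bar> \<le> C * z powr (- 1 / 2)" using circ_decay by metis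
  have tail: "\<bar>integral {z..X} circ_sin\<bar> \<le> 2 * C * z powr (- 1 / 2)" if z: "0 < z" "z \<le> X" for z X
  proof -
    have hi: "((\<lambda>s. C * s powr (- 3 / 2)) has_integral C * (- 2 * X powr (- 1 / 2) - - 2 * z powr (- 1 / 2))) {z..X}"
      using z by (intro has_integral_mult_right fundamental_theorem_of_calculus)
        (auto intro!: derivative_eq_intros simp: has_real_derivative_iff_has_vector_derivative[symmetric])
    have "\<bar>circ_sin s\<bar> \<le> C * s powr (- 3 / 2)" if s: "s \<in> {z..X}" for s
    proof -
      have s0: "s > 0" using s z by auto
      have "circ_sin s = - circ' s / s" using circ'_eq[of s] s0 by simp
      then have "\<bar>circ_sin s\<bar> = \<bar>circ' s\<bar> / s" using s0 by simp
      also have "\<dots> \<le> C * s powr (- 1 / 2) / s" using C(2)[OF s0] s0 by (intro divide_right_mono) auto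
      also have "\<dots> = C * s powr (- 3 / 2)" using s0 powr_add[of s "- 1 / 2" "- 1"] by (simp add: powr_minus_divide)
      finally show ?thesis .
    qed
    then have "norm (integral {z..X} circ_sin) \<le> integral {z..X} (\<lambda>s. C * s powr (- 3 / 2))"
      using hi
      by (intro Henstock_Kurzweil_Integration.integral_norm_bound_integral has_integral_integrable[OF hi]
          integrable_continuous_interval[OF circ_sin_continuous]) auto
    also have "\<dots> = C * (- 2 * X powr (- 1 / 2) - - 2 * z powr (- 1 / 2))" using hi by (rule integral_unique)
    also have "\<dots> \<le> 2 * C * z powr (- 1 / 2)" using C(1) by (simp add: algebra_simps)
    finally show ?thesis by simp
  qed
  show ?thesis
  proof (rule that[of "3 * C + 2 * pi"])
    show "3 * C + 2 * pi \<ge> 0" using C(1) by simp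
    fix X z :: real assume z: "0 < z" "z \<le> X"
    have "\<bar>circ_anti X z\<bar> \<le> C * z powr (- 1 / 2) + 2 * C * z powr (- 1 / 2)"
      unfolding circ_anti_def using C(2)[OF z(1)] tail[OF z] by linarith
    also have "\<dots> \<le> (3 * C + 2 * pi) * z powr (- 1 / 2)" by (simp add: algebra_simps)
    finally show "\<bar>circ_anti X z\<bar> \<le> (3 * C + 2 * pi) * z powr (- 1 / 2)" .
  next
    fix X :: real assume X: "X \<ge> 0"
    have small: "\<bar>integral {0..Y} circ_sin\<bar> \<le> pi" if "0 \<le> Y" "Y \<le> 1" for Y
    proof -
      have "norm (integral {0..Y} circ_sin) \<le> pi * (Y - 0)"
        using that circ_bounds(3) by (intro integral_bound circ_sin_continuous) auto
      also have "\<dots> \<le> pi" using that by (simp add: mult_left_le)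
      finally show ?thesis by simp
    qed
    have "\<bar>integral {0..X} circ_sin\<bar> \<le> pi + 2 * C"
    proof (cases "X \<le> 1")
      case True
      then show ?thesis using small[OF X True] C(1) by simp
    next
      case False
      then have "integral {0..X} circ_sin = integral {0..1} circ_sin + integral {1..X} circ_sin"
        by (intro Henstock_Kurzweil_Integration.integral_combine[symmetric] integrable_continuous_interval circ_sin_continuous) auto
      then show ?thesis using small[of 1] tail[of 1 X] False by simp
    qed
    then show "\<bar>circ_anti X 0\<bar> \<le> 3 * C + 2 * pi"
      unfolding circ_anti_def using circ_bounds(2)[of 0] C(1) by linarith
    show "\<bar>circ_anti X X\<bar> \<le> 3 * C + 2 * pi"
      unfolding circ_anti_def using circ_bounds(2)[of X] C(1) pi_ge_zero by simp
  qed
qed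

section \<open>The oscillatory integral for \<open>n = 3\<close>\<close>

text \<open>The identity is read in both directions: solved for the last integral, it integrates the
  exponential; as it stands, it integrates the Bessel factor, with \<open>f\<close> an
  antiderivative.\<close>

lemma integral_exp_by_parts:
  fixes f f' :: "real \<Rightarrow> real"
  assumes R: "R \<ge> 0" and f: "\<And>r. r \<in> {0..R} \<Longrightarrow> (f has_real_derivative f' r) (at r within {0..R})"
    and c: "continuous_on {0..R} f'"
  shows "integral {0..R} (\<lambda>r. exp (\<i> * of_real (k * r)) * of_real (f' r)) =
    exp (\<i> * of_real (k * R)) * of_real (f R) - of_real (f 0) -
    \<i> * of_real k * integral {0..R} (\<lambda>r. exp (\<i> * of_real (k * r)) * of_real (f r))"
proof -
  let ?e = "\<lambda>r. exp (\<i> * complex_of_real (k * r))"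
  have cf: "continuous_on {0..R} f" using f by (rule DERIV_continuous_on)
  have "((\<lambda>r. ?e r * of_real (f' r) + \<i> * of_real k * (?e r * of_real (f r))) has_integral
      (?e R * of_real (f R) - ?e 0 * of_real (f 0))) {0..R}"
  proof (rule fundamental_theorem_of_calculus[OF R])
    fix r assume r: "r \<in> {0..R}"
    have 1: "((\<lambda>r. complex_of_real (f r)) has_vector_derivative of_real (f' r)) (at r within {0..R})"
      using f[OF r] by (intro has_vector_derivative_of_real) (simp add: has_real_derivative_iff_has_vector_derivative)
    have 2: "(?e has_vector_derivative \<i> * of_real k * ?e r) (at r within {0..R})"
    proof -
      have "((\<lambda>z. exp (\<i> * (of_real k * z))) has_field_derivative \<i> * of_real k * exp (\<i> * (of_real k * of_real r))) (at (of_real r))"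
        by (auto intro!: derivative_eq_intros)
      from has_vector_derivative_real_field[OF this] show ?thesis by simp
    qed
    have "((\<lambda>r. ?e r * of_real (f r)) has_vector_derivative ?e r * of_real (f' r) + \<i> * of_real k * ?e r * of_real (f r)) (at r within {0..R})"
      by (rule has_vector_derivative_mult[OF 2 1])
    then show "((\<lambda>r. ?e r * of_real (f r)) has_vector_derivative ?e r * of_real (f' r) + \<i> * of_real k * (?e r * of_real (f r))) (at r within {0..R})"
      by (simp add: mult.assoc)
  qed
  then have "integral {0..R} (\<lambda>r. ?e r * of_real (f' r) + \<i> * of_real k * (?e r * of_real (f r))) = ?e R * of_real (f R) - of_real (f 0)"
    by (simp add: integral_unique)
  moreover have "integral {0..R} (\<lambda>r. ?e r * of_real (f' r) + \<i> * of_real k * (?e r * of_real (f r))) =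
     integral {0..R} (\<lambda>r. ?e r * of_real (f' r)) + \<i> * of_real k * integral {0..R} (\<lambda>r. ?e r * of_real (f r))"
    unfolding integral_mult_right[symmetric]
    by (intro integral_add integrable_continuous_interval continuous_intros c cf)
  ultimately show ?thesis by (simp add: algebra_simps)
qed

lemma inverse_max_le:
  fixes k \<rho> :: real
  assumes k: "k > 0" and \<rho>: "\<rho> \<ge> 0"
  shows "1 / max k \<rho> \<le> 2 * (k\<^sup>2 + \<rho>\<^sup>2) powr (- 1 / 2)"
proof -
  let ?m = "max k \<rho>"
  have m: "?m > 0" using k by simp
  have p: "k\<^sup>2 + \<rho>\<^sup>2 > 0" using k by (simp add: add_pos_nonneg)
  have "k\<^sup>2 \<le> ?m\<^sup>2" "\<rho>\<^sup>2 \<le> ?m\<^sup>2" using k \<rho> by (auto intro!: power_mono)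
  moreover have "(2 * ?m)\<^sup>2 = 4 * ?m\<^sup>2" by (simp add: power_mult_distrib)
  ultimately have "k\<^sup>2 + \<rho>\<^sup>2 \<le> (2 * ?m)\<^sup>2" using zero_le_power2[of ?m] by linarith
  then have "sqrt (k\<^sup>2 + \<rho>\<^sup>2) \<le> sqrt ((2 * ?m)\<^sup>2)" by (rule real_sqrt_le_mono)
  also have "\<dots> = 2 * ?m" unfolding real_sqrt_abs using m by simp
  finally have "sqrt (k\<^sup>2 + \<rho>\<^sup>2) \<le> 2 * ?m" .
  moreover have "sqrt (k\<^sup>2 + \<rho>\<^sup>2) > 0" using p by simp
  ultimately have "1 / ?m \<le> 2 * (1 / sqrt (k\<^sup>2 + \<rho>\<^sup>2))" using m by (simp add: divide_simps)
  also have "1 / sqrt (k\<^sup>2 + \<rho>\<^sup>2) = (k\<^sup>2 + \<rho>\<^sup>2) powr (- 1 / 2)"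
    using p by (simp add: powr_minus_divide powr_half_sqrt)
  finally show ?thesis .
qed

text \<open>For \<open>\<rho> \<le> k\<close> the remainder involves
  \<open>\<rho> * circ' (\<rho> * r)\<close>, whose integral is of size
  \<open>sqrt (\<rho> * R)\<close>; for \<open>\<rho> > k\<close> it is \<open>k / \<rho>\<close>
  times an integral of size \<open>sqrt (R / \<rho>)\<close>. Both are at most a multiple of
  \<open>sqrt (k * R)\<close>, after which \<open>inverse_max_le\<close> replaces
  \<open>1 / max k \<rho>\<close> by the weight.\<close>

theorem oscillatory_integral_bound:
  obtains C where "C \<ge> 0"
    "\<And>k \<rho> R. k > 0 \<Longrightarrow> \<rho> \<ge> 0 \<Longrightarrow> R > 0 \<Longrightarrow>
      norm (integral {0..R} (\<lambda>r. exp (\<i> * of_real (k * r)) * of_real (circ (\<rho> * r)))) \<le>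
      C * (1 + sqrt (k * R)) * (k\<^sup>2 + \<rho>\<^sup>2) powr (- 1 / 2)"
proof -
  obtain C where C: "C \<ge> 0" "\<And>z. z > 0 \<Longrightarrow> \<bar>circ' z\<bar> \<le> C * z powr (- 1 / 2)" using circ_decay by metis
  obtain D where D: "D \<ge> 0" "\<And>X z. 0 < z \<Longrightarrow> z \<le> X \<Longrightarrow> \<bar>circ_anti X z\<bar> \<le> D * z powr (- 1 / 2)"
    "\<And>X. X \<ge> 0 \<Longrightarrow> \<bar>circ_anti X 0\<bar> \<le> D" "\<And>X. X \<ge> 0 \<Longrightarrow> \<bar>circ_anti X X\<bar> \<le> D" using circ_anti_decay by metis
  \<comment> \<open>The terms in \<open>pi\<close> and \<open>C\<close> belong to the case
    \<open>\<rho> \<le> k\<close>, the term in \<open>D\<close> to the other.\<close>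
  let ?M = "2 * pi + 2 * C + 2 * D"
  have cont: "continuous_on A circ" "continuous_on A circ'" for A
    using circ_deriv circ'_deriv by (meson DERIV_isCont continuous_at_imp_continuous_on)+
  show ?thesis
  proof (rule that[of "2 * ?M"])
    show "2 * ?M \<ge> 0" using C(1) D(1) by simp
    fix k \<rho> R :: real assume k: "k > 0" and \<rho>: "\<rho> \<ge> 0" and R: "R > 0"
    let ?e = "\<lambda>r. exp (\<i> * complex_of_real (k * r))"
    let ?I = "integral {0..R} (\<lambda>r. ?e r * of_real (circ (\<rho> * r)))"
    let ?m = "max k \<rho>"
    have main: "norm ?I \<le> ?M * (1 + sqrt (k * R)) / ?m"
    proof (cases "\<rho> \<le> k")
      case True
      have "integral {0..R} (\<lambda>r. ?e r * of_real (\<rho> * circ' (\<rho> * r))) =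
        ?e R * of_real (circ (\<rho> * R)) - of_real (circ (\<rho> * 0)) - \<i> * of_real k * ?I"
      proof (rule integral_exp_by_parts)
        show "((\<lambda>r. circ (\<rho> * r)) has_real_derivative \<rho> * circ' (\<rho> * r)) (at r within {0..R})" for r
        proof (rule has_field_derivative_at_within)
          have "((\<lambda>r. circ (\<rho> * r)) has_real_derivative circ' (\<rho> * r) * \<rho>) (at r)"
            by (rule DERIV_chain2[OF circ_deriv]) (auto intro!: derivative_eq_intros)
          then show "((\<lambda>r. circ (\<rho> * r)) has_real_derivative \<rho> * circ' (\<rho> * r)) (at r)"
            by (simp add: mult.commute)
        qed
        show "continuous_on {0..R} (\<lambda>r. \<rho> * circ' (\<rho> * r))"
          by (intro continuous_intros continuous_on_compose2[OF cont(2)[of UNIV]]) auto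
      qed (use R in simp)
      then have eq0: "\<i> * of_real k * ?I = ?e R * of_real (circ (\<rho> * R)) - of_real (circ (\<rho> * 0)) -
         integral {0..R} (\<lambda>r. ?e r * of_real (\<rho> * circ' (\<rho> * r)))" by (simp add: algebra_simps)
      have "k * norm ?I = norm (?e R * of_real (circ (\<rho> * R)) - of_real (circ (\<rho> * 0)) -
         integral {0..R} (\<lambda>r. ?e r * of_real (\<rho> * circ' (\<rho> * r))))" unfolding eq0[symmetric] using k by (simp add: norm_mult)
      also have "\<dots> \<le> norm (?e R * of_real (circ (\<rho> * R))) + norm (complex_of_real (circ (\<rho> * 0))) +
         norm (integral {0..R} (\<lambda>r. ?e r * of_real (\<rho> * circ' (\<rho> * r))))"
        by (rule order_trans[OF norm_triangle_ineq4 add_right_mono[OF norm_triangle_ineq4]])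
      also have "\<dots> \<le> pi + pi + 2 * C * sqrt (k * R)"
      proof (intro add_mono)
        show "norm (?e R * of_real (circ (\<rho> * R))) \<le> pi" "norm (complex_of_real (circ (\<rho> * 0))) \<le> pi"
          using circ_bounds(1) by (simp_all add: norm_mult del: of_real_mult)
        show "norm (integral {0..R} (\<lambda>r. ?e r * of_real (\<rho> * circ' (\<rho> * r)))) \<le> 2 * C * sqrt (k * R)"
        \<comment> \<open>The decay estimate is applied with frequency \<rho> and divides by it; for
          \<open>\<rho> = 0\<close> the integrand vanishes.\<close>
        proof (cases "\<rho> = 0")
          case True
          then show ?thesis using C(1) k R by simp
        next
          case False
          then have \<rho>0: "\<rho> > 0" using \<rho> by simp
          have "norm (integral {0..R} (\<lambda>r. ?e r * of_real (\<rho> * circ' (\<rho> * r)))) \<le> 2 * (\<rho> * C) * sqrt (R / \<rho>)"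
          proof (rule norm_integral_le_powr_minus_half[OF _ \<rho>0])
            show "continuous_on {0..R} (\<lambda>r. ?e r * of_real (\<rho> * circ' (\<rho> * r)))"
              by (intro continuous_intros continuous_on_compose2[OF cont(2)[of UNIV]]) auto
            show "norm (?e r * of_real (\<rho> * circ' (\<rho> * r))) \<le> \<rho> * C * (\<rho> * r) powr (- 1 / 2)" if "0 < r" for r
              using C(2)[of "\<rho> * r"] that \<rho>0 by (simp add: norm_mult abs_mult mult_left_mono mult.assoc del: of_real_mult)
          qed (use R C(1) \<rho> in auto)
          also have "2 * (\<rho> * C) * sqrt (R / \<rho>) = 2 * C * (sqrt \<rho> * sqrt \<rho> * sqrt (R / \<rho>))"
            using \<rho> by simp
          also have "sqrt \<rho> * sqrt \<rho> * sqrt (R / \<rho>) = sqrt (\<rho> * R)"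
            unfolding real_sqrt_mult[symmetric] using \<rho>0 by (simp add: real_sqrt_mult)
          also have "2 * C * sqrt (\<rho> * R) \<le> 2 * C * sqrt (k * R)"
            using C(1) True R by (intro mult_left_mono real_sqrt_le_mono mult_right_mono) auto
          finally show ?thesis .
        qed
      qed
      also have "\<dots> \<le> ?M * (1 + sqrt (k * R))"
        using C(1) D(1) k R by (simp add: algebra_simps add_increasing2)
      finally show ?thesis using k True by (simp add: pos_le_divide_eq max_def mult.commute)
    next
      case False
      then have \<rho>0: "\<rho> > 0" using k by simp
      \<comment> \<open>Anchoring the antiderivative at \<open>X = \<rho> * R\<close> makes its
        decay bound available on the whole range of integration and bounded at both ends.\<close>
      let ?f = "\<lambda>r. circ_anti (\<rho> * R) (\<rho> * r) / \<rho>"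
      have fd: "(?f has_real_derivative circ (\<rho> * r)) (at r within {0..R})" if r: "r \<in> {0..R}" for r
      proof -
        have "(circ_anti (\<rho> * R) has_real_derivative circ (\<rho> * r)) (at (\<rho> * r) within (\<lambda>r. \<rho> * r) ` {0..R})"
          by (rule has_field_derivative_subset[OF circ_anti_deriv[of "\<rho> * r" "\<rho> * R"]]) (use r \<rho>0 in auto)
        moreover have "((\<lambda>r. \<rho> * r) has_real_derivative \<rho>) (at r within {0..R})"
          by (auto intro!: derivative_eq_intros)
        ultimately have "((\<lambda>r. circ_anti (\<rho> * R) (\<rho> * r)) has_real_derivative circ (\<rho> * r) * \<rho>) (at r within {0..R})"
          by (rule DERIV_image_chain[unfolded comp_def])
        from DERIV_cdivide[OF this, of \<rho>] show ?thesis using \<rho>0 by simp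
      qed
      have eq: "?I = ?e R * of_real (?f R) - of_real (?f 0) - \<i> * of_real k * integral {0..R} (\<lambda>r. ?e r * of_real (?f r))"
        using R by (intro integral_exp_by_parts fd continuous_on_compose2[OF cont(1)[of UNIV]] continuous_intros) auto
      have cf: "continuous_on {0..R} ?f" using fd by (rule DERIV_continuous_on)
      have i: "norm (integral {0..R} (\<lambda>r. ?e r * of_real (?f r))) \<le> 2 * (D / \<rho>) * sqrt (R / \<rho>)"
      proof (rule norm_integral_le_powr_minus_half[OF _ \<rho>0])
        show "continuous_on {0..R} (\<lambda>r. ?e r * of_real (?f r))" by (intro continuous_intros cf)
        show "norm (?e r * of_real (?f r)) \<le> D / \<rho> * (\<rho> * r) powr (- 1 / 2)" if "0 < r" "r \<le> R" for r
          using D(2)[of "\<rho> * r" "\<rho> * R"] that \<rho>0 by (simp add: norm_mult divide_right_mono del: of_real_mult of_real_divide)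
      qed (use R D(1) \<rho>0 in auto)
      have "norm ?I \<le> norm (?e R * of_real (?f R)) + norm (complex_of_real (?f 0)) + norm (\<i> * of_real k * integral {0..R} (\<lambda>r. ?e r * of_real (?f r)))"
        unfolding eq by (rule order_trans[OF norm_triangle_ineq4 add_right_mono[OF norm_triangle_ineq4]])
      also have "\<dots> \<le> D / \<rho> + D / \<rho> + k * (2 * (D / \<rho>) * sqrt (R / \<rho>))"
      proof (intro add_mono)
        show "norm (?e R * of_real (?f R)) \<le> D / \<rho>" "norm (complex_of_real (?f 0)) \<le> D / \<rho>"
          using D(3,4)[of "\<rho> * R"] R \<rho>0 by (simp_all add: norm_mult divide_right_mono del: of_real_mult of_real_divide)
        show "norm (\<i> * of_real k * integral {0..R} (\<lambda>r. ?e r * of_real (?f r))) \<le> k * (2 * (D / \<rho>) * sqrt (R / \<rho>))"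
          using mult_left_mono[OF i, of k] k by (simp add: norm_mult del: of_real_divide)
      qed
      also have "\<dots> = (2 * D + 2 * D * (k * sqrt (R / \<rho>))) / \<rho>" using \<rho>0 by (simp add: field_simps)
      also have "\<dots> \<le> (2 * D + 2 * D * sqrt (k * R)) / \<rho>"
      proof (intro divide_right_mono add_left_mono mult_left_mono)
        have "k * sqrt (R / \<rho>) = sqrt (k * k * (R / \<rho>))" unfolding real_sqrt_mult[of "k * k"] using k by simp
        also have "\<dots> \<le> sqrt (k * R)"
        proof (rule real_sqrt_le_mono)
          have h: "k * (R / \<rho>) \<le> R" using False R \<rho>0 by (simp add: divide_le_eq mult_right_mono)
          show "k * k * (R / \<rho>) \<le> k * R"
            unfolding mult.assoc[of k k] by (intro mult_left_mono h less_imp_le k)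
        qed
        finally show "k * sqrt (R / \<rho>) \<le> sqrt (k * R)" .
      qed (use D(1) \<rho>0 in auto)
      also have "\<dots> \<le> ?M * (1 + sqrt (k * R)) / \<rho>"
      proof (rule divide_right_mono)
        have "2 * D * (1 + sqrt (k * R)) \<le> ?M * (1 + sqrt (k * R))"
          using C(1) k R by (intro mult_right_mono) auto
        then show "2 * D + 2 * D * sqrt (k * R) \<le> ?M * (1 + sqrt (k * R))" by (simp add: distrib_left)
      qed (use \<rho>0 in simp)
      finally show ?thesis using False by (simp add: max_def)
    qed
    note inverse_max_le[OF k \<rho>]
    moreover have "0 \<le> ?M * (1 + sqrt (k * R))"
      using C(1) D(1) k R by (intro mult_nonneg_nonneg) auto
    ultimately have "?M * (1 + sqrt (k * R)) * (1 / ?m) \<le> ?M * (1 + sqrt (k * R)) * (2 * (k\<^sup>2 + \<rho>\<^sup>2) powr (- 1 / 2))"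
      by (rule mult_left_mono)
    moreover have "a * b * (1 / c) = a * b / c" "a * b * (2 * c) = 2 * a * b * c" for a b c :: real
      by simp_all
    ultimately have "?M * (1 + sqrt (k * R)) / ?m \<le> 2 * ?M * (1 + sqrt (k * R)) * (k\<^sup>2 + \<rho>\<^sup>2) powr (- 1 / 2)"
      by (simp only:)
    with main show "norm ?I \<le> 2 * ?M * (1 + sqrt (k * R)) * (k\<^sup>2 + \<rho>\<^sup>2) powr (- 1 / 2)" by linarith
  qed
qed

section \<open>Polar coordinates in the plane\<close>

text \<open>On the compact intervals between \<open>- arctan n\<close> and \<open>arctan n\<close>
  the substitution rule applies, and monotone convergence exhausts both the line and the open half
  circle.\<close>

lemma nn_integral_tan_substitution:
  fixes h :: "real \<Rightarrow> ennreal"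
  assumes [measurable]: "h \<in> borel_measurable borel"
  shows "(\<integral>\<^sup>+t. h t \<partial>lborel) =
    (\<integral>\<^sup>+\<theta>. h (tan \<theta>) * ennreal (1 / (cos \<theta>)\<^sup>2) * indicator {- (pi / 2)<..<pi / 2} \<theta> \<partial>lborel)"
proof (rule LIMSEQ_unique)
  let ?a = "\<lambda>n. arctan (real (Suc n))"
  have a: "0 < ?a n" "?a n < pi / 2" for n using arctan_ubound by auto
  let ?g = "\<lambda>\<theta>. h (tan \<theta>) * ennreal (1 / (cos \<theta>)\<^sup>2)"
  have tm[measurable]: "(tan :: real \<Rightarrow> real) \<in> borel_measurable borel" unfolding tan_def by measurable
  have eq: "(\<integral>\<^sup>+t. h t * indicator {- real (Suc n)..real (Suc n)} t \<partial>lborel) =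
      (\<integral>\<^sup>+\<theta>. ?g \<theta> * indicator {- ?a n..?a n} \<theta> \<partial>lborel)" for n
  proof -
    have "(\<integral>\<^sup>+t. h t * indicator {tan (- ?a n)..tan (?a n)} t \<partial>lborel) =
      (\<integral>\<^sup>+\<theta>. h (tan \<theta>) * ennreal (inverse ((cos \<theta>)\<^sup>2)) * indicator {- ?a n..?a n} \<theta> \<partial>lborel)"
    proof (rule nn_integral_substitution_aux)
      fix x assume "x \<in> {- ?a n..?a n}"
      then have "- (pi / 2) < x" "x < pi / 2" using a[of n] by auto
      then have "cos x \<noteq> 0" using cos_gt_zero_pi[of x] by auto
      then show "(tan has_real_derivative inverse ((cos x)\<^sup>2)) (at x)" by (rule DERIV_tan)
    next
      show "continuous_on {- ?a n..?a n} (\<lambda>x. inverse ((cos x)\<^sup>2))"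
      proof (intro continuous_intros ballI)
        fix x assume "x \<in> {- ?a n..?a n}"
        then have "- (pi / 2) < x" "x < pi / 2" using a[of n] by auto
        then show "(cos x)\<^sup>2 \<noteq> 0" using cos_gt_zero_pi[of x] by auto
      qed
      show "- ?a n < ?a n" using a[of n] by simp
    qed auto
    then show ?thesis by (simp add: tan_arctan inverse_eq_divide)
  qed
  have incr: "incseq (\<lambda>n x. f x * indicator (A n) x)" if "\<And>m n. m \<le> n \<Longrightarrow> A m \<subseteq> A n" for f :: "real \<Rightarrow> ennreal" and A :: "nat \<Rightarrow> real set"
    using that by (fastforce simp: incseq_def le_fun_def split: split_indicator)
  have lim: "(\<lambda>n. f x * indicator (A n) x) \<longlonglongrightarrow> f x * indicator B x"
    if "\<forall>\<^sub>F n in sequentially. x \<in> A n \<longleftrightarrow> x \<in> B" for f :: "real \<Rightarrow> ennreal" and A B x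
    by (rule tendsto_eventually) (use that in \<open>eventually_elim, simp add: indicator_def\<close>)
  show "(\<lambda>n. \<integral>\<^sup>+t. h t * indicator {- real (Suc n)..real (Suc n)} t \<partial>lborel) \<longlonglongrightarrow> (\<integral>\<^sup>+t. h t \<partial>lborel)"
  proof (rule nn_integral_LIMSEQ)
    fix x :: real
    have "\<forall>\<^sub>F n in sequentially. x \<in> {- real (Suc n)..real (Suc n)} \<longleftrightarrow> x \<in> UNIV"
      using eventually_ge_at_top[of "nat \<lceil>\<bar>x\<bar>\<rceil>"] by eventually_elim (auto simp: nat_le_iff ceiling_le_iff abs_le_iff)
    from lim[OF this, of h] show "(\<lambda>n. h x * indicator {- real (Suc n)..real (Suc n)} x) \<longlonglongrightarrow> h x" by simp
  qed (auto intro!: incr)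
  have "(\<lambda>n. \<integral>\<^sup>+\<theta>. ?g \<theta> * indicator {- ?a n..?a n} \<theta> \<partial>lborel) \<longlonglongrightarrow> (\<integral>\<^sup>+\<theta>. ?g \<theta> * indicator {- (pi / 2)<..<pi / 2} \<theta> \<partial>lborel)"
  proof (rule nn_integral_LIMSEQ)
    fix x :: real
    have "\<forall>\<^sub>F n in sequentially. x \<in> {- ?a n..?a n} \<longleftrightarrow> x \<in> {- (pi / 2)<..<pi / 2}"
    proof (cases "x \<in> {- (pi / 2)<..<pi / 2}")
      case True
      show ?thesis using eventually_ge_at_top[of "nat \<lceil>\<bar>tan x\<bar>\<rceil>"]
      proof eventually_elim
        case (elim n)
        then have "\<bar>tan x\<bar> \<le> real (Suc n)" by (simp add: nat_le_iff ceiling_le_iff)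
        then have "arctan (tan x) \<le> ?a n" "- ?a n \<le> arctan (tan x)"
          unfolding arctan_minus[symmetric] by (auto simp: arctan_le_iff abs_le_iff)
        then show ?case using True by (simp add: arctan_tan)
      qed
    next
      case False
      have "x \<in> {- ?a n..?a n} \<longleftrightarrow> x \<in> {- (pi / 2)<..<pi / 2}" for n using False a[of n] by auto
      then show ?thesis by (intro always_eventually allI)
    qed
    then show "(\<lambda>n. ?g x * indicator {- ?a n..?a n} x) \<longlonglongrightarrow> ?g x * indicator {- (pi / 2)<..<pi / 2} x" by (rule lim)
  next
    show "incseq (\<lambda>n x. ?g x * indicator {- ?a n..?a n} x)"
      by (rule incr) (auto simp: arctan_le_iff intro: order_trans)
  qed measurable
  then show "(\<lambda>n. \<integral>\<^sup>+t. h t * indicator {- real (Suc n)..real (Suc n)} t \<partial>lborel) \<longlonglongrightarrow>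
     (\<integral>\<^sup>+\<theta>. ?g \<theta> * indicator {- (pi / 2)<..<pi / 2} \<theta> \<partial>lborel)"
    unfolding eq .
qed

text \<open>The radius runs over all of \<open>\<real>\<close> and the angle over a half circle, so that the substitutions
  \<open>y = x t\<close>, \<open>t = tan \<theta>\<close>, \<open>x = r cos \<theta>\<close> are all one-dimensional.\<close>

lemma nn_integral_polar_real2:
  fixes f :: "real \<times> real \<Rightarrow> ennreal"
  assumes f[measurable]: "f \<in> borel_measurable (lborel \<Otimes>\<^sub>M lborel)"
  shows "(\<integral>\<^sup>+p. f p \<partial>(lborel \<Otimes>\<^sub>M lborel)) =
    (\<integral>\<^sup>+\<theta>. (\<integral>\<^sup>+r. indicator {- (pi / 2)<..<pi / 2} \<theta> * ennreal \<bar>r\<bar> * f (r * cos \<theta>, r * sin \<theta>) \<partial>lborel) \<partial>lborel)"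
proof -
  let ?h = "\<lambda>t. \<integral>\<^sup>+x. ennreal \<bar>x\<bar> * f (x, x * t) \<partial>lborel"
  have hm[measurable]: "?h \<in> borel_measurable borel" by measurable
  have "(\<integral>\<^sup>+p. f p \<partial>(lborel \<Otimes>\<^sub>M lborel)) = (\<integral>\<^sup>+x. (\<integral>\<^sup>+y. f (x, y) \<partial>lborel) \<partial>lborel)"
    by (rule lborel.nn_integral_fst[symmetric, OF f])
  also have "\<dots> = (\<integral>\<^sup>+x. (\<integral>\<^sup>+t. ennreal \<bar>x\<bar> * f (x, x * t) \<partial>lborel) \<partial>lborel)"
  proof (rule nn_integral_cong_AE)
    \<comment> \<open>The substitution \<open>y = x * t\<close> degenerates only at
      \<open>x = 0\<close>, a null set.\<close>
    show "AE x in lborel. (\<integral>\<^sup>+y. f (x, y) \<partial>lborel) = (\<integral>\<^sup>+t. ennreal \<bar>x\<bar> * f (x, x * t) \<partial>lborel)"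
      using AE_lborel_singleton[of "0::real"]
    proof eventually_elim
      case (elim x)
      have "(\<integral>\<^sup>+y. f (x, y) \<partial>lborel) = ennreal \<bar>x\<bar> * (\<integral>\<^sup>+t. f (x, 0 + x * t) \<partial>lborel)"
        by (rule nn_integral_real_affine[OF _ elim]) measurable
      then show ?case by (simp add: nn_integral_cmult)
    qed
  qed
  also have "\<dots> = (\<integral>\<^sup>+t. ?h t \<partial>lborel)"
    by (rule lborel_pair.Fubini') measurable
  also have "\<dots> = (\<integral>\<^sup>+\<theta>. ?h (tan \<theta>) * ennreal (1 / (cos \<theta>)\<^sup>2) * indicator {- (pi / 2)<..<pi / 2} \<theta> \<partial>lborel)"
    by (rule nn_integral_tan_substitution[OF hm])
  also have "\<dots> = (\<integral>\<^sup>+\<theta>. (\<integral>\<^sup>+r. indicator {- (pi / 2)<..<pi / 2} \<theta> * ennreal \<bar>r\<bar> * f (r * cos \<theta>, r * sin \<theta>) \<partial>lborel) \<partial>lborel)"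
  proof (rule nn_integral_cong)
    fix \<theta> :: real
    show "?h (tan \<theta>) * ennreal (1 / (cos \<theta>)\<^sup>2) * indicator {- (pi / 2)<..<pi / 2} \<theta> =
        (\<integral>\<^sup>+r. indicator {- (pi / 2)<..<pi / 2} \<theta> * ennreal \<bar>r\<bar> * f (r * cos \<theta>, r * sin \<theta>) \<partial>lborel)"
    proof (cases "\<theta> \<in> {- (pi / 2)<..<pi / 2}")
      case True
      then have c: "cos \<theta> > 0" using cos_gt_zero_pi[of \<theta>] by auto
      have "?h (tan \<theta>) = ennreal \<bar>cos \<theta>\<bar> * (\<integral>\<^sup>+r. ennreal \<bar>0 + cos \<theta> * r\<bar> * f (0 + cos \<theta> * r, (0 + cos \<theta> * r) * tan \<theta>) \<partial>lborel)"
        by (rule nn_integral_real_affine, measurable) (use c in simp)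
      also have "(\<lambda>r. ennreal \<bar>0 + cos \<theta> * r\<bar> * f (0 + cos \<theta> * r, (0 + cos \<theta> * r) * tan \<theta>)) =
          (\<lambda>r. ennreal (cos \<theta>) * (ennreal \<bar>r\<bar> * f (r * cos \<theta>, r * sin \<theta>)))"
        using c by (auto simp: fun_eq_iff abs_mult ennreal_mult tan_def mult_ac)
      also have "(\<integral>\<^sup>+r. ennreal (cos \<theta>) * (ennreal \<bar>r\<bar> * f (r * cos \<theta>, r * sin \<theta>)) \<partial>lborel) =
          ennreal (cos \<theta>) * (\<integral>\<^sup>+r. ennreal \<bar>r\<bar> * f (r * cos \<theta>, r * sin \<theta>) \<partial>lborel)"
        by (rule nn_integral_cmult) measurable
      finally have h: "?h (tan \<theta>) = ennreal (cos \<theta>) * (ennreal (cos \<theta>) * (\<integral>\<^sup>+r. ennreal \<bar>r\<bar> * f (r * cos \<theta>, r * sin \<theta>) \<partial>lborel))"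
        using c by simp
      \<comment> \<open>One cosine comes from \<open>|x| = cos \<theta> * |r|\<close>, one from
        \<open>dx = cos \<theta> dr\<close>; together they cancel the derivative of the tangent and
        leave the Jacobian \<open>|r|\<close>.\<close>
      have "ennreal (cos \<theta>) * ennreal (cos \<theta>) * ennreal (1 / (cos \<theta>)\<^sup>2) = 1"
        using c by (simp add: ennreal_mult[symmetric] power2_eq_square)
      then have "?h (tan \<theta>) * ennreal (1 / (cos \<theta>)\<^sup>2) = (\<integral>\<^sup>+r. ennreal \<bar>r\<bar> * f (r * cos \<theta>, r * sin \<theta>) \<partial>lborel)"
        unfolding h by (metis (no_types, lifting) mult.assoc mult.commute mult.left_neutral)
      then show ?thesis using True by simp
    qed simp
  qed
  finally show ?thesis .
qed

section \<open>Planar Lebesgue measure as an image measure in polar coordinates\<close>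

lemma lborel_eq_distr_plane:
  assumes B: "(Basis :: 'a::euclidean_space set) = {b1, b2}" "b1 \<noteq> b2"
  shows "(lborel :: 'a measure) = distr (lborel \<Otimes>\<^sub>M lborel) borel (\<lambda>(x, y). x *\<^sub>R b1 + y *\<^sub>R b2)"
proof (rule lborel_eqI)
  let ?T = "\<lambda>(x, y). x *\<^sub>R b1 + y *\<^sub>R b2"
  fix l u :: 'a assume le: "\<And>b. b \<in> Basis \<Longrightarrow> l \<bullet> b \<le> u \<bullet> b"
  have bb: "b1 \<in> Basis" "b2 \<in> Basis" using B by auto
  have o: "b1 \<bullet> b1 = 1" "b2 \<bullet> b2 = 1" "b1 \<bullet> b2 = 0" "b2 \<bullet> b1 = 0"
    using inner_Basis[OF bb(1) bb(1)] inner_Basis[OF bb(2) bb(2)] inner_Basis[OF bb(1) bb(2)] inner_Basis[OF bb(2) bb(1)] B(2) by auto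
  have pre: "?T -` box l u \<inter> space (lborel \<Otimes>\<^sub>M lborel) = box (l \<bullet> b1) (u \<bullet> b1) \<times> box (l \<bullet> b2) (u \<bullet> b2)"
  proof (intro set_eqI)
    fix p :: "real \<times> real"
    have "?T p \<bullet> b1 = fst p" "?T p \<bullet> b2 = snd p"
      unfolding split_beta inner_add_left inner_scaleR_left o by simp_all
    then show "p \<in> ?T -` box l u \<inter> space (lborel \<Otimes>\<^sub>M lborel) \<longleftrightarrow> p \<in> box (l \<bullet> b1) (u \<bullet> b1) \<times> box (l \<bullet> b2) (u \<bullet> b2)"
      unfolding box_def[of l u] vimage_def B(1) space_pair_measure mem_Times_iff by simp
  qed
  have "emeasure (distr (lborel \<Otimes>\<^sub>M lborel) borel ?T) (box l u) =
      emeasure (lborel \<Otimes>\<^sub>M lborel) (box (l \<bullet> b1) (u \<bullet> b1) \<times> box (l \<bullet> b2) (u \<bullet> b2))"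
    by (subst emeasure_distr) (measurable, simp only: pre)
  also have "\<dots> = emeasure lborel (box (l \<bullet> b1) (u \<bullet> b1)) * emeasure lborel (box (l \<bullet> b2) (u \<bullet> b2))"
    by (rule lborel.emeasure_pair_measure_Times) auto
  also have "\<dots> = ennreal ((u - l) \<bullet> b1) * ennreal ((u - l) \<bullet> b2)"
    using le[OF bb(1)] le[OF bb(2)] by (simp add: inner_diff_left)
  also have "\<dots> = (\<Prod>b\<in>Basis. (u - l) \<bullet> b)"
    unfolding B(1) using le[OF bb(1)] le[OF bb(2)] B(2) by (simp add: ennreal_mult inner_diff_left)
  finally show "emeasure (distr (lborel \<Otimes>\<^sub>M lborel) borel ?T) (box l u) = (\<Prod>b\<in>Basis. (u - l) \<bullet> b)" .
qed simp

definition polar_density :: "real \<times> real \<Rightarrow> real" where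
  "polar_density = (\<lambda>(\<theta>, r). indicator {- (pi / 2)<..<pi / 2} \<theta> * \<bar>r\<bar>)"

definition polar :: "'a::real_vector \<Rightarrow> 'a \<Rightarrow> real \<times> real \<Rightarrow> 'a" where
  "polar b1 b2 = (\<lambda>(\<theta>, r). (r * cos \<theta>) *\<^sub>R b1 + (r * sin \<theta>) *\<^sub>R b2)"

lemma polar_measurable [measurable]:
  "polar_density \<in> borel_measurable (lborel \<Otimes>\<^sub>M lborel)"
  "polar b1 (b2 :: 'a::euclidean_space) \<in> borel_measurable (lborel \<Otimes>\<^sub>M lborel)"
  unfolding polar_density_def polar_def by measurable

lemma lborel_eq_distr_polar:
  assumes B: "(Basis :: 'a::euclidean_space set) = {b1, b2}" "b1 \<noteq> b2"
  shows "(lborel :: 'a measure) =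
    distr (density (lborel \<Otimes>\<^sub>M lborel) (\<lambda>p. ennreal (polar_density p))) borel (polar b1 b2)"
proof (rule measure_eqI)
  fix A :: "'a set" assume "A \<in> sets lborel"
  then have A[measurable]: "A \<in> sets borel" by simp
  let ?T = "\<lambda>(x, y). x *\<^sub>R b1 + y *\<^sub>R b2"
  have "emeasure lborel A = (\<integral>\<^sup>+x. indicator A x \<partial>lborel)" by simp
  also have "\<dots> = (\<integral>\<^sup>+p. indicator A (?T p) \<partial>(lborel \<Otimes>\<^sub>M lborel))"
    by (subst lborel_eq_distr_plane[OF B], subst nn_integral_distr) measurable
  also have "\<dots> = (\<integral>\<^sup>+\<theta>. (\<integral>\<^sup>+r. indicator {- (pi / 2)<..<pi / 2} \<theta> * ennreal \<bar>r\<bar> * indicator A (?T (r * cos \<theta>, r * sin \<theta>)) \<partial>lborel) \<partial>lborel)"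
    by (rule nn_integral_polar_real2) measurable
  also have "\<dots> = (\<integral>\<^sup>+\<theta>. (\<integral>\<^sup>+r. ennreal (polar_density (\<theta>, r)) * indicator A (polar b1 b2 (\<theta>, r)) \<partial>lborel) \<partial>lborel)"
    by (intro nn_integral_cong) (simp add: polar_density_def polar_def split: split_indicator)
  also have "\<dots> = (\<integral>\<^sup>+p. ennreal (polar_density p) * indicator A (polar b1 b2 p) \<partial>(lborel \<Otimes>\<^sub>M lborel))"
    by (rule lborel.nn_integral_fst) measurable
  also have "\<dots> = (\<integral>\<^sup>+p. indicator A (polar b1 b2 p) \<partial>density (lborel \<Otimes>\<^sub>M lborel) (\<lambda>p. ennreal (polar_density p)))"
    by (rule nn_integral_density[symmetric]) measurable
  also have "\<dots> = (\<integral>\<^sup>+x. indicator A x \<partial>distr (density (lborel \<Otimes>\<^sub>M lborel) (\<lambda>p. ennreal (polar_density p))) borel (polar b1 b2))"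
    by (rule nn_integral_distr[symmetric]) measurable
  also have "\<dots> = emeasure (distr (density (lborel \<Otimes>\<^sub>M lborel) (\<lambda>p. ennreal (polar_density p))) borel (polar b1 b2)) A"
    by simp
  finally show "emeasure lborel A = emeasure (distr (density (lborel \<Otimes>\<^sub>M lborel) (\<lambda>p. ennreal (polar_density p))) borel (polar b1 b2)) A" .
qed simp

lemma
  fixes f :: "'a::euclidean_space \<Rightarrow> complex"
  assumes B: "(Basis :: 'a set) = {b1, b2}" "b1 \<noteq> b2" and f[measurable]: "f \<in> borel_measurable borel"
  shows integrable_polar_iff: "integrable lborel f \<longleftrightarrow>
      integrable (lborel \<Otimes>\<^sub>M lborel) (\<lambda>p. polar_density p *\<^sub>R f (polar b1 b2 p))"
    and integral_polar: "(LINT x|lborel. f x) = (LINT p|(lborel \<Otimes>\<^sub>M lborel). polar_density p *\<^sub>R f (polar b1 b2 p))"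
proof -
  have nn: "AE p in lborel \<Otimes>\<^sub>M lborel. 0 \<le> polar_density p"
    by (intro AE_I2) (auto simp: polar_density_def split: prod.split)
  show "integrable lborel f \<longleftrightarrow> integrable (lborel \<Otimes>\<^sub>M lborel) (\<lambda>p. polar_density p *\<^sub>R f (polar b1 b2 p))"
    by (subst lborel_eq_distr_polar[OF B], subst integrable_distr_eq, measurable, subst integrable_density)
       (use nn in measurable)
  show "(LINT x|lborel. f x) = (LINT p|(lborel \<Otimes>\<^sub>M lborel). polar_density p *\<^sub>R f (polar b1 b2 p))"
    by (subst lborel_eq_distr_polar[OF B], subst integral_distr, measurable, subst integral_density)
       (use nn in measurable)
qed

text \<open>The derivative of the shifted integral with respect to the shift is a difference of
  boundary values of \<open>g\<close> one period apart, hence 0.\<close>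

lemma integral_periodic_shift:
  fixes g g' :: "real \<Rightarrow> real"
  assumes g: "\<And>x. (g has_real_derivative g' x) (at x)" and c: "continuous_on UNIV g'"
    and per: "\<And>x. g (x + pi) = g x"
  shows "integral angles (\<lambda>\<theta>. g (\<theta> - \<alpha>)) = integral angles g"
proof -
  define H where "H a = integral angles (\<lambda>\<theta>. g (\<theta> - a))" for a
  have cg: "continuous_on UNIV g" using g by (meson DERIV_isCont continuous_at_imp_continuous_on)
  have gd: "((\<lambda>\<theta>. g (\<theta> - a)) has_real_derivative g' (\<theta> - a)) (at \<theta> within A)" for \<theta> a A
  proof (rule has_field_derivative_at_within)
    have "((\<lambda>\<theta>. g (\<theta> - a)) has_real_derivative g' (\<theta> - a) * 1) (at \<theta>)"
      by (rule DERIV_chain2[OF g]) (auto intro!: derivative_eq_intros)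
    then show "((\<lambda>\<theta>. g (\<theta> - a)) has_real_derivative g' (\<theta> - a)) (at \<theta>)" by simp
  qed
  have "(H has_real_derivative 0) (at a)" for a
  proof -
    have "(H has_real_derivative integral angles (\<lambda>\<theta>. - g' (\<theta> - a))) (at a)"
      unfolding H_def[abs_def]
    proof (rule leibniz_rule_field_derivative[where U=UNIV])
      show "((\<lambda>x. g (t - x)) has_real_derivative - g' (t - x)) (at x)" for x t
      proof -
        have "((\<lambda>x. g (t - x)) has_real_derivative g' (t - x) * - 1) (at x)"
          by (rule DERIV_chain2[OF g]) (auto intro!: derivative_eq_intros)
        then show ?thesis by simp
      qed
      show "(\<lambda>\<theta>. g (\<theta> - x)) integrable_on angles" for x
        by (intro integrable_continuous continuous_on_compose2[OF cg] continuous_intros) auto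
      show "continuous_on (UNIV \<times> angles) (\<lambda>(x, t). - g' (t - x))"
        unfolding split_beta by (intro continuous_intros continuous_on_compose2[OF c]) auto
    qed auto
    moreover have "((\<lambda>\<theta>. g' (\<theta> - a)) has_integral g (pi / 2 - a) - g (- (pi / 2) - a)) {- (pi / 2)..pi / 2}"
      by (rule fundamental_theorem_of_calculus)
         (auto simp: has_real_derivative_iff_has_vector_derivative[symmetric] gd)
    moreover have "g (pi / 2 - a) = g (- (pi / 2) - a)" using per[of "- (pi / 2) - a"] by (simp add: algebra_simps)
    ultimately show ?thesis by (simp add: integral_unique)
  qed
  then have "H \<alpha> = H 0" by (intro DERIV_isconst_all) auto
  then show ?thesis by (simp add: H_def)
qed

lemma circ_shift: "integral angles (\<lambda>\<theta>. cos (z * cos (\<theta> - \<alpha>))) = circ z"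
  unfolding circ_def
proof (rule integral_periodic_shift)
  show "((\<lambda>\<theta>. cos (z * cos \<theta>)) has_real_derivative sin (z * cos x) * (z * sin x)) (at x)" for x
    by (auto intro!: derivative_eq_intros)
qed (auto intro!: continuous_intros)

section \<open>The symbol for \<open>n = 3\<close>\<close>

text \<open>The Jacobian \<open>|r|\<close> times the truncated kernel at distance
  \<open>|r|\<close>: the two powers of \<open>|r|\<close> cancel and the singularity disappears.
  The origin is excluded to match the product, where the Jacobian is 0.\<close>

definition radial_weight :: "real \<Rightarrow> real \<Rightarrow> real \<Rightarrow> complex" where
  "radial_weight k R r = indicator ({- R<..<R} - {0}) r *\<^sub>R (exp (\<i> * of_real (k * \<bar>r\<bar>)) / of_real (4 * pi))"

lemma radial_weight_measurable [measurable]: "radial_weight k R \<in> borel_measurable borel"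
  unfolding radial_weight_def[abs_def] by measurable

lemma norm_radial_weight: "norm (radial_weight k R r) \<le> indicator {- R..R} r / (4 * pi)"
  by (auto simp: radial_weight_def norm_divide norm_mult split: split_indicator)

lemma radial_weight_integrable: "integrable lborel (radial_weight k R)"
proof (rule Bochner_Integration.integrable_bound)
  have "integrable lborel (indicator {- R..R} :: real \<Rightarrow> real)"
    by (intro integrable_real_indicator) (auto simp: emeasure_lborel_Icc_eq)
  then show "integrable lborel (\<lambda>r. indicator {- R..R} r / (4 * pi))" by simp
  show "AE r in lborel. norm (radial_weight k R r) \<le> norm (indicator {- R..R} r / (4 * pi))"
    by (intro AE_I2 order_trans[OF norm_radial_weight]) simp
qed measurable

lemma angular_indicator_integrable: "integrable lborel (\<lambda>\<theta>. indicator {- (pi / 2)<..<pi / 2} \<theta> :: real)"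
  by (intro integrable_real_indicator) auto

definition angular_integral :: "real \<Rightarrow> real \<Rightarrow> complex" where
  "angular_integral \<alpha> z = (LINT \<theta>|lborel. indicator {- (pi / 2)<..<pi / 2} \<theta> *\<^sub>R exp (- (\<i> * of_real (z * cos (\<theta> - \<alpha>)))))"

text \<open>Changing the sign of \<open>z\<close> conjugates the integrand, so the sine parts
  cancel. Only then does the integrand have period \<open>pi\<close>, and the angle \<alpha> can be
  removed by \<open>circ_shift\<close>.\<close>

lemma angular_integral_add: "angular_integral \<alpha> z + angular_integral \<alpha> (- z) = 2 * of_real (circ z)"
proof -
  let ?f = "\<lambda>z \<theta>. exp (- (\<i> * complex_of_real (z * cos (\<theta> - \<alpha>))))"
  have i: "integrable lborel (\<lambda>\<theta>. indicator {- (pi / 2)<..<pi / 2} \<theta> *\<^sub>R ?f z \<theta>)" for z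
    by (rule Bochner_Integration.integrable_bound[OF angular_indicator_integrable]) auto
  have "angular_integral \<alpha> z + angular_integral \<alpha> (- z) =
      (LINT \<theta>|lborel. indicator {- (pi / 2)<..<pi / 2} \<theta> *\<^sub>R ?f z \<theta> + indicator {- (pi / 2)<..<pi / 2} \<theta> *\<^sub>R ?f (- z) \<theta>)"
    unfolding angular_integral_def by (rule Bochner_Integration.integral_add[symmetric, OF i i])
  also have "\<dots> = (LINT \<theta>|lborel. 2 * complex_of_real (indicator {- (pi / 2)..pi / 2} \<theta> *\<^sub>R cos (z * cos (\<theta> - \<alpha>))))"
  proof (rule integral_cong_AE)
    show "AE \<theta> in lborel. indicator {- (pi / 2)<..<pi / 2} \<theta> *\<^sub>R ?f z \<theta> + indicator {- (pi / 2)<..<pi / 2} \<theta> *\<^sub>R ?f (- z) \<theta> =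
       2 * complex_of_real (indicator {- (pi / 2)..pi / 2} \<theta> *\<^sub>R cos (z * cos (\<theta> - \<alpha>)))"
      using AE_lborel_singleton[of "pi / 2"] AE_lborel_singleton[of "- (pi / 2)"]
    proof eventually_elim
      case (elim \<theta>)
      have "?f z \<theta> + ?f (- z) \<theta> = 2 * of_real (cos (z * cos (\<theta> - \<alpha>)))"
        by (simp add: cos_exp_eq flip: of_real_mult cos_of_real)
      then show ?case using elim by (auto split: split_indicator simp: scaleR_conv_of_real)
    qed
  qed measurable
  also have "\<dots> = 2 * of_real (LINT \<theta>|lborel. indicator {- (pi / 2)..pi / 2} \<theta> *\<^sub>R cos (z * cos (\<theta> - \<alpha>)))"
    unfolding integral_mult_right_zero integral_complex_of_real ..
  also have "(LINT \<theta>|lborel. indicator {- (pi / 2)..pi / 2} \<theta> *\<^sub>R cos (z * cos (\<theta> - \<alpha>))) =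
      integral {- (pi / 2)..pi / 2} (\<lambda>\<theta>. cos (z * cos (\<theta> - \<alpha>)))"
    unfolding set_lebesgue_integral_def[symmetric]
    by (intro set_borel_integral_eq_integral borel_integrable_atLeastAtMost')
       (auto intro!: continuous_intros)
  also have "\<dots> = circ z" using circ_shift[of z \<alpha>] by simp
  finally show ?thesis .
qed

lemma polar_integrand_measurable:
  "(\<lambda>(\<theta>, r). indicator {- (pi / 2)<..<pi / 2} \<theta> *\<^sub>R exp (- (\<i> * complex_of_real ((r * \<rho>) * cos (\<theta> - \<alpha>)))) *
    radial_weight k R r) \<in> borel_measurable (lborel \<Otimes>\<^sub>M lborel)"
  by measurable

lemma integral_even:
  fixes F :: "real \<Rightarrow> complex"
  assumes F: "integrable lborel F" and even: "\<And>r. F (- r) = F r" and "F 0 = 0"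
  shows "(LINT r|lborel. F r) = 2 * (LINT r|lborel. indicator {0<..} r *\<^sub>R F r)"
proof -
  have [measurable]: "F \<in> borel_measurable borel" using F by (simp add: integrable_iff_bounded)
  have i: "integrable lborel (\<lambda>r. indicator A r *\<^sub>R F r)" if "A \<in> sets borel" for A
    using that by (intro integrable_mult_indicator F) simp
  have "(LINT r|lborel. F r) = (LINT r|lborel. indicator {0<..} r *\<^sub>R F r + indicator {..<0} r *\<^sub>R F r)"
    by (rule Bochner_Integration.integral_cong[OF refl]) (use \<open>F 0 = 0\<close> in \<open>auto simp: indicator_def\<close>)
  also have "\<dots> = (LINT r|lborel. indicator {0<..} r *\<^sub>R F r) + (LINT r|lborel. indicator {..<0} r *\<^sub>R F r)"
    by (intro Bochner_Integration.integral_add i) auto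
  also have "(LINT r|lborel. indicator {..<0} r *\<^sub>R F r) = (LINT r|lborel. indicator {..<0} (0 - r) *\<^sub>R F (0 - r))"
    by (rule lborel_integral_reflect[symmetric]) measurable
  also have "\<dots> = (LINT r|lborel. indicator {0<..} r *\<^sub>R F r)"
    by (rule Bochner_Integration.integral_cong[OF refl]) (auto simp: indicator_def even)
  finally show ?thesis by simp
qed

text \<open>The type \<open>'a\<close> stands for the hyperplane, so dimension 2 is the case
  \<open>n = 3\<close>.\<close>

context
  assumes dim2: "DIM('a::euclidean_space) = 2"
begin

lemma sl_kernel_dim2: "sl_kernel k (x::'a) = exp (\<i> * of_real (k * norm x)) / of_real (4 * pi * norm x)"
  using dim2 by (simp add: sl_kernel_def Phi_def)

lemma trunc_kernel_polar:
  assumes B: "(Basis :: 'a set) = {b1, b2}" "b1 \<noteq> b2"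
  shows "polar_density (\<theta>, r) *\<^sub>R trunc_kernel k R (polar b1 b2 (\<theta>, r)) =
    indicator {- (pi / 2)<..<pi / 2} \<theta> *\<^sub>R radial_weight k R r"
proof -
  have bb: "b1 \<in> Basis" "b2 \<in> Basis" using B by auto
  have o: "b1 \<bullet> b1 = 1" "b2 \<bullet> b2 = 1" "b1 \<bullet> b2 = 0" "b2 \<bullet> b1 = 0"
    using inner_Basis[OF bb(1) bb(1)] inner_Basis[OF bb(2) bb(2)] inner_Basis[OF bb(1) bb(2)] inner_Basis[OF bb(2) bb(1)] B(2) by auto
  have "norm (polar b1 b2 (\<theta>, r)) = sqrt ((r * cos \<theta>)\<^sup>2 + (r * sin \<theta>)\<^sup>2)"
    unfolding norm_eq_sqrt_inner polar_def by (simp add: inner_simps o power2_eq_square)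
  also have "(r * cos \<theta>)\<^sup>2 + (r * sin \<theta>)\<^sup>2 = r\<^sup>2"
    unfolding power_mult_distrib distrib_left[symmetric] by simp
  finally have n: "norm (polar b1 b2 (\<theta>, r)) = \<bar>r\<bar>" by simp
  then have ball: "polar b1 b2 (\<theta>, r) \<in> ball 0 R \<longleftrightarrow> \<bar>r\<bar> < R" by simp
  show ?thesis
  proof (cases "r = 0 \<or> \<not> \<bar>r\<bar> < R")
    case True
    then show ?thesis
      unfolding trunc_kernel_def using ball by (auto simp: polar_density_def radial_weight_def split: split_indicator)
  next
    case False
    then have "\<bar>r\<bar> *\<^sub>R sl_kernel k (polar b1 b2 (\<theta>, r)) = exp (\<i> * of_real (k * \<bar>r\<bar>)) / of_real (4 * pi)"
      unfolding sl_kernel_dim2 n by (simp add: scaleR_conv_of_real field_simps)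
    moreover have "indicator (ball 0 R) (polar b1 b2 (\<theta>, r)) = (1::real)" using False ball by simp
    moreover have "indicator ({- R<..<R} - {0}) r = (1::real)" using False by (auto simp: indicator_def abs_less_iff)
    ultimately show ?thesis
      unfolding trunc_kernel_def radial_weight_def polar_density_def by (simp add: scaleR_scaleR[symmetric] del: scaleR_scaleR)
  qed
qed

lemma sl_kernel_measurable_dim2: "(sl_kernel k :: 'a \<Rightarrow> complex) \<in> borel_measurable borel"
  unfolding sl_kernel_dim2[abs_def] by measurable

lemma trunc_kernel_measurable_dim2: "(trunc_kernel k R :: 'a \<Rightarrow> complex) \<in> borel_measurable borel"
  unfolding trunc_kernel_def[abs_def]
  by (intro borel_measurable_scaleR borel_measurable_indicator sl_kernel_measurable_dim2) simp

lemma trunc_kernel_integrable_dim2: "integrable lborel (trunc_kernel k R :: 'a \<Rightarrow> complex)"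
proof -
  obtain b1 b2 where B: "(Basis :: 'a set) = {b1, b2}" "b1 \<noteq> b2" using dim2 by (auto simp: card_2_iff)
  note [measurable] = trunc_kernel_measurable_dim2
  show ?thesis
    unfolding integrable_polar_iff[OF B trunc_kernel_measurable_dim2]
  proof (rule integrable_pair_bound[OF _ angular_indicator_integrable integrable_norm[OF radial_weight_integrable[of k R]]])
    show "(\<lambda>p. polar_density p *\<^sub>R trunc_kernel k R (polar b1 b2 p)) \<in> borel_measurable (lborel \<Otimes>\<^sub>M lborel)" by measurable
  qed (simp add: trunc_kernel_polar[OF B])
qed

text \<open>Averaging over both signs of the radius replaces the half-circle exponential by
  \<open>circ\<close>, and folding the even radial integrand onto \<open>{0..R}\<close> doubles it.
  The factor \<open>4 * pi\<close> of the kernel thus becomes \<open>2 * pi\<close>.\<close>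

lemma trunc_symbol_dim2:
  fixes \<xi> :: 'a
  assumes R: "R > 0"
  shows "trunc_symbol k R \<xi> =
    integral {0..R} (\<lambda>r. exp (\<i> * of_real (k * r)) * of_real (circ (norm \<xi> * r))) / of_real (2 * pi)"
proof -
  obtain b1 b2 where B: "(Basis :: 'a set) = {b1, b2}" "b1 \<noteq> b2" using dim2 by (auto simp: card_2_iff)
  define \<rho> where "\<rho> = norm \<xi>"
  note [measurable] = trunc_kernel_measurable_dim2
  let ?z = "Complex (\<xi> \<bullet> b1) (\<xi> \<bullet> b2)"
  \<comment> \<open>The polar angle of \<xi> in the basis \<open>b1\<close>, \<open>b2\<close>, so
    that its inner product with a polar point is a single cosine of the angle difference.\<close>
  define \<alpha> where "\<alpha> = Arg ?z"
  have "(norm \<xi>)\<^sup>2 = (\<xi> \<bullet> b1)\<^sup>2 + (\<xi> \<bullet> b2)\<^sup>2"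
    unfolding power2_norm_eq_inner by (subst euclidean_inner) (simp add: B power2_eq_square)
  then have "cmod ?z = \<rho>" by (simp add: \<rho>_def complex_norm real_sqrt_unique)
  then have pol: "\<xi> \<bullet> b1 = \<rho> * cos \<alpha>" "\<xi> \<bullet> b2 = \<rho> * sin \<alpha>"
    using rcis_cmod_Arg[of ?z] by (auto simp: rcis_def complex_eq_iff \<alpha>_def)
  have ip: "\<xi> \<bullet> polar b1 b2 (\<theta>, r) = (r * \<rho>) * cos (\<theta> - \<alpha>)" for \<theta> r
    by (simp add: polar_def inner_add_right pol cos_diff algebra_simps)
  let ?e = "\<lambda>\<theta> r. exp (- (\<i> * complex_of_real ((r * \<rho>) * cos (\<theta> - \<alpha>))))"
  let ?h = "\<lambda>\<theta> r. indicator {- (pi / 2)<..<pi / 2} \<theta> *\<^sub>R ?e \<theta> r * radial_weight k R r"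
  have hi: "integrable (lborel \<Otimes>\<^sub>M lborel) (\<lambda>(\<theta>, r). ?h \<theta> r)"
  proof (rule integrable_pair_bound[OF _ angular_indicator_integrable integrable_norm[OF radial_weight_integrable[of k R]]])
    show "(\<lambda>(\<theta>, r). ?h \<theta> r) \<in> borel_measurable (lborel \<Otimes>\<^sub>M lborel)"
      by (rule polar_integrand_measurable)
  qed (simp add: norm_mult)
  have inner: "(LINT \<theta>|lborel. ?h \<theta> r) = radial_weight k R r * angular_integral \<alpha> (r * \<rho>)" for r
    unfolding angular_integral_def integral_mult_left_zero by (rule mult.commute)
  have "trunc_symbol k R \<xi> = (LINT p|(lborel \<Otimes>\<^sub>M lborel). polar_density p *\<^sub>R
      (exp (- (\<i> * of_real (\<xi> \<bullet> polar b1 b2 p))) * trunc_kernel k R (polar b1 b2 p)))"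
    unfolding trunc_symbol_def by (rule integral_polar[OF B]) measurable
  also have "\<dots> = (LINT p|(lborel \<Otimes>\<^sub>M lborel). (\<lambda>(\<theta>, r). ?h \<theta> r) p)"
  proof (rule Bochner_Integration.integral_cong[OF refl])
    fix p :: "real \<times> real"
    obtain \<theta> r where p: "p = (\<theta>, r)" by (cases p)
    show "polar_density p *\<^sub>R (exp (- (\<i> * of_real (\<xi> \<bullet> polar b1 b2 p))) * trunc_kernel k R (polar b1 b2 p)) = (\<lambda>(\<theta>, r). ?h \<theta> r) p"
      unfolding p ip prod.case using trunc_kernel_polar[OF B, of \<theta> r k R]
      unfolding mult_scaleR_right[symmetric] by (simp only: mult_scaleR_left mult_scaleR_right)
  qed
  also have "\<dots> = (LINT r|lborel. LINT \<theta>|lborel. ?h \<theta> r)"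
    by (rule lborel_pair.integral_snd[symmetric, OF hi])
  also have "\<dots> = (LINT r|lborel. radial_weight k R r * angular_integral \<alpha> (r * \<rho>))"
    unfolding inner ..
  finally have T: "trunc_symbol k R \<xi> = (LINT r|lborel. radial_weight k R r * angular_integral \<alpha> (r * \<rho>))" .
  have wi: "integrable lborel (\<lambda>r. radial_weight k R r * angular_integral \<alpha> (r * \<rho>))"
    using lborel_pair.integrable_snd[OF hi] unfolding prod.case inner .
  have even: "radial_weight k R (- r) = radial_weight k R r" for r
    by (auto simp: radial_weight_def indicator_def)
  have T': "trunc_symbol k R \<xi> = (LINT r|lborel. radial_weight k R r * angular_integral \<alpha> (- (r * \<rho>)))"
    and wi': "integrable lborel (\<lambda>r. radial_weight k R r * angular_integral \<alpha> (- (r * \<rho>)))"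
    using lborel_integral_reflect[of "\<lambda>r. radial_weight k R r * angular_integral \<alpha> (r * \<rho>)" 0]
      lborel_integrable_reflect[OF wi, of 0] wi
    unfolding T by (simp_all add: even integrable_iff_bounded)
  have "2 * trunc_symbol k R \<xi> = (LINT r|lborel. radial_weight k R r * angular_integral \<alpha> (r * \<rho>) +
      radial_weight k R r * angular_integral \<alpha> (- (r * \<rho>)))"
    using T T' by (subst Bochner_Integration.integral_add[OF wi wi']) simp
  also have "\<dots> = (LINT r|lborel. 2 * (radial_weight k R r * of_real (circ (r * \<rho>))))"
    by (rule Bochner_Integration.integral_cong[OF refl]) (simp only: distrib_left[symmetric] angular_integral_add mult.left_commute)
  finally have T2: "trunc_symbol k R \<xi> = (LINT r|lborel. radial_weight k R r * of_real (circ (r * \<rho>)))"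
    unfolding integral_mult_right_zero by simp
  have circ_cont: "continuous_on UNIV circ"
    by (intro continuous_at_imp_continuous_on ballI DERIV_isCont[OF circ_deriv])
  then have [measurable]: "circ \<in> borel_measurable borel" by (rule borel_measurable_continuous_onI)
  have ci: "integrable lborel (\<lambda>r. radial_weight k R r * complex_of_real (circ (r * \<rho>)))"
    by (rule Bochner_Integration.integrable_bound[where f="\<lambda>r. radial_weight k R r * of_real pi"],
        intro integrable_mult_left radial_weight_integrable)
       (auto intro!: AE_I2 mult_left_mono circ_bounds simp: norm_mult)
  have circ_even: "circ (- z) = circ z" for z unfolding circ_def mult_minus_left cos_minus ..
  have "trunc_symbol k R \<xi> = 2 * (LINT r|lborel. indicator {0<..} r *\<^sub>R (radial_weight k R r * of_real (circ (r * \<rho>))))"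
    unfolding T2 by (rule integral_even[OF ci]) (simp_all only: even circ_even mult_minus_left, simp add: radial_weight_def)
  also have "(LINT r|lborel. indicator {0<..} r *\<^sub>R (radial_weight k R r * of_real (circ (r * \<rho>)))) =
     (LINT r|lborel. (1 / of_real (4 * pi)) * (indicator {0..R} r *\<^sub>R (exp (\<i> * of_real (k * r)) * of_real (circ (\<rho> * r)))))"
  proof (rule integral_cong_AE)
    show "AE r in lborel. indicator {0<..} r *\<^sub>R (radial_weight k R r * of_real (circ (r * \<rho>))) =
       (1 / of_real (4 * pi)) * (indicator {0..R} r *\<^sub>R (exp (\<i> * of_real (k * r)) * of_real (circ (\<rho> * r))))"
      using AE_lborel_singleton[of "0::real"] AE_lborel_singleton[of R]
    proof eventually_elim
      case (elim r)
      then show ?case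
        unfolding radial_weight_def mult.commute[of r \<rho>] by (auto split: split_indicator)
    qed
  qed measurable
  also have "\<dots> = (1 / of_real (4 * pi)) * integral {0..R} (\<lambda>r. exp (\<i> * of_real (k * r)) * of_real (circ (\<rho> * r)))"
    unfolding integral_mult_right_zero set_lebesgue_integral_def[symmetric]
    by (subst set_borel_integral_eq_integral, intro borel_integrable_atLeastAtMost')
       (auto intro!: continuous_intros continuous_on_compose2[OF circ_cont])
  finally show ?thesis by (simp add: \<rho>_def)
qed

theorem trunc_symbol_bound_dim2:
  obtains C where "C \<ge> 0"
    "\<And>k R \<xi>. k > 0 \<Longrightarrow> R > 0 \<Longrightarrow> norm (trunc_symbol k R (\<xi>::'a)) \<le> C * (1 + sqrt (k * R)) * weight k (- 1 / 2) \<xi>"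
proof (rule oscillatory_integral_bound)
  fix C :: real assume C: "C \<ge> 0" "\<And>k \<rho> R. k > 0 \<Longrightarrow> \<rho> \<ge> 0 \<Longrightarrow> R > 0 \<Longrightarrow>
      norm (integral {0..R} (\<lambda>r. exp (\<i> * of_real (k * r)) * of_real (circ (\<rho> * r)))) \<le>
      C * (1 + sqrt (k * R)) * (k\<^sup>2 + \<rho>\<^sup>2) powr (- 1 / 2)"
  show thesis
  proof (rule that[of "C / (2 * pi)"])
    show "C / (2 * pi) \<ge> 0" using C(1) by simp
    fix k R :: real and \<xi> :: 'a assume kR: "k > 0" "R > 0"
    have "norm (trunc_symbol k R \<xi>) \<le> C * (1 + sqrt (k * R)) * (k\<^sup>2 + (norm \<xi>)\<^sup>2) powr (- 1 / 2) / (2 * pi)"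
      unfolding trunc_symbol_dim2[OF kR(2)] norm_divide norm_of_real
      using C(2)[OF kR(1) norm_ge_zero kR(2), of \<xi>] by (simp add: divide_right_mono)
    then show "norm (trunc_symbol k R \<xi>) \<le> C / (2 * pi) * (1 + sqrt (k * R)) * weight k (- 1 / 2) \<xi>"
      by (simp add: weight_def)
  qed
qed

end

section \<open>The Bessel functions of order zero\<close>

text \<open>With \<open>w = z^2 / 4\<close>, Bessel's equation of order 0 for
  \<open>p (z^2 / 4)\<close> becomes \<open>w * p'' + p' + p = 0\<close>, which on coefficients is
  the two-term expression on the right.\<close>

lemma power_series_ode:
  fixes c :: "nat \<Rightarrow> real"
  assumes s: "\<And>y. summable (\<lambda>n. c n * y ^ n)"
  shows "w * (\<Sum>n. diffs (diffs c) n * w ^ n) + (\<Sum>n. diffs c n * w ^ n) + (\<Sum>n. c n * w ^ n) =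
    (\<Sum>n. ((real n + 1)\<^sup>2 * c (Suc n) + c n) * w ^ n)"
proof -
  note s1 = termdiff_converges_all[of c, OF s]
  note s2 = termdiff_converges_all[of "diffs c", OF s1]
  have "(\<lambda>n. w * (of_nat n * diffs c n * w ^ (n - Suc 0))) sums (w * (\<Sum>n. diffs (diffs c) n * w ^ n))"
    by (rule sums_mult[OF diffs_equiv[OF s2]])
  moreover have "w * (of_nat n * diffs c n * w ^ (n - Suc 0)) = of_nat n * diffs c n * w ^ n" for n
    by (cases n) auto
  ultimately have "(\<lambda>n. of_nat n * diffs c n * w ^ n) sums (w * (\<Sum>n. diffs (diffs c) n * w ^ n))" by simp
  from sums_add[OF sums_add[OF this summable_sums[OF s1]] summable_sums[OF s]]
  have "(\<lambda>n. of_nat n * diffs c n * w ^ n + diffs c n * w ^ n + c n * w ^ n) sums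
    (w * (\<Sum>n. diffs (diffs c) n * w ^ n) + (\<Sum>n. diffs c n * w ^ n) + (\<Sum>n. c n * w ^ n))" .
  moreover have "of_nat n * diffs c n * w ^ n + diffs c n * w ^ n + c n * w ^ n =
      ((real n + 1)\<^sup>2 * c (Suc n) + c n) * w ^ n" for n
    by (simp add: diffs_def algebra_simps power2_eq_square)
  ultimately show ?thesis by (simp add: sums_unique)
qed

section \<open>The series of the Bessel functions in the variable \<open>z^2 / 4\<close>\<close>

definition J_coeff :: "nat \<Rightarrow> real" where
  "J_coeff m = (-1) ^ m / (fact m)\<^sup>2"

definition Y_coeff :: "nat \<Rightarrow> real" where
  "Y_coeff m = (-1) ^ m * harm m / (fact m)\<^sup>2"

lemma summable_of_factorial_bound:
  fixes c :: "nat \<Rightarrow> real"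
  assumes "\<And>m. \<bar>c m\<bar> \<le> 1 / fact m"
  shows "summable (\<lambda>m. c m * y ^ m)"
proof (rule summable_comparison_test')
  show "summable (\<lambda>m. inverse (fact m) * \<bar>y\<bar> ^ m)" by (rule summable_exp)
  show "norm (c m * y ^ m) \<le> inverse (fact m) * \<bar>y\<bar> ^ m" for m
    using mult_right_mono[OF assms[of m], of "\<bar>y\<bar> ^ m"] by (simp add: abs_mult power_abs inverse_eq_divide)
qed

lemma harm_le_fact: "harm m \<le> (fact m :: real)"
proof -
  have "harm m \<le> real m"
  proof (induction m)
    case (Suc m)
    have "inverse (real (Suc m)) \<le> 1" by (simp add: inverse_le_1_iff)
    then show ?case using Suc by (simp add: harm_Suc)
  qed (simp add: harm_def)
  also have "real m \<le> fact m" using fact_ge_self[of m] by (metis of_nat_fact of_nat_le_iff)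
  finally show ?thesis .
qed

lemma J_coeff_summable: "summable (\<lambda>m. J_coeff m * y ^ m)"
proof (rule summable_of_factorial_bound)
  fix m
  have "fact m * 1 \<le> fact m * (fact m :: real)" by (intro mult_left_mono) auto
  then show "\<bar>J_coeff m\<bar> \<le> 1 / fact m"
    by (simp add: J_coeff_def power2_eq_square abs_mult power_abs frac_le)
qed

lemma Y_coeff_summable: "summable (\<lambda>m. Y_coeff m * y ^ m)"
proof (rule summable_of_factorial_bound)
  fix m
  have "harm m / (fact m)\<^sup>2 \<le> (fact m :: real) / (fact m)\<^sup>2"
    by (intro divide_right_mono harm_le_fact) simp
  then show "\<bar>Y_coeff m\<bar> \<le> 1 / fact m"
    by (simp add: Y_coeff_def power2_eq_square abs_mult power_abs harm_nonneg)
qed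

definition J_ser :: "real \<Rightarrow> real" where "J_ser w = (\<Sum>m. J_coeff m * w ^ m)"
definition J_ser' :: "real \<Rightarrow> real" where "J_ser' w = (\<Sum>m. diffs J_coeff m * w ^ m)"
definition J_ser'' :: "real \<Rightarrow> real" where "J_ser'' w = (\<Sum>m. diffs (diffs J_coeff) m * w ^ m)"
definition Y_ser :: "real \<Rightarrow> real" where "Y_ser w = (\<Sum>m. Y_coeff m * w ^ m)"
definition Y_ser' :: "real \<Rightarrow> real" where "Y_ser' w = (\<Sum>m. diffs Y_coeff m * w ^ m)"
definition Y_ser'' :: "real \<Rightarrow> real" where "Y_ser'' w = (\<Sum>m. diffs (diffs Y_coeff) m * w ^ m)"

lemma series_derivs:
  "(J_ser has_real_derivative J_ser' w) (at w)" "(J_ser' has_real_derivative J_ser'' w) (at w)"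
  "(Y_ser has_real_derivative Y_ser' w) (at w)" "(Y_ser' has_real_derivative Y_ser'' w) (at w)"
  unfolding J_ser_def[abs_def] J_ser'_def[abs_def] J_ser''_def Y_ser_def[abs_def] Y_ser'_def[abs_def] Y_ser''_def
  by (intro termdiffs_strong_converges_everywhere termdiff_converges_all J_coeff_summable Y_coeff_summable)+

lemma fact_Suc_sq: "(real n + 1)\<^sup>2 / (fact (Suc n))\<^sup>2 = 1 / (fact n :: real)\<^sup>2"
proof -
  have "(fact (Suc n) :: real) = (real n + 1) * fact n" by simp
  moreover have "real n + 1 \<noteq> 0" by linarith
  ultimately show ?thesis unfolding power_mult_distrib by (simp only: power_mult_distrib) simp
qed

lemma J_ser_ode: "w * J_ser'' w + J_ser' w + J_ser w = 0"
proof -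
  have "(real n + 1)\<^sup>2 * J_coeff (Suc n) + J_coeff n = 0" for n
  proof -
    have "(real n + 1)\<^sup>2 * J_coeff (Suc n) = - ((-1) ^ n) * ((real n + 1)\<^sup>2 / (fact (Suc n))\<^sup>2)"
      by (simp add: J_coeff_def del: fact_Suc)
    then show ?thesis unfolding fact_Suc_sq by (simp add: J_coeff_def)
  qed
  then show ?thesis
    unfolding J_ser_def J_ser'_def J_ser''_def power_series_ode[OF J_coeff_summable] by simp
qed

text \<open>The recursion that annihilates the series of \<open>J_ser\<close> leaves here the
  increment \<open>1 / (n + 1)\<close> of the harmonic numbers, and the remaining series is that of
  \<open>J_ser'\<close>. This source term compensates the derivatives of the logarithm in
  \<open>bessel_Y0\<close>.\<close>

lemma Y_ser_ode: "w * Y_ser'' w + Y_ser' w + Y_ser w = J_ser' w"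
proof -
  have "(real n + 1)\<^sup>2 * Y_coeff (Suc n) + Y_coeff n = diffs J_coeff n" for n
  proof -
    have alg: "- (s * (h + q)) / F + s * h / F = - s * q * (1 / F)" for s h q F :: real
      by (simp add: algebra_simps add_divide_distrib diff_divide_distrib)
    have "(real n + 1)\<^sup>2 * Y_coeff (Suc n) = - ((-1) ^ n * harm (Suc n)) * ((real n + 1)\<^sup>2 / (fact (Suc n))\<^sup>2)"
      by (simp add: Y_coeff_def del: fact_Suc)
    also have "\<dots> = - ((-1) ^ n * (harm n + 1 / (real n + 1))) / (fact n)\<^sup>2"
      unfolding fact_Suc_sq by (simp add: harm_Suc inverse_eq_divide)
    finally have l: "(real n + 1)\<^sup>2 * Y_coeff (Suc n) + Y_coeff n = - ((-1) ^ n) * (1 / (real n + 1)) * (1 / (fact n)\<^sup>2)"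
      unfolding Y_coeff_def by (simp only: alg)
    have "diffs J_coeff n = - ((-1) ^ n) * (1 / (real n + 1)) * ((real n + 1)\<^sup>2 / (fact (Suc n))\<^sup>2)"
      by (simp add: diffs_def J_coeff_def power2_eq_square del: fact_Suc)
    then show ?thesis unfolding l fact_Suc_sq by simp
  qed
  then show ?thesis
    unfolding J_ser'_def Y_ser_def Y_ser'_def Y_ser''_def power_series_ode[OF Y_coeff_summable] by simp
qed

lemma half_power_even: "(z / 2) ^ (2 * m) = (z\<^sup>2 / 4 :: real) ^ m"
  by (simp add: power_mult power_divide)

lemma bessel_J0_eq: "bessel_J0 z = J_ser (z\<^sup>2 / 4)"
  unfolding bessel_J0_def J_ser_def J_coeff_def half_power_even ..

lemma bessel_Y0_eq:
  "bessel_Y0 z = 2 / pi * ((ln (z / 2) + euler_mascheroni) * J_ser (z\<^sup>2 / 4) - Y_ser (z\<^sup>2 / 4))"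
  unfolding bessel_Y0_def bessel_J0_eq Y_ser_def Y_coeff_def
  unfolding half_power_even by (simp add: algebra_simps)

definition bessel_J0' :: "real \<Rightarrow> real" where
  "bessel_J0' z = J_ser' (z\<^sup>2 / 4) * (z / 2)"

definition bessel_J0'' :: "real \<Rightarrow> real" where
  "bessel_J0'' z = J_ser'' (z\<^sup>2 / 4) * (z\<^sup>2 / 4) + J_ser' (z\<^sup>2 / 4) / 2"

definition bessel_Y0' :: "real \<Rightarrow> real" where
  "bessel_Y0' z = 2 / pi * (bessel_J0 z / z + (ln (z / 2) + euler_mascheroni) * bessel_J0' z - Y_ser' (z\<^sup>2 / 4) * (z / 2))"

definition bessel_Y0'' :: "real \<Rightarrow> real" where
  "bessel_Y0'' z = 2 / pi * (2 * bessel_J0' z / z - bessel_J0 z / z\<^sup>2 + (ln (z / 2) + euler_mascheroni) * bessel_J0'' z -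
     (Y_ser'' (z\<^sup>2 / 4) * (z\<^sup>2 / 4) + Y_ser' (z\<^sup>2 / 4) / 2))"

lemma deriv_quarter_square:
  assumes "\<And>w. (p has_real_derivative p' w) (at w)"
  shows "((\<lambda>z. p (z\<^sup>2 / 4)) has_real_derivative p' (z\<^sup>2 / 4) * (z / 2)) (at z)"
  by (rule DERIV_chain2[OF assms]) (auto intro!: derivative_eq_intros)

lemma deriv_quarter_square':
  assumes "\<And>w. (p' has_real_derivative p'' w) (at w)"
  shows "((\<lambda>z. p' (z\<^sup>2 / 4) * (z / 2)) has_real_derivative p'' (z\<^sup>2 / 4) * (z\<^sup>2 / 4) + p' (z\<^sup>2 / 4) / 2) (at z)"
  using DERIV_mult[OF deriv_quarter_square[OF assms, where z=z] DERIV_cdivide[OF DERIV_ident, of 2]]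
  by (simp add: power2_eq_square mult.assoc)

lemma bessel_J0_deriv: "(bessel_J0 has_real_derivative bessel_J0' z) (at z)"
  unfolding bessel_J0_eq[abs_def] bessel_J0'_def by (rule deriv_quarter_square[OF series_derivs(1)])

lemma bessel_J0'_deriv: "(bessel_J0' has_real_derivative bessel_J0'' z) (at z)"
  unfolding bessel_J0'_def[abs_def] bessel_J0''_def by (rule deriv_quarter_square'[OF series_derivs(2)])

lemma bessel_J0_ode: "z * bessel_J0'' z + bessel_J0' z + z * bessel_J0 z = 0"
proof -
  have "z * bessel_J0'' z + bessel_J0' z + z * bessel_J0 z =
      z * (z\<^sup>2 / 4 * J_ser'' (z\<^sup>2 / 4) + J_ser' (z\<^sup>2 / 4) + J_ser (z\<^sup>2 / 4))"
    unfolding bessel_J0_eq bessel_J0'_def bessel_J0''_def by (simp add: algebra_simps)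
  then show ?thesis unfolding J_ser_ode by simp
qed

lemma ln_half_deriv: "z > 0 \<Longrightarrow> ((\<lambda>z. ln (z / 2) + euler_mascheroni) has_real_derivative 1 / z) (at z)"
  by (auto intro!: derivative_eq_intros simp: field_simps)

lemma bessel_Y0_deriv:
  assumes "z > 0"
  shows "(bessel_Y0 has_real_derivative bessel_Y0' z) (at z)"
proof -
  have "((\<lambda>z. 2 / pi * ((ln (z / 2) + euler_mascheroni) * bessel_J0 z - Y_ser (z\<^sup>2 / 4))) has_real_derivative
    2 / pi * (1 / z * bessel_J0 z + bessel_J0' z * (ln (z / 2) + euler_mascheroni) - Y_ser' (z\<^sup>2 / 4) * (z / 2))) (at z)"
    by (intro DERIV_cmult DERIV_diff DERIV_mult ln_half_deriv assms bessel_J0_deriv deriv_quarter_square series_derivs)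
  then show ?thesis unfolding bessel_Y0_eq[abs_def] bessel_J0_eq[abs_def] bessel_Y0'_def
    by (simp add: bessel_J0_eq mult.commute)
qed

lemma bessel_Y0'_deriv:
  assumes "z > 0"
  shows "(bessel_Y0' has_real_derivative bessel_Y0'' z) (at z)"
proof -
  have "((\<lambda>z. bessel_J0 z / z) has_real_derivative (bessel_J0' z * z - bessel_J0 z * 1) / (z * z)) (at z)"
    using assms by (intro DERIV_divide bessel_J0_deriv DERIV_ident) simp
  then have "((\<lambda>z. 2 / pi * (bessel_J0 z / z + (ln (z / 2) + euler_mascheroni) * bessel_J0' z - Y_ser' (z\<^sup>2 / 4) * (z / 2))) has_real_derivative
    2 / pi * ((bessel_J0' z * z - bessel_J0 z * 1) / (z * z) + (1 / z * bessel_J0' z + bessel_J0'' z * (ln (z / 2) + euler_mascheroni)) -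
      (Y_ser'' (z\<^sup>2 / 4) * (z\<^sup>2 / 4) + Y_ser' (z\<^sup>2 / 4) / 2))) (at z)"
    by (intro DERIV_cmult DERIV_diff DERIV_add DERIV_mult ln_half_deriv assms bessel_J0'_deriv deriv_quarter_square' series_derivs)
  moreover have "(bessel_J0' z * z - bessel_J0 z * 1) / (z * z) + (1 / z * bessel_J0' z + bessel_J0'' z * (ln (z / 2) + euler_mascheroni)) =
      2 * bessel_J0' z / z - bessel_J0 z / z\<^sup>2 + (ln (z / 2) + euler_mascheroni) * bessel_J0'' z"
    using assms by (simp add: field_simps power2_eq_square)
  ultimately show ?thesis unfolding bessel_Y0'_def[abs_def] bessel_Y0''_def by (simp only:)
qed

text \<open>The logarithm multiplies Bessel's equation for \<open>bessel_J0\<close> and drops out.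
  Its derivatives leave \<open>2 * bessel_J0' z\<close>, which equals
  \<open>z * J_ser' (z^2 / 4)\<close> and cancels the source term of
  \<open>Y_ser_ode\<close>.\<close>

lemma bessel_Y0_ode:
  assumes "z > 0"
  shows "z * bessel_Y0'' z + bessel_Y0' z + z * bessel_Y0 z = 0"
proof -
  let ?l = "ln (z / 2) + euler_mascheroni" and ?w = "z\<^sup>2 / 4"
  have "z * bessel_Y0'' z + bessel_Y0' z + z * bessel_Y0 z = 2 / pi *
      (z * (2 * bessel_J0' z / z - bessel_J0 z / z\<^sup>2 + ?l * bessel_J0'' z - (Y_ser'' ?w * ?w + Y_ser' ?w / 2)) +
       (bessel_J0 z / z + ?l * bessel_J0' z - Y_ser' ?w * (z / 2)) + z * (?l * bessel_J0 z - Y_ser ?w))"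
    unfolding bessel_Y0''_def bessel_Y0'_def bessel_Y0_eq bessel_J0_eq[symmetric] by (simp add: algebra_simps)
  also have "\<dots> = 2 / pi * (?l * (z * bessel_J0'' z + bessel_J0' z + z * bessel_J0 z) + 2 * bessel_J0' z -
       z * (?w * Y_ser'' ?w + Y_ser' ?w + Y_ser ?w))"
    using assms by (simp add: field_simps power2_eq_square)
  also have "\<dots> = 0" unfolding bessel_J0_ode Y_ser_ode by (simp add: bessel_J0'_def)
  finally show ?thesis .
qed

section \<open>Behaviour of the Bessel functions near the origin\<close>

lemma bessel_J0'_bound:
  obtains B where "B \<ge> 0" "\<And>z. 0 \<le> z \<Longrightarrow> z \<le> 1 \<Longrightarrow> \<bar>bessel_J0' z\<bar> \<le> B * z"
    "\<And>z. 0 \<le> z \<Longrightarrow> z \<le> 1 \<Longrightarrow> \<bar>Y_ser' (z\<^sup>2 / 4)\<bar> \<le> B"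
proof -
  have "\<exists>M. \<forall>x\<ge>0. x \<le> 1 \<longrightarrow> \<bar>p (x\<^sup>2 / 4)\<bar> \<le> M" if "\<And>w. (p has_real_derivative p' w) (at w)" for p p' :: "real \<Rightarrow> real"
    using isCont_bounded[of 0 1 "\<lambda>x. \<bar>p (x\<^sup>2 / 4)\<bar>"] DERIV_isCont[OF deriv_quarter_square[OF that]]
    by auto
  from this[OF series_derivs(2)] this[OF series_derivs(4)]
  obtain M N where M: "\<And>x. 0 \<le> x \<Longrightarrow> x \<le> 1 \<Longrightarrow> \<bar>J_ser' (x\<^sup>2 / 4)\<bar> \<le> M"
    and N: "\<And>x. 0 \<le> x \<Longrightarrow> x \<le> 1 \<Longrightarrow> \<bar>Y_ser' (x\<^sup>2 / 4)\<bar> \<le> N" by blast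
  have nn: "M \<ge> 0" "N \<ge> 0" using M[of 0] N[of 0] by auto
  show ?thesis
  proof (rule that[of "M + N"])
    fix z :: real assume z: "0 \<le> z" "z \<le> 1"
    have "\<bar>bessel_J0' z\<bar> = \<bar>J_ser' (z\<^sup>2 / 4)\<bar> * (z / 2)" using z by (simp add: bessel_J0'_def abs_mult)
    also have "\<dots> \<le> (M + N) * z" using M[OF z] nn z by (intro mult_mono) auto
    finally show "\<bar>bessel_J0' z\<bar> \<le> (M + N) * z" .
    show "\<bar>Y_ser' (z\<^sup>2 / 4)\<bar> \<le> M + N" using N[OF z] nn by simp
  qed (use nn in simp)
qed

lemma abs_mult_ln_le: "\<bar>z * ln z\<bar> \<le> 1" if "0 < z" "z \<le> (1::real)"
proof -
  have "ln (1 / z) \<le> 1 / z - 1" using that by (intro ln_le_minus_one) simp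
  then have "z * (- ln z) \<le> z * (1 / z - 1)" using that by (intro mult_left_mono) (auto simp: ln_div)
  also have "\<dots> \<le> 1" using that by (simp add: algebra_simps)
  finally show ?thesis using that by (simp add: abs_mult)
qed

text \<open>After removal of the singular term three summands remain:
  \<open>(bessel_J0 z - 1) / z\<close>, bounded by the mean value theorem; the logarithm times
  \<open>bessel_J0' z\<close>, bounded because \<open>z * ln z\<close> is; and a series term bounded
  by continuity.\<close>

lemma bessel_Y0'_near_zero:
  obtains C where "\<And>z. 0 < z \<Longrightarrow> z \<le> 1 \<Longrightarrow> \<bar>bessel_Y0' z - 2 / pi / z\<bar> \<le> C"
proof -
  obtain B where B: "B \<ge> 0" "\<And>z. 0 \<le> z \<Longrightarrow> z \<le> 1 \<Longrightarrow> \<bar>bessel_J0' z\<bar> \<le> B * z"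
    "\<And>z. 0 \<le> z \<Longrightarrow> z \<le> 1 \<Longrightarrow> \<bar>Y_ser' (z\<^sup>2 / 4)\<bar> \<le> B" by (rule bessel_J0'_bound) blast
  let ?g = "euler_mascheroni :: real"
  show ?thesis
  proof (rule that)
    fix z :: real assume z: "0 < z" "z \<le> 1"
    have J1: "\<bar>bessel_J0 z - 1\<bar> \<le> B * z"
    proof -
      obtain y where y: "0 < y" "y < z" "bessel_J0 z - bessel_J0 0 = (z - 0) * bessel_J0' y"
        using MVT2[of 0 z bessel_J0 bessel_J0'] bessel_J0_deriv z by blast
      have "bessel_J0 0 = J_coeff 0" unfolding bessel_J0_eq J_ser_def by (simp add: powser_zero)
      then have "bessel_J0 z - 1 = z * bessel_J0' y" using y(3) by (simp add: J_coeff_def)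
      then have "\<bar>bessel_J0 z - 1\<bar> = z * \<bar>bessel_J0' y\<bar>" using z by (simp add: abs_mult)
      also have "\<dots> \<le> z * (B * y)" using B(2)[of y] y z by (intro mult_left_mono) auto
      also have "\<dots> \<le> z * (B * 1)" using y z B(1) by (intro mult_left_mono) auto
      finally show ?thesis by (simp add: mult.commute)
    qed
    have "\<bar>(bessel_J0 z - 1) / z\<bar> \<le> B" using J1 z by (simp add: abs_divide divide_le_eq)
    moreover have "\<bar>(ln (z / 2) + ?g) * bessel_J0' z\<bar> \<le> B * (1 + ln 2 + \<bar>?g\<bar>)"
    proof -
      have "\<bar>(ln (z / 2) + ?g) * bessel_J0' z\<bar> \<le> \<bar>ln (z / 2) + ?g\<bar> * (B * z)"
        using B(2)[of z] z by (simp add: abs_mult mult_left_mono)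
      also have "\<dots> = B * \<bar>z * (ln (z / 2) + ?g)\<bar>" using z by (simp add: abs_mult)
      also have "z * (ln (z / 2) + ?g) = z * ln z - z * ln 2 + z * ?g" using z by (simp add: ln_div algebra_simps)
      also have "B * \<bar>z * ln z - z * ln 2 + z * ?g\<bar> \<le> B * (1 + ln 2 + \<bar>?g\<bar>)"
      proof (rule mult_left_mono[OF _ B(1)])
        have "z * ln 2 \<le> 1 * ln 2" using z by (intro mult_right_mono) auto
        moreover have "0 \<le> z * ln 2" using z by simp
        moreover have "\<bar>z * ?g\<bar> \<le> 1 * \<bar>?g\<bar>" unfolding abs_mult using z by (intro mult_right_mono) auto
        ultimately show "\<bar>z * ln z - z * ln 2 + z * ?g\<bar> \<le> 1 + ln 2 + \<bar>?g\<bar>"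
          using abs_mult_ln_le[OF z] by linarith
      qed
      finally show ?thesis .
    qed
    moreover have "\<bar>Y_ser' (z\<^sup>2 / 4) * (z / 2)\<bar> \<le> B * 1"
      unfolding abs_mult using B(1,3) z by (intro mult_mono) auto
    ultimately have "\<bar>(bessel_J0 z - 1) / z + (ln (z / 2) + ?g) * bessel_J0' z - Y_ser' (z\<^sup>2 / 4) * (z / 2)\<bar> \<le>
        B + B * (1 + ln 2 + \<bar>?g\<bar>) + B" by linarith
    then have "2 / pi * \<bar>(bessel_J0 z - 1) / z + (ln (z / 2) + ?g) * bessel_J0' z - Y_ser' (z\<^sup>2 / 4) * (z / 2)\<bar> \<le>
        2 / pi * (B + B * (1 + ln 2 + \<bar>?g\<bar>) + B)" by (intro mult_left_mono) auto
    moreover have "bessel_Y0' z - 2 / pi / z =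
        2 / pi * ((bessel_J0 z - 1) / z + (ln (z / 2) + ?g) * bessel_J0' z - Y_ser' (z\<^sup>2 / 4) * (z / 2))"
      unfolding bessel_Y0'_def using z by (simp add: field_simps)
    ultimately show "\<bar>bessel_Y0' z - 2 / pi / z\<bar> \<le> 2 / pi * (B + B * (1 + ln 2 + \<bar>?g\<bar>) + B)"
      by (simp only: abs_mult) simp
  qed
qed

section \<open>The symbol for \<open>n = 2\<close>\<close>

text \<open>Satisfied by \<open>J\<^sub>0\<close> with \<open>c = 0\<close> and by \<open>Y\<^sub>0\<close> with \<open>c = 2 / \<pi>\<close>.\<close>

locale log_singular =
  fixes u u' :: "real \<Rightarrow> real" and c C :: real
  assumes deriv: "\<And>z. z > 0 \<Longrightarrow> (u has_real_derivative u' z) (at z)"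
    and near: "\<And>z. 0 < z \<Longrightarrow> z \<le> 1 \<Longrightarrow> \<bar>u' z - c / z\<bar> \<le> C"
    and far: "\<And>z. z \<ge> 1 \<Longrightarrow> \<bar>u z\<bar> \<le> C * z powr (- 1 / 2)" "\<And>z. z \<ge> 1 \<Longrightarrow> \<bar>u' z\<bar> \<le> C * z powr (- 1 / 2)"
    and measurable_u [measurable]: "u \<in> borel_measurable borel"
begin

lemma C_nonneg: "C \<ge> 0" using near[of 1] by simp

text \<open>The function \<open>u z - c * ln z\<close> has a derivative bounded by \<open>C\<close>
  on \<open>(0, 1]\<close>, so it differs from its value at 1 by at most \<open>C\<close>, and
  \<open>u 1\<close> itself is bounded by \<open>C\<close>.\<close>

lemma near_zero: "\<bar>u z\<bar> \<le> 2 * C + \<bar>c\<bar> * (- ln z)" if z: "0 < z" "z \<le> 1"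
proof -
  have "\<bar>(u z - c * ln z) - u 1\<bar> \<le> C"
  proof (cases "z = 1")
    case True then show ?thesis using C_nonneg by simp
  next
    case False
    then have z1: "z < 1" using z by simp
    have "((\<lambda>z. u z - c * ln z) has_real_derivative u' x - c / x) (at x)" if "z \<le> x" for x
      using that z by (auto intro!: derivative_eq_intros deriv)
    then obtain y where y: "z < y" "y < 1" "(u 1 - c * ln 1) - (u z - c * ln z) = (1 - z) * (u' y - c / y)"
      using MVT2[of z 1 "\<lambda>z. u z - c * ln z" "\<lambda>x. u' x - c / x"] z1 by blast
    have "\<bar>(1 - z) * (u' y - c / y)\<bar> \<le> 1 * C"
      unfolding abs_mult using near[of y] y z by (intro mult_mono) auto
    then have "\<bar>(u 1 - c * ln 1) - (u z - c * ln z)\<bar> \<le> C" unfolding y(3) by simp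
    then show ?thesis unfolding ln_one mult_zero_right by linarith
  qed
  moreover have "\<bar>u 1\<bar> \<le> C" using far(1)[of 1] by simp
  moreover have "\<bar>c * ln z\<bar> = \<bar>c\<bar> * (- ln z)" using z by (simp add: abs_mult)
  ultimately show ?thesis by linarith
qed

lemma powr_bound: "\<bar>u z\<bar> \<le> (2 * C + 2 * \<bar>c\<bar>) * z powr (- 1 / 2)" if z: "z > 0"
proof (cases "z \<ge> 1")
  case True
  have "C * z powr (- 1 / 2) \<le> (2 * C + 2 * \<bar>c\<bar>) * z powr (- 1 / 2)"
    using C_nonneg by (intro mult_right_mono) auto
  then show ?thesis using far(1)[OF True] by linarith
next
  case False
  let ?p = "z powr (- 1 / 2)"
  have p: "?p \<ge> 1" using False z powr_mono2'[of "- 1 / 2" z 1] by simp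
  \<comment> \<open>Since \<open>- ln z = 2 * ln ?p\<close>, the elementary bound of the logarithm
    turns the logarithmic singularity into an inverse square root, matching the decay at
    infinity.\<close>
  have "ln ?p \<le> ?p - 1" using z by (intro ln_le_minus_one) simp
  then have l: "- ln z \<le> 2 * ?p" using z by (simp add: ln_powr)
  have "2 * C * 1 \<le> 2 * C * ?p" using p C_nonneg by (intro mult_left_mono) auto
  moreover have "\<bar>c\<bar> * (- ln z) \<le> \<bar>c\<bar> * (2 * ?p)" using l by (intro mult_left_mono) auto
  ultimately have "\<bar>u z\<bar> \<le> 2 * C * ?p + \<bar>c\<bar> * (2 * ?p)" using near_zero[OF z] False by linarith
  then show ?thesis by (simp add: algebra_simps)
qed

text \<open>\<open>ln (2 + 1 / z)\<close> dominates \<open>- ln z\<close> and never falls below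
  \<open>ln 2\<close>, so it serves near 0 as well as at infinity. Applied at the upper limit of
  integration, it is the source of the logarithm in the theorem.\<close>

lemma log_bound: "\<bar>u z\<bar> \<le> (3 * C + \<bar>c\<bar>) * ln (2 + 1 / z) / ln 2" if z: "z > 0"
proof -
  let ?L = "ln (2 + 1 / z)"
  have L: "ln 2 \<le> ?L" using z by (intro ln_mono) auto
  have l2: "0 < ln (2::real)" "ln (2::real) \<le> 1" using ln_2_less_1 by auto
  have L0: "0 \<le> ?L" using L l2(1) by linarith
  have "\<bar>u z\<bar> * ln 2 \<le> (3 * C + \<bar>c\<bar>) * ?L"
  proof (cases "z \<ge> 1")
    case True
    have "z powr (- 1 / 2) \<le> 1" using powr_mono2'[of "- 1 / 2" 1 z] True by simp
    then have "C * z powr (- 1 / 2) \<le> C * 1" using C_nonneg by (intro mult_left_mono)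
    then have "\<bar>u z\<bar> \<le> 3 * C + \<bar>c\<bar>" using far(1)[OF True] C_nonneg by linarith
    then show ?thesis using L l2 C_nonneg by (intro mult_mono) auto
  next
    case False
    have "ln (1 / z) \<le> ?L" using z by (intro ln_mono) auto
    then have l: "- ln z \<le> ?L" using z by (simp add: ln_div)
    have "\<bar>u z\<bar> * ln 2 \<le> (2 * C + \<bar>c\<bar> * (- ln z)) * ln 2"
      using near_zero[OF z] False l2 by (intro mult_right_mono) auto
    also have "\<dots> = 2 * C * ln 2 + \<bar>c\<bar> * (- ln z * ln 2)" by (simp add: algebra_simps)
    also have "\<dots> \<le> 3 * C * ?L + \<bar>c\<bar> * (?L * 1)"
    proof (rule add_mono)
      show "2 * C * ln 2 \<le> 3 * C * ?L" using C_nonneg L l2 by (intro mult_mono) auto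
      have "- ln z * ln 2 \<le> ?L * 1" using l l2 L0 by (intro mult_mono) auto
      then show "\<bar>c\<bar> * (- ln z * ln 2) \<le> \<bar>c\<bar> * (?L * 1)" by (rule mult_left_mono) simp
    qed
    finally show ?thesis by (simp add: algebra_simps)
  qed
  then show ?thesis using l2 by (simp add: pos_le_divide_eq)
qed

section \<open>Cosine integrals of a function with a logarithmic singularity\<close>

lemma powr_half_integrable:
  assumes X: "X > 0"
  shows "integrable lborel (\<lambda>z. indicator {0<..<X} z * z powr (- 1 / 2))"
    and "(LINT z|lborel. indicator {0<..<X} z * z powr (- 1 / 2)) = 2 * sqrt X"
proof -
  have "((\<lambda>r. (1 * r) powr (- 1 / 2)) has_integral 2 * sqrt (X / 1)) {0..X}"
    using X by (intro has_integral_powr_minus_half) auto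
  then have "((\<lambda>r. r powr (- 1 / 2)) has_integral 2 * sqrt X) {0<..<X}" by (simp add: has_integral_Icc_iff_Ioo)
  then have "((\<lambda>r. if r \<in> {0<..<X} then r powr (- 1 / 2) else 0) has_integral 2 * sqrt X) UNIV"
    unfolding has_integral_restrict_UNIV .
  moreover have e: "(\<lambda>r. if r \<in> {0<..<X} then r powr (- 1 / 2) else 0) = (\<lambda>z. indicator {0<..<X} z * z powr (- 1 / 2) :: real)"
    by (auto simp: fun_eq_iff)
  ultimately have I: "((\<lambda>z. indicator {0<..<X} z * z powr (- 1 / 2) :: real) has_integral 2 * sqrt X) UNIV" by simp
  have n: "(\<integral>\<^sup>+z. ennreal (indicator {0<..<X} z * z powr (- 1 / 2)) \<partial>lborel) = ennreal (2 * sqrt X)"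
    by (rule nn_integral_has_integral_lborel[OF _ _ I]) auto
  show "integrable lborel (\<lambda>z. indicator {0<..<X} z * z powr (- 1 / 2) :: real)"
    by (rule integrableI_nn_integral_finite[OF _ _ n]) auto
  show "(LINT z|lborel. indicator {0<..<X} z * z powr (- 1 / 2)) = 2 * sqrt X"
    by (subst integral_eq_nn_integral) (use n X in auto)
qed

lemma cos_integrable: "set_integrable lborel {0<..<X} (\<lambda>z. u z * cos (\<sigma> * z))" if X: "X > 0"
  unfolding set_integrable_def
proof (rule Bochner_Integration.integrable_bound)
  show "integrable lborel (\<lambda>z. (2 * C + 2 * \<bar>c\<bar>) * (indicator {0<..<X} z * z powr (- 1 / 2)))"
    by (intro integrable_mult_right powr_half_integrable X)
  show "AE z in lborel. norm (indicator {0<..<X} z *\<^sub>R (u z * cos (\<sigma> * z))) \<le>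
      norm ((2 * C + 2 * \<bar>c\<bar>) * (indicator {0<..<X} z * z powr (- 1 / 2)))"
  proof (intro AE_I2)
    fix z :: real
    have "\<bar>u z * cos (\<sigma> * z)\<bar> \<le> (2 * C + 2 * \<bar>c\<bar>) * z powr (- 1 / 2)" if "z > 0"
    proof -
      have "\<bar>u z * cos (\<sigma> * z)\<bar> \<le> \<bar>u z\<bar> * 1" unfolding abs_mult by (intro mult_left_mono) auto
      then show ?thesis using powr_bound[OF that] by linarith
    qed
    then show "norm (indicator {0<..<X} z *\<^sub>R (u z * cos (\<sigma> * z))) \<le>
      norm ((2 * C + 2 * \<bar>c\<bar>) * (indicator {0<..<X} z * z powr (- 1 / 2)))"
      using C_nonneg by (auto split: split_indicator)
  qed
qed measurable

text \<open>No cancellation is used, only the inverse square root bound of \<open>u\<close>. This is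
  the estimate for frequencies \<open>\<sigma> \<le> 1\<close>.\<close>

lemma cos_integral_le_sqrt:
  assumes X: "X > 0"
  shows "\<bar>LINT z:{0<..<X}|lborel. u z * cos (\<sigma> * z)\<bar> \<le> (2 * C + 2 * \<bar>c\<bar>) * (2 * sqrt X)"
proof -
  have "\<bar>LINT z:{0<..<X}|lborel. u z * cos (\<sigma> * z)\<bar> \<le> (LINT z|lborel. norm (indicator {0<..<X} z *\<^sub>R (u z * cos (\<sigma> * z))))"
    unfolding set_lebesgue_integral_def real_norm_def[symmetric] by (rule integral_norm_bound)
  also have "\<dots> \<le> (LINT z|lborel. (2 * C + 2 * \<bar>c\<bar>) * (indicator {0<..<X} z * z powr (- 1 / 2)))"
  proof (rule integral_mono)
    show "integrable lborel (\<lambda>z. norm (indicator {0<..<X} z *\<^sub>R (u z * cos (\<sigma> * z))))"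
      using cos_integrable[OF X, unfolded set_integrable_def] by (rule integrable_norm)
    show "integrable lborel (\<lambda>z. (2 * C + 2 * \<bar>c\<bar>) * (indicator {0<..<X} z * z powr (- 1 / 2)))"
      by (intro integrable_mult_right powr_half_integrable X)
    fix z :: real
    have "\<bar>u z * cos (\<sigma> * z)\<bar> \<le> (2 * C + 2 * \<bar>c\<bar>) * z powr (- 1 / 2)" if "z > 0"
    proof -
      have "\<bar>u z * cos (\<sigma> * z)\<bar> \<le> \<bar>u z\<bar> * 1" unfolding abs_mult by (intro mult_left_mono) auto
      then show ?thesis using powr_bound[OF that] by linarith
    qed
    then show "norm (indicator {0<..<X} z *\<^sub>R (u z * cos (\<sigma> * z))) \<le> (2 * C + 2 * \<bar>c\<bar>) * (indicator {0<..<X} z * z powr (- 1 / 2))"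
      by (auto split: split_indicator)
  qed
  also have "\<dots> = (2 * C + 2 * \<bar>c\<bar>) * (2 * sqrt X)"
    unfolding integral_mult_right_zero powr_half_integrable(2)[OF X] ..
  finally show ?thesis .
qed

text \<open>At 0 the bound \<open>z^(-1/2)\<close> of \<open>u\<close> is beaten by the zero of the
  sine, leaving a multiple of \<open>sqrt z\<close>. Integration by parts therefore has no boundary
  term at 0.\<close>

lemma sine_product_continuous: "continuous_on {0..X} (\<lambda>z. u z * sin (\<sigma> * z))"
  unfolding continuous_on_eq_continuous_within
proof
  fix z :: real assume z: "z \<in> {0..X}"
  show "continuous (at z within {0..X}) (\<lambda>z. u z * sin (\<sigma> * z))"
  proof (cases "z = 0")
    case False
    then have "isCont (\<lambda>z. u z * sin (\<sigma> * z)) z"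
      using z by (intro continuous_intros DERIV_isCont[OF deriv]) auto
    then show ?thesis by (rule continuous_at_imp_continuous_at_within)
  next
    case True
    let ?K = "(2 * C + 2 * \<bar>c\<bar>) * \<bar>\<sigma>\<bar>"
    have "((\<lambda>z. u z * sin (\<sigma> * z)) \<longlongrightarrow> 0) (at 0 within {0..X})"
    proof (rule Lim_null_comparison)
      show "\<forall>\<^sub>F z in at 0 within {0..X}. norm (u z * sin (\<sigma> * z)) \<le> ?K * sqrt z"
        unfolding eventually_at_filter
      proof (intro always_eventually allI impI)
        fix z :: real assume "z \<noteq> 0" "z \<in> {0..X}"
        then have z: "z > 0" by simp
        have "\<bar>u z * sin (\<sigma> * z)\<bar> \<le> (2 * C + 2 * \<bar>c\<bar>) * z powr (- 1 / 2) * \<bar>\<sigma> * z\<bar>"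
          unfolding abs_mult[of "u z"] using C_nonneg by (intro mult_mono powr_bound z abs_sin_x_le_abs_x) auto
        also have "\<dots> = ?K * (z powr (- 1 / 2) * z powr 1)" using z by (simp add: abs_mult)
        also have "z powr (- 1 / 2) * z powr 1 = sqrt z"
          unfolding powr_add[symmetric] using z by (simp add: powr_half_sqrt)
        finally show "norm (u z * sin (\<sigma> * z)) \<le> ?K * sqrt z" by simp
      qed
      have "((\<lambda>z. ?K * sqrt z) \<longlongrightarrow> ?K * sqrt 0) (at 0 within {0..X})"
        by (intro tendsto_intros)
      then show "((\<lambda>z. ?K * sqrt z) \<longlongrightarrow> 0) (at 0 within {0..X})" by simp
    qed
    then show ?thesis unfolding True continuous_within by simp
  qed
qed

text \<open>The fundamental theorem needs the derivative only in the open interval, so it also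
  delivers integrability of \<open>u' z * sin (\<sigma> * z)\<close>, in the gauge sense, up to the
  singular point.\<close>

lemma cos_integral_by_parts:
  assumes X: "X > 0"
  shows "((\<lambda>z. u' z * sin (\<sigma> * z)) has_integral u X * sin (\<sigma> * X) -
    \<sigma> * (LINT z:{0<..<X}|lborel. u z * cos (\<sigma> * z))) {0..X}"
proof -
  have h1: "((\<lambda>z. u' z * sin (\<sigma> * z) + \<sigma> * (u z * cos (\<sigma> * z))) has_integral u X * sin (\<sigma> * X) - u 0 * sin (\<sigma> * 0)) {0..X}"
  proof (rule fundamental_theorem_of_calculus_interior[OF _ sine_product_continuous])
    fix z assume "z \<in> {0<..<X}"
    then have "((\<lambda>z. u z * sin (\<sigma> * z)) has_real_derivative u' z * sin (\<sigma> * z) + \<sigma> * (u z * cos (\<sigma> * z))) (at z)"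
      by (auto intro!: derivative_eq_intros deriv)
    then show "((\<lambda>z. u z * sin (\<sigma> * z)) has_vector_derivative u' z * sin (\<sigma> * z) + \<sigma> * (u z * cos (\<sigma> * z))) (at z)"
      by (simp add: has_real_derivative_iff_has_vector_derivative)
  qed (use X in simp)
  have h2: "((\<lambda>z. \<sigma> * (u z * cos (\<sigma> * z))) has_integral \<sigma> * (LINT z:{0<..<X}|lborel. u z * cos (\<sigma> * z))) {0..X}"
  proof (rule has_integral_mult_right)
    show "((\<lambda>z. u z * cos (\<sigma> * z)) has_integral (LINT z:{0<..<X}|lborel. u z * cos (\<sigma> * z))) {0..X}"
      unfolding has_integral_Icc_iff_Ioo
      using set_borel_integral_eq_integral[OF cos_integrable[OF X]] by (simp add: has_integral_integrable_integral)
  qed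
  show ?thesis using has_integral_diff[OF h1 h2] by simp
qed

text \<open>The interval is split at \<open>min X 1\<close>. On the lower part
  \<open>c * sin (\<sigma> * z) / z\<close> is subtracted; its integral is a difference of sine
  integrals, bounded independently of \<sigma>. The four terms of the bound are the boundary value
  at \<open>X\<close>, the remainder \<open>u' z - c / z\<close>, the sine integral, and the tail
  with decay \<open>z^(-1/2)\<close>.\<close>

lemma cos_integral_le_log:
  assumes X: "X > 0" and \<sigma>: "\<sigma> > 0" and B: "\<And>t. \<bar>Si t\<bar> \<le> B"
  shows "\<bar>\<sigma> * (LINT z:{0<..<X}|lborel. u z * cos (\<sigma> * z))\<bar> \<le> \<bar>u X\<bar> + C + \<bar>c\<bar> * (2 * B) + 2 * C * sqrt X"
proof -
  let ?s = "\<lambda>z. u' z * sin (\<sigma> * z)" and ?Y = "min X 1"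
  note P = cos_integral_by_parts[OF X, of \<sigma>]
  have i: "?s integrable_on {0..X}" using P by blast
  have Y: "0 < ?Y" "?Y \<le> X" using X by auto
  have iY: "?s integrable_on {0..?Y}" "?s integrable_on {?Y..X}"
    by (rule integrable_on_subinterval[OF i], use Y in auto)+
  have split: "integral {0..?Y} ?s + integral {?Y..X} ?s = integral {0..X} ?s"
    by (rule Henstock_Kurzweil_Integration.integral_combine) (use Y i in auto)
  have si: "((\<lambda>z. c * (sin (\<sigma> * z) / z)) has_integral c * (Si (\<sigma> * ?Y) - Si (\<sigma> * 0))) {0..?Y}"
  proof (rule has_integral_mult_right)
    have "((\<lambda>z. sinc (\<sigma> * z) * \<sigma>) has_integral Si (\<sigma> * ?Y) - Si (\<sigma> * 0)) {0..?Y}"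
    proof (rule fundamental_theorem_of_calculus)
      fix z
      have "((\<lambda>z. Si (\<sigma> * z)) has_real_derivative sinc (\<sigma> * z) * \<sigma>) (at z)"
        by (rule DERIV_chain2[OF DERIV_Si]) (auto intro!: derivative_eq_intros)
      then show "((\<lambda>z. Si (\<sigma> * z)) has_vector_derivative sinc (\<sigma> * z) * \<sigma>) (at z within {0..?Y})"
        by (simp add: has_real_derivative_iff_has_vector_derivative has_vector_derivative_at_within)
    qed (use Y in simp)
    then show "((\<lambda>z. sin (\<sigma> * z) / z) has_integral Si (\<sigma> * ?Y) - Si (\<sigma> * 0)) {0..?Y}"
      by (rule has_integral_spike[OF negligible_sing[of 0], rotated]) (use \<sigma> in auto)
  qed
  have d: "((\<lambda>z. ?s z - c * (sin (\<sigma> * z) / z)) has_integral integral {0..?Y} ?s - c * (Si (\<sigma> * ?Y) - Si (\<sigma> * 0))) {0..?Y}"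
    by (rule has_integral_diff[OF integrable_integral[OF iY(1)] si])
  have "norm (integral {0..?Y} ?s - c * (Si (\<sigma> * ?Y) - Si (\<sigma> * 0))) \<le> C * measure lborel (cbox 0 ?Y)"
  proof (rule has_integral_bound[OF C_nonneg])
    show "((\<lambda>z. ?s z - c * (sin (\<sigma> * z) / z)) has_integral integral {0..?Y} ?s - c * (Si (\<sigma> * ?Y) - Si (\<sigma> * 0))) (cbox 0 ?Y)"
      using d by simp
    fix z assume "z \<in> cbox 0 ?Y"
    then have z: "0 \<le> z" "z \<le> 1" by auto
    show "norm (?s z - c * (sin (\<sigma> * z) / z)) \<le> C"
    \<comment> \<open>At 0 nothing is known of \<open>u'\<close>, but the factor
      \<open>sin 0\<close> and the convention \<open>x / 0 = 0\<close> make the integrand 0.\<close>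
    proof (cases "z = 0")
      case True then show ?thesis using C_nonneg by simp
    next
      case False
      have "?s z - c * (sin (\<sigma> * z) / z) = (u' z - c / z) * sin (\<sigma> * z)" by (simp add: algebra_simps)
      also have "norm \<dots> \<le> C * 1"
        unfolding norm_mult using near[of z] False z C_nonneg by (intro mult_mono) auto
      finally show ?thesis by simp
    qed
  qed
  also have "C * measure lborel (cbox 0 ?Y) \<le> C * 1" using C_nonneg Y by (intro mult_left_mono) auto
  finally have e1: "\<bar>integral {0..?Y} ?s - c * (Si (\<sigma> * ?Y) - Si (\<sigma> * 0))\<bar> \<le> C" by simp
  have e2: "\<bar>c * (Si (\<sigma> * ?Y) - Si (\<sigma> * 0))\<bar> \<le> \<bar>c\<bar> * (2 * B)"
    unfolding abs_mult using B[of "\<sigma> * ?Y"] B[of "\<sigma> * 0"] by (intro mult_left_mono) auto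
  have e3: "\<bar>integral {?Y..X} ?s\<bar> \<le> 2 * C * sqrt X"
  proof (cases "X \<le> 1")
    case True then show ?thesis using C_nonneg X by simp
  next
    case False
    then have Y1: "?Y = 1" by simp
    have hi: "((\<lambda>r. C * (1 * r) powr (- 1 / 2)) has_integral C * (2 * sqrt (X / 1))) {0..X}"
      using X by (intro has_integral_mult_right has_integral_powr_minus_half) auto
    have "norm (integral {1..X} ?s) \<le> integral {1..X} (\<lambda>z. C * (1 * z) powr (- 1 / 2))"
    proof (rule integral_norm_bound_integral)
      show "?s integrable_on {1..X}" using iY(2) Y1 by simp
      show "(\<lambda>z. C * (1 * z) powr (- 1 / 2)) integrable_on {1..X}"
        by (rule integrable_on_subinterval[OF has_integral_integrable[OF hi]]) auto
      fix z assume "z \<in> {1..X}"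
      then have "norm (?s z) \<le> C * z powr (- 1 / 2) * 1"
        unfolding norm_mult using far(2)[of z] by (intro mult_mono) auto
      then show "norm (?s z) \<le> C * (1 * z) powr (- 1 / 2)" by simp
    qed
    also have "\<dots> \<le> integral {0..X} (\<lambda>z. C * (1 * z) powr (- 1 / 2))"
      using C_nonneg hi by (intro integral_subset_le integrable_on_subinterval[OF has_integral_integrable[OF hi]]) auto
    also have "\<dots> = 2 * C * sqrt X" using integral_unique[OF hi] by simp
    finally show ?thesis unfolding Y1 by simp
  qed
  have "\<bar>u X * sin (\<sigma> * X)\<bar> \<le> \<bar>u X\<bar> * 1" unfolding abs_mult by (intro mult_left_mono) auto
  moreover have "integral {0..X} ?s = u X * sin (\<sigma> * X) - \<sigma> * (LINT z:{0<..<X}|lborel. u z * cos (\<sigma> * z))"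
    using P by (rule integral_unique)
  ultimately show ?thesis using split e1 e2 e3 by linarith
qed

text \<open>Absolute integration is used for \<open>\<sigma> \<le> 1\<close> and integration by
  parts for \<open>\<sigma> > 1\<close>, which bounds the integral times
  \<open>max 1 \<sigma>\<close>. Terms without a logarithm are multiplied by
  \<open>ln (2 + 1 / X) / ln 2\<close>, which is at least 1.\<close>

lemma cos_integral_bound:
  obtains D where "D \<ge> 0" "\<And>X \<sigma>. X > 0 \<Longrightarrow> \<sigma> \<ge> 0 \<Longrightarrow>
    \<bar>LINT z:{0<..<X}|lborel. u z * cos (\<sigma> * z)\<bar> \<le> D * ln (2 + 1 / X) * (1 + sqrt X) * (1 + \<sigma>\<^sup>2) powr (- 1 / 2)"
proof -
  obtain B where B: "\<And>t. \<bar>Si t\<bar> \<le> B" using bounded_Si by blast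
  then have B0: "B \<ge> 0" using abs_ge_zero order_trans by blast
  \<comment> \<open>For \<open>\<sigma> > 1\<close> the contributions \<open>3 * C\<close>,
    \<open>C\<close> and \<open>2 * C\<close> come from \<open>log_bound\<close>, the part near 0
    and the tail; the coefficient 4 of \<open>\<bar>c\<bar>\<close> is required for
    \<open>\<sigma> \<le> 1\<close>.\<close>
  let ?E = "(6 * C + 4 * \<bar>c\<bar> + \<bar>c\<bar> * (2 * B)) / ln 2"
  have l2: "0 < ln (2::real)" by simp
  have E0: "?E \<ge> 0" using C_nonneg B0 by simp
  show ?thesis
  proof (rule that[of "2 * ?E"])
    show "2 * ?E \<ge> 0" by (rule mult_nonneg_nonneg[OF _ E0]) simp
    fix X \<sigma> :: real assume X: "X > 0" and \<sigma>: "\<sigma> \<ge> 0"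
    let ?L = "ln (2 + 1 / X)" and ?I = "LINT z:{0<..<X}|lborel. u z * cos (\<sigma> * z)"
    have L2: "ln 2 \<le> ?L" using X by (intro ln_mono) auto
    then have L: "1 \<le> ?L / ln 2" using l2 by (simp add: le_divide_eq)
    have L0: "0 \<le> ?L" using L2 l2 by linarith
    have pos: "0 \<le> ?E * ?L * (1 + sqrt X)" using X by (intro mult_nonneg_nonneg E0 L0) auto
    have scale: "a * b \<le> a * (?L / ln 2) * b" if "a \<ge> 0" "b \<ge> 0" for a b :: real
      using mult_right_mono[OF mult_left_mono[OF L that(1)] that(2)] by simp
    have "\<bar>?I\<bar> * max 1 \<sigma> \<le> ?E * ?L * (1 + sqrt X)"
    proof (cases "\<sigma> \<le> 1")
      case True
      have "\<bar>?I\<bar> \<le> (4 * C + 4 * \<bar>c\<bar>) * sqrt X" using cos_integral_le_sqrt[OF X, of \<sigma>] by (simp add: algebra_simps)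
      also have "\<dots> \<le> (6 * C + 4 * \<bar>c\<bar> + \<bar>c\<bar> * (2 * B)) * (1 + sqrt X)"
        using C_nonneg B0 X by (intro mult_mono) auto
      also have "\<dots> \<le> (6 * C + 4 * \<bar>c\<bar> + \<bar>c\<bar> * (2 * B)) * (?L / ln 2) * (1 + sqrt X)"
        using C_nonneg B0 X by (intro scale) auto
      finally show ?thesis using True by simp
    next
      case False
      let ?M = "?L / ln 2"
      have "\<bar>?I\<bar> * \<sigma> = \<bar>\<sigma> * ?I\<bar>" using \<sigma> by (simp add: abs_mult mult.commute)
      also have "\<dots> \<le> \<bar>u X\<bar> + C + \<bar>c\<bar> * (2 * B) + 2 * C * sqrt X"
        using False by (intro cos_integral_le_log[OF X _ B]) simp
      also have "\<dots> \<le> (3 * C + \<bar>c\<bar>) * ?M * 1 + (C + \<bar>c\<bar> * (2 * B)) * ?M * 1 + 2 * C * ?M * sqrt X"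
      proof -
        have "\<bar>u X\<bar> \<le> (3 * C + \<bar>c\<bar>) * ?M * 1" using log_bound[OF X] by simp
        moreover have "(C + \<bar>c\<bar> * (2 * B)) * 1 \<le> (C + \<bar>c\<bar> * (2 * B)) * ?M * 1"
          using C_nonneg B0 by (intro scale) auto
        moreover have "2 * C * sqrt X \<le> 2 * C * ?M * sqrt X" using C_nonneg X by (intro scale) auto
        ultimately have "\<bar>u X\<bar> + (C + \<bar>c\<bar> * (2 * B)) * 1 + 2 * C * sqrt X \<le>
          (3 * C + \<bar>c\<bar>) * ?M * 1 + (C + \<bar>c\<bar> * (2 * B)) * ?M * 1 + 2 * C * ?M * sqrt X"
          by (intro add_mono)
        then show ?thesis by (simp only: mult_1_right add.assoc)
      qed
      also have "\<dots> \<le> (3 * C + \<bar>c\<bar>) * ?M * (1 + sqrt X) + (C + \<bar>c\<bar> * (2 * B)) * ?M * (1 + sqrt X) + 2 * C * ?M * (1 + sqrt X)"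
        using C_nonneg B0 X L by (intro add_mono mult_left_mono mult_nonneg_nonneg) auto
      also have "\<dots> = (6 * C + \<bar>c\<bar> + \<bar>c\<bar> * (2 * B)) * (?M * (1 + sqrt X))" by (simp only: distrib_right mult.assoc)
      also have "\<dots> \<le> (6 * C + 4 * \<bar>c\<bar> + \<bar>c\<bar> * (2 * B)) * (?M * (1 + sqrt X))"
        using X L by (intro mult_right_mono mult_nonneg_nonneg) auto
      finally show ?thesis using False by (simp add: max_def)
    qed
    then have "\<bar>?I\<bar> * max 1 \<sigma> * (1 / max 1 \<sigma>) \<le> ?E * ?L * (1 + sqrt X) * (1 / max 1 \<sigma>)"
      by (rule mult_right_mono) simp
    then have "\<bar>?I\<bar> \<le> ?E * ?L * (1 + sqrt X) * (1 / max 1 \<sigma>)"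
      by (simp only: mult.assoc) (simp add: max_def split: if_splits)
    also have "\<dots> \<le> ?E * ?L * (1 + sqrt X) * (2 * (1\<^sup>2 + \<sigma>\<^sup>2) powr (- 1 / 2))"
      by (rule mult_left_mono[OF inverse_max_le[OF _ \<sigma>] pos]) simp
    also have "\<dots> = 2 * ?E * ?L * (1 + sqrt X) * (1 + \<sigma>\<^sup>2) powr (- 1 / 2)" by simp
    finally show "\<bar>?I\<bar> \<le> 2 * ?E * ?L * (1 + sqrt X) * (1 + \<sigma>\<^sup>2) powr (- 1 / 2)" .
  qed
qed

end

section \<open>Cosine integrals of the Hankel function\<close>

lemma log_singular_J0: obtains C where "log_singular bessel_J0 bessel_J0' 0 C"
proof -
  obtain B where B: "B \<ge> 0" "\<And>z. 0 \<le> z \<Longrightarrow> z \<le> 1 \<Longrightarrow> \<bar>bessel_J0' z\<bar> \<le> B * z" by (rule bessel_J0'_bound) blast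
  obtain D where D: "D \<ge> 0" "\<And>z. z \<ge> 1 \<Longrightarrow> \<bar>bessel_J0 z\<bar> \<le> D * z powr (- 1 / 2)"
    "\<And>z. z \<ge> 1 \<Longrightarrow> \<bar>bessel_J0' z\<bar> \<le> D * z powr (- 1 / 2)"
    by (rule bessel_ode_decay[OF bessel_J0_deriv bessel_J0'_deriv bessel_J0_ode]) blast
  have le: "D * z powr (- 1 / 2) \<le> (B + D) * z powr (- 1 / 2)" for z :: real
    using B(1) by (intro mult_right_mono) auto
  have "log_singular bessel_J0 bessel_J0' 0 (B + D)"
  proof
    show "bessel_J0 \<in> borel_measurable borel"
      by (intro borel_measurable_continuous_onI continuous_at_imp_continuous_on ballI DERIV_isCont[OF bessel_J0_deriv])
    fix z :: real
    show "(bessel_J0 has_real_derivative bessel_J0' z) (at z)" by (rule bessel_J0_deriv)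
    show "\<bar>bessel_J0 z\<bar> \<le> (B + D) * z powr (- 1 / 2)" "\<bar>bessel_J0' z\<bar> \<le> (B + D) * z powr (- 1 / 2)" if "z \<ge> 1"
      using D(2,3)[OF that] le[of z] by linarith+
    assume z: "0 < z" "z \<le> 1"
    have "B * z \<le> B * 1" using z B(1) by (intro mult_left_mono) auto
    then show "\<bar>bessel_J0' z - 0 / z\<bar> \<le> B + D" using B(2)[of z] D(1) z by simp
  qed
  then show thesis by (rule that)
qed

lemma log_singular_Y0: obtains C where "log_singular bessel_Y0 bessel_Y0' (2 / pi) C"
proof -
  obtain B where B: "\<And>z. 0 < z \<Longrightarrow> z \<le> 1 \<Longrightarrow> \<bar>bessel_Y0' z - 2 / pi / z\<bar> \<le> B" by (rule bessel_Y0'_near_zero) blast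
  obtain D where D: "D \<ge> 0" "\<And>z. z \<ge> 1 \<Longrightarrow> \<bar>bessel_Y0 z\<bar> \<le> D * z powr (- 1 / 2)"
    "\<And>z. z \<ge> 1 \<Longrightarrow> \<bar>bessel_Y0' z\<bar> \<le> D * z powr (- 1 / 2)"
    using bessel_ode_decay[OF bessel_Y0_deriv bessel_Y0'_deriv bessel_Y0_ode] by metis
  have "B \<ge> 0" using B[of 1] by linarith
  then have le: "D * z powr (- 1 / 2) \<le> (B + D) * z powr (- 1 / 2)" for z :: real
    by (intro mult_right_mono) auto
  have "log_singular bessel_Y0 bessel_Y0' (2 / pi) (B + D)"
  proof
    have [measurable]: "J_ser \<in> borel_measurable borel" "Y_ser \<in> borel_measurable borel"
      by (intro borel_measurable_continuous_onI continuous_at_imp_continuous_on ballI DERIV_isCont[OF series_derivs(1)] DERIV_isCont[OF series_derivs(3)])+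
    show "bessel_Y0 \<in> borel_measurable borel" unfolding bessel_Y0_eq[abs_def] by measurable
    fix z :: real
    show "(bessel_Y0 has_real_derivative bessel_Y0' z) (at z)" if "z > 0" using that by (rule bessel_Y0_deriv)
    show "\<bar>bessel_Y0 z\<bar> \<le> (B + D) * z powr (- 1 / 2)" "\<bar>bessel_Y0' z\<bar> \<le> (B + D) * z powr (- 1 / 2)" if "z \<ge> 1"
      using D(2,3)[OF that] le[of z] by linarith+
    show "\<bar>bessel_Y0' z - 2 / pi / z\<bar> \<le> B + D" if "0 < z" "z \<le> 1" using B[OF that] D(1) by simp
  qed
  then show thesis by (rule that)
qed

lemma hankel_H0_eq: "hankel_H0 z = of_real (bessel_J0 z) + \<i> * of_real (bessel_Y0 z)"
  by (simp add: hankel_H0_def complex_eq_iff)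

lemma hankel_H0_measurable [measurable]: "hankel_H0 \<in> borel_measurable borel"
proof -
  obtain C D where "log_singular bessel_J0 bessel_J0' 0 C" "log_singular bessel_Y0 bessel_Y0' (2 / pi) D"
    using log_singular_J0 log_singular_Y0 by metis
  then have [measurable]: "bessel_J0 \<in> borel_measurable borel" "bessel_Y0 \<in> borel_measurable borel"
    by (simp_all add: log_singular_def)
  show ?thesis unfolding hankel_H0_eq[abs_def] by measurable
qed

lemma
  assumes X: "X > 0"
  shows hankel_cos_integrable: "integrable lborel (\<lambda>z. indicator {0<..<X} z *\<^sub>R (hankel_H0 z * of_real (cos (\<sigma> * z))))"
    and hankel_cos_integral: "(LINT z|lborel. indicator {0<..<X} z *\<^sub>R (hankel_H0 z * of_real (cos (\<sigma> * z)))) =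
      of_real (LINT z:{0<..<X}|lborel. bessel_J0 z * cos (\<sigma> * z)) + \<i> * of_real (LINT z:{0<..<X}|lborel. bessel_Y0 z * cos (\<sigma> * z))"
proof -
  obtain C where "log_singular bessel_J0 bessel_J0' 0 C" by (rule log_singular_J0)
  then interpret J: log_singular bessel_J0 bessel_J0' 0 C .
  obtain D where "log_singular bessel_Y0 bessel_Y0' (2 / pi) D" by (rule log_singular_Y0)
  then interpret Y: log_singular bessel_Y0 bessel_Y0' "2 / pi" D .
  let ?j = "\<lambda>z. indicator {0<..<X} z *\<^sub>R (bessel_J0 z * cos (\<sigma> * z))"
  let ?y = "\<lambda>z. indicator {0<..<X} z *\<^sub>R (bessel_Y0 z * cos (\<sigma> * z))"
  have eq: "indicator {0<..<X} z *\<^sub>R (hankel_H0 z * of_real (cos (\<sigma> * z))) = of_real (?j z) + \<i> * of_real (?y z)" for z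
    by (simp add: hankel_H0_eq scaleR_conv_of_real algebra_simps)
  have i: "integrable lborel (\<lambda>z. complex_of_real (?j z))" "integrable lborel (\<lambda>z. \<i> * complex_of_real (?y z))"
    using J.cos_integrable[OF X, of \<sigma>] Y.cos_integrable[OF X, of \<sigma>] unfolding set_integrable_def
    by (auto intro!: integrable_mult_right integrable_of_real simp del: of_real_mult)
  show "integrable lborel (\<lambda>z. indicator {0<..<X} z *\<^sub>R (hankel_H0 z * of_real (cos (\<sigma> * z))))"
    unfolding eq by (rule Bochner_Integration.integrable_add[OF i])
  show "(LINT z|lborel. indicator {0<..<X} z *\<^sub>R (hankel_H0 z * of_real (cos (\<sigma> * z)))) =
      of_real (LINT z:{0<..<X}|lborel. bessel_J0 z * cos (\<sigma> * z)) + \<i> * of_real (LINT z:{0<..<X}|lborel. bessel_Y0 z * cos (\<sigma> * z))"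
    unfolding eq Bochner_Integration.integral_add[OF i] integral_mult_right_zero integral_complex_of_real set_lebesgue_integral_def ..
qed

lemma hankel_cos_bound:
  obtains D where "D \<ge> 0" "\<And>X \<sigma>. X > 0 \<Longrightarrow> \<sigma> \<ge> 0 \<Longrightarrow>
    norm (LINT z|lborel. indicator {0<..<X} z *\<^sub>R (hankel_H0 z * of_real (cos (\<sigma> * z)))) \<le>
    D * ln (2 + 1 / X) * (1 + sqrt X) * (1 + \<sigma>\<^sup>2) powr (- 1 / 2)"
proof -
  obtain C where "log_singular bessel_J0 bessel_J0' 0 C" by (rule log_singular_J0)
  then interpret J: log_singular bessel_J0 bessel_J0' 0 C .
  obtain D where "log_singular bessel_Y0 bessel_Y0' (2 / pi) D" by (rule log_singular_Y0)
  then interpret Y: log_singular bessel_Y0 bessel_Y0' "2 / pi" D .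
  obtain E where E: "E \<ge> 0" "\<And>X \<sigma>. X > 0 \<Longrightarrow> \<sigma> \<ge> 0 \<Longrightarrow>
    \<bar>LINT z:{0<..<X}|lborel. bessel_J0 z * cos (\<sigma> * z)\<bar> \<le> E * ln (2 + 1 / X) * (1 + sqrt X) * (1 + \<sigma>\<^sup>2) powr (- 1 / 2)"
    by (rule J.cos_integral_bound) blast
  obtain F where F: "F \<ge> 0" "\<And>X \<sigma>. X > 0 \<Longrightarrow> \<sigma> \<ge> 0 \<Longrightarrow>
    \<bar>LINT z:{0<..<X}|lborel. bessel_Y0 z * cos (\<sigma> * z)\<bar> \<le> F * ln (2 + 1 / X) * (1 + sqrt X) * (1 + \<sigma>\<^sup>2) powr (- 1 / 2)"
    by (rule Y.cos_integral_bound) blast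
  show ?thesis
  proof (rule that[of "E + F"])
    show "E + F \<ge> 0" using E F by simp
    fix X \<sigma> :: real assume X: "X > 0" "\<sigma> \<ge> 0"
    have "norm (LINT z|lborel. indicator {0<..<X} z *\<^sub>R (hankel_H0 z * of_real (cos (\<sigma> * z)))) \<le>
      \<bar>LINT z:{0<..<X}|lborel. bessel_J0 z * cos (\<sigma> * z)\<bar> + \<bar>LINT z:{0<..<X}|lborel. bessel_Y0 z * cos (\<sigma> * z)\<bar>"
      unfolding hankel_cos_integral[OF X(1)] by (rule order_trans[OF norm_triangle_ineq]) (simp add: norm_mult)
    also have "\<dots> \<le> (E + F) * ln (2 + 1 / X) * (1 + sqrt X) * (1 + \<sigma>\<^sup>2) powr (- 1 / 2)"
      using E(2)[OF X] F(2)[OF X] by (simp add: distrib_right)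
    finally show "norm (LINT z|lborel. indicator {0<..<X} z *\<^sub>R (hankel_H0 z * of_real (cos (\<sigma> * z)))) \<le>
      (E + F) * ln (2 + 1 / X) * (1 + sqrt X) * (1 + \<sigma>\<^sup>2) powr (- 1 / 2)" .
  qed
qed

section \<open>Reduction of the one-dimensional symbol to the half line\<close>

lemma lborel_eq_distr_line:
  assumes B: "(Basis :: 'a::euclidean_space set) = {b}"
  shows "(lborel :: 'a measure) = distr lborel borel (\<lambda>t. t *\<^sub>R b)"
proof (rule lborel_eqI)
  fix l u :: 'a assume le: "\<And>b. b \<in> Basis \<Longrightarrow> l \<bullet> b \<le> u \<bullet> b"
  have b: "b \<in> Basis" using B by blast
  then have bb: "b \<bullet> b = 1" by (simp add: inner_Basis)
  have "(\<lambda>t. t *\<^sub>R b) -` box l u \<inter> space lborel = box (l \<bullet> b) (u \<bullet> b)"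
    unfolding box_def[of l u] vimage_def B by (auto simp: bb)
  then have "emeasure (distr lborel borel (\<lambda>t. t *\<^sub>R b)) (box l u) = emeasure lborel (box (l \<bullet> b) (u \<bullet> b))"
    by (subst emeasure_distr) auto
  also have "\<dots> = (\<Prod>b\<in>Basis. (u - l) \<bullet> b)"
    unfolding B using le[OF b] by (simp add: inner_diff_left)
  finally show "emeasure (distr lborel borel (\<lambda>t. t *\<^sub>R b)) (box l u) = (\<Prod>b\<in>Basis. (u - l) \<bullet> b)" .
qed simp

lemma
  fixes f :: "'a::euclidean_space \<Rightarrow> complex"
  assumes B: "(Basis :: 'a set) = {b}" and f[measurable]: "f \<in> borel_measurable borel"
  shows integrable_line_iff: "integrable lborel f \<longleftrightarrow> integrable lborel (\<lambda>t. f (t *\<^sub>R b))"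
    and integral_line: "(LINT x|lborel. f x) = (LINT t|lborel. f (t *\<^sub>R b))"
  by (subst lborel_eq_distr_line[OF B], simp add: integrable_distr_eq integral_distr)+

definition half_line_profile :: "real \<Rightarrow> real \<Rightarrow> real \<Rightarrow> complex" where
  "half_line_profile k R t = indicator {0<..<R} t *\<^sub>R hankel_H0 (k * t)"

lemma half_line_profile_measurable [measurable]: "half_line_profile k R \<in> borel_measurable borel"
  unfolding half_line_profile_def[abs_def] by measurable

lemma half_line_profile_scale:
  assumes "k > 0"
  shows "half_line_profile k R t * of_real (cos (\<rho> * t)) =
    indicator {0<..<k * R} (0 + k *\<^sub>R t) *\<^sub>R (hankel_H0 (0 + k *\<^sub>R t) * of_real (cos (\<rho> / k * (0 + k *\<^sub>R t))))"
  using assms by (auto simp: half_line_profile_def indicator_def zero_less_mult_iff)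

lemma half_line_profile_integrable:
  assumes k: "k > 0" and R: "R > 0"
  shows "integrable lborel (half_line_profile k R)"
proof -
  have "integrable lborel (\<lambda>t. half_line_profile k R t * of_real (cos (0 * t)))"
    unfolding half_line_profile_scale[OF k]
    by (rule lborel_integrable_affine[OF hankel_cos_integrable]) (use k R in simp_all)
  then show ?thesis by simp
qed

context
  assumes dim1: "DIM('a::euclidean_space) = 1"
begin

lemma sl_kernel_dim1: "sl_kernel k (x::'a) = \<i> / 4 * hankel_H0 (k * norm x)"
  using dim1 by (simp add: sl_kernel_def Phi_def)

text \<open>Splitting the even kernel into two reflected profiles reduces the symbol to integrals
  over positive \<open>t\<close>. At \<open>t = 0\<close> both profiles vanish whereas the kernel
  takes the value of \<open>hankel_H0\<close> at 0, hence the restriction.\<close>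

lemma trunc_kernel_line:
  assumes B: "(Basis :: 'a set) = {b}" and "t \<noteq> 0"
  shows "trunc_kernel k R (t *\<^sub>R b) = \<i> / 4 * (half_line_profile k R t + half_line_profile k R (0 - t))"
proof -
  have "b \<in> Basis" using B by blast
  then have "norm (t *\<^sub>R b) = \<bar>t\<bar>" by simp
  then show ?thesis unfolding trunc_kernel_def sl_kernel_dim1 half_line_profile_def
    using \<open>t \<noteq> 0\<close> by (cases "t > 0") (auto simp: indicator_def)
qed

lemma trunc_kernel_measurable_dim1: "(trunc_kernel k R :: 'a \<Rightarrow> complex) \<in> borel_measurable borel"
proof -
  have "(sl_kernel k :: 'a \<Rightarrow> complex) \<in> borel_measurable borel" unfolding sl_kernel_dim1[abs_def] by measurable
  then show ?thesis unfolding trunc_kernel_def[abs_def]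
    by (intro borel_measurable_scaleR borel_measurable_indicator) simp
qed

lemma trunc_kernel_integrable_dim1:
  assumes k: "k > 0" and R: "R > 0"
  shows "integrable lborel (trunc_kernel k R :: 'a \<Rightarrow> complex)"
proof -
  obtain b where B: "(Basis :: 'a set) = {b}" using dim1 by (auto simp: card_1_singleton_iff)
  have [measurable]: "(trunc_kernel k R :: 'a \<Rightarrow> complex) \<in> borel_measurable borel" by (rule trunc_kernel_measurable_dim1)
  have i: "integrable lborel (\<lambda>t. \<i> / 4 * (half_line_profile k R t + half_line_profile k R (0 - t)))"
    by (intro integrable_mult_right Bochner_Integration.integrable_add half_line_profile_integrable[OF assms]
        lborel_integrable_reflect)
  have "integrable lborel (\<lambda>t. trunc_kernel k R (t *\<^sub>R b))"
    by (rule integrable_cong_AE_imp[OF i], measurable, use AE_lborel_singleton[of "0::real"] in eventually_elim)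
       (simp add: trunc_kernel_line[OF B])
  then show ?thesis using integrable_line_iff[OF B trunc_kernel_measurable_dim1] by simp
qed

text \<open>The substitution \<open>z = k * t\<close> leaves the dimensionless parameters
  \<open>X = k * R\<close> and \<open>\<sigma> = |\<xi>| / k\<close>, so that a bound uniform in
  these two is uniform in \<open>k\<close>.\<close>

lemma trunc_symbol_dim1:
  fixes \<xi> :: 'a
  assumes k: "k > 0" and R: "R > 0"
  shows "trunc_symbol k R \<xi> = \<i> / 2 * ((1 / of_real k) *
    (LINT z|lborel. indicator {0<..<k * R} z *\<^sub>R (hankel_H0 z * of_real (cos (norm \<xi> / k * z)))))"
proof -
  obtain b where B: "(Basis :: 'a set) = {b}" using dim1 by (auto simp: card_1_singleton_iff)
  define \<rho> where "\<rho> = \<xi> \<bullet> b"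
  have "\<xi> = \<rho> *\<^sub>R b" using euclidean_representation[of \<xi>] unfolding B \<rho>_def by simp
  moreover have "norm b = 1" using norm_Basis[of b] B by blast
  ultimately have n: "norm \<xi> = \<bar>\<rho>\<bar>" by simp
  have c: "cos (\<bar>\<rho>\<bar> * t) = cos (\<rho> * t)" for t by (cases "\<rho> \<ge> 0") auto
  let ?g = "half_line_profile k R" let ?e = "\<lambda>t. exp (- (\<i> * complex_of_real (\<rho> * t)))"
  note gi = half_line_profile_integrable[OF assms]
  have [measurable]: "(trunc_kernel k R :: 'a \<Rightarrow> complex) \<in> borel_measurable borel" by (rule trunc_kernel_measurable_dim1)
  have i1: "integrable lborel (\<lambda>t. ?e t * ?g t)" by (rule Bochner_Integration.integrable_bound[OF gi]) (auto simp: norm_mult)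
  have i3: "integrable lborel (\<lambda>t. ?e (0 - t) * ?g t)" by (rule Bochner_Integration.integrable_bound[OF gi]) (auto simp: norm_mult)
  have i2: "integrable lborel (\<lambda>t. ?e t * ?g (0 - t))" using lborel_integrable_reflect[OF i3, of 0] by simp
  have "trunc_symbol k R \<xi> = (LINT t|lborel. exp (- (\<i> * complex_of_real (\<xi> \<bullet> (t *\<^sub>R b)))) * trunc_kernel k R (t *\<^sub>R b))"
    unfolding trunc_symbol_def by (rule integral_line[OF B]) measurable
  also have "\<dots> = (LINT t|lborel. \<i> / 4 * (?e t * ?g t + ?e t * ?g (0 - t)))"
  proof (rule integral_cong_AE)
    show "AE t in lborel. exp (- (\<i> * complex_of_real (\<xi> \<bullet> (t *\<^sub>R b)))) * trunc_kernel k R (t *\<^sub>R b) =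
        \<i> / 4 * (?e t * ?g t + ?e t * ?g (0 - t))"
      using AE_lborel_singleton[of "0::real"]
    proof eventually_elim
      case (elim t)
      have "\<xi> \<bullet> (t *\<^sub>R b) = \<rho> * t" by (simp add: \<rho>_def)
      then show ?case unfolding trunc_kernel_line[OF B elim] by (simp only: distrib_left mult.left_commute)
    qed
  qed measurable
  also have "\<dots> = \<i> / 4 * ((LINT t|lborel. ?e t * ?g t) + (LINT t|lborel. ?e t * ?g (0 - t)))"
    unfolding integral_mult_right_zero Bochner_Integration.integral_add[OF i1 i2] ..
  also have "(LINT t|lborel. ?e t * ?g (0 - t)) = (LINT t|lborel. ?e (0 - t) * ?g t)"
    using lborel_integral_reflect[of "\<lambda>t. ?e (0 - t) * ?g t" 0] by simp
  also have "(LINT t|lborel. ?e t * ?g t) + (LINT t|lborel. ?e (0 - t) * ?g t) = (LINT t|lborel. 2 * (?g t * of_real (cos (norm \<xi> * t))))"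
  proof (subst Bochner_Integration.integral_add[OF i1 i3, symmetric], rule Bochner_Integration.integral_cong[OF refl])
    fix t
    have "?e t + ?e (0 - t) = 2 * of_real (cos (\<rho> * t))"
      unfolding cos_of_real[symmetric] cos_exp_eq by simp
    then show "?e t * ?g t + ?e (0 - t) * ?g t = 2 * (?g t * of_real (cos (norm \<xi> * t)))"
      unfolding n c distrib_right[symmetric] by simp
  qed
  also have "\<dots> = 2 * (LINT t|lborel. ?g t * of_real (cos (norm \<xi> * t)))" by (rule integral_mult_right_zero)
  also have "(LINT t|lborel. ?g t * of_real (cos (norm \<xi> * t))) = (1 / of_real k) *
    (LINT z|lborel. indicator {0<..<k * R} z *\<^sub>R (hankel_H0 z * of_real (cos (norm \<xi> / k * z))))"
  proof -
    have "(LINT z|lborel. indicator {0<..<k * R} z *\<^sub>R (hankel_H0 z * of_real (cos (norm \<xi> / k * z)))) =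
      k *\<^sub>R (LINT t|lborel. ?g t * of_real (cos (norm \<xi> * t)))"
      unfolding half_line_profile_scale[OF k]
      by (subst lborel_integral_affine[where a=k and c=0]) (use k in simp_all)
    then show ?thesis using k by (simp add: scaleR_conv_of_real)
  qed
  finally show ?thesis by simp
qed

theorem trunc_symbol_bound_dim1:
  obtains C where "C \<ge> 0"
    "\<And>k R \<xi>. k > 0 \<Longrightarrow> R > 0 \<Longrightarrow>
      norm (trunc_symbol k R (\<xi>::'a)) \<le> C * ln (2 + 1 / (k * R)) * (1 + sqrt (k * R)) * weight k (- 1 / 2) \<xi>"
proof (rule hankel_cos_bound)
  fix D :: real assume D: "D \<ge> 0" "\<And>X \<sigma>. X > 0 \<Longrightarrow> \<sigma> \<ge> 0 \<Longrightarrow>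
    norm (LINT z|lborel. indicator {0<..<X} z *\<^sub>R (hankel_H0 z * of_real (cos (\<sigma> * z)))) \<le>
    D * ln (2 + 1 / X) * (1 + sqrt X) * (1 + \<sigma>\<^sup>2) powr (- 1 / 2)"
  show thesis
  proof (rule that[of "D / 2"])
    show "D / 2 \<ge> 0" using D(1) by simp
    fix k R :: real and \<xi> :: 'a assume k: "k > 0" and R: "R > 0"
    let ?I = "LINT z|lborel. indicator {0<..<k * R} z *\<^sub>R (hankel_H0 z * of_real (cos (norm \<xi> / k * z)))"
    let ?A = "D * ln (2 + 1 / (k * R)) * (1 + sqrt (k * R))"
    have "1 + (norm \<xi> / k)\<^sup>2 = (1 / k)\<^sup>2 * (k\<^sup>2 + (norm \<xi>)\<^sup>2)"
      using k by (simp add: power_divide distrib_left)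
    \<comment> \<open>The factor \<open>k\<close> gained here cancels the \<open>1 / k\<close> that
      the substitution produced in the symbol.\<close>
    then have w: "(1 + (norm \<xi> / k)\<^sup>2) powr (- 1 / 2) = k * weight k (- 1 / 2) \<xi>"
      using k by (simp add: weight_def powr_mult powr_minus_divide powr_half_sqrt real_sqrt_divide)
    have "norm (trunc_symbol k R \<xi>) = norm ?I / (2 * k)"
      unfolding trunc_symbol_dim1[OF k R] using k by (simp add: norm_mult norm_divide)
    also have "\<dots> \<le> ?A * (k * weight k (- 1 / 2) \<xi>) / (2 * k)"
      unfolding w[symmetric] using k R by (intro divide_right_mono D(2)) auto
    also have "\<dots> = D / 2 * ln (2 + 1 / (k * R)) * (1 + sqrt (k * R)) * weight k (- 1 / 2) \<xi>"
      using k by simp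
    finally show "norm (trunc_symbol k R \<xi>) \<le> D / 2 * ln (2 + 1 / (k * R)) * (1 + sqrt (k * R)) * weight k (- 1 / 2) \<xi>" .
  qed
qed

end

section \<open>Boundedness of the single-layer operator\<close>

lemma ln_two_plus_inverse_half:
  fixes X :: real
  assumes "X > 0"
  shows "ln (2 + 1 / (2 * X)) \<le> ln (2 + 1 / X)"
proof (rule ln_mono)
  have "1 / (2 * X) \<le> 1 / X" using assms by (intro divide_left_mono) auto
  then show "2 + 1 / (2 * X) \<le> 2 + 1 / X" by simp
qed (use assms in \<open>auto intro: add_pos_nonneg\<close>)

lemma one_plus_sqrt_double: "1 + sqrt (2 * X) \<le> 2 * (1 + sqrt X)" if "X \<ge> 0"
proof -
  have "sqrt (2 * X) \<le> sqrt (4 * X)" using that by (intro real_sqrt_le_mono) auto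
  also have "\<dots> = 2 * sqrt X" by (simp add: real_sqrt_mult)
  finally show ?thesis by simp
qed

text \<open>Dropping the vanishing last coordinate is an isometry on \<Gamma>, and relative openness
  becomes openness by pulling an ambient open set back along the embedding of
  \<open>'a\<close>.\<close>

lemma flat_domain:
  fixes \<Gamma> :: "('a::euclidean_space \<times> real) set"
  assumes b: "bounded \<Gamma>" and ne: "\<Gamma> \<noteq> {}" and o: "openin (top_of_set Gamma_inf) \<Gamma>"
  shows "open (fst ` \<Gamma>)" "bounded (fst ` \<Gamma>)" "fst ` \<Gamma> \<noteq> {}" "diameter (fst ` \<Gamma>) = diameter \<Gamma>"
proof -
  have flat: "snd x = 0" if "x \<in> \<Gamma>" for x
    using openin_imp_subset[OF o] that by (auto simp: Gamma_inf_def)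
  obtain T where T: "open T" "\<Gamma> = Gamma_inf \<inter> T" using o by (auto simp: openin_open)
  have "fst ` \<Gamma> = (\<lambda>x. (x, 0)) -` T" unfolding T(2) Gamma_inf_def by force
  moreover have "open ((\<lambda>x. (x, 0 :: real)) -` T)"
    by (rule open_vimage[OF T(1)]) (intro continuous_intros)
  ultimately show "open (fst ` \<Gamma>)" by simp
  show "bounded (fst ` \<Gamma>)" by (rule bounded_fst[OF b])
  show "fst ` \<Gamma> \<noteq> {}" using ne by simp
  have d: "dist (fst x) (fst y) = dist x y" if "x \<in> \<Gamma>" "y \<in> \<Gamma>" for x y
    using flat[OF that(1)] flat[OF that(2)] by (simp add: dist_prod_def)
  have "(SUP (x, y)\<in>fst ` \<Gamma> \<times> fst ` \<Gamma>. dist x y) = (SUP (x, y)\<in>\<Gamma> \<times> \<Gamma>. dist x y)"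
  proof (rule arg_cong[where f=Sup])
    show "(\<lambda>(x, y). dist x y) ` (fst ` \<Gamma> \<times> fst ` \<Gamma>) = (\<lambda>(x, y). dist x y) ` (\<Gamma> \<times> \<Gamma>)"
    proof -
      have "fst ` \<Gamma> \<times> fst ` \<Gamma> = (\<lambda>(x, y). (fst x, fst y)) ` (\<Gamma> \<times> \<Gamma>)"
        by (auto simp: image_iff)
      then show ?thesis by (simp only: image_image) (rule image_cong, use d in auto)
    qed
  qed
  then show "diameter (fst ` \<Gamma>) = diameter \<Gamma>" using ne by (simp add: diameter_def)
qed

definition symbol_constant :: "nat \<Rightarrow> real \<Rightarrow> real \<Rightarrow> real" where
  "symbol_constant n C X = (if n = 3 then C * (1 + sqrt X) else C * ln (2 + 1 / X) * (1 + sqrt X))"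

lemma symbol_constant_nonneg: "C \<ge> 0 \<Longrightarrow> X > 0 \<Longrightarrow> symbol_constant n C X \<ge> 0"
  unfolding symbol_constant_def by (auto intro!: mult_nonneg_nonneg ln_ge_zero)

text \<open>This trades the truncation radius \<open>2 L\<close> for \<open>L\<close>: the square
  root term costs a factor 2 and the logarithm only decreases. The summand 1 keeps the new constant
  positive even if \<open>C = 0\<close>.\<close>

lemma symbol_constant_double:
  assumes C: "C \<ge> 0" and X: "X > 0"
  shows "symbol_constant n C (2 * X) \<le> symbol_constant n (2 * C + 1) X"
proof -
  have s: "1 + sqrt (2 * X) \<le> 2 * (1 + sqrt X)" using X by (intro one_plus_sqrt_double) simp
  have L: "0 \<le> ln (2 + 1 / X)" using X by (intro ln_ge_zero) auto
  have le: "C * l * (1 + sqrt (2 * X)) \<le> (2 * C + 1) * m * (1 + sqrt X)" if "l \<le> m" "0 \<le> m" for l m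
  proof -
    have "C * l * (1 + sqrt (2 * X)) \<le> C * m * (2 * (1 + sqrt X))"
      using that C X s by (intro mult_mono mult_left_mono mult_nonneg_nonneg) auto
    also have "\<dots> = 2 * C * (m * (1 + sqrt X))" by simp
    also have "\<dots> \<le> (2 * C + 1) * (m * (1 + sqrt X))"
      using that X by (intro mult_right_mono mult_nonneg_nonneg) auto
    finally show ?thesis by (simp add: mult.assoc)
  qed
  show ?thesis
    unfolding symbol_constant_def using le[of 1 1] le[OF ln_two_plus_inverse_half[OF X] L] by simp
qed

lemma trunc_symbol_estimate:
  assumes "DIM('a::euclidean_space \<times> real) \<in> {2, 3}"
  obtains C where "C \<ge> 0"
    "\<And>k R. k > 0 \<Longrightarrow> R > 0 \<Longrightarrow> integrable lborel (trunc_kernel k R :: 'a \<Rightarrow> complex)"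
    "\<And>k R \<xi>. k > 0 \<Longrightarrow> R > 0 \<Longrightarrow>
      norm (trunc_symbol k R (\<xi> :: 'a)) \<le> symbol_constant (DIM('a \<times> real)) C (k * R) * weight k (- 1 / 2) \<xi>"
proof (cases "DIM('a \<times> real) = 3")
  case True
  then have d: "DIM('a) = 2" by simp
  obtain C where C: "C \<ge> 0" "\<And>k R \<xi>. k > 0 \<Longrightarrow> R > 0 \<Longrightarrow>
      norm (trunc_symbol k R (\<xi> :: 'a)) \<le> C * (1 + sqrt (k * R)) * weight k (- 1 / 2) \<xi>"
    by (rule trunc_symbol_bound_dim2[OF d]) blast
  show thesis
  proof (rule that[OF C(1)])
    show "integrable lborel (trunc_kernel k R :: 'a \<Rightarrow> complex)" for k R by (rule trunc_kernel_integrable_dim2[OF d])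
    show "norm (trunc_symbol k R (\<xi> :: 'a)) \<le> symbol_constant (DIM('a \<times> real)) C (k * R) * weight k (- 1 / 2) \<xi>"
      if "k > 0" "R > 0" for k R \<xi>
      using C(2)[OF that, of \<xi>] by (simp only: symbol_constant_def True simp_thms if_True)
  qed
next
  case False
  then have d: "DIM('a) = 1" using assms by auto
  obtain C where C: "C \<ge> 0" "\<And>k R \<xi>. k > 0 \<Longrightarrow> R > 0 \<Longrightarrow>
      norm (trunc_symbol k R (\<xi> :: 'a)) \<le> C * ln (2 + 1 / (k * R)) * (1 + sqrt (k * R)) * weight k (- 1 / 2) \<xi>"
    by (rule trunc_symbol_bound_dim1[OF d]) blast
  show thesis
  proof (rule that[OF C(1)])
    show "integrable lborel (trunc_kernel k R :: 'a \<Rightarrow> complex)" if "k > 0" "R > 0" for k R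
      by (rule trunc_kernel_integrable_dim1[OF d that])
    show "norm (trunc_symbol k R (\<xi> :: 'a)) \<le> symbol_constant (DIM('a \<times> real)) C (k * R) * weight k (- 1 / 2) \<xi>"
      if "k > 0" "R > 0" for k R \<xi>
      using C(2)[OF that, of \<xi>] False by (simp only: symbol_constant_def if_False)
  qed
qed

text \<open>\<open>single_layer\<close> is a definite description, so the unique-existence clause
  certifies that it denotes the limit along approximating sequences. The constant of the second
  clause is quantified before \<open>k\<close> and \<Gamma>; it comes from the symbol estimate,
  where neither the domain nor the order \<open>s\<close> enters.\<close>

theorem theorem5p2:
  fixes s :: real
  assumes "DIM('a::euclidean_space \<times> real) \<in> {2, 3}"
  shows "(\<forall>k::real. \<forall>\<Gamma>::('a \<times> real) set.
            k > 0 \<and> bounded \<Gamma> \<and> \<Gamma> \<noteq> {} \<and> openin (top_of_set Gamma_inf) \<Gamma> \<longrightarrow>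
              (\<forall>\<phi> \<in> sobolev_supp k s (closure (fst ` \<Gamma>)). \<exists>!v. is_single_layer k s (fst ` \<Gamma>) \<phi> v) \<and>
              bounded_linear_operator
                (sobolev_supp k s (closure (fst ` \<Gamma>))) (sobolev_norm k s)
                (sobolev_on k (s + 1) (fst ` \<Gamma>)) (sobolev_norm_on k (s + 1) (fst ` \<Gamma>))
                (single_layer k s (fst ` \<Gamma>)))
       \<and> (\<exists>C>0. \<forall>k::real. \<forall>\<Gamma>::('a \<times> real) set.
            k > 0 \<and> bounded \<Gamma> \<and> \<Gamma> \<noteq> {} \<and> openin (top_of_set Gamma_inf) \<Gamma> \<longrightarrow>
              (\<forall>\<phi> \<in> sobolev_supp k s (closure (fst ` \<Gamma>)).
                 sobolev_norm_on k (s + 1) (fst ` \<Gamma>) (single_layer k s (fst ` \<Gamma>) \<phi>)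
                 \<le> (if DIM('a \<times> real) = 3
                    then C * (1 + sqrt (k * diameter \<Gamma>))
                    else C * ln (2 + 1 / (k * diameter \<Gamma>)) * (1 + sqrt (k * diameter \<Gamma>)))
                   * sobolev_norm k s \<phi>))"
proof -
  obtain C where C: "C \<ge> 0"
    and int: "\<And>k R. k > 0 \<Longrightarrow> R > 0 \<Longrightarrow> integrable lborel (trunc_kernel k R :: 'a \<Rightarrow> complex)"
    and bound: "\<And>k R \<xi>. k > 0 \<Longrightarrow> R > 0 \<Longrightarrow>
      norm (trunc_symbol k R (\<xi> :: 'a)) \<le> symbol_constant (DIM('a \<times> real)) C (k * R) * weight k (- 1 / 2) \<xi>"
    by (rule trunc_symbol_estimate[OF assms]) blast
  let ?A = "\<lambda>k R. symbol_constant (DIM('a \<times> real)) C (k * R)"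
  have loc: "single_layer_symbol k (?A k) (fst ` \<Gamma>)"
    if "k > 0" "bounded \<Gamma>" "\<Gamma> \<noteq> {}" "openin (top_of_set Gamma_inf) \<Gamma>" for k and \<Gamma> :: "('a \<times> real) set"
  proof
    show "symbol_constant (DIM('a \<times> real)) C (k * R) \<ge> 0" if "R > 0" for R
      using C \<open>k > 0\<close> that by (intro symbol_constant_nonneg) auto
  qed (use flat_domain[OF that(2,3,4)] that(1) int bound in auto)
  show ?thesis
  \<comment> \<open>The witness is the constant of \<open>symbol_constant_double\<close>, which
    converts the bound at radius \<open>2 * diameter \<Gamma>\<close> into one in terms of the
    diameter.\<close>
  proof (intro conjI exI[of _ "2 * C + 1"] allI impI)
    fix k :: real and \<Gamma> :: "('a \<times> real) set"
    assume "k > 0 \<and> bounded \<Gamma> \<and> \<Gamma> \<noteq> {} \<and> openin (top_of_set Gamma_inf) \<Gamma>"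
    then have h: "k > 0" "bounded \<Gamma>" "\<Gamma> \<noteq> {}" "openin (top_of_set Gamma_inf) \<Gamma>" by auto
    interpret single_layer_symbol k "?A k" "fst ` \<Gamma>" by (rule loc[OF h])
    show "\<forall>\<phi> \<in> sobolev_supp k s (closure (fst ` \<Gamma>)). \<exists>!v. is_single_layer k s (fst ` \<Gamma>) \<phi> v"
      using is_single_layer_T is_single_layer_unique by blast
    show "bounded_linear_operator
        (sobolev_supp k s (closure (fst ` \<Gamma>))) (sobolev_norm k s)
        (sobolev_on k (s + 1) (fst ` \<Gamma>)) (sobolev_norm_on k (s + 1) (fst ` \<Gamma>))
        (single_layer k s (fst ` \<Gamma>))"
      by (rule single_layer_bounded_linear)
    show "\<forall>\<phi> \<in> sobolev_supp k s (closure (fst ` \<Gamma>)).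
         sobolev_norm_on k (s + 1) (fst ` \<Gamma>) (single_layer k s (fst ` \<Gamma>) \<phi>)
         \<le> (if DIM('a \<times> real) = 3
            then (2 * C + 1) * (1 + sqrt (k * diameter \<Gamma>))
            else (2 * C + 1) * ln (2 + 1 / (k * diameter \<Gamma>)) * (1 + sqrt (k * diameter \<Gamma>)))
           * sobolev_norm k s \<phi>"
      unfolding symbol_constant_def[symmetric]
    proof
      fix \<phi> :: "'a distr" assume \<phi>: "\<phi> \<in> sobolev_supp k s (closure (fst ` \<Gamma>))"
      let ?L = "diameter \<Gamma>"
      have L: "diameter (fst ` \<Gamma>) = ?L" by (rule flat_domain(4)[OF h(2,3,4)])
      have "k * ?L > 0" using h(1) diameter_pos unfolding L by simp
      then have "symbol_constant (DIM('a \<times> real)) C (2 * (k * ?L)) \<le> symbol_constant (DIM('a \<times> real)) (2 * C + 1) (k * ?L)"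
        using C by (intro symbol_constant_double)
      then have "?A k (2 * ?L) * sobolev_norm k s \<phi> \<le> symbol_constant (DIM('a \<times> real)) (2 * C + 1) (k * ?L) * sobolev_norm k s \<phi>"
        unfolding mult.left_commute[of k 2] by (intro mult_right_mono) (simp_all add: sobolev_norm_def)
      then show "sobolev_norm_on k (s + 1) (fst ` \<Gamma>) (single_layer k s (fst ` \<Gamma>) \<phi>) \<le>
          symbol_constant (DIM('a \<times> real)) (2 * C + 1) (k * ?L) * sobolev_norm k s \<phi>"
        using single_layer_norm_le[OF \<phi>] unfolding L by linarith
    qed
  qed (use C in simp)
qed

end
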